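(* Let $(M^4,g,J)$ be an ALE Kähler surface (with the metric fall-off described in the context, for some $\varepsilon>0$), with Kähler form $\omega=g(J\cdot,\cdot)$. Let $M_{\infty,i}$ be an end of $M$, let $\widetilde{M}_{\infty,i}$ be the universal cover of $M_{\infty,i}$, and let $$(x^1,\ldots,x^4):\widetilde{M}_{\infty,i}\to\mathbb{R}^4-B$$ be a diffeomorphism, where $B\subset\mathbb{R}^4$ is a standard closed ball of some large radius centered at the origin. Suppose that these asymptotic coordinates are adapted in the sense of the context, so that in particular: the Kähler form $\omega$ (pulled back to $\widetilde{M}_{\infty,i}$ and regarded as a $2$-form on $\mathbb{R}^4-B$) is of class $C^2$ and satisfies $$\omega=\omega_0+O(|x|^{-1-\varepsilon}),\qquad \triangledown\omega=O(|x|^{-2-\varepsilon}),$$ where $\omega_0=dx^1\wedge dx^2+dx^3\wedge dx^4$ and $\triangledown$ is the flat Euclidean connection; and the action of $\pi_1(M_{\infty,i})$ on $\widetilde{M}_{\infty,i}$ by deck transformations is represented in these coordinates by the action of a finite group $\Gamma_i\subset\mathbf{U}(2)$ of unitary transformations, acting on $\mathbb{R}^4=\mathbb{C}^2$ in the usual way. Then there is a $\Gamma_i$-equivariant $C^2$-diffeomorphism $$\Phi:\mathbb{R}^4-C\to\mathbb{R}^4-D,$$ where $C\subset\mathbb{R}^4$ is a standard closed ball centered at the origin, $D\subset\mathbb{R}^4$ is a smooth $4$-ball whose boundary $\partial D$ is a $\Gamma_i$-invariant differentiable $S^3$, and $B\subset C\cap D$, such that $$\Phi^*\omega=\omega_0,$$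 with $|\Phi(x)-x|=O(|x|^{-\varepsilon})$ and $|\Phi_*-I|=O(|x|^{-1-\varepsilon})$.
   Context: An ALE (asymptotically locally Euclidean) Kähler surface $(M^4,g,J)$ is a complete connected non-compact Kähler manifold of complex dimension $2$ for which there is a compact set $\mathbf{K}\subset M$ such that $M-\mathbf{K}$ has finitely many components $M_{\infty,i}$ (the ends), each diffeomorphic to $(\mathbb{R}^4-\mathbf{D}^4)/\Gamma_i$, where $\mathbf{D}^4$ is a closed ball centered at the origin and $\Gamma_i\subset\mathbf{O}(4)$ is a finite group acting freely on the unit sphere. Several ends are allowed a priori. Fall-off assumption: on each end there are asymptotic coordinates $(x^1,\ldots,x^4)$ on the universal cover of the end in which $$g_{jk}=\delta_{jk}+O(|x|^{-1-\varepsilon}),\qquad g_{jk,\ell}=O(|x|^{-2-\varepsilon})$$ for some fixed $\varepsilon>0$ (commas denote partial derivatives), with $\Gamma_i$ acting by linear isometries of the Euclidean metric $\delta$ that also preserve $g$. Adapted coordinates: the asymptotic coordinates can be, and are assumed to be, rotated so that the complex structure satisfies $J=J_0+O(|x|^{-1-\varepsilon})$ and $\triangledown J=O(|x|^{-2-\varepsilon})$, where $$J_0=dx^1\otimes\tfrac{\partial}{\partial x^2}-dx^2\otimes\tfrac{\partial}{\partial x^1}+dx^3\otimes\tfrac{\partial}{\partial x^4}-dx^4\otimes\tfrac{\partial}{\partial x^3}$$ is the standard complex structure of $\mathbb{C}^2=\mathbb{R}^4$. It follows that $\Gamma_i\subset\mathbf{U}(2)$ and that the stated fall-off of $\omega$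 holds with the same $\varepsilon$. Here $\Phi_*$ is the derivative (Jacobian) of $\Phi$, $I$ is the identity, and norms are Euclidean. *)

theory Defs
  imports "HOL-Analysis.Analysis" "HOL-Library.Landau_Symbols"
begin

section \<open>Differentiability classes on open subsets of Euclidean space\<close>

primrec Ck_on :: "nat \<Rightarrow> ('a::euclidean_space \<Rightarrow> 'b::real_normed_vector) \<Rightarrow> 'a set \<Rightarrow> bool" where
  "Ck_on 0 f S \<longleftrightarrow> continuous_on S f"
| "Ck_on (Suc k) f S \<longleftrightarrow>
     (\<forall>x\<in>S. f differentiable (at x)) \<and>
     (\<forall>v\<in>Basis. Ck_on k (\<lambda>x. frechet_derivative f (at x) v) S)"

definition smooth_on :: "('a::euclidean_space \<Rightarrow> 'b::real_normed_vector) \<Rightarrow> 'a set \<Rightarrow> bool" where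
  "smooth_on f S \<longleftrightarrow> (\<forall>k. Ck_on k f S)"

definition Ck_diffeo :: "nat \<Rightarrow> ('a::euclidean_space \<Rightarrow> 'b::euclidean_space) \<Rightarrow> 'a set \<Rightarrow> 'b set \<Rightarrow> bool" where
  "Ck_diffeo k f S T \<longleftrightarrow>
     open S \<and> open T \<and> bij_betw f S T \<and> Ck_on k f S \<and> Ck_on k (inv_into S f) T"

abbreviation partial :: "4 \<Rightarrow> (real^4 \<Rightarrow> 'b::real_normed_vector) \<Rightarrow> real^4 \<Rightarrow> 'b" where
  "partial l f x \<equiv> frechet_derivative f (at x) (axis l 1)"

text \<open>A closed 4-ball with \<open>C\<^sup>k\<close> boundary: the image of the closed unit ball under
  a \<open>C\<^sup>k\<close> diffeomorphism between open sets, one of which contains that ball. Its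
  boundary is then a \<open>C\<^sup>k\<close>-embedded 3-sphere.\<close>

definition Ck_ball :: "nat \<Rightarrow> (real^4) set \<Rightarrow> bool" where
  "Ck_ball k D \<longleftrightarrow>
     (\<exists>(f :: real^4 \<Rightarrow> real^4) U V. cball 0 1 \<subseteq> U \<and> Ck_diffeo k f U V \<and>
              D = f ` cball 0 1 \<and> frontier D = f ` sphere 0 1)"


section \<open>Tensors on \<open>\<real>\<^sup>4\<close> in matrix form\<close>

text \<open>A bilinear form \<open>T\<close> is represented by the matrix with entries
  \<open>T (\<partial>\<^sub>j, \<partial>\<^sub>k)\<close>, so that \<open>T (v, w) = v \<bullet> (T *v w)\<close>; an endomorphism is represented
  by its usual matrix. Note that \<open>4 = 0\<close> in the index type \<open>4\<close>, so \<open>1, 2, 3, 4\<close>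
  enumerate it without repetition.\<close>

definition mat_unit :: "4 \<Rightarrow> 4 \<Rightarrow> real^4^4" where
  "mat_unit j k = (\<chi> a b. if a = j \<and> b = k then 1 else 0)"

text \<open>The endomorphism \<open>dx\<^sup>j \<otimes> \<partial>\<^sub>k\<close>.\<close>

definition dx_tensor :: "4 \<Rightarrow> 4 \<Rightarrow> real^4^4" where
  "dx_tensor j k = mat_unit k j"

definition dx_wedge :: "4 \<Rightarrow> 4 \<Rightarrow> real^4^4" where
  "dx_wedge j k = mat_unit j k - mat_unit k j"

definition J0 :: "real^4^4" where
  "J0 = dx_tensor 1 2 - dx_tensor 2 1 + dx_tensor 3 4 - dx_tensor 4 3"

definition omega0 :: "real^4^4" where
  "omega0 = dx_wedge 1 2 + dx_wedge 3 4"

definition closed_2form_on :: "(real^4 \<Rightarrow> real^4^4) \<Rightarrow> (real^4) set \<Rightarrow> bool" where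
  "closed_2form_on \<Omega> S \<longleftrightarrow>
     (\<forall>x\<in>S. \<forall>i j k. partial i \<Omega> x $ j $ k + partial j \<Omega> x $ k $ i + partial k \<Omega> x $ i $ j = 0)"

definition pullback_form :: "(real^4 \<Rightarrow> real^4) \<Rightarrow> (real^4 \<Rightarrow> real^4^4) \<Rightarrow> real^4 \<Rightarrow> real^4^4" where
  "pullback_form f T x =
     transpose (jacobian f (at x)) ** T (f x) ** jacobian f (at x)"

definition fall_off :: "real \<Rightarrow> (real^4 \<Rightarrow> real^4^4) \<Rightarrow> real^4^4 \<Rightarrow> bool" where
  "fall_off \<epsilon> T T0 \<longleftrightarrow>
     (\<lambda>x. norm (T x - T0)) \<in> O[at_infinity](\<lambda>x. norm x powr (- 1 - \<epsilon>)) \<and>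
     (\<forall>l. (\<lambda>x. norm (partial l T x)) \<in> O[at_infinity](\<lambda>x. norm x powr (- 2 - \<epsilon>)))"

definition complex_coords :: "real^4 \<Rightarrow> complex^2" where
  "complex_coords x = (\<chi> i. if i = 1 then Complex (x $ 1) (x $ 2) else Complex (x $ 3) (x $ 4))"

definition unitary_mat :: "complex^2^2 \<Rightarrow> bool" where
  "unitary_mat U \<longleftrightarrow> (\<chi> i j. cnj (U $ j $ i)) ** U = mat 1"

text \<open>\<open>U(2)\<close>, as a set of real matrices, acting on \<open>\<real>\<^sup>4 = \<complex>\<^sup>2\<close>.\<close>

definition U2 :: "(real^4^4) set" where
  "U2 = {A. \<exists>U. unitary_mat U \<and> (\<forall>x. complex_coords (A *v x) = U *v complex_coords x)}"

definition finite_free_subgroup_O4 :: "(real^4^4) set \<Rightarrow> bool" where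
  "finite_free_subgroup_O4 \<Gamma> \<longleftrightarrow>
     finite \<Gamma> \<and> (\<forall>A\<in>\<Gamma>. orthogonal_matrix A) \<and>
     mat 1 \<in> \<Gamma> \<and> (\<forall>A\<in>\<Gamma>. \<forall>B\<in>\<Gamma>. A ** B \<in> \<Gamma>) \<and> (\<forall>A\<in>\<Gamma>. matrix_inv A \<in> \<Gamma>) \<and>
     (\<forall>A\<in>\<Gamma>. A \<noteq> mat 1 \<longrightarrow> (\<forall>x\<in>sphere 0 1. A *v x \<noteq> x))"


section \<open>Smooth 4-manifolds and Kaehler surfaces\<close>

text \<open>A 4-manifold is a whole type \<open>'m\<close> (Hausdorff and second countable) with an
  atlas of charts \<open>(U, \<phi>)\<close>. A tensor field is the family of its component matrices:
  \<open>T c y\<close> is its value in the chart \<open>c = (U, \<phi>)\<close> at the point \<open>y \<in> \<phi> ` U\<close>, and the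
  families for different charts are related by the usual transformation law. Values
  for \<open>c\<close> outside the atlas or \<open>y\<close> outside \<open>\<phi> ` U\<close> are irrelevant.\<close>

type_synonym 'm chart = "'m set \<times> ('m \<Rightarrow> real^4)"
type_synonym 'm tensor = "'m chart \<Rightarrow> real^4 \<Rightarrow> real^4^4"

definition transition :: "'m chart \<Rightarrow> 'm chart \<Rightarrow> real^4 \<Rightarrow> real^4" where
  "transition c d = snd d \<circ> inv_into (fst c) (snd c)"

definition smooth_atlas :: "'m::{t2_space, second_countable_topology} chart set \<Rightarrow> bool" where
  "smooth_atlas \<A> \<longleftrightarrow>
     (\<forall>(U, \<phi>)\<in>\<A>. open U \<and> open (\<phi> ` U) \<and> homeomorphism U (\<phi> ` U) \<phi> (inv_into U \<phi>)) \<and>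
     (\<Union>c\<in>\<A>. fst c) = UNIV \<and>
     (\<forall>c\<in>\<A>. \<forall>d\<in>\<A>. smooth_on (transition c d) (snd c ` (fst c \<inter> fst d)))"

definition riemannian_metric :: "'m chart set \<Rightarrow> 'm tensor \<Rightarrow> bool" where
  "riemannian_metric \<A> g \<longleftrightarrow>
     (\<forall>c\<in>\<A>. Ck_on 2 (g c) (snd c ` fst c) \<and>
        (\<forall>x\<in>snd c ` fst c. transpose (g c x) = g c x \<and> (\<forall>v. v \<noteq> 0 \<longrightarrow> v \<bullet> (g c x *v v) > 0))) \<and>
     (\<forall>c\<in>\<A>. \<forall>d\<in>\<A>. \<forall>x\<in>snd c ` (fst c \<inter> fst d).
        g c x = pullback_form (transition c d) (g d) x)"

text \<open>\<open>J\<close> is an integrable almost complex structure: near each point there are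
  coordinates \<open>z\<close>, with values in \<open>\<complex>\<^sup>2 = \<real>\<^sup>4\<close>, in which \<open>J\<close> is the standard
  complex structure.\<close>

definition complex_structure :: "'m chart set \<Rightarrow> 'm tensor \<Rightarrow> bool" where
  "complex_structure \<A> J \<longleftrightarrow>
     (\<forall>c\<in>\<A>. smooth_on (J c) (snd c ` fst c) \<and>
        (\<forall>x\<in>snd c ` fst c. J c x ** J c x = - mat 1)) \<and>
     (\<forall>c\<in>\<A>. \<forall>d\<in>\<A>. \<forall>x\<in>snd c ` (fst c \<inter> fst d).
        jacobian (transition c d) (at x) ** J c x =
        J d (transition c d x) ** jacobian (transition c d) (at x)) \<and>
     (\<forall>c\<in>\<A>. \<forall>x\<in>snd c ` fst c. \<exists>W z. x \<in> W \<and> W \<subseteq> snd c ` fst c \<and>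
        (\<forall>k. Ck_diffeo k z W (z ` W)) \<and>
        (\<forall>y\<in>W. jacobian z (at y) ** J c y = J0 ** jacobian z (at y)))"

text \<open>The form \<open>\<omega> (v, w) = g (J v, w)\<close>.\<close>

definition kahler_form :: "'m tensor \<Rightarrow> 'm tensor \<Rightarrow> 'm tensor" where
  "kahler_form g J c x = transpose (J c x) ** g c x"

definition kahler_surface :: "'m::{t2_space, second_countable_topology} chart set \<Rightarrow> 'm tensor \<Rightarrow> 'm tensor \<Rightarrow> bool" where
  "kahler_surface \<A> g J \<longleftrightarrow>
     smooth_atlas \<A> \<and> riemannian_metric \<A> g \<and> complex_structure \<A> J \<and>
     (\<forall>c\<in>\<A>. \<forall>x\<in>snd c ` fst c. transpose (J c x) ** g c x ** J c x = g c x) \<and>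
     (\<forall>c\<in>\<A>. closed_2form_on (kahler_form g J c) (snd c ` fst c))"

text \<open>The chart chosen at a point is immaterial wherever \<open>chart_at\<close> is used below,
  by the transformation laws.\<close>

definition chart_at :: "'m chart set \<Rightarrow> 'm \<Rightarrow> 'm chart" where
  "chart_at \<A> m = (SOME c. c \<in> \<A> \<and> m \<in> fst c)"

definition speed :: "'m chart set \<Rightarrow> 'm tensor \<Rightarrow> (real \<Rightarrow> 'm) \<Rightarrow> real \<Rightarrow> real" where
  "speed \<A> g \<gamma> t =
     (let c = chart_at \<A> (\<gamma> t); v = vector_derivative (snd c \<circ> \<gamma>) (at t)
      in sqrt (v \<bullet> (g c (snd c (\<gamma> t)) *v v)))"

text \<open>Integrability of the speed is required because \<open>piecewise_C1_differentiable_on\<close>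
  does not bound the derivative near the exceptional points, and the integral of a
  non-integrable function is \<open>0\<close> by convention.\<close>

definition rectifiable_curve :: "'m::topological_space chart set \<Rightarrow> 'm tensor \<Rightarrow> (real \<Rightarrow> 'm) \<Rightarrow> bool" where
  "rectifiable_curve \<A> g \<gamma> \<longleftrightarrow>
     path \<gamma> \<and>
     (\<forall>c\<in>\<A>. \<forall>a b. {a..b} \<subseteq> {0..1} \<and> \<gamma> ` {a..b} \<subseteq> fst c \<longrightarrow>
        (snd c \<circ> \<gamma>) piecewise_C1_differentiable_on {a..b}) \<and>
     speed \<A> g \<gamma> integrable_on {0..1}"

definition riemannian_dist :: "'m::topological_space chart set \<Rightarrow> 'm tensor \<Rightarrow> 'm \<Rightarrow> 'm \<Rightarrow> real" where
  "riemannian_dist \<A> g p q =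
     Inf {integral {0..1} (speed \<A> g \<gamma>) | \<gamma>.
            rectifiable_curve \<A> g \<gamma> \<and> pathstart \<gamma> = p \<and> pathfinish \<gamma> = q}"

definition complete_metric :: "'m::topological_space chart set \<Rightarrow> 'm tensor \<Rightarrow> bool" where
  "complete_metric \<A> g \<longleftrightarrow>
     (\<forall>s :: nat \<Rightarrow> 'm.
        (\<forall>e>0. \<exists>N. \<forall>m\<ge>N. \<forall>n\<ge>N. riemannian_dist \<A> g (s m) (s n) < e) \<longrightarrow>
        (\<exists>l. s \<longlonglongrightarrow> l))"

text \<open>Pullbacks along a local diffeomorphism \<open>p\<close> from an open subset of \<open>\<real>\<^sup>4\<close> to \<open>M\<close>.\<close>

definition local_diffeo :: "'m::topological_space chart set \<Rightarrow> (real^4 \<Rightarrow> 'm) \<Rightarrow> (real^4) set \<Rightarrow> bool" where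
  "local_diffeo \<A> p S \<longleftrightarrow>
     continuous_on S p \<and>
     (\<forall>(U, \<phi>)\<in>\<A>. smooth_on (\<phi> \<circ> p) {x\<in>S. p x \<in> U} \<and>
        (\<forall>x\<in>S. p x \<in> U \<longrightarrow> invertible (jacobian (\<phi> \<circ> p) (at x))))"

definition pullback_bilinear :: "'m chart set \<Rightarrow> (real^4 \<Rightarrow> 'm) \<Rightarrow> 'm tensor \<Rightarrow> real^4 \<Rightarrow> real^4^4" where
  "pullback_bilinear \<A> p T x =
     (let c = chart_at \<A> (p x) in pullback_form (snd c \<circ> p) (T c) x)"

definition pullback_endo :: "'m chart set \<Rightarrow> (real^4 \<Rightarrow> 'm) \<Rightarrow> 'm tensor \<Rightarrow> real^4 \<Rightarrow> real^4^4" where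
  "pullback_endo \<A> p T x =
     (let c = chart_at \<A> (p x); P = jacobian (snd c \<circ> p) (at x)
      in matrix_inv P ** T c (snd c (p x)) ** P)"


section \<open>Asymptotically locally Euclidean ends\<close>

definition deck_transformation :: "'u::topological_space set \<Rightarrow> ('u \<Rightarrow> 'm) \<Rightarrow> ('u \<Rightarrow> 'u) \<Rightarrow> bool" where
  "deck_transformation Mt \<pi> h \<longleftrightarrow>
     (\<exists>k. homeomorphism Mt Mt h k) \<and> (\<forall>u\<in>Mt. \<pi> (h u) = \<pi> u)"

text \<open>\<open>Mt\<close> is the universal cover of the end \<open>E\<close>, with projection \<open>\<pi>\<close>, and \<open>X\<close> the
  coordinate map from \<open>Mt\<close> onto the complement of the closed ball \<open>B\<close> of radius \<open>R\<close>.
  The smooth structure of \<open>Mt\<close> is the one pulled back by \<open>\<pi>\<close>, so that \<open>X\<close> is a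
  diffeomorphism iff it is a homeomorphism and \<open>\<pi> \<circ> X\<^sup>-\<^sup>1\<close> is a local diffeomorphism.
  In the coordinates, deck transformations are exactly the elements of \<open>\<Gamma>\<close>.\<close>

definition asymptotic_coords ::
  "'m::{t2_space, second_countable_topology} chart set \<Rightarrow> 'm tensor \<Rightarrow> real \<Rightarrow> 'm set \<Rightarrow>
   'u::topological_space set \<Rightarrow> ('u \<Rightarrow> 'm) \<Rightarrow> ('u \<Rightarrow> real^4) \<Rightarrow> real \<Rightarrow> (real^4^4) set \<Rightarrow> bool" where
  "asymptotic_coords \<A> g \<epsilon> E Mt \<pi> X R \<Gamma> \<longleftrightarrow>
     0 < R \<and> covering_space Mt \<pi> E \<and> simply_connected Mt \<and>
     homeomorphism Mt (- cball 0 R) X (inv_into Mt X) \<and>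
     local_diffeo \<A> (\<pi> \<circ> inv_into Mt X) (- cball 0 R) \<and>
     finite_free_subgroup_O4 \<Gamma> \<and>
     (\<forall>A\<in>\<Gamma>. \<exists>h. deck_transformation Mt \<pi> h \<and> (\<forall>u\<in>Mt. X (h u) = A *v X u)) \<and>
     (\<forall>h. deck_transformation Mt \<pi> h \<longrightarrow> (\<exists>A\<in>\<Gamma>. \<forall>u\<in>Mt. X (h u) = A *v X u)) \<and>
     (\<forall>A\<in>\<Gamma>. \<forall>x\<in>- cball 0 R.
        pullback_form ((*v) A) (pullback_bilinear \<A> (\<pi> \<circ> inv_into Mt X) g) x =
        pullback_bilinear \<A> (\<pi> \<circ> inv_into Mt X) g x) \<and>
     fall_off \<epsilon> (pullback_bilinear \<A> (\<pi> \<circ> inv_into Mt X) g) (mat 1)"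

text \<open>For the ends of an ALE surface the universal cover is realised as the
  complement of a ball itself, with the identity as coordinate map.\<close>

definition ALE_kahler_surface ::
  "'m::{t2_space, second_countable_topology} chart set \<Rightarrow> 'm tensor \<Rightarrow> 'm tensor \<Rightarrow> 'm set \<Rightarrow> real \<Rightarrow> bool" where
  "ALE_kahler_surface \<A> g J K \<epsilon> \<longleftrightarrow>
     kahler_surface \<A> g J \<and> complete_metric \<A> g \<and>
     connected (UNIV :: 'm set) \<and> \<not> compact (UNIV :: 'm set) \<and>
     0 < \<epsilon> \<and> compact K \<and> finite (components (- K)) \<and>
     (\<forall>E\<in>components (- K). \<exists>p R \<Gamma>. asymptotic_coords \<A> g \<epsilon> E (- cball 0 R) p id R \<Gamma>)"

end

theory Submission
  imports Defs
begin

text \<open>This is Moser's argument at infinity. The form \<open>F = \<omega> - \<omega>\<^sub>0\<close> is closed and \<open>O(|x|\<^sup>-\<^sup>1\<^sup>-\<^sup>\<epsilon>)\<close>. Contracting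
  it with a unit vector and integrating along the rays in that direction gives primitives of size
  \<open>O(|x|\<^sup>-\<^sup>\<epsilon>)\<close> away from the opposite direction; two opposite directions cover the exterior of a ball, and the
  two primitives are glued over a band, which is possible since \<open>H\<^sup>1\<close> of the exterior of a ball in \<open>\<real>\<^sup>3\<close>
  vanishes. Averaging over unit segments makes the result \<open>C\<^sup>2\<close>, averaging over \<open>\<Gamma>\<close> makes it invariant.
  With this primitive \<open>\<theta>\<close>, the field \<open>V\<^sub>t\<close> defined by \<open>(\<omega>\<^sub>0 + t F) V\<^sub>t = \<theta>\<close>, cut off near the ball, has a
  global flow, whose time-one map \<open>\<Phi>\<close> is the diffeomorphism. The image of the ball under \<open>\<Phi>\<close> is \<open>D\<close>.\<close>

section \<open>Calculus of \<open>C\<^sup>k\<close> functions\<close>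

text \<open>Decay is assumed for \<open>F\<close> and its first derivatives only, while a
  \<open>C\<^sup>2\<close> diffeomorphism calls for a \<open>C\<^sup>2\<close> field. The two
  demands are kept apart: every estimate involves at most one derivative, and second derivatives
  enter through continuity alone. This works because existence of the flow and the bounds on its
  derivative use only the first space derivative of the field. The two rates in the conclusion are
  those of the field and of its first derivative: far out \<open>\<omega>\<^sub>0 + t F\<close> is
  invertible with a uniform bound, so \<open>V\<close> inherits O(|x|^(-\<epsilon>)) from \<theta>,
  and its derivative O(|x|^(-1-\<epsilon>)). The flow of the cut-off field lives on all of
  \<open>\<real>\<^sup>4\<close> and is the identity on a ball. Hence \<Phi> is the restriction of a
  global diffeomorphism, which is what makes \<open>D\<close> a ball containing \<open>B\<close>.
  Two properties of \<omega> come from geometry rather than from the coordinates: it is closed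
  because locally it is the pullback of the Kaehler form by a chart expression of the covering map,
  and it is \<Gamma>-invariant because the elements of \<Gamma> are deck transformations.\<close>

lemma frechet_derivative_cong:
  assumes "open S" "x \<in> S" "\<And>y. y \<in> S \<Longrightarrow> f y = g y"
  shows "frechet_derivative f (at x) = frechet_derivative g (at x)"
proof -
  have "(f has_derivative D) (at x) \<longleftrightarrow> (g has_derivative D) (at x)" for D
    using has_derivative_transform_within_open[of f D x UNIV S g]
      has_derivative_transform_within_open[of g D x UNIV S f] assms by auto
  then show ?thesis by (simp add: frechet_derivative_def)
qed

lemma frechet_derivative_eqI:
  "(f has_derivative D) (at x) \<Longrightarrow> frechet_derivative f (at x) = D"
  using frechet_derivative_at by metis

lemma has_frechet_derivative:
  "f differentiable (at x) \<Longrightarrow> (f has_derivative frechet_derivative f (at x)) (at x)"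
  using frechet_derivative_works by blast

lemma differentiable_cong:
  assumes "open S" "x \<in> S" "\<And>y. y \<in> S \<Longrightarrow> f y = g y" "f differentiable (at x)"
  shows "g differentiable (at x)"
  using assms has_derivative_transform_within_open[of f _ x UNIV S g]
  unfolding differentiable_def by blast

lemma Ck_on_cong:
  assumes "open S" "\<And>x. x \<in> S \<Longrightarrow> f x = g x" "Ck_on k f S"
  shows "Ck_on k g S"
  using assms(2,3)
proof (induction k arbitrary: f g)
  case 0
  then show ?case by (auto cong: continuous_on_cong)
next
  case (Suc k)
  have "Ck_on k (\<lambda>x. frechet_derivative g (at x) v) S" if "v \<in> Basis" for v
    by (rule Suc.IH[of "\<lambda>x. frechet_derivative f (at x) v"])
       (use Suc.prems that frechet_derivative_cong[OF assms(1), of _ f g] in auto)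
  then show ?case
    using Suc.prems differentiable_cong[OF assms(1), of _ f g] by auto
qed

lemma Ck_on_subset: "Ck_on k f S \<Longrightarrow> T \<subseteq> S \<Longrightarrow> Ck_on k f T"
proof (induction k arbitrary: f)
  case 0 then show ?case by (auto intro: continuous_on_subset)
next
  case (Suc k) then show ?case by auto
qed

text \<open>Allows any explicit expression \<open>f'\<close> for the derivative; openness of
  \<open>S\<close> is what lets it replace \<open>frechet_derivative\<close> under further
  differentiation. The closure properties below are inductions on \<open>k\<close> through this
  rule.\<close>

lemma Ck_on_SucI:
  assumes "open S" "\<And>x. x \<in> S \<Longrightarrow> (f has_derivative f' x) (at x)"
    and "\<And>v. v \<in> Basis \<Longrightarrow> Ck_on k (\<lambda>x. f' x v) S"
  shows "Ck_on (Suc k) f S"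
proof -
  have "Ck_on k (\<lambda>x. frechet_derivative f (at x) v) S" if "v \<in> Basis" for v
    by (rule Ck_on_cong[OF assms(1) _ assms(3)[OF that]])
       (simp add: frechet_derivative_eqI[OF assms(2)])
  then show ?thesis using assms(2) by (auto simp: differentiable_def)
qed

lemma Ck_on_Suc_has_derivative:
  "Ck_on (Suc k) f S \<Longrightarrow> x \<in> S \<Longrightarrow> (f has_derivative frechet_derivative f (at x)) (at x)"
  by (simp add: has_frechet_derivative)

lemma Ck_on_decrease: "Ck_on (Suc k) f S \<Longrightarrow> Ck_on k f S"
proof (induction k arbitrary: f)
  case 0
  then show ?case
    by (auto intro!: differentiable_imp_continuous_on simp: differentiable_on_def differentiable_at_withinI)
next
  case (Suc k)
  have "Ck_on k (\<lambda>x. frechet_derivative f (at x) v) S" if "v \<in> Basis" for v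
    using Suc.prems that by (intro Suc.IH) simp
  with Suc.prems show ?case by simp
qed

lemma Ck_on_mono: "Ck_on m f S \<Longrightarrow> k \<le> m \<Longrightarrow> Ck_on k f S"
  by (induction m) (auto simp: le_Suc_eq simp del: Ck_on.simps dest: Ck_on_decrease)

lemma Ck_on_imp_continuous_on: "Ck_on k f S \<Longrightarrow> continuous_on S f"
  using Ck_on_mono[of k f S 0] by simp

lemma Ck_on_local:
  assumes "\<And>x. x \<in> S \<Longrightarrow> \<exists>U. open U \<and> x \<in> U \<and> Ck_on k f U"
  shows "Ck_on k f S"
  using assms
proof (induction k arbitrary: f)
  case 0
  show ?case
  proof (simp add: continuous_on_eq_continuous_within, intro ballI)
    fix x assume "x \<in> S"
    with 0 obtain U where "open U" "x \<in> U" "continuous_on U f" by auto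
    then show "continuous (at x within S) f"
      using continuous_on_eq_continuous_at continuous_at_imp_continuous_at_within by blast
  qed
next
  case (Suc k)
  have "Ck_on k (\<lambda>x. frechet_derivative f (at x) v) S" if "v \<in> Basis" for v
  proof (rule Suc.IH)
    fix x assume "x \<in> S"
    with Suc.prems that show "\<exists>U. open U \<and> x \<in> U \<and> Ck_on k (\<lambda>x. frechet_derivative f (at x) v) U"
      by fastforce
  qed
  moreover have "f differentiable (at x)" if "x \<in> S" for x
    using Suc.prems[OF that] by auto
  ultimately show ?case by simp
qed

lemma Ck_on_const: "Ck_on k (\<lambda>x. c) S"
  by (induction k arbitrary: c) (auto simp: frechet_derivative_const)

lemma Ck_on_add:
  assumes "open S" "Ck_on k f S" "Ck_on k g S"
  shows "Ck_on k (\<lambda>x. f x + g x) S"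
  using assms(2,3)
proof (induction k arbitrary: f g)
  case 0 then show ?case by (auto intro: continuous_intros)
next
  case (Suc k)
  show ?case
  proof (rule Ck_on_SucI[OF assms(1)])
    show "((\<lambda>x. f x + g x) has_derivative
        (\<lambda>v. frechet_derivative f (at x) v + frechet_derivative g (at x) v)) (at x)" if "x \<in> S" for x
      using Suc.prems that by (intro has_derivative_add Ck_on_Suc_has_derivative)
  qed (use Suc in auto)
qed

lemma Ck_on_linear_image:
  assumes "open S" "bounded_linear h" "Ck_on k f S"
  shows "Ck_on k (\<lambda>x. h (f x)) S"
  using assms(3)
proof (induction k arbitrary: f)
  case 0 then show ?case
    using bounded_linear.continuous_on[OF assms(2)] by auto
next
  case (Suc k)
  show ?case
  proof (rule Ck_on_SucI[OF assms(1)])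
    show "((\<lambda>x. h (f x)) has_derivative (\<lambda>v. h (frechet_derivative f (at x) v))) (at x)"
      if "x \<in> S" for x
      using Suc.prems that
      by (intro bounded_linear.has_derivative[OF assms(2)] Ck_on_Suc_has_derivative)
  qed (use Suc in auto)
qed

lemma Ck_on_sum:
  assumes "open S" "\<And>i. i \<in> I \<Longrightarrow> Ck_on k (f i) S"
  shows "Ck_on k (\<lambda>x. \<Sum>i\<in>I. f i x) S"
  using assms(2)
  by (induction I rule: infinite_finite_induct) (auto intro: Ck_on_const Ck_on_add assms(1))

lemma linear_basis_sum:
  fixes h :: "'a::euclidean_space \<Rightarrow> 'b::real_normed_vector"
  assumes "linear h"
  shows "h v = (\<Sum>b\<in>Basis. (v \<bullet> b) *\<^sub>R h b)"
proof -
  have "h (\<Sum>b\<in>Basis. (v \<bullet> b) *\<^sub>R b) = (\<Sum>b\<in>Basis. (v \<bullet> b) *\<^sub>R h b)"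
    by (simp add: linear_sum[OF assms] linear_scale[OF assms])
  then show ?thesis by (simp add: euclidean_representation)
qed

text \<open>\<open>Ck_on\<close> controls derivatives along \<open>Basis\<close> vectors only;
  linearity of the derivative covers every fixed direction \<open>v\<close>.\<close>

lemma Ck_on_frechet:
  assumes "open S" "Ck_on (Suc k) f S"
  shows "Ck_on k (\<lambda>x. frechet_derivative f (at x) v) S"
proof (rule Ck_on_cong[OF assms(1)])
  show "(\<Sum>b\<in>Basis. (v \<bullet> b) *\<^sub>R frechet_derivative f (at x) b) = frechet_derivative f (at x) v"
    if "x \<in> S" for x
  proof -
    have "linear (frechet_derivative f (at x))"
      using Ck_on_Suc_has_derivative[OF assms(2) that] has_derivative_linear by blast
    from linear_basis_sum[OF this, of v] show ?thesis by (rule sym)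
  qed
  show "Ck_on k (\<lambda>x. \<Sum>b\<in>Basis. (v \<bullet> b) *\<^sub>R frechet_derivative f (at x) b) S"
        using assms
    by (intro Ck_on_sum[OF assms(1)] Ck_on_linear_image[OF assms(1) bounded_linear_scaleR_right]) simp
qed

lemma Ck_on_linear: "open S \<Longrightarrow> bounded_linear h \<Longrightarrow> Ck_on k h S"
proof (cases k)
  case (Suc m)
  assume "open S" "bounded_linear h"
  then show ?thesis unfolding Suc
    by (intro Ck_on_SucI[where f'="\<lambda>_. h"] Ck_on_const bounded_linear_imp_has_derivative)
qed (auto intro: linear_continuous_on)

lemma Ck_on_ident: "open S \<Longrightarrow> Ck_on k (\<lambda>x. x) S"
  by (rule Ck_on_linear) auto

lemma Ck_on_bilinear:
  assumes "open S" "bounded_bilinear pr" "Ck_on k f S" "Ck_on k g S"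
  shows "Ck_on k (\<lambda>x. pr (f x) (g x)) S"
  using assms(3,4)
proof (induction k arbitrary: f g)
  case 0 then show ?case
    using bounded_bilinear.continuous_on[OF assms(2)] by auto
next
  case (Suc k)
  show ?case
  proof (rule Ck_on_SucI[OF assms(1)])
    show "((\<lambda>x. pr (f x) (g x)) has_derivative
        (\<lambda>v. pr (f x) (frechet_derivative g (at x) v) + pr (frechet_derivative f (at x) v) (g x))) (at x)"
      if "x \<in> S" for x
      using Suc.prems that
      by (intro bounded_bilinear.FDERIV[OF assms(2)] Ck_on_Suc_has_derivative)
    show "Ck_on k (\<lambda>x. pr (f x) (frechet_derivative g (at x) v) + pr (frechet_derivative f (at x) v) (g x)) S"
      for v
      using Suc.prems by (intro Ck_on_add Suc.IH Ck_on_frechet assms(1)) (auto dest: Ck_on_decrease simp del: Ck_on.simps)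
  qed
qed

lemmas Ck_on_scaleR = Ck_on_bilinear[OF _ bounded_bilinear_scaleR]
lemmas Ck_on_mult = Ck_on_bilinear[OF _ bounded_bilinear_mult]
lemmas Ck_on_inner = Ck_on_bilinear[OF _ bounded_bilinear_inner]

lemma Ck_on_minus:
  assumes "open S" "Ck_on k f S" "Ck_on k g S"
  shows "Ck_on k (\<lambda>x. f x - g x) S"
  using Ck_on_add[OF assms(1,2) Ck_on_linear_image[OF assms(1) bounded_linear_minus[OF bounded_linear_ident] assms(3)]]
  by simp

lemma Ck_on_componentwise:
  fixes f :: "'a::euclidean_space \<Rightarrow> 'b::euclidean_space"
  assumes "open S" "\<And>i. i \<in> Basis \<Longrightarrow> Ck_on k (\<lambda>x. f x \<bullet> i) S"
  shows "Ck_on k f S"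
proof -
  have "Ck_on k (\<lambda>x. \<Sum>i\<in>Basis. (f x \<bullet> i) *\<^sub>R i) S"
    by (intro Ck_on_sum Ck_on_scaleR Ck_on_const assms)
  then show ?thesis by (simp add: euclidean_representation)
qed

lemma Ck_on_matrix:
  fixes f :: "'a::euclidean_space \<Rightarrow> real^'n^'m"
  assumes "open S" "\<And>i j. Ck_on k (\<lambda>x. f x $ i $ j) S"
  shows "Ck_on k f S"
  by (rule Ck_on_componentwise[OF assms(1)]) (use assms(2) in \<open>auto simp: Basis_vec_def inner_axis\<close>)

lemma Ck_on_matrix_entry:
  fixes f :: "'a::euclidean_space \<Rightarrow> real^'n^'m"
  assumes "open S" "Ck_on k f S"
  shows "Ck_on k (\<lambda>x. f x $ i $ j) S"
  by (rule Ck_on_linear_image[OF assms(1) bounded_linear_compose[OF bounded_linear_vec_nth bounded_linear_vec_nth] assms(2)])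

lemma Ck_on_Pair:
  assumes "open S" "Ck_on k f S" "Ck_on k g S"
  shows "Ck_on k (\<lambda>x. (f x, g x)) S"
proof -
  have "bounded_linear (\<lambda>x. (x, 0::'c))" "bounded_linear (\<lambda>y. (0::'b, y))"
    by (auto intro: bounded_linear_intros)
  from Ck_on_add[OF assms(1) Ck_on_linear_image[OF assms(1) this(1) assms(2)]
      Ck_on_linear_image[OF assms(1) this(2) assms(3)]]
  show ?thesis by simp
qed

text \<open>In the chain rule the vector fed to the derivative of \<open>f\<close> varies with
  \<open>x\<close>. Expanding over \<open>Basis\<close> turns the derivative into a sum of products
  of functions of order \<open>k\<close>, to which the induction hypothesis for the partial
  derivatives of \<open>f\<close> applies.\<close>

lemma Ck_on_compose:
  assumes "open S" "open T" "Ck_on k f T" "Ck_on k g S" "g ` S \<subseteq> T"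
  shows "Ck_on k (\<lambda>x. f (g x)) S"
  using assms(3,4)
proof (induction k arbitrary: f)
  case 0 then show ?case
    using continuous_on_compose2[of T f S g] assms(5) by auto
next
  case (Suc k)
  show ?case
  proof (rule Ck_on_SucI[OF assms(1)])
    show *: "((\<lambda>x. f (g x)) has_derivative
        (\<lambda>v. \<Sum>b\<in>Basis. (frechet_derivative g (at x) v \<bullet> b) *\<^sub>R frechet_derivative f (at (g x)) b)) (at x)"
      if "x \<in> S" for x
    proof -
      have d: "(f has_derivative frechet_derivative f (at (g x))) (at (g x))"
        using Suc.prems(1) assms(5) that by (intro Ck_on_Suc_has_derivative) auto
      have "frechet_derivative f (at (g x)) w =
          (\<Sum>b\<in>Basis. (w \<bullet> b) *\<^sub>R frechet_derivative f (at (g x)) b)" for w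
        by (rule linear_basis_sum[OF has_derivative_linear[OF d]])
      then have "(\<lambda>v. frechet_derivative f (at (g x)) (frechet_derivative g (at x) v)) =
          (\<lambda>v. \<Sum>b\<in>Basis. (frechet_derivative g (at x) v \<bullet> b) *\<^sub>R frechet_derivative f (at (g x)) b)"
        by blast
      with has_derivative_compose[OF Ck_on_Suc_has_derivative[OF Suc.prems(2) that] d]
      show ?thesis by (simp only:)
    qed
    show "Ck_on k (\<lambda>x. \<Sum>b\<in>Basis. (frechet_derivative g (at x) v \<bullet> b) *\<^sub>R frechet_derivative f (at (g x)) b) S" for v
      by (intro Ck_on_sum Ck_on_scaleR Ck_on_inner Ck_on_const Ck_on_frechet assms(1) Suc.prems(2) Suc.IH
          Ck_on_decrease[OF Suc.prems(2)]) (use Suc.prems assms in auto)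
  qed
qed

lemma Ck_on_inverse:
  fixes f :: "'a::euclidean_space \<Rightarrow> real"
  assumes "open S" "Ck_on k f S" "\<And>x. x \<in> S \<Longrightarrow> f x \<noteq> 0"
  shows "Ck_on k (\<lambda>x. inverse (f x)) S"
  using assms(2)
proof (induction k)
  case 0 then show ?case using assms(3) by (auto intro: continuous_intros)
next
  case (Suc k)
  show ?case
  proof (rule Ck_on_SucI[OF assms(1)])
    show "((\<lambda>x. inverse (f x)) has_derivative
        (\<lambda>v. - (inverse (f x) * frechet_derivative f (at x) v * inverse (f x)))) (at x)" if "x \<in> S" for x
      using Suc.prems that assms(3) by (intro Deriv.has_derivative_inverse Ck_on_Suc_has_derivative) auto
    show "Ck_on k (\<lambda>x. - (inverse (f x) * frechet_derivative f (at x) v * inverse (f x))) S" for v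
      by (intro Ck_on_linear_image[OF assms(1) bounded_linear_minus[OF bounded_linear_ident]]
          Ck_on_mult assms(1) Suc.IH Ck_on_frechet Suc.prems Ck_on_decrease[OF Suc.prems])
  qed
qed

lemma Ck_on_norm:
  fixes S :: "'a::euclidean_space set"
  assumes "open S" "0 \<notin> S"
  shows "Ck_on k norm S"
proof (induction k)
  case 0 then show ?case by (simp add: continuous_on_norm)
next
  case (Suc k)
  show ?case
  proof (rule Ck_on_SucI[OF assms(1)])
    show "(norm has_derivative (\<lambda>v. (x \<bullet> v) * inverse (norm x))) (at x)" if "x \<in> S" for x
    proof -
      have "x \<noteq> 0" using that assms by auto
      from has_derivative_norm[OF this] show ?thesis
        by (simp add: sgn_div_norm divide_inverse inner_commute mult.commute)
    qed
    show "Ck_on k (\<lambda>x. (x \<bullet> v) * inverse (norm x)) S" for v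
      using assms by (intro Ck_on_mult Ck_on_inner Ck_on_ident Ck_on_const Ck_on_inverse Suc.IH) auto
  qed
qed

section \<open>A cut-off function of class \<open>C\<^sup>2\<close>\<close>

text \<open>Each further power of the positive part gains one order of smoothness: the derivative is
  a multiple of the previous power, and only the origin needs a separate look.\<close>

lemma Ck_on_max_power: "Ck_on k (\<lambda>t::real. max 0 t ^ Suc k) UNIV"
proof (induction k)
  case 0 then show ?case by (auto intro!: continuous_intros)
next
  case (Suc k)
  show ?case
  proof (rule Ck_on_SucI)
    show "((\<lambda>t::real. max 0 t ^ Suc (Suc k)) has_derivative (\<lambda>v. v * (real (Suc (Suc k)) * max 0 t ^ Suc k))) (at t)" for t
    proof (cases "t = 0")
      case False
      then consider "t < 0" | "t > 0" by linarith
      then show ?thesis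
      proof cases
        case 1
        have "((\<lambda>t::real. max 0 t ^ Suc (Suc k)) has_derivative (\<lambda>v. 0)) (at t)"
          by (rule has_derivative_transform_within_open[OF has_derivative_const[of 0] open_lessThan[of 0]])
             (use 1 in auto)
        then show ?thesis using 1 by (simp add: max_def)
      next
        case 2
        have "((\<lambda>t::real. t ^ Suc (Suc k)) has_derivative (\<lambda>v. v * (real (Suc (Suc k)) * t ^ Suc k))) (at t)"
        proof -
          have "((\<lambda>t::real. t ^ Suc (Suc k)) has_field_derivative (real (Suc (Suc k)) * t ^ Suc k)) (at t)"
            using DERIV_pow[of "Suc (Suc k)" t] by simp
          then show ?thesis by (simp only: has_field_derivative_def mult.commute[of _ "real (Suc (Suc k)) * t ^ Suc k"])
        qed
        then have "((\<lambda>t::real. max 0 t ^ Suc (Suc k)) has_derivative (\<lambda>v. v * (real (Suc (Suc k)) * t ^ Suc k))) (at t)"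
          by (rule has_derivative_transform_within_open[OF _ open_greaterThan[of 0]]) (use 2 in auto)
        then show ?thesis using 2 by (simp add: max_def)
      qed
    next
      case True
      have "((\<lambda>t::real. max 0 t * max 0 t ^ Suc k) has_field_derivative 0) (at 0)"
      proof -
        have "((\<lambda>h::real. (max 0 h * max 0 h ^ Suc k) / h) \<longlongrightarrow> 0) (at 0)"
        proof (rule Lim_null_comparison)
          show "\<forall>\<^sub>F h in at 0. norm (max 0 h * max 0 h ^ Suc k / h) \<le> max 0 h ^ Suc k" for h :: real
            by (auto simp: max_def eventually_at_filter)
          have "((\<lambda>h::real. max 0 h ^ Suc k) \<longlongrightarrow> max 0 0 ^ Suc k) (at 0)"
            by (intro tendsto_intros)
          then show "((\<lambda>h::real. max 0 h ^ Suc k) \<longlongrightarrow> 0) (at 0)" by simp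
        qed
        then show ?thesis by (simp add: has_field_derivative_iff)
      qed
      moreover have "(*) (0::real) = (\<lambda>v. v * (real (Suc (Suc k)) * max 0 0 ^ Suc k))" by auto
      ultimately show ?thesis using True
        by (simp only: has_field_derivative_def power_Suc[of _ "Suc k"])
    qed
    show "Ck_on k (\<lambda>t. v * (real (Suc (Suc k)) * max 0 t ^ Suc k)) UNIV" for v
      using Ck_on_linear_image[OF open_UNIV bounded_linear_mult_right Suc.IH, of "v * real (Suc (Suc k))"]
      by (simp add: mult.assoc)
  qed auto
qed

text \<open>Two derivatives are enough, so cubes of positive parts take the place of the usual
  \<open>exp (- 1 / t)\<close>. The denominator never vanishes because \<open>t\<close> and
  \<open>1 - t\<close> are not both nonpositive.\<close>

definition smoothstep :: "real \<Rightarrow> real" where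
  "smoothstep t = max 0 t ^ 3 * inverse (max 0 t ^ 3 + max 0 (1 - t) ^ 3)"

lemma smoothstep_denom_pos: "max 0 t ^ 3 + max 0 (1 - t) ^ 3 > (0::real)"
proof (cases "t > 0")
  case True then show ?thesis by (intro add_pos_nonneg) auto
next
  case False then show ?thesis by (intro add_nonneg_pos) auto
qed

lemma smoothstep_0: "t \<le> 0 \<Longrightarrow> smoothstep t = 0"
  and smoothstep_1: "t \<ge> 1 \<Longrightarrow> smoothstep t = 1"
  and smoothstep_nonneg: "0 \<le> smoothstep t"
  and smoothstep_le_1: "smoothstep t \<le> 1"
proof -
  show "t \<le> 0 \<Longrightarrow> smoothstep t = 0" by (simp add: smoothstep_def)
  show "t \<ge> 1 \<Longrightarrow> smoothstep t = 1" by (simp add: smoothstep_def max_def)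
  show "0 \<le> smoothstep t" using smoothstep_denom_pos[of t] by (simp add: smoothstep_def)
  show "smoothstep t \<le> 1" using smoothstep_denom_pos[of t]
    by (simp add: smoothstep_def field_simps)
qed

lemma Ck_on_smoothstep: "Ck_on 2 smoothstep UNIV"
proof -
  have p: "Ck_on 2 (\<lambda>t::real. max 0 t ^ 3) UNIV"
    using Ck_on_max_power[of 2] by (simp add: eval_nat_numeral)
  have q: "Ck_on 2 (\<lambda>t::real. max 0 (1 - t) ^ 3) UNIV"
    by (intro Ck_on_compose[OF _ _ p] Ck_on_minus Ck_on_const Ck_on_ident) auto
  have "smoothstep = (\<lambda>t. max 0 t ^ 3 * inverse (max 0 t ^ 3 + max 0 (1 - t) ^ 3))"
    by (auto simp: smoothstep_def)
  moreover have "Ck_on 2 \<dots> UNIV"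
    using smoothstep_denom_pos by (intro Ck_on_mult Ck_on_inverse Ck_on_add p q open_UNIV) (metis less_irrefl)
  ultimately show ?thesis by simp
qed

lemma Ck_on_1_has_derivative:
  "Ck_on 1 f S \<Longrightarrow> x \<in> S \<Longrightarrow> (f has_derivative frechet_derivative f (at x)) (at x)"
  using Ck_on_Suc_has_derivative[of 0 f S] by simp

section \<open>Integrals depending on a parameter\<close>

text \<open>The Leibniz rule needs the derivative to be continuous as an operator. In finite
  dimension continuity of \<open>f' x t v\<close> for each fixed \<open>v\<close> gives this, and
  that is the form in which continuity is available below.\<close>

lemma has_derivative_parametric_integral:
  fixes f :: "'a::euclidean_space \<Rightarrow> real \<Rightarrow> 'b::euclidean_space"
  assumes U: "open U" "x0 \<in> U"
    and f: "\<And>x t. x \<in> U \<Longrightarrow> t \<in> {a..b} \<Longrightarrow> ((\<lambda>x. f x t) has_derivative f' x t) (at x)"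
    and cf: "\<And>x. x \<in> U \<Longrightarrow> continuous_on {a..b} (f x)"
    and cf': "\<And>v. continuous_on (U \<times> {a..b}) (\<lambda>(x, t). f' x t v)"
  shows "((\<lambda>x. integral {a..b} (f x)) has_derivative (\<lambda>v. integral {a..b} (\<lambda>t. f' x0 t v))) (at x0)"
proof -
  obtain d where d: "d > 0" "ball x0 d \<subseteq> U" using U open_contains_ball by blast
  let ?B = "ball x0 d"
  have bl: "bounded_linear (f' x t)" if "x \<in> U" "t \<in> {a..b}" for x t
    using f[OF that] has_derivative_bounded_linear by blast
  have c: "continuous_on (?B \<times> {a..b}) (\<lambda>z. Blinfun (f' (fst z) (snd z)))"
  proof (rule continuous_on_blinfun_componentwise)
    fix v :: 'a
    have "continuous_on (?B \<times> {a..b}) (\<lambda>z. f' (fst z) (snd z) v)"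
      using continuous_on_subset[OF cf'[of v], of "?B \<times> {a..b}"] d by (auto simp: case_prod_beta')
    then show "continuous_on (?B \<times> {a..b}) (\<lambda>z. blinfun_apply (Blinfun (f' (fst z) (snd z))) v)"
      by (rule continuous_on_eq) (use d bl in \<open>auto simp: bounded_linear_Blinfun_apply\<close>)
  qed
  have x0: "x0 \<in> ?B" using d by simp
  have "((\<lambda>x. integral (cbox a b) (f x)) has_derivative
      integral (cbox a b) (\<lambda>t. Blinfun (f' x0 t))) (at x0 within ?B)"
  proof (rule leibniz_rule)
    show "((\<lambda>x. f x t) has_derivative blinfun_apply (Blinfun (f' x t))) (at x within ?B)"
      if "x \<in> ?B" "t \<in> cbox a b" for x t
      using f[of x t] bl[of x t] that d
      by (auto simp: bounded_linear_Blinfun_apply has_derivative_at_withinI)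
    show "f x integrable_on cbox a b" if "x \<in> ?B" for x
      using integrable_continuous[of a b "f x"] cf[of x] d that by auto
    show "continuous_on (?B \<times> cbox a b) (\<lambda>(x, t). Blinfun (f' x t))"
      using c by (simp add: case_prod_beta')
  qed (use d in auto)
  moreover have "blinfun_apply (integral (cbox a b) (\<lambda>t. Blinfun (f' x0 t))) =
      (\<lambda>v. integral {a..b} (\<lambda>t. f' x0 t v))"
  proof
    fix v
    have "continuous_on (cbox a b) (\<lambda>t. Blinfun (f' x0 t))"
    proof -
      have "continuous_on (cbox a b) (\<lambda>t. Blinfun (f' (fst (x0, t)) (snd (x0, t))))"
        by (rule continuous_on_compose2[OF c]) (use x0 in \<open>auto intro!: continuous_intros\<close>)
      then show ?thesis by simp
    qed
    then have "blinfun_apply (integral (cbox a b) (\<lambda>t. Blinfun (f' x0 t))) v =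
        integral (cbox a b) (\<lambda>t. blinfun_apply (Blinfun (f' x0 t)) v)"
      using integral_linear[OF integrable_continuous blinfun.bounded_linear_left, of a b "\<lambda>t. Blinfun (f' x0 t)" v]
      by (simp add: o_def)
    also have "\<dots> = integral {a..b} (\<lambda>t. f' x0 t v)"
      using bl U by (auto intro!: integral_cong simp: bounded_linear_Blinfun_apply)
    finally show "blinfun_apply (integral (cbox a b) (\<lambda>t. Blinfun (f' x0 t))) v =
        integral {a..b} (\<lambda>t. f' x0 t v)" .
  qed
  ultimately show ?thesis
    using at_within_open[OF x0 open_ball] by simp
qed

lemma continuous_on_frechet:
  assumes "open S" "Ck_on (Suc k) f S"
  shows "continuous_on S (\<lambda>x. frechet_derivative f (at x) v)"
  using Ck_on_frechet[OF assms] Ck_on_imp_continuous_on by blast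

lemma has_derivative_shift:
  "(f has_derivative f') (at (x + c)) \<Longrightarrow> ((\<lambda>x. f (x + c)) has_derivative f') (at x)"
  by (rule has_derivative_compose[of "\<lambda>x. x + c" "\<lambda>v. v" x UNIV f])
     (auto intro!: derivative_eq_intros)

lemma has_derivative_linear_arg:
  assumes "bounded_linear h" "(f has_derivative f') (at (h x))"
  shows "((\<lambda>x. f (h x)) has_derivative (\<lambda>v. f' (h v))) (at x)"
  using bounded_linear_imp_has_derivative[OF assms(1)] assms(2) by (rule has_derivative_compose)

lemma integral_along_line:
  fixes f :: "'a::euclidean_space \<Rightarrow> 'b::banach"
  assumes "a \<le> b" "\<And>s. s \<in> {a..b} \<Longrightarrow> (f has_derivative f' (x + s *\<^sub>R e)) (at (x + s *\<^sub>R e))"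
  shows "((\<lambda>s. f' (x + s *\<^sub>R e) e) has_integral (f (x + b *\<^sub>R e) - f (x + a *\<^sub>R e))) {a..b}"
proof (rule fundamental_theorem_of_calculus[OF assms(1)])
  fix s assume s: "s \<in> {a..b}"
  have "((\<lambda>s. f (x + s *\<^sub>R e)) has_derivative (\<lambda>h. f' (x + s *\<^sub>R e) (h *\<^sub>R e))) (at s)"
    by (rule has_derivative_compose[where f="\<lambda>s. x + s *\<^sub>R e" and g=f])
       (use assms(2)[OF s] in \<open>auto intro!: derivative_eq_intros\<close>)
  moreover have "f' (x + s *\<^sub>R e) (h *\<^sub>R e) = h *\<^sub>R f' (x + s *\<^sub>R e) e" for h
    using has_derivative_linear[OF assms(2)[OF s]] linear_scale by blast
  ultimately show "((\<lambda>s. f (x + s *\<^sub>R e)) has_vector_derivative f' (x + s *\<^sub>R e) e) (at s within {a..b})"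
    by (simp add: has_vector_derivative_def has_derivative_at_withinI)
qed

text \<open>Translations commute with differentiation. The weight \<open>w\<close> is there for the
  averages with weight \<open>1 - s\<close> in the smoothing of primitives; plain integrals take
  weight \<open>1\<close>.\<close>

lemma has_derivative_line_integral:
  fixes g :: "'a::euclidean_space \<Rightarrow> 'b::euclidean_space" and w :: "real \<Rightarrow> real"
  assumes "open S" "open T" "Ck_on 1 g T" "x \<in> S" "continuous_on {a..b} w"
    and ST: "\<And>x s. x \<in> S \<Longrightarrow> s \<in> {a..b} \<Longrightarrow> x + s *\<^sub>R e \<in> T"
  shows "((\<lambda>x. integral {a..b} (\<lambda>s. w s *\<^sub>R g (x + s *\<^sub>R e))) has_derivative
    (\<lambda>v. integral {a..b} (\<lambda>s. w s *\<^sub>R frechet_derivative g (at (x + s *\<^sub>R e)) v))) (at x)"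
proof (rule has_derivative_parametric_integral[OF assms(1,4),
      where f'="\<lambda>x s v. w s *\<^sub>R frechet_derivative g (at (x + s *\<^sub>R e)) v"])
  fix x s assume xs: "x \<in> S" "s \<in> {a..b}"
  have "(g has_derivative frechet_derivative g (at (x + s *\<^sub>R e))) (at (x + s *\<^sub>R e))"
    using assms(3) ST[OF xs] by (intro Ck_on_Suc_has_derivative[of 0]) simp_all
  from has_derivative_shift[OF this] show "((\<lambda>x. w s *\<^sub>R g (x + s *\<^sub>R e)) has_derivative
      (\<lambda>v. w s *\<^sub>R frechet_derivative g (at (x + s *\<^sub>R e)) v)) (at x)"
    by (rule has_derivative_scaleR_right)
next
  fix x assume "x \<in> S"
  then show "continuous_on {a..b} (\<lambda>s. w s *\<^sub>R g (x + s *\<^sub>R e))"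
    by (intro continuous_intros assms(5) continuous_on_compose2[OF Ck_on_imp_continuous_on[OF assms(3)]])
       (use ST in auto)
next
  fix v
  have "continuous_on (S \<times> {a..b}) (\<lambda>z. w (snd z) *\<^sub>R frechet_derivative g (at (fst z + snd z *\<^sub>R e)) v)"
    using assms(2,3)
    by (intro continuous_intros continuous_on_compose2[OF assms(5)]
        continuous_on_compose2[OF continuous_on_frechet[where k=0]]) (use ST in auto)
  then show "continuous_on (S \<times> {a..b}) (\<lambda>(x, s). w s *\<^sub>R frechet_derivative g (at (x + s *\<^sub>R e)) v)"
    by (simp add: case_prod_beta')
qed

lemma Ck_on_line_integral:
  fixes g :: "'a::euclidean_space \<Rightarrow> 'b::euclidean_space" and w :: "real \<Rightarrow> real"
  assumes "open S" "open T" "Ck_on k g T" "continuous_on {a..b} w"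
    and ST: "\<And>x s. x \<in> S \<Longrightarrow> s \<in> {a..b} \<Longrightarrow> x + s *\<^sub>R e \<in> T"
  shows "Ck_on k (\<lambda>x. integral {a..b} (\<lambda>s. w s *\<^sub>R g (x + s *\<^sub>R e))) S"
  using assms(3)
proof (induction k arbitrary: g)
  case 0
  have "continuous_on (S \<times> cbox a b) (\<lambda>z. w (snd z) *\<^sub>R g (fst z + snd z *\<^sub>R e))"
    by (intro continuous_on_scaleR continuous_on_compose2[OF assms(4)] continuous_on_compose2[OF 0[simplified]])
      (use ST in \<open>auto intro!: continuous_intros\<close>)
  then have "continuous_on (S \<times> cbox a b) (\<lambda>(x, s). w s *\<^sub>R g (x + s *\<^sub>R e))"
    by (simp add: case_prod_beta')
  from integral_continuous_on_param[OF this] show ?case by simp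
next
  case (Suc k)
  have "Ck_on 1 g T" by (rule Ck_on_mono[OF Suc.prems]) simp
  show ?case
  proof (rule Ck_on_SucI[OF assms(1)])
    show "((\<lambda>x. integral {a..b} (\<lambda>s. w s *\<^sub>R g (x + s *\<^sub>R e))) has_derivative
      (\<lambda>v. integral {a..b} (\<lambda>s. w s *\<^sub>R frechet_derivative g (at (x + s *\<^sub>R e)) v))) (at x)"
      if "x \<in> S" for x
      by (rule has_derivative_line_integral[OF assms(1,2) \<open>Ck_on 1 g T\<close> that assms(4) ST])
  qed (rule Suc.IH[OF Ck_on_frechet[OF assms(2) Suc.prems]])
qed

text \<open>By the fundamental theorem of calculus and differentiation under the integral, the
  derivative of \<open>f\<close> in direction \<open>b\<close> at \<open>x + s *\<^sub>R a\<close>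
  is its value at \<open>s = 0\<close> plus an integral over \<open>{0..s}\<close>. Its one-sided
  derivative at \<open>s = 0\<close> is then read off in two ways.\<close>

lemma second_frechet_derivative_commute:
  fixes f :: "'a::euclidean_space \<Rightarrow> 'b::euclidean_space"
  assumes S: "open S" "x \<in> S" and f: "Ck_on 2 f S"
  shows "frechet_derivative (\<lambda>y. frechet_derivative f (at y) a) (at x) b =
    frechet_derivative (\<lambda>y. frechet_derivative f (at y) b) (at x) a"
proof -
  obtain d where d: "d > 0" "ball x d \<subseteq> S" using S open_contains_ball by blast
  define s0 where "s0 = d / (2 * (norm a + 1))"
  have s0: "s0 > 0" "s0 * norm a < d / 2"
    using d by (auto simp: s0_def field_simps add_pos_nonneg)
  have f': "Ck_on (Suc (Suc 0)) f S" using f by (simp add: eval_nat_numeral)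
  let ?B = "ball x (d/2)"
  have in_S: "y + s *\<^sub>R a \<in> S" if "y \<in> ?B" "s \<in> {0..s0}" for y s
  proof -
    have "norm (s *\<^sub>R a) < d / 2"
      using that s0 mult_right_mono[of s s0 "norm a"] by auto
    moreover have "dist x (y + s *\<^sub>R a) \<le> dist x y + norm (s *\<^sub>R a)"
      by (metis add_diff_cancel_left' dist_norm dist_triangle norm_minus_commute)
    ultimately show ?thesis using that d by (intro subsetD[OF d(2)]) auto
  qed
  let ?u = "\<lambda>s. frechet_derivative f (at (x + s *\<^sub>R a)) b"
  let ?k = "\<lambda>s. frechet_derivative (\<lambda>y. frechet_derivative f (at y) a) (at (x + s *\<^sub>R a)) b"
  have Da: "Ck_on 1 (\<lambda>y. frechet_derivative f (at y) v) S" for v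
    using Ck_on_frechet[OF S(1) f'] by simp
  have xB: "x \<in> ?B" using d by simp
  have u: "?u s = ?u 0 + integral {0..s} ?k" if s: "s \<in> {0..s0}" for s
  proof -
    have ftc: "f (y + s *\<^sub>R a) - f y = integral {0..s} (\<lambda>r. 1 *\<^sub>R frechet_derivative f (at (y + r *\<^sub>R a)) a)"
      if "y \<in> ?B" for y
      using integral_along_line[of 0 s f "\<lambda>z. frechet_derivative f (at z)" y a] s that in_S[OF that]
        Ck_on_Suc_has_derivative[OF f'] by (auto simp: integral_unique)
    have "((\<lambda>y. integral {0..s} (\<lambda>r. 1 *\<^sub>R frechet_derivative f (at (y + r *\<^sub>R a)) a)) has_derivative
       (\<lambda>v. integral {0..s} (\<lambda>r. 1 *\<^sub>R frechet_derivative (\<lambda>y. frechet_derivative f (at y) a) (at (x + r *\<^sub>R a)) v)))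
       (at x)"
      by (rule has_derivative_line_integral[OF open_ball S(1) Da xB]) (use d s in_S in auto)
    then have "((\<lambda>y. f (y + s *\<^sub>R a) - f y) has_derivative
       (\<lambda>v. integral {0..s} (\<lambda>r. frechet_derivative (\<lambda>y. frechet_derivative f (at y) a) (at (x + r *\<^sub>R a)) v)))
       (at x)"
      unfolding scaleR_one
      by (rule has_derivative_transform_within_open[OF _ open_ball xB])
         (use ftc in simp)
    moreover have "((\<lambda>y. f (y + s *\<^sub>R a) - f y) has_derivative
        (\<lambda>v. frechet_derivative f (at (x + s *\<^sub>R a)) v - frechet_derivative f (at x) v)) (at x)"
      using Ck_on_Suc_has_derivative[OF f' in_S[OF xB s]] Ck_on_Suc_has_derivative[OF f' S(2)]
      by (intro has_derivative_diff has_derivative_shift)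
    ultimately have "(\<lambda>v. frechet_derivative f (at (x + s *\<^sub>R a)) v - frechet_derivative f (at x) v) =
       (\<lambda>v. integral {0..s} (\<lambda>r. frechet_derivative (\<lambda>y. frechet_derivative f (at y) a) (at (x + r *\<^sub>R a)) v))"
      using has_derivative_unique by blast
    from fun_cong[OF this, of b] show ?thesis by (simp add: algebra_simps)
  qed
  have "continuous_on {0..s0} ?k"
    by (rule continuous_on_compose2[OF continuous_on_frechet[where k=0]])
       (use S Da in_S xB in \<open>auto intro!: continuous_intros\<close>)
  then have "((\<lambda>s. integral {0..s} ?k) has_vector_derivative ?k 0) (at 0 within {0..s0})"
    using s0 by (intro integral_has_vector_derivative) auto
  then have "((\<lambda>s. ?u 0 + integral {0..s} ?k) has_vector_derivative ?k 0) (at 0 within {0..s0})"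
    by (auto intro!: derivative_eq_intros)
  then have "(?u has_vector_derivative ?k 0) (at 0 within {0..s0})"
    by (rule has_vector_derivative_transform[rotated 2]) (use u s0 in auto)
  moreover have "(?u has_vector_derivative frechet_derivative (\<lambda>y. frechet_derivative f (at y) b) (at x) a)
      (at 0 within {0..s0})"
  proof -
    let ?D = "frechet_derivative (\<lambda>y. frechet_derivative f (at y) b) (at x)"
    have D: "((\<lambda>y. frechet_derivative f (at y) b) has_derivative ?D) (at x)"
      using Ck_on_1_has_derivative Da S by blast
    have "(?u has_derivative (\<lambda>h. ?D (h *\<^sub>R a))) (at 0)"
      by (rule has_derivative_compose[where g="\<lambda>y. frechet_derivative f (at y) b"])
         (use D in \<open>auto intro!: derivative_eq_intros\<close>)
    moreover have "?D (h *\<^sub>R a) = h *\<^sub>R ?D a" for h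
      using has_derivative_linear[OF D] linear_scale by blast
    ultimately show ?thesis
      by (simp add: has_vector_derivative_def has_derivative_at_withinI)
  qed
  ultimately show ?thesis
    using vector_derivative_unique_within_closed_interval[of 0 s0 0 ?u] s0
    by (auto simp: box_real)
qed

section \<open>Symbol classes\<close>

text \<open>The fall-off condition on \<open>\<omega>\<close> says that \<open>\<omega> - \<omega>\<^sub>0\<close> lies in the class with \<open>q = 1 + \<epsilon>\<close>.\<close>

definition symb :: "real \<Rightarrow> ('a::euclidean_space \<Rightarrow> 'b::real_normed_vector) \<Rightarrow> 'a set \<Rightarrow> bool" where
  "symb q f U \<longleftrightarrow> Ck_on 1 f U \<and> (\<exists>C. \<forall>x\<in>U. norm (f x) \<le> C * norm x powr (- q) \<and>
     (\<forall>v. norm (frechet_derivative f (at x) v) \<le> C * norm x powr (- q - 1) * norm v))"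

lemma symb_Ck: "symb q f U \<Longrightarrow> Ck_on 1 f U"
  by (simp add: symb_def)

lemma symbE:
  assumes "symb q f U"
  obtains C where "C \<ge> 0" "\<And>x. x \<in> U \<Longrightarrow> norm (f x) \<le> C * norm x powr (- q)"
    "\<And>x v. x \<in> U \<Longrightarrow> norm (frechet_derivative f (at x) v) \<le> C * norm x powr (- q - 1) * norm v"
    "\<And>x. x \<in> U \<Longrightarrow> (f has_derivative frechet_derivative f (at x)) (at x)"
proof -
  obtain C where C: "\<forall>x\<in>U. norm (f x) \<le> C * norm x powr (- q) \<and>
     (\<forall>v. norm (frechet_derivative f (at x) v) \<le> C * norm x powr (- q - 1) * norm v)"
    using assms by (auto simp: symb_def)
  have le: "C * a \<le> max C 0 * a" if "a \<ge> 0" for a using that by (intro mult_right_mono) auto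
  show ?thesis
  proof (rule that[of "max C 0"])
    show "norm (f x) \<le> max C 0 * norm x powr (- q)" if "x \<in> U" for x
      proof -
      have "norm (f x) \<le> C * norm x powr (- q)" using C that by simp
      also have "\<dots> \<le> max C 0 * norm x powr (- q)" by (rule le) simp
      finally show ?thesis .
    qed
    show "norm (frechet_derivative f (at x) v) \<le> max C 0 * norm x powr (- q - 1) * norm v" if "x \<in> U" for x v
      proof -
      have "norm (frechet_derivative f (at x) v) \<le> C * (norm x powr (- q - 1) * norm v)"
        using C that by (simp add: mult.assoc)
      also have "\<dots> \<le> max C 0 * (norm x powr (- q - 1) * norm v)" by (rule le) simp
      finally show ?thesis by (simp add: mult.assoc)
    qed
    show "(f has_derivative frechet_derivative f (at x)) (at x)" if "x \<in> U" for x
      using assms that Ck_on_1_has_derivative unfolding symb_def by blast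
  qed simp
qed

lemma symbI:
  assumes "open U" "\<And>x. x \<in> U \<Longrightarrow> (f has_derivative f' x) (at x)"
    and "\<And>v. continuous_on U (\<lambda>x. f' x v)"
    and "\<And>x. x \<in> U \<Longrightarrow> norm (f x) \<le> C * norm x powr (- q)"
    and "\<And>x v. x \<in> U \<Longrightarrow> norm (f' x v) \<le> C' * norm x powr (- q - 1) * norm v"
  shows "symb q f U"
  unfolding symb_def
proof (intro conjI exI ballI allI)
  show "Ck_on 1 f U" using Ck_on_SucI[of U f f' 0] assms(1-3) by simp
  show "norm (f x) \<le> max C C' * norm x powr (- q)" if "x \<in> U" for x
    using assms(4)[OF that] mult_right_mono[of C "max C C'" "norm x powr (- q)"] by simp
  show "norm (frechet_derivative f (at x) v) \<le> max C C' * norm x powr (- q - 1) * norm v" if "x \<in> U" for x v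
    using assms(5)[OF that, of v] mult_right_mono[of C' "max C C'" "norm x powr (- q - 1) * norm v"]
      frechet_derivative_eqI[OF assms(2)[OF that]] by (simp add: mult.assoc)
qed

lemma symb_subset: "symb q f U \<Longrightarrow> V \<subseteq> U \<Longrightarrow> symb q f V"
  unfolding symb_def using Ck_on_subset by (metis subsetD)

lemma symb_cong:
  assumes "open U" "\<And>x. x \<in> U \<Longrightarrow> f x = g x" "symb q f U"
  shows "symb q g U"
proof -
  have "frechet_derivative g (at x) = frechet_derivative f (at x)" if "x \<in> U" for x
    using frechet_derivative_cong[OF assms(1) that] assms(2) by metis
  then show ?thesis
    using Ck_on_cong[OF assms(1), of f g 1] assms(2,3) unfolding symb_def by (metis (no_types, lifting))
qed

lemma symb_Un:
  assumes "open U" "open V" "symb q f U" "symb q f V"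
  shows "symb q f (U \<union> V)"
proof -
  have *: "symb q f W \<Longrightarrow> W \<in> {U, V} \<Longrightarrow> Ck_on 1 f W" for W by (simp add: symb_def)
  have "Ck_on 1 f (U \<union> V)" by (rule Ck_on_local) (use assms * in blast)
  moreover obtain C1 where C1: "\<And>x. x \<in> U \<Longrightarrow> norm (f x) \<le> C1 * norm x powr (- q)"
    "\<And>x v. x \<in> U \<Longrightarrow> norm (frechet_derivative f (at x) v) \<le> C1 * norm x powr (- q - 1) * norm v"
    by (rule symbE[OF assms(3)]) blast
  moreover obtain C2 where C2: "\<And>x. x \<in> V \<Longrightarrow> norm (f x) \<le> C2 * norm x powr (- q)"
    "\<And>x v. x \<in> V \<Longrightarrow> norm (frechet_derivative f (at x) v) \<le> C2 * norm x powr (- q - 1) * norm v"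
    by (rule symbE[OF assms(4)]) blast
  moreover have le: "C1 * a \<le> max C1 C2 * a" "C2 * a \<le> max C1 C2 * a" if "a \<ge> 0" for a
    using that by (auto intro!: mult_right_mono)
  moreover have "norm (f x) \<le> max C1 C2 * norm x powr (- q)" if "x \<in> U \<union> V" for x
    using that C1(1)[of x] C2(1)[of x] le[OF powr_ge_zero, of "norm x" "- q"]
    by (elim UnE) (meson order_trans)+
  moreover have "norm (frechet_derivative f (at x) v) \<le> max C1 C2 * norm x powr (- q - 1) * norm v"
    if "x \<in> U \<union> V" for x v
    using that C1(2)[of x v] C2(2)[of x v] le[OF mult_nonneg_nonneg[OF powr_ge_zero norm_ge_zero], of "norm x" "- q - 1" v]
    by (elim UnE) (simp_all only: mult.assoc, (meson order_trans)+)
  ultimately show ?thesis unfolding symb_def by blast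
qed

text \<open>The origin has to be excluded because \<open>0 powr 0\<close> is
  \<open>0\<close>.\<close>

lemma symb_const:
  assumes "0 \<notin> U"
  shows "symb 0 (\<lambda>x. c) U"
proof -
  have nz: "x \<noteq> 0" if "x \<in> U" for x using assms that by auto
  have "Ck_on 1 (\<lambda>x. c) U" by (rule Ck_on_const)
  then show ?thesis unfolding symb_def
    by (intro conjI exI[of _ "norm c"]) (auto simp: powr_def dest: nz)
qed

lemma symb_bilinear:
  assumes U: "open U" "0 \<notin> U" and pr: "bounded_bilinear pr" and fg: "symb p f U" "symb q g U"
  shows "symb (p + q) (\<lambda>x. pr (f x) (g x)) U"
proof -
  obtain C1 where C1: "C1 \<ge> 0" "\<And>x. x \<in> U \<Longrightarrow> norm (f x) \<le> C1 * norm x powr (- p)"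
    "\<And>x v. x \<in> U \<Longrightarrow> norm (frechet_derivative f (at x) v) \<le> C1 * norm x powr (- p - 1) * norm v"
    "\<And>x. x \<in> U \<Longrightarrow> (f has_derivative frechet_derivative f (at x)) (at x)"
    by (rule symbE[OF fg(1)]) blast
  obtain C2 where C2: "C2 \<ge> 0" "\<And>x. x \<in> U \<Longrightarrow> norm (g x) \<le> C2 * norm x powr (- q)"
    "\<And>x v. x \<in> U \<Longrightarrow> norm (frechet_derivative g (at x) v) \<le> C2 * norm x powr (- q - 1) * norm v"
    "\<And>x. x \<in> U \<Longrightarrow> (g has_derivative frechet_derivative g (at x)) (at x)"
    by (rule symbE[OF fg(2)]) blast
  obtain K where K: "K \<ge> 0" "\<And>a b. norm (pr a b) \<le> norm a * norm b * K"
    using bounded_bilinear.nonneg_bounded[OF pr] by blast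
  have bd: "norm (pr a b) \<le> A * B * K" if "norm a \<le> A" "norm b \<le> B" for a b A B
  proof -
    have "norm a * norm b \<le> A * B" using that by (intro mult_mono) (auto intro: order_trans[OF norm_ge_zero])
    with K show ?thesis by (meson mult_right_mono order_trans)
  qed
  show ?thesis
  proof (rule symbI[OF U(1)])
    fix x assume x: "x \<in> U"
    then have nx: "norm x > 0" using U by auto
    show "((\<lambda>x. pr (f x) (g x)) has_derivative
      (\<lambda>v. pr (f x) (frechet_derivative g (at x) v) + pr (frechet_derivative f (at x) v) (g x))) (at x)"
      using C1(4) C2(4) x by (intro bounded_bilinear.FDERIV[OF pr])
    have "norm (pr (f x) (g x)) \<le> (C1 * norm x powr (- p)) * (C2 * norm x powr (- q)) * K"
      using C1 C2 x by (intro bd)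
    also have "\<dots> = (C1 * C2 * K) * (norm x powr (- p) * norm x powr (- q))" by simp
    also have "norm x powr (- p) * norm x powr (- q) = norm x powr (- (p + q))"
      by (simp flip: powr_add)
    finally show "norm (pr (f x) (g x)) \<le> (C1 * C2 * K) * norm x powr (- (p + q))" .
    fix v
    have e: "norm x powr (- p) * norm x powr (- q - 1) = norm x powr (- (p + q) - 1)"
       "norm x powr (- p - 1) * norm x powr (- q) = norm x powr (- (p + q) - 1)"
      by (simp_all flip: powr_add add: algebra_simps)
    have "norm (pr (f x) (frechet_derivative g (at x) v) + pr (frechet_derivative f (at x) v) (g x))
      \<le> (C1 * norm x powr (- p)) * (C2 * norm x powr (- q - 1) * norm v) * K +
        (C1 * norm x powr (- p - 1) * norm v) * (C2 * norm x powr (- q)) * K"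
      using C1 C2 x by (intro norm_triangle_le add_mono bd)
    also have "\<dots> = (C1 * C2 * K) * (norm x powr (- p) * norm x powr (- q - 1)) * norm v +
        (C1 * C2 * K) * (norm x powr (- p - 1) * norm x powr (- q)) * norm v"
      by (simp add: mult_ac)
    also have "\<dots> = (2 * C1 * C2 * K) * norm x powr (- (p + q) - 1) * norm v"
      unfolding e by simp
    finally show "norm (pr (f x) (frechet_derivative g (at x) v) + pr (frechet_derivative f (at x) v) (g x))
      \<le> (2 * C1 * C2 * K) * norm x powr (- (p + q) - 1) * norm v" .
  next
    fix v
    show "continuous_on U (\<lambda>x. pr (f x) (frechet_derivative g (at x) v) + pr (frechet_derivative f (at x) v) (g x))"
      using fg U continuous_on_frechet[of U 0 f v] continuous_on_frechet[of U 0 g v]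
        Ck_on_imp_continuous_on[of 1 f U] Ck_on_imp_continuous_on[of 1 g U]
      by (intro continuous_intros bounded_bilinear.continuous_on[OF pr]) (auto simp: symb_def)
  qed
qed

lemma symb_add:
  assumes U: "open U" and fg: "symb q f U" "symb q g U"
  shows "symb q (\<lambda>x. f x + g x) U"
proof -
  obtain C1 where C1: "\<And>x. x \<in> U \<Longrightarrow> norm (f x) \<le> C1 * norm x powr (- q)"
    "\<And>x v. x \<in> U \<Longrightarrow> norm (frechet_derivative f (at x) v) \<le> C1 * norm x powr (- q - 1) * norm v"
    "\<And>x. x \<in> U \<Longrightarrow> (f has_derivative frechet_derivative f (at x)) (at x)"
    by (rule symbE[OF fg(1)]) blast
  obtain C2 where C2: "\<And>x. x \<in> U \<Longrightarrow> norm (g x) \<le> C2 * norm x powr (- q)"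
    "\<And>x v. x \<in> U \<Longrightarrow> norm (frechet_derivative g (at x) v) \<le> C2 * norm x powr (- q - 1) * norm v"
    "\<And>x. x \<in> U \<Longrightarrow> (g has_derivative frechet_derivative g (at x)) (at x)"
    by (rule symbE[OF fg(2)]) blast
  show ?thesis
  proof (rule symbI[OF U, where f'="\<lambda>x v. frechet_derivative f (at x) v + frechet_derivative g (at x) v"])
    show "continuous_on U (\<lambda>x. frechet_derivative f (at x) v + frechet_derivative g (at x) v)" for v
      using fg U by (intro continuous_intros continuous_on_frechet[where k=0]) (auto simp: symb_def)
    show "norm (f x + g x) \<le> (C1 + C2) * norm x powr (- q)" if "x \<in> U" for x
      using C1(1)[OF that] C2(1)[OF that] by (intro norm_triangle_le) (simp add: algebra_simps)
    show "norm (frechet_derivative f (at x) v + frechet_derivative g (at x) v)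
      \<le> (C1 + C2) * norm x powr (- q - 1) * norm v" if "x \<in> U" for x v
      using C1(2)[OF that, of v] C2(2)[OF that, of v] by (intro norm_triangle_le) (simp add: algebra_simps)
  qed (use C1 C2 in \<open>auto intro: has_derivative_add\<close>)
qed

text \<open>Reduced to the product rule: \<open>a *\<^sub>R h b\<close> is bilinear in
  \<open>(a, b)\<close>, and the constant \<open>a = 1\<close> has order 0.\<close>

lemma symb_linear_image:
  assumes U: "open U" "0 \<notin> U" and h: "bounded_linear h" and f: "symb q f U"
  shows "symb q (\<lambda>x. h (f x)) U"
proof -
  have "bounded_bilinear (\<lambda>(a::real) b. a *\<^sub>R h b)"
    by (rule bounded_bilinear.comp[OF bounded_bilinear_scaleR bounded_linear_ident h])
  from symb_bilinear[OF U this symb_const[OF U(2), of 1] f] show ?thesis by simp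
qed

lemma symb_minus:
  assumes U: "open U" "0 \<notin> U" and fg: "symb q f U" "symb q g U"
  shows "symb q (\<lambda>x. f x - g x) U"
  using symb_add[OF U(1) fg(1) symb_linear_image[OF U bounded_linear_minus[OF bounded_linear_ident] fg(2)]]
  by simp

lemma symb_sum:
  assumes U: "open U" "0 \<notin> U" and f: "\<And>i. i \<in> I \<Longrightarrow> symb q (f i) U"
  shows "symb q (\<lambda>x. \<Sum>i\<in>I. f i x :: 'b::real_normed_vector) U"
proof -
  have z: "symb q (\<lambda>x. 0::'b) U"
    using Ck_on_const[of 1 "0::'b" U] by (auto simp: symb_def intro!: exI[of _ 0])
  show ?thesis using f
    by (induction I rule: infinite_finite_induct) (auto intro: symb_add U z)
qed

text \<open>The derivative of a function homogeneous of degree \<open>- q\<close> is homogeneous of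
  degree \<open>- q - 1\<close>, so both bounds follow from compactness of the unit sphere. The
  second part makes gradients of homogeneous functions accessible to the first.\<close>

lemma symb_homogeneous:
  fixes f :: "'a::euclidean_space \<Rightarrow> 'b::real_normed_vector"
  assumes f: "Ck_on 1 f (- {0})"
    and hom: "\<And>x c. x \<noteq> 0 \<Longrightarrow> c > 0 \<Longrightarrow> f (c *\<^sub>R x) = c powr (- q) *\<^sub>R f x"
  shows "symb q f (- {0})"
    and "\<And>x c v. x \<noteq> 0 \<Longrightarrow> c > 0 \<Longrightarrow> frechet_derivative f (at (c *\<^sub>R x)) v = c powr (- q - 1) *\<^sub>R frechet_derivative f (at x) v"
proof -
  have op: "open (- {0::'a})" by (simp add: open_Compl)
  have df: "(f has_derivative frechet_derivative f (at x)) (at x)" if "x \<noteq> 0" for x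
    using Ck_on_1_has_derivative[OF f] that by simp
  show hom': "frechet_derivative f (at (c *\<^sub>R x)) v = c powr (- q - 1) *\<^sub>R frechet_derivative f (at x) v"
    if x: "x \<noteq> 0" and c: "c > 0" for x c v
  proof -
    have "((\<lambda>x. f (c *\<^sub>R x)) has_derivative (\<lambda>v. frechet_derivative f (at (c *\<^sub>R x)) (c *\<^sub>R v))) (at x)"
      by (rule has_derivative_linear_arg[OF bounded_linear_scaleR_right df]) (use x c in auto)
    moreover have "((\<lambda>x. f (c *\<^sub>R x)) has_derivative (\<lambda>v. c powr (- q) *\<^sub>R frechet_derivative f (at x) v)) (at x)"
      by (rule has_derivative_transform_within_open[OF has_derivative_scaleR_right[OF df[OF x]] op])
         (use x c hom in auto)
    ultimately have "frechet_derivative f (at (c *\<^sub>R x)) (c *\<^sub>R v) = c powr (- q) *\<^sub>R frechet_derivative f (at x) v"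
      by (metis (no_types) has_derivative_unique)
    moreover have "frechet_derivative f (at (c *\<^sub>R x)) (c *\<^sub>R v) = c *\<^sub>R frechet_derivative f (at (c *\<^sub>R x)) v"
      using has_derivative_linear[OF df[of "c *\<^sub>R x"]] x c by (simp add: linear_scale)
    ultimately have "(1 / c) *\<^sub>R c *\<^sub>R frechet_derivative f (at (c *\<^sub>R x)) v =
        (1 / c) *\<^sub>R c powr (- q) *\<^sub>R frechet_derivative f (at x) v" by simp
    then show ?thesis using c by (simp add: powr_diff)
  qed
  have bd: "\<exists>C. \<forall>x\<in>sphere 0 1. norm (g x) \<le> C" if "continuous_on (- {0}) g" for g :: "'a \<Rightarrow> 'b"
  proof -
    have "bounded (g ` sphere 0 1)"
      by (intro compact_imp_bounded compact_continuous_image continuous_on_subset[OF that]) auto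
    then show ?thesis by (auto simp: bounded_iff)
  qed
  obtain C where C: "\<And>x. norm x = 1 \<Longrightarrow> norm (f x) \<le> C"
    using bd[OF Ck_on_imp_continuous_on[OF f]] by (auto simp: sphere_def)
  have "\<forall>b. \<exists>C. \<forall>x\<in>sphere 0 1. norm (frechet_derivative f (at x) b) \<le> C"
    using bd continuous_on_frechet[OF op, of 0 f] f by auto
  then obtain C' where C': "\<And>b x. norm x = 1 \<Longrightarrow> norm (frechet_derivative f (at x) b) \<le> C' b"
    by (metis mem_sphere_0)
  show "symb q f (- {0})"
  proof (rule symbI[OF op])
    fix x :: 'a assume "x \<in> - {0}"
    then have x: "x \<noteq> 0" by simp
    define u where "u = (1 / norm x) *\<^sub>R x"
    have u: "norm u = 1" "x = norm x *\<^sub>R u" "u \<noteq> 0" using x by (auto simp: u_def)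
    have "norm (f x) = norm x powr (- q) * norm (f u)"
      using hom[OF u(3), of "norm x"] x u by simp
    also have "\<dots> \<le> norm x powr (- q) * C" using C[OF u(1)] by (intro mult_left_mono) auto
    finally show "norm (f x) \<le> C * norm x powr (- q)" by (simp add: mult.commute)
    show "(f has_derivative frechet_derivative f (at x)) (at x)" by (rule df[OF x])
    fix v
    have "norm (frechet_derivative f (at u) v) \<le> (\<Sum>b\<in>Basis. C' b) * norm v"
    proof -
      have "frechet_derivative f (at u) v = (\<Sum>b\<in>Basis. (v \<bullet> b) *\<^sub>R frechet_derivative f (at u) b)"
        by (rule linear_basis_sum[OF has_derivative_linear[OF df[OF u(3)]]])
      also have "norm \<dots> \<le> (\<Sum>b\<in>Basis. norm v * C' b)"
        by (rule sum_norm_le) (use C'[OF u(1)] Basis_le_norm[of _ v] in \<open>auto intro!: mult_mono\<close>)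
      finally show ?thesis by (simp add: sum_distrib_left mult.commute)
    qed
    then have "norm x powr (- q - 1) * norm (frechet_derivative f (at u) v) \<le>
        norm x powr (- q - 1) * ((\<Sum>b\<in>Basis. C' b) * norm v)"
      by (intro mult_left_mono) auto
    moreover have "norm (frechet_derivative f (at x) v) = norm x powr (- q - 1) * norm (frechet_derivative f (at u) v)"
      using hom'[OF u(3), of "norm x" v] x u by simp
    ultimately show "norm (frechet_derivative f (at x) v) \<le> (\<Sum>b\<in>Basis. C' b) * norm x powr (- q - 1) * norm v"
      by (simp add: mult_ac)
  next
    show "continuous_on (- {0}) (\<lambda>x. frechet_derivative f (at x) v)" for v
      using continuous_on_frechet[OF op, of 0 f] f by auto
  qed
qed

text \<open>Order \<open>- 1\<close> for \<open>N\<close> means that its derivative is bounded;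
  together with \<open>norm (N x) = norm x\<close> this leaves all orders unchanged. It is meant for
  the elements of \<Gamma> and for the retraction of the exterior of a ball onto a single
  ray.\<close>

lemma symb_compose_norm_preserving:
  fixes N :: "'a::euclidean_space \<Rightarrow> 'a"
  assumes U: "open U" "open T" "0 \<notin> U" and N: "symb (- 1) N U" "\<And>x. x \<in> U \<Longrightarrow> norm (N x) = norm x" "N ` U \<subseteq> T"
    and f: "symb q f T"
  shows "symb q (\<lambda>x. f (N x)) U"
proof -
  obtain C1 where C1: "C1 \<ge> 0" "\<And>x. x \<in> T \<Longrightarrow> norm (f x) \<le> C1 * norm x powr (- q)"
    "\<And>x v. x \<in> T \<Longrightarrow> norm (frechet_derivative f (at x) v) \<le> C1 * norm x powr (- q - 1) * norm v"
    "\<And>x. x \<in> T \<Longrightarrow> (f has_derivative frechet_derivative f (at x)) (at x)"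
    by (rule symbE[OF f]) blast
  obtain C2 where C2: "C2 \<ge> 0" "\<And>x v. x \<in> U \<Longrightarrow> norm (frechet_derivative N (at x) v) \<le> C2 * norm x powr (- (- 1) - 1) * norm v"
    "\<And>x. x \<in> U \<Longrightarrow> (N has_derivative frechet_derivative N (at x)) (at x)"
    by (rule symbE[OF N(1)]) blast
  have d: "((\<lambda>x. f (N x)) has_derivative (\<lambda>v. frechet_derivative f (at (N x)) (frechet_derivative N (at x) v))) (at x)"
    if "x \<in> U" for x
    by (rule has_derivative_compose[OF C2(3)[OF that] C1(4)]) (use that N in auto)
  have ck: "Ck_on 1 (\<lambda>x. f (N x)) U"
    by (rule Ck_on_compose[OF U(1,2) symb_Ck[OF f] symb_Ck[OF N(1)] N(3)])
  show ?thesis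
  proof (rule symbI[OF U(1) d])
    show "continuous_on U (\<lambda>x. frechet_derivative f (at (N x)) (frechet_derivative N (at x) v))" for v
      by (rule continuous_on_eq[OF continuous_on_frechet[OF U(1), of 0]])
         (use ck frechet_derivative_eqI[OF d] in auto)
    show "norm (f (N x)) \<le> C1 * norm x powr (- q)" if "x \<in> U" for x
      using C1(2)[of "N x"] N that by auto
    show "norm (frechet_derivative f (at (N x)) (frechet_derivative N (at x) v))
        \<le> (C1 * C2) * norm x powr (- q - 1) * norm v" if "x \<in> U" for x v
    proof -
      have "norm x > 0" using that U by auto
      then have "norm (frechet_derivative N (at x) v) \<le> C2 * norm v" using C2(2)[OF that, of v] by simp
      then have "C1 * norm x powr (- q - 1) * norm (frechet_derivative N (at x) v) \<le> C1 * norm x powr (- q - 1) * (C2 * norm v)"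
        by (rule mult_left_mono) (use C1 in auto)
      moreover have "norm (frechet_derivative f (at (N x)) (frechet_derivative N (at x) v)) \<le>
         C1 * norm x powr (- q - 1) * norm (frechet_derivative N (at x) v)"
        using C1(3)[of "N x" "frechet_derivative N (at x) v"] N that by auto
      ultimately show ?thesis by (simp add: mult_ac)
    qed
  qed
qed

text \<open>Beyond radius \<open>r + 1 \<ge> 2\<close> a shift by at most 1 changes the norm by at
  most a factor 2, hence decay rates by a constant only.\<close>

lemma symb_line_integral:
  fixes g :: "'a::euclidean_space \<Rightarrow> 'b::euclidean_space" and w :: "real \<Rightarrow> real"
  assumes q: "q \<ge> 0" and g: "symb q g (- cball 0 r)" and w: "continuous_on {0..1} w" "\<And>s. s \<in> {0..1} \<Longrightarrow> \<bar>w s\<bar> \<le> 1"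
    and e: "norm e \<le> 1" and r: "r \<ge> 1"
  shows "symb q (\<lambda>x. integral {0..1} (\<lambda>s. w s *\<^sub>R g (x + s *\<^sub>R e))) (- cball 0 (r + 1))"
proof -
  obtain C where C: "C \<ge> 0" "\<And>x. x \<in> - cball 0 r \<Longrightarrow> norm (g x) \<le> C * norm x powr (- q)"
    "\<And>x v. x \<in> - cball 0 r \<Longrightarrow> norm (frechet_derivative g (at x) v) \<le> C * norm x powr (- q - 1) * norm v"
    by (rule symbE[OF g]) blast
  have op: "open (- cball (0::'a) \<rho>)" for \<rho> by (simp add: open_Compl)
  have shift: "norm (x + s *\<^sub>R e) > r" "norm (x + s *\<^sub>R e) \<ge> norm x / 2"
    if "x \<in> - cball 0 (r + 1)" "s \<in> {0..1}" for x s
  proof -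
    have "norm (s *\<^sub>R e) \<le> 1" using that e mult_mono[of s 1 "norm e" 1] by auto
    moreover have "norm x \<le> norm (x + s *\<^sub>R e) + norm (s *\<^sub>R e)"
      by (metis add_diff_cancel_right' norm_triangle_ineq4)
    ultimately show "norm (x + s *\<^sub>R e) > r" "norm (x + s *\<^sub>R e) \<ge> norm x / 2" using that r by auto
  qed
  then have sh: "x + s *\<^sub>R e \<in> - cball 0 r" if "x \<in> - cball 0 (r + 1)" "s \<in> {0..1}" for x s
    using that by fastforce
  have pw: "norm (x + s *\<^sub>R e) powr (- p) \<le> 2 powr p * norm x powr (- p)"
    if "x \<in> - cball 0 (r + 1)" "s \<in> {0..1}" "p \<ge> 0" for x s p
  proof -
    have "norm x > 0" using that r by auto
    then have "norm (x + s *\<^sub>R e) powr (- p) \<le> (norm x / 2) powr (- p)"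
      using shift(2)[OF that(1,2)] that by (intro powr_mono2') auto
    also have "\<dots> = 2 powr p * norm x powr (- p)"
      using \<open>norm x > 0\<close> by (simp add: powr_divide powr_minus field_simps)
    finally show ?thesis .
  qed
  have int_bd: "norm (integral {0..1} (\<lambda>s. w s *\<^sub>R h s)) \<le> B"
    if "continuous_on {0..1} h" "\<And>s. s \<in> {0..1} \<Longrightarrow> norm (h s) \<le> B" for B and h :: "real \<Rightarrow> 'b"
  proof -
    have "norm (integral {0..1} (\<lambda>s. w s *\<^sub>R h s)) \<le> B * (1 - 0)"
    proof (rule integral_bound)
      show "continuous_on {0..1} (\<lambda>s. w s *\<^sub>R h s)" by (intro continuous_intros w that)
      show "norm (w s *\<^sub>R h s) \<le> B" if "s \<in> {0..1}" for s
        using w(2)[OF that] \<open>\<And>s. s \<in> {0..1} \<Longrightarrow> norm (h s) \<le> B\<close>[OF that]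
          mult_mono[of "\<bar>w s\<bar>" 1 "norm (h s)" B] by auto
    qed simp
    then show ?thesis by simp
  qed
  show ?thesis
  proof (rule symbI[OF op has_derivative_line_integral[OF op op symb_Ck[OF g] _ w(1) sh]])
    show "continuous_on (- cball 0 (r + 1)) (\<lambda>x. integral {0..1} (\<lambda>s. w s *\<^sub>R frechet_derivative g (at (x + s *\<^sub>R e)) v))" for v
      using Ck_on_line_integral[OF op op, of 0 "\<lambda>x. frechet_derivative g (at x) v", OF _ w(1) sh]
        continuous_on_frechet[OF op, of 0 g] symb_Ck[OF g] by auto
    fix x :: 'a assume x: "x \<in> - cball 0 (r + 1)"
    show "norm (integral {0..1} (\<lambda>s. w s *\<^sub>R g (x + s *\<^sub>R e))) \<le> (C * 2 powr q) * norm x powr (- q)"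
    proof (rule int_bd)
      show "continuous_on {0..1} (\<lambda>s. g (x + s *\<^sub>R e))"
        by (rule continuous_on_compose2[OF Ck_on_imp_continuous_on[OF symb_Ck[OF g]]])
           (use sh x in \<open>auto intro!: continuous_intros\<close>)
      show "norm (g (x + s *\<^sub>R e)) \<le> (C * 2 powr q) * norm x powr (- q)" if "s \<in> {0..1}" for s
        using C(2)[OF sh[OF x that]] mult_left_mono[OF pw[OF x that q] C(1)] by (simp add: mult.assoc)
    qed
    fix v
    show "norm (integral {0..1} (\<lambda>s. w s *\<^sub>R frechet_derivative g (at (x + s *\<^sub>R e)) v))
      \<le> (C * 2 powr (q + 1)) * norm x powr (- q - 1) * norm v"
    proof (rule int_bd)
      show "continuous_on {0..1} (\<lambda>s. frechet_derivative g (at (x + s *\<^sub>R e)) v)"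
        by (rule continuous_on_compose2[OF continuous_on_frechet[OF op, of 0 g]])
           (use sh x symb_Ck[OF g] in \<open>auto intro!: continuous_intros\<close>)
      show "norm (frechet_derivative g (at (x + s *\<^sub>R e)) v) \<le> (C * 2 powr (q + 1)) * norm x powr (- q - 1) * norm v"
        if "s \<in> {0..1}" for s
        using C(3)[OF sh[OF x that], of v] mult_right_mono[OF mult_left_mono[OF pw[OF x that, of "q + 1"] C(1)], of "norm v"] q
        by (simp add: mult.assoc)
    qed
  qed
qed

section \<open>Flows of time-dependent vector fields\<close>

text \<open>Derivatives are taken within \<open>{0..1}\<close>, hence one-sided at the end points;
  this form is stable under the reversal \<open>t \<mapsto> 1 - t\<close>.\<close>

definition is_solution :: "(real \<times> 'a \<Rightarrow> 'a) \<Rightarrow> (real \<Rightarrow> 'a::euclidean_space) \<Rightarrow> bool" where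
  "is_solution V y \<longleftrightarrow> (\<forall>t\<in>{0..1}. (y has_vector_derivative V (t, y t)) (at t within {0..1}))"

lemma has_vector_derivative_imp_continuous_on:
  assumes "\<And>t. t \<in> S \<Longrightarrow> (y has_vector_derivative y' t) (at t within S)"
  shows "continuous_on S y"
  using assms has_vector_derivative_continuous continuous_on_eq_continuous_within by blast

lemma is_solution_continuous_on: "is_solution V y \<Longrightarrow> continuous_on {0..1} y"
  unfolding is_solution_def by (rule has_vector_derivative_imp_continuous_on) blast

text \<open>\<open>|u|\<^sup>2 + b\<^sup>2\<close> grows at most exponentially at rate \<open>2 L + 1\<close>.\<close>

lemma gronwall_norm:
  fixes u :: "real \<Rightarrow> 'a::real_inner"
  assumes T: "T \<le> 1" and cont: "continuous_on {0..T} u"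
    and u: "\<And>t. 0 < t \<Longrightarrow> t < T \<Longrightarrow> (u has_vector_derivative u' t) (at t)"
    and bd: "\<And>t. 0 < t \<Longrightarrow> t < T \<Longrightarrow> norm (u' t) \<le> b + L * norm (u t)"
    and b: "b \<ge> 0" "L \<ge> 0" and t: "t \<in> {0..T}"
  shows "norm (u t) \<le> (norm (u 0) + b) * exp (L + 1)"
proof -
  let ?k = "2 * L + 1"
  let ?w = "\<lambda>t. (u t \<bullet> u t + b\<^sup>2) * exp (- (?k * t))"
  have "?w t \<le> ?w 0"
  proof (rule DERIV_nonpos_imp_decreasing_open[of 0 t ?w])
    show "0 \<le> t" using t by simp
    show "continuous_on {0..t} ?w"
      by (intro continuous_intros continuous_on_subset[OF cont]) (use t in auto)
    fix s assume s: "0 < s" "s < t"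
    then have sT: "s < T" using t by simp
    note us = u[OF s(1) sT]
    have "((\<lambda>t. u t \<bullet> u t) has_vector_derivative (u s \<bullet> u' s + u' s \<bullet> u s)) (at s)"
      by (rule bounded_bilinear.has_vector_derivative[OF bounded_bilinear_inner us us])
    then have "((\<lambda>t. u t \<bullet> u t) has_real_derivative 2 * (u s \<bullet> u' s)) (at s)"
      by (simp add: has_real_derivative_iff_has_vector_derivative inner_commute)
    then have d: "(?w has_real_derivative
        (2 * (u s \<bullet> u' s)) * exp (- (?k * s)) + (u s \<bullet> u s + b\<^sup>2) * (- ?k * exp (- (?k * s)))) (at s)"
      by (auto intro!: derivative_eq_intros)
    have "u s \<bullet> u' s \<le> norm (u s) * norm (u' s)" by (rule norm_cauchy_schwarz)
    also have "\<dots> \<le> norm (u s) * (b + L * norm (u s))"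
      using bd[OF s(1) sT] by (intro mult_left_mono) auto
    finally have "2 * (u s \<bullet> u' s) \<le> 2 * norm (u s) * b + 2 * L * (norm (u s))\<^sup>2"
      by (simp add: algebra_simps power2_eq_square)
    also have "2 * norm (u s) * b \<le> (norm (u s))\<^sup>2 + b\<^sup>2" by (rule sum_squares_bound)
    finally have "2 * (u s \<bullet> u' s) \<le> ?k * (norm (u s))\<^sup>2 + b\<^sup>2" by (simp add: algebra_simps)
    also have "\<dots> \<le> ?k * (u s \<bullet> u s + b\<^sup>2)"
      using b by (simp add: power2_norm_eq_inner algebra_simps)
    finally have "2 * (u s \<bullet> u' s) - ?k * (u s \<bullet> u s + b\<^sup>2) \<le> 0" by simp
    then have "(2 * (u s \<bullet> u' s) - ?k * (u s \<bullet> u s + b\<^sup>2)) * exp (- (?k * s)) \<le> 0"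
      by (intro mult_nonpos_nonneg) auto
    then have "(2 * (u s \<bullet> u' s)) * exp (- (?k * s)) + (u s \<bullet> u s + b\<^sup>2) * (- ?k * exp (- (?k * s))) \<le> 0"
      by (simp add: algebra_simps)
    with d show "\<exists>y. (?w has_real_derivative y) (at s) \<and> y \<le> 0" by blast
  qed
  then have "?w t * exp (?k * t) \<le> ?w 0 * exp (?k * t)" by (intro mult_right_mono) auto
  then have "u t \<bullet> u t + b\<^sup>2 \<le> (u 0 \<bullet> u 0 + b\<^sup>2) * exp (?k * t)"
    by (simp add: mult.assoc flip: exp_add)
  also have "\<dots> \<le> (norm (u 0) + b)\<^sup>2 * exp (2 * (L + 1))"
  proof (rule mult_mono)
    show "u 0 \<bullet> u 0 + b\<^sup>2 \<le> (norm (u 0) + b)\<^sup>2"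
      using b by (simp add: power2_sum flip: power2_norm_eq_inner)
    \<comment> \<open>The rate \<open>2 * L + 1\<close> is rounded up to \<open>2 * (L + 1)\<close>,
      so that the exponential is a perfect square and the root can be taken.\<close>
    have "?k * t \<le> ?k * 1" using t T b by (intro mult_left_mono) auto
    then show "exp (?k * t) \<le> exp (2 * (L + 1))" by simp
  qed auto
  also have "\<dots> = ((norm (u 0) + b) * exp (L + 1))\<^sup>2"
    by (simp only: power_mult_distrib exp_double)
  finally have "(norm (u t))\<^sup>2 + b\<^sup>2 \<le> ((norm (u 0) + b) * exp (L + 1))\<^sup>2"
    by (simp only: power2_norm_eq_inner)
  then have "(norm (u t))\<^sup>2 \<le> ((norm (u 0) + b) * exp (L + 1))\<^sup>2"
    using zero_le_power2[of b] by linarith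
  then show ?thesis
    by (rule power2_le_imp_le) (use b in auto)
qed

lemma gronwall_norm_within:
  fixes u :: "real \<Rightarrow> 'a::real_inner"
  assumes u: "\<And>t. t \<in> {0..1} \<Longrightarrow> (u has_vector_derivative u' t) (at t within {0..1})"
    and bd: "\<And>t. t \<in> {0..1} \<Longrightarrow> norm (u' t) \<le> b + L * norm (u t)"
    and b: "b \<ge> 0" "L \<ge> 0" and t: "t \<in> {0..1}"
  shows "norm (u t) \<le> (norm (u 0) + b) * exp (L + 1)"
proof (rule gronwall_norm[of 1 u u' b L])
  show "continuous_on {0..1} u" by (rule has_vector_derivative_imp_continuous_on[OF u])
  show "(u has_vector_derivative u' t) (at t)" if "0 < t" "t < 1" for t
    using u[of t] that by (simp add: at_within_Icc_at)
qed (use bd b t in auto)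

text \<open>Banach's fixed point theorem for \<open>g t = exp (- \<lambda> t) y t\<close> with \<open>\<lambda> = 2 L + 1\<close>: the
  exponential weight makes the Picard operator a contraction whatever the Lipschitz constant.\<close>

lemma picard_lindelof:
  fixes V :: "real \<times> 'a::euclidean_space \<Rightarrow> 'a"
  assumes cont: "continuous_on ({0..1} \<times> UNIV) V"
    and lip: "\<And>t x y. t \<in> {0..1} \<Longrightarrow> norm (V (t, x) - V (t, y)) \<le> L * norm (x - y)"
    and L: "L \<ge> 0"
  shows "\<exists>y. y 0 = x0 \<and> is_solution V y"
proof -
  define k where "k = 2 * L + 1"
  have k: "k > 0" "L / k \<le> 1 / 2" using L by (auto simp: k_def field_simps)
  \<comment> \<open>Bounded continuous functions live on the whole line; clamping time to
    \<open>{0..1}\<close> makes the Picard iterate total and bounded.\<close>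
  define c where "c t = max 0 (min 1 t)" for t :: real
  have c: "c t \<in> {0..1}" "t \<in> {0..1} \<Longrightarrow> c t = t" for t by (auto simp: c_def)
  have cc: "continuous_on UNIV c" unfolding c_def by (intro continuous_intros)
  define F where "F g s = V (s, exp (k * s) *\<^sub>R apply_bcontfun g s)" for g :: "real \<Rightarrow>\<^sub>C 'a" and s
  have contF: "continuous_on {0..1} (F g)" for g
    unfolding F_def by (rule continuous_on_compose2[OF cont]) (auto intro!: continuous_intros)
  have intF: "F g integrable_on {0..t}" if "t \<in> {0..1}" for g t
    by (rule integrable_continuous_real[OF continuous_on_subset[OF contF]]) (use that in auto)
  define Y where "Y g t = x0 + integral {0..t} (F g)" for g t
  define P where "P g t = exp (- (k * c t)) *\<^sub>R Y g (c t)" for g t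
  have contY: "continuous_on {0..1} (Y g)" for g
    unfolding Y_def by (intro continuous_intros indefinite_integral_continuous_1 intF) auto
  have P: "P g \<in> bcontfun" for g
  proof -
    have 1: "continuous_on {0..1} (\<lambda>t. exp (- (k * t)) *\<^sub>R Y g t)"
      by (intro continuous_intros contY)
    have "continuous_on UNIV (P g)"
      unfolding P_def by (rule continuous_on_compose2[OF 1 cc]) (use c in auto)
    moreover have "bounded (range (P g))"
    proof (rule bounded_subset)
      show "bounded ((\<lambda>t. exp (- (k * t)) *\<^sub>R Y g t) ` {0..1})"
        by (intro compact_imp_bounded compact_continuous_image 1) auto
      show "range (P g) \<subseteq> (\<lambda>t. exp (- (k * t)) *\<^sub>R Y g t) ` {0..1}"
        using c(1) by (auto simp: P_def)
    qed
    ultimately show ?thesis by (simp add: bcontfun_def)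
  qed
  have contraction: "dist (Bcontfun (P g)) (Bcontfun (P h)) \<le> 1 / 2 * dist g h" for g h
  proof (rule dist_bound)
    fix t
    let ?t = "c t"
    have t: "?t \<in> {0..1}" by (rule c)
    have "norm (integral {0..?t} (\<lambda>s. F g s - F h s)) \<le> integral {0..?t} (\<lambda>s. (L * dist g h) * exp (k * s))"
    proof (rule integral_norm_bound_integral)
      show "(\<lambda>s. F g s - F h s) integrable_on {0..?t}" by (intro integrable_diff intF t)
      show "(\<lambda>s. (L * dist g h) * exp (k * s)) integrable_on {0..?t}"
        by (intro integrable_continuous_real continuous_intros)
      fix s assume "s \<in> {0..?t}"
      then have s: "s \<in> {0..1}" using t by auto
      have "norm (F g s - F h s) \<le> L * norm (exp (k * s) *\<^sub>R apply_bcontfun g s - exp (k * s) *\<^sub>R apply_bcontfun h s)"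
        unfolding F_def by (rule lip[OF s])
      also have "\<dots> = L * exp (k * s) * dist (apply_bcontfun g s) (apply_bcontfun h s)"
        by (simp add: dist_norm flip: scaleR_diff_right)
      also have "\<dots> \<le> L * exp (k * s) * dist g h"
        using L by (intro mult_left_mono dist_bounded) auto
      finally show "norm (F g s - F h s) \<le> (L * dist g h) * exp (k * s)" by (simp add: mult_ac)
    qed
    \<comment> \<open>The weight pays off here: integrating \<open>exp (k * s)\<close> gains the
      factor \<open>1 / k\<close>, and \<open>L / k \<le> 1 / 2\<close>.\<close>
    also have "integral {0..?t} (\<lambda>s. (L * dist g h) * exp (k * s)) =
        (L * dist g h) * (exp (k * ?t) / k) - (L * dist g h) * (exp (k * 0) / k)"
      by (intro integral_unique fundamental_theorem_of_calculus)
         (use t k in \<open>auto intro!: derivative_eq_intros simp flip: has_real_derivative_iff_has_vector_derivative\<close>)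
    also have "\<dots> \<le> (L / k) * dist g h * exp (k * ?t)"
      using L k by (simp add: field_simps)
    also have "\<dots> \<le> (1 / 2) * dist g h * exp (k * ?t)"
      using k by (intro mult_right_mono) auto
    finally have le: "norm (integral {0..?t} (\<lambda>s. F g s - F h s)) \<le> 1 / 2 * dist g h * exp (k * ?t)" .
    have "integral {0..?t} (F g) - integral {0..?t} (F h) = integral {0..?t} (\<lambda>s. F g s - F h s)"
      by (rule integral_diff[symmetric]) (intro intF t)+
    then have "P g t - P h t = exp (- (k * ?t)) *\<^sub>R integral {0..?t} (\<lambda>s. F g s - F h s)"
      by (simp add: P_def Y_def flip: scaleR_diff_right)
    then have "norm (P g t - P h t) \<le> exp (- (k * ?t)) * (1 / 2 * dist g h * exp (k * ?t))"
      using le by simp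
    also have "\<dots> = 1 / 2 * dist g h" by (simp add: exp_minus)
    finally show "dist (apply_bcontfun (Bcontfun (P g)) t) (apply_bcontfun (Bcontfun (P h)) t) \<le> 1 / 2 * dist g h"
      using P by (simp add: Bcontfun_inverse dist_norm)
  qed
  have "\<exists>!g. Bcontfun (P g) = g"
    by (rule banach_fix_type[where c="1/2"]) (use contraction in auto)
  then obtain g where g: "Bcontfun (P g) = g" by blast
  then have gP: "apply_bcontfun g = P g" using Bcontfun_inverse[OF P[of g]] by simp
  have "F g s = V (s, Y g s)" if "s \<in> {0..1}" for s
    unfolding F_def gP using that by (simp add: P_def c(2) flip: exp_add)
  moreover have "(Y g has_vector_derivative F g t) (at t within {0..1})" if "t \<in> {0..1}" for t
    unfolding Y_def using integral_has_vector_derivative[OF contF that]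
    by (auto intro!: derivative_eq_intros)
  ultimately have "is_solution V (Y g)" by (simp add: is_solution_def)
  moreover have "Y g 0 = x0" by (simp add: Y_def)
  ultimately show ?thesis by blast
qed

section \<open>Differentiability of the flow in the initial point\<close>

abbreviation space_deriv :: "(real \<times> 'a::euclidean_space \<Rightarrow> 'b::real_normed_vector) \<Rightarrow> real \<times> 'a \<Rightarrow> 'a \<Rightarrow> 'b" where
  "space_deriv V z v \<equiv> frechet_derivative V (at z) (0, v)"

lemma continuous_attains_bound:
  fixes f :: "'a::metric_space \<Rightarrow> real"
  assumes "compact K" "continuous_on K f"
  obtains B where "B \<ge> 0" "\<And>x. x \<in> K \<Longrightarrow> f x \<le> B"
proof -
  have "bounded (f ` K)" by (intro compact_imp_bounded compact_continuous_image assms)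
  then obtain B where "\<forall>x\<in>K. norm (f x) \<le> B" by (auto simp: bounded_iff)
  then show ?thesis using that[of "max B 0"] by force
qed

lemma linear_bound_by_basis:
  fixes h :: "'a::euclidean_space \<Rightarrow> 'b::real_normed_vector"
  assumes "linear h"
  shows "norm (h v) \<le> (\<Sum>b\<in>Basis. norm (h b)) * norm v"
proof -
  have "norm (h v) \<le> (\<Sum>b\<in>Basis. norm (h b) * norm v)"
    unfolding linear_basis_sum[OF assms, of v]
    by (rule sum_norm_le) (simp add: Basis_le_norm mult.commute[of "norm (h _)"] mult_right_mono)
  then show ?thesis by (simp add: sum_distrib_right)
qed

text \<open>A continuity argument: the times at which the norm is at least 1 form a closed set, so
  there would be a first one, which \<open>step\<close> excludes.\<close>

lemma stays_in_unit_ball: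
  fixes u :: "real \<Rightarrow> 'a::real_normed_vector"
  assumes "continuous_on {0..1} u"
    and step: "\<And>t. t \<in> {0..1} \<Longrightarrow> (\<And>s. 0 \<le> s \<Longrightarrow> s < t \<Longrightarrow> norm (u s) < 1) \<Longrightarrow> norm (u t) < 1"
    and "t \<in> {0..1}"
  shows "norm (u t) < 1"
proof (rule ccontr)
  assume neg: "\<not> norm (u t) < 1"
  define S where "S = {0..1} \<inter> (\<lambda>t. norm (u t)) -` {1..}"
  have "closed S" unfolding S_def
    by (intro continuous_closed_preimage continuous_intros assms)
  moreover have "S \<noteq> {}" using neg assms(3) by (auto simp: S_def)
  moreover have bdd: "bdd_below S" by (auto simp: S_def intro: bdd_belowI[of _ 0])
  ultimately have "Inf S \<in> S" by (intro closed_contains_Inf)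
  moreover have "norm (u s) < 1" if "0 \<le> s" "s < Inf S" for s
    using cInf_lower[OF _ bdd, of s] that \<open>Inf S \<in> S\<close> by (force simp: S_def)
  ultimately show False using step[of "Inf S"] by (auto simp: S_def)
qed

lemma has_derivative_space_deriv:
  assumes "(V has_derivative D) (at (t, x))"
  shows "((\<lambda>x. V (t, x)) has_derivative (\<lambda>v. D (0, v))) (at x)"
  by (rule has_derivative_compose[of "\<lambda>x. (t, x)" "\<lambda>v. (0, v)" x UNIV V])
     (use assms in \<open>auto intro!: derivative_eq_intros\<close>)

text \<open>A family of solutions of a \<open>C\<^sup>1\<close> field is taken as given, without a
  global Lipschitz bound. The reason is that the locale is also applied to the field of the
  variational equation, whose derivative contains second derivatives of \<open>V\<close> and grows
  with the tangent vector. All constants therefore come from a compact tube around one trajectory.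
  \<open>T\<close> is an open set of times because \<open>Ck_on\<close> refers to full
  neighbourhoods.\<close>

locale C1_flow =
  fixes V :: "real \<times> 'a::euclidean_space \<Rightarrow> 'a" and T :: "real set" and \<phi> :: "real \<Rightarrow> 'a \<Rightarrow> 'a"
  assumes T: "open T" "{0..1} \<subseteq> T"
    and V: "Ck_on 1 V (T \<times> UNIV)"
    and \<phi>0: "\<And>x. \<phi> 0 x = x"
    and sol: "\<And>x. is_solution V (\<lambda>t. \<phi> t x)"
begin

lemma openT: "open (T \<times> (UNIV :: 'a set))"
  using T by (intro open_Times) auto

lemma linear_space_deriv:
  assumes "t \<in> {0..1}" shows "linear (space_deriv V (t, x))"
proof -
  have "(V has_derivative frechet_derivative V (at (t, x))) (at (t, x))"
    by (rule Ck_on_1_has_derivative[OF V]) (use assms T in auto)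
  from has_derivative_linear[OF has_derivative_space_deriv[OF this]] show ?thesis .
qed

lemma has_space_derivative:
  assumes "t \<in> {0..1}" shows "((\<lambda>x. V (t, x)) has_derivative space_deriv V (t, x)) (at x)"
  by (rule has_derivative_space_deriv[OF Ck_on_1_has_derivative[OF V]]) (use assms T in auto)

lemma continuous_on_space_deriv: "continuous_on ({0..1} \<times> UNIV) (\<lambda>z. space_deriv V z v)"
  using V by (intro continuous_on_subset[OF continuous_on_frechet[OF openT, of 0]]) (use T in auto)

lemma space_deriv_along:
  assumes "continuous_on A \<tau>" "continuous_on A y" "\<tau> ` A \<subseteq> {0..1}"
  shows "continuous_on A (\<lambda>z. space_deriv V (\<tau> z, y z) v)"
  by (rule continuous_on_compose2[OF continuous_on_space_deriv]) (use assms in \<open>auto intro!: continuous_intros\<close>)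

text \<open>The tube of radius 1 around a trajectory is the continuous image of a compact set, and
  the sum over \<open>Basis\<close> dominates the operator norm.\<close>

lemma tube_bound:
  obtains L where "L \<ge> 0" "\<And>t w v. t \<in> {0..1} \<Longrightarrow> norm w \<le> 1 \<Longrightarrow> norm (space_deriv V (t, \<phi> t x + w) v) \<le> L * norm v"
proof -
  let ?N = "\<lambda>z. \<Sum>b\<in>Basis. norm (space_deriv V (fst z, \<phi> (fst z) x + snd z) b)"
  have "continuous_on ({0..1} \<times> cball (0::'a) 1) ?N"
    by (intro continuous_intros space_deriv_along continuous_on_compose2[OF is_solution_continuous_on[OF sol[of x]]]) auto
  then obtain L where L: "L \<ge> 0" "\<And>z. z \<in> {0..1} \<times> cball 0 1 \<Longrightarrow> ?N z \<le> L"
    by (rule continuous_attains_bound[OF compact_Times[OF compact_Icc compact_cball]]) blast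
  show ?thesis
  proof (rule that[OF L(1)])
    fix t :: real and w v :: 'a assume t: "t \<in> {0..1}" "norm w \<le> 1"
    have "norm (space_deriv V (t, \<phi> t x + w) v) \<le> ?N (t, w) * norm v"
      using linear_bound_by_basis[OF linear_space_deriv[OF t(1)]] by simp
    also have "\<dots> \<le> L * norm v" using t by (intro mult_right_mono L(2)) auto
    finally show "norm (space_deriv V (t, \<phi> t x + w) v) \<le> L * norm v" .
  qed
qed

text \<open>Uniform continuity on the same tube; this modulus plays the role that a bound on the
  second derivative would have in a Taylor estimate.\<close>

lemma tube_modulus:
  assumes "\<eta> > 0"
  obtains \<delta> where "\<delta> > 0" "\<delta> \<le> 1" "\<And>t w v. t \<in> {0..1} \<Longrightarrow> norm w \<le> \<delta> \<Longrightarrow>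
    norm (space_deriv V (t, \<phi> t x + w) v - space_deriv V (t, \<phi> t x) v) \<le> \<eta> * norm v"
proof -
  let ?M = "\<lambda>z. \<Sum>b\<in>Basis. norm (space_deriv V (fst z, \<phi> (fst z) x + snd z) b - space_deriv V (fst z, \<phi> (fst z) x) b)"
  have "continuous_on ({0..1} \<times> cball (0::'a) 1) ?M"
    by (intro continuous_intros space_deriv_along continuous_on_compose2[OF is_solution_continuous_on[OF sol[of x]]]) auto
  then have "uniformly_continuous_on ({0..1} \<times> cball (0::'a) 1) ?M"
    by (rule compact_uniformly_continuous) (intro compact_Times compact_Icc compact_cball)
  from this[unfolded uniformly_continuous_on_def, rule_format, OF assms]
  obtain \<delta> where \<delta>: "\<delta> > 0" and \<delta>': "\<forall>z\<in>{0..1} \<times> cball (0::'a) 1. \<forall>z'\<in>{0..1} \<times> cball (0::'a) 1.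
      dist z' z < \<delta> \<longrightarrow> dist (?M z') (?M z) < \<eta>"
    by (elim exE conjE)
  show ?thesis
  proof (rule that[of "min (\<delta> / 2) 1"])
    fix t :: real and w v :: 'a assume t: "t \<in> {0..1}" "norm w \<le> min (\<delta> / 2) 1"
    have "dist (?M (t, w)) (?M (t, 0)) < \<eta>"
      using t \<delta> by (intro \<delta>'[rule_format]) (auto simp: dist_Pair_Pair)
    then have M: "?M (t, w) \<le> \<eta>" by (simp add: sum_nonneg dist_norm)
    have "linear (\<lambda>v. space_deriv V (t, \<phi> t x + w) v - space_deriv V (t, \<phi> t x) v)"
      by (intro linear_compose_sub linear_space_deriv t)
    from linear_bound_by_basis[OF this, of v]
    have "norm (space_deriv V (t, \<phi> t x + w) v - space_deriv V (t, \<phi> t x) v) \<le> ?M (t, w) * norm v" by simp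
    also have "\<dots> \<le> \<eta> * norm v" using M by (intro mult_right_mono) auto
    finally show "norm (space_deriv V (t, \<phi> t x + w) v - space_deriv V (t, \<phi> t x) v) \<le> \<eta> * norm v" .
  qed (use \<delta> in auto)
qed

text \<open>The Lipschitz estimate for \<open>V\<close> is valid only inside the unit tube, so it
  has to be shown that the neighbouring trajectory stays there. An initial distance below
  \<open>exp (- (L + 1))\<close> makes the Gronwall bound less than 1, and
  \<open>stays_in_unit_ball\<close> closes the circle.\<close>

lemma flow_lipschitz:
  obtains K \<delta> where "K \<ge> 0" "\<delta> > 0" "\<And>x' t. norm (x' - x) < \<delta> \<Longrightarrow> t \<in> {0..1} \<Longrightarrow>
    norm (\<phi> t x' - \<phi> t x) \<le> K * norm (x' - x)"
proof -
  obtain L where L: "L \<ge> 0" "\<And>t w v. t \<in> {0..1} \<Longrightarrow> norm w \<le> 1 \<Longrightarrow> norm (space_deriv V (t, \<phi> t x + w) v) \<le> L * norm v"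
    by (rule tube_bound[of x]) blast
  have est: "norm (V (t, \<phi> t x + w) - V (t, \<phi> t x)) \<le> L * norm w" if t: "t \<in> {0..1}" "norm w \<le> 1" for t w
  proof -
    have "norm (V (t, \<phi> t x + w) - V (t, \<phi> t x)) \<le> L * norm ((\<phi> t x + w) - \<phi> t x)"
    proof (rule differentiable_bound[of "cball (\<phi> t x) 1"])
      fix y assume y: "y \<in> cball (\<phi> t x) 1"
      show "((\<lambda>y. V (t, y)) has_derivative space_deriv V (t, y)) (at y within cball (\<phi> t x) 1)"
        by (rule has_derivative_at_withinI[OF has_space_derivative[OF t(1)]])
      show "onorm (space_deriv V (t, y)) \<le> L"
        using L(2)[OF t(1), of "y - \<phi> t x"] y by (intro onorm_bound L(1)) (auto simp: dist_norm norm_minus_commute)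
    qed (use t in \<open>auto simp: dist_norm\<close>)
    then show ?thesis by simp
  qed
  show ?thesis
  proof (rule that[of "exp (L + 1)" "exp (- (L + 1))"])
    fix x' and t :: real assume x': "norm (x' - x) < exp (- (L + 1))" and t: "t \<in> {0..1}"
    let ?u = "\<lambda>t. \<phi> t x' - \<phi> t x"
    let ?u' = "\<lambda>t. V (t, \<phi> t x') - V (t, \<phi> t x)"
    have u: "(?u has_vector_derivative ?u' t) (at t within {0..1})" if "t \<in> {0..1}" for t
      using sol[of x] sol[of x'] that unfolding is_solution_def
      by (intro has_vector_derivative_diff) auto
    have cu: "continuous_on {0..1} ?u" by (rule has_vector_derivative_imp_continuous_on[OF u])
    have bd: "norm (?u' s) \<le> 0 + L * norm (?u s)" if "s \<in> {0..1}" "norm (?u s) \<le> 1" for s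
      using est[OF that] by simp
    have small: "norm (?u t) < 1" if "t \<in> {0..1}" for t
    proof (rule stays_in_unit_ball[OF cu _ that])
      fix t assume t: "t \<in> {0..1}" and less: "\<And>s. 0 \<le> s \<Longrightarrow> s < t \<Longrightarrow> norm (?u s) < 1"
      have "norm (?u t) \<le> (norm (?u 0) + 0) * exp (L + 1)"
      proof (rule gronwall_norm[of t ?u ?u' 0 L])
        show "continuous_on {0..t} ?u" by (rule continuous_on_subset[OF cu]) (use t in auto)
        fix s assume s: "0 < s" "s < t"
        show "(?u has_vector_derivative ?u' s) (at s)"
          using u[of s] s t by (simp add: at_within_Icc_at)
        show "norm (?u' s) \<le> 0 + L * norm (?u s)" using bd[of s] less[of s] s t by simp
      qed (use t L in auto)
      also have "\<dots> < exp (- (L + 1)) * exp (L + 1)" using x' by (simp add: \<phi>0)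
      also have "\<dots> = 1" by (simp flip: exp_add)
      finally show "norm (?u t) < 1" .
    qed
    have "norm (?u t) \<le> (norm (?u 0) + 0) * exp (L + 1)"
      by (rule gronwall_norm_within[OF u bd]) (use small L t in \<open>auto intro: less_imp_le\<close>)
    then show "norm (\<phi> t x' - \<phi> t x) \<le> exp (L + 1) * norm (x' - x)" by (simp add: \<phi>0 mult.commute)
  qed auto
qed

text \<open>The solution of the variational equation along the trajectory of \<open>x\<close> with
  initial value \<open>v\<close>. It is available before \<phi> is known to be differentiable, and
  turns out to be the derivative of \<open>\<phi> t\<close>.\<close>

definition tangent :: "real \<Rightarrow> 'a \<Rightarrow> 'a \<Rightarrow> 'a" where
  "tangent t x v = (SOME y. y 0 = v \<and> is_solution (\<lambda>z. space_deriv V (fst z, \<phi> (fst z) x) (snd z)) y) t"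

lemma tangent: "tangent 0 x v = v"
  "t \<in> {0..1} \<Longrightarrow> ((\<lambda>t. tangent t x v) has_vector_derivative space_deriv V (t, \<phi> t x) (tangent t x v)) (at t within {0..1})"
proof -
  let ?W = "\<lambda>z. space_deriv V (fst z, \<phi> (fst z) x) (snd z)"
  obtain L where L: "L \<ge> 0" "\<And>t w v. t \<in> {0..1} \<Longrightarrow> norm w \<le> 1 \<Longrightarrow> norm (space_deriv V (t, \<phi> t x + w) v) \<le> L * norm v"
    by (rule tube_bound[of x]) blast
  have "\<exists>y. y 0 = v \<and> is_solution ?W y"
  proof (rule picard_lindelof)
    have "continuous_on ({0..1} \<times> UNIV) (\<lambda>z. \<Sum>b\<in>Basis. (snd z \<bullet> b) *\<^sub>R space_deriv V (fst z, \<phi> (fst z) x) b)"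
      by (intro continuous_intros space_deriv_along continuous_on_compose2[OF is_solution_continuous_on[OF sol[of x]]]) auto
    then show "continuous_on ({0..1} \<times> UNIV) ?W"
      by (rule continuous_on_eq) (auto simp: linear_basis_sum[OF linear_space_deriv, symmetric])
    show "norm (?W (t, a) - ?W (t, b)) \<le> L * norm (a - b)" if "t \<in> {0..1}" for t a b
      using L(2)[OF that, of 0 "a - b"] by (simp add: linear_diff[OF linear_space_deriv[OF that]])
  qed (rule L(1))
  then have *: "(SOME y. y 0 = v \<and> is_solution ?W y) 0 = v \<and> is_solution ?W (SOME y. y 0 = v \<and> is_solution ?W y)"
    by (rule someI_ex)
  then show "tangent 0 x v = v"
    "t \<in> {0..1} \<Longrightarrow> ((\<lambda>t. tangent t x v) has_vector_derivative space_deriv V (t, \<phi> t x) (tangent t x v)) (at t within {0..1})"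
    unfolding tangent_def is_solution_def by auto
qed

lemma tangent_unique:
  assumes y: "\<And>t. t \<in> {0..1} \<Longrightarrow> (y has_vector_derivative space_deriv V (t, \<phi> t x) (y t)) (at t within {0..1})"
    and t: "t \<in> {0..1}"
  shows "y t = tangent t x (y 0)"
proof -
  obtain L where L: "L \<ge> 0" "\<And>t w v. t \<in> {0..1} \<Longrightarrow> norm w \<le> 1 \<Longrightarrow> norm (space_deriv V (t, \<phi> t x + w) v) \<le> L * norm v"
    by (rule tube_bound[of x]) blast
  let ?u = "\<lambda>t. y t - tangent t x (y 0)"
  have "norm (?u t) \<le> (norm (?u 0) + 0) * exp (L + 1)"
  proof (rule gronwall_norm_within)
    fix t :: real assume t: "t \<in> {0..1}"
    show "(?u has_vector_derivative space_deriv V (t, \<phi> t x) (?u t)) (at t within {0..1})"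
      using has_vector_derivative_diff[OF y[OF t] tangent(2)[OF t, of x "y 0"]]
      by (simp add: linear_diff[OF linear_space_deriv[OF t]])
    show "norm (space_deriv V (t, \<phi> t x) (?u t)) \<le> 0 + L * norm (?u t)"
      using L(2)[OF t, of 0] by simp
  qed (use L t in auto)
  then show ?thesis by (simp add: tangent(1))
qed

lemma linear_tangent:
  assumes t: "t \<in> {0..1}"
  shows "linear (tangent t x)"
proof (rule linearI)
  fix v w :: 'a
  have "tangent t x v + tangent t x w = tangent t x (tangent 0 x v + tangent 0 x w)"
  proof (rule tangent_unique[OF _ t])
    show "((\<lambda>t. tangent t x v + tangent t x w) has_vector_derivative
        space_deriv V (t, \<phi> t x) (tangent t x v + tangent t x w)) (at t within {0..1})" if "t \<in> {0..1}" for t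
      using has_vector_derivative_add[OF tangent(2)[OF that] tangent(2)[OF that], of x v x w]
      by (simp add: linear_add[OF linear_space_deriv[OF that]])
  qed
  then show "tangent t x (v + w) = tangent t x v + tangent t x w" by (simp add: tangent(1))
next
  fix c :: real and v :: 'a
  have "c *\<^sub>R tangent t x v = tangent t x (c *\<^sub>R tangent 0 x v)"
  proof (rule tangent_unique[OF _ t])
    show "((\<lambda>t. c *\<^sub>R tangent t x v) has_vector_derivative
        space_deriv V (t, \<phi> t x) (c *\<^sub>R tangent t x v)) (at t within {0..1})" if "t \<in> {0..1}" for t
      using has_vector_derivative_scaleR[OF DERIV_const tangent(2)[OF that], of c x v]
      by (simp add: linear_scale[OF linear_space_deriv[OF that]])
  qed
  then show "tangent t x (c *\<^sub>R v) = c *\<^sub>R tangent t x v" by (simp add: tangent(1))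
qed

text \<open>The error \<open>?u = \<phi> t y - \<phi> t x - tangent t x (y - x)\<close> starts at 0
  and solves the variational equation up to the linearization remainder of \<open>V\<close>. That
  remainder is at most \<eta> times \<open>norm (\<phi> s y - \<phi> s x)\<close>, hence at most
  \<open>\<eta> * K * norm (y - x)\<close>, and Gronwall transfers this bound to
  \<open>?u\<close>.\<close>

lemma has_derivative_flow:
  assumes t: "t \<in> {0..1}"
  shows "(\<phi> t has_derivative tangent t x) (at x)"
proof -
  obtain L where L: "L \<ge> 0" "\<And>t w v. t \<in> {0..1} \<Longrightarrow> norm w \<le> 1 \<Longrightarrow> norm (space_deriv V (t, \<phi> t x + w) v) \<le> L * norm v"
    by (rule tube_bound[of x]) blast
  obtain K \<delta> where K: "K \<ge> 0" "\<delta> > 0" "\<And>x' t. norm (x' - x) < \<delta> \<Longrightarrow> t \<in> {0..1} \<Longrightarrow>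
    norm (\<phi> t x' - \<phi> t x) \<le> K * norm (x' - x)"
    by (rule flow_lipschitz[of x]) blast
  show ?thesis
    unfolding has_derivative_at_alt
  proof (intro conjI allI impI)
    show "bounded_linear (tangent t x)"
      using linear_tangent[OF t] by (rule linear_conv_bounded_linear[THEN iffD1])
    fix e :: real assume e: "e > 0"
    \<comment> \<open>Chosen to absorb the Lipschitz constant \<open>K\<close> and the Gronwall
      factor; \<open>K + 1\<close> keeps the denominator positive when \<open>K = 0\<close>.\<close>
    define \<eta> where "\<eta> = e / ((K + 1) * exp (L + 1))"
    have \<eta>: "\<eta> > 0" using e K by (simp add: \<eta>_def)
    obtain \<delta>' where \<delta>': "\<delta>' > 0" "\<delta>' \<le> 1" "\<And>t w v. t \<in> {0..1} \<Longrightarrow> norm w \<le> \<delta>' \<Longrightarrow>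
      norm (space_deriv V (t, \<phi> t x + w) v - space_deriv V (t, \<phi> t x) v) \<le> \<eta> * norm v"
      by (rule tube_modulus[OF \<eta>, of x]) blast
    define d where "d = min \<delta> (\<delta>' / (K + 1))"
    have d: "d > 0" using K \<delta>' by (simp add: d_def)
    have "norm (\<phi> t y - \<phi> t x - tangent t x (y - x)) \<le> e * norm (y - x)" if y: "norm (y - x) < d" for y
    proof -
      have small: "norm (\<phi> s y - \<phi> s x) \<le> K * norm (y - x)" "norm (\<phi> s y - \<phi> s x) \<le> \<delta>'" if "s \<in> {0..1}" for s
      proof -
        show 1: "norm (\<phi> s y - \<phi> s x) \<le> K * norm (y - x)" using K(3)[OF _ that, of y] y by (simp add: d_def)
        have "K * norm (y - x) \<le> (K + 1) * d" using K y d by (intro mult_mono) auto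
        also have "\<dots> \<le> (K + 1) * (\<delta>' / (K + 1))" using K by (intro mult_left_mono) (auto simp: d_def)
        also have "\<dots> = \<delta>'" using K by simp
        finally show "norm (\<phi> s y - \<phi> s x) \<le> \<delta>'" using 1 by simp
      qed
      let ?u = "\<lambda>t. \<phi> t y - \<phi> t x - tangent t x (y - x)"
      let ?u' = "\<lambda>t. V (t, \<phi> t y) - V (t, \<phi> t x) - space_deriv V (t, \<phi> t x) (tangent t x (y - x))"
      have "norm (?u t) \<le> (norm (?u 0) + \<eta> * (K * norm (y - x))) * exp (L + 1)"
      proof (rule gronwall_norm_within)
        fix s :: real assume s: "s \<in> {0..1}"
        show "(?u has_vector_derivative ?u' s) (at s within {0..1})"
          using sol[of x] sol[of y] s unfolding is_solution_def
          by (intro has_vector_derivative_diff tangent) auto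
        let ?w = "\<phi> s y - \<phi> s x"
        have "norm (V (s, \<phi> s y) - V (s, \<phi> s x) - space_deriv V (s, \<phi> s x) (\<phi> s y - \<phi> s x))
          \<le> norm (\<phi> s y - \<phi> s x) * \<eta>"
        proof (rule differentiable_bound_linearization[where f="\<lambda>y. V (s, y)" and S="cball (\<phi> s x) \<delta>'"
            and f'="\<lambda>y. space_deriv V (s, y)" and ?x0.0="\<phi> s x"])
          show "\<phi> s x + r *\<^sub>R (\<phi> s y - \<phi> s x) \<in> cball (\<phi> s x) \<delta>'" if "r \<in> {0..1}" for r
          proof -
            have "r * norm (\<phi> s y - \<phi> s x) \<le> 1 * norm (\<phi> s y - \<phi> s x)"
              using that by (intro mult_right_mono) auto
            then show ?thesis using small(2)[OF s] that by (simp add: dist_norm)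
          qed
          show "((\<lambda>y. V (s, y)) has_derivative space_deriv V (s, y)) (at y within cball (\<phi> s x) \<delta>')" for y
            by (rule has_derivative_at_withinI[OF has_space_derivative[OF s]])
          fix y' assume "y' \<in> cball (\<phi> s x) \<delta>'"
          then show "onorm (space_deriv V (s, y') - space_deriv V (s, \<phi> s x)) \<le> \<eta>"
            using \<delta>'(3)[OF s, of "y' - \<phi> s x"] \<eta> by (intro onorm_bound) (auto simp: dist_norm norm_minus_commute)
        qed (use \<delta>' in auto)
        moreover have "norm ?w * \<eta> \<le> \<eta> * (K * norm (y - x))"
          using small(1)[OF s] \<eta> by (simp add: mult.commute)
        moreover have "norm (space_deriv V (s, \<phi> s x) (?u s)) \<le> L * norm (?u s)"
          using L(2)[OF s, of 0] by simp
        moreover have "?u' s = (V (s, \<phi> s y) - V (s, \<phi> s x) - space_deriv V (s, \<phi> s x) ?w) + space_deriv V (s, \<phi> s x) (?u s)"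
          by (simp add: linear_diff[OF linear_space_deriv[OF s]])
        ultimately show "norm (?u' s) \<le> \<eta> * (K * norm (y - x)) + L * norm (?u s)"
          by (smt (verit) norm_triangle_ineq)
      qed (use L K \<eta> t in auto)
      also have "\<dots> = \<eta> * K * exp (L + 1) * norm (y - x)" by (simp add: \<phi>0 tangent(1))
      also have "\<dots> \<le> \<eta> * (K + 1) * exp (L + 1) * norm (y - x)"
        using \<eta> by (intro mult_right_mono) auto
      also have "\<eta> * (K + 1) * exp (L + 1) = e" using K by (simp add: \<eta>_def)
      finally show ?thesis .
    qed
    with d show "\<exists>d>0. \<forall>y. norm (y - x) < d \<longrightarrow> norm (\<phi> t y - \<phi> t x - tangent t x (y - x)) \<le> e * norm (y - x)"
      by blast
  qed
qed

text \<open>The difference of the tangent solutions along two trajectories solves a linear equation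
  driven by the difference of the coefficients. The latter is small by \<open>tube_modulus\<close>,
  applied to the solution along \<open>x\<close>, which is bounded by \<open>B\<close>.\<close>

lemma continuous_on_tangent:
  assumes t: "t \<in> {0..1}"
  shows "continuous_on UNIV (\<lambda>x. tangent t x v)"
  unfolding continuous_on_iff
proof (intro ballI allI impI)
  fix x :: 'a and e :: real assume e: "e > 0"
  obtain L where L: "L \<ge> 0" "\<And>t w v. t \<in> {0..1} \<Longrightarrow> norm w \<le> 1 \<Longrightarrow> norm (space_deriv V (t, \<phi> t x + w) v) \<le> L * norm v"
    by (rule tube_bound[of x]) blast
  obtain K \<delta> where K: "K \<ge> 0" "\<delta> > 0" "\<And>x' t. norm (x' - x) < \<delta> \<Longrightarrow> t \<in> {0..1} \<Longrightarrow>
    norm (\<phi> t x' - \<phi> t x) \<le> K * norm (x' - x)"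
    by (rule flow_lipschitz[of x]) blast
  have "continuous_on {0..1} (\<lambda>t. norm (tangent t x v))"
    by (intro continuous_intros has_vector_derivative_imp_continuous_on[OF tangent(2)])
  then obtain B where B: "B \<ge> 0" "\<And>t. t \<in> {0..1} \<Longrightarrow> norm (tangent t x v) \<le> B"
    using continuous_attains_bound[of "{0..1::real}"] by (metis compact_Icc)
  define \<eta> where "\<eta> = e / (2 * (B + 1) * exp (L + 1))"
  have \<eta>: "\<eta> > 0" using e B by (simp add: \<eta>_def)
  obtain \<delta>' where \<delta>': "\<delta>' > 0" "\<delta>' \<le> 1" "\<And>t w v. t \<in> {0..1} \<Longrightarrow> norm w \<le> \<delta>' \<Longrightarrow>
    norm (space_deriv V (t, \<phi> t x + w) v - space_deriv V (t, \<phi> t x) v) \<le> \<eta> * norm v"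
    by (rule tube_modulus[OF \<eta>, of x]) blast
  define d where "d = min \<delta> (\<delta>' / (K + 1))"
  have d: "d > 0" using K \<delta>' by (simp add: d_def)
  have "dist (tangent t x' v) (tangent t x v) < e" if x': "dist x' x < d" for x'
  proof -
    have small: "norm (\<phi> s x' - \<phi> s x) \<le> \<delta>'" if "s \<in> {0..1}" for s
    proof -
      have "norm (\<phi> s x' - \<phi> s x) \<le> K * norm (x' - x)" using K(3)[OF _ that, of x'] x' by (simp add: d_def dist_norm)
      also have "\<dots> \<le> (K + 1) * d" using K x' d by (intro mult_mono) (auto simp: dist_norm)
      also have "\<dots> \<le> (K + 1) * (\<delta>' / (K + 1))" using K by (intro mult_left_mono) (auto simp: d_def)
      also have "\<dots> = \<delta>'" using K by simp
      finally show ?thesis .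
    qed
    let ?u = "\<lambda>t. tangent t x' v - tangent t x v"
    let ?u' = "\<lambda>t. space_deriv V (t, \<phi> t x') (tangent t x' v) - space_deriv V (t, \<phi> t x) (tangent t x v)"
    have "norm (?u t) \<le> (norm (?u 0) + \<eta> * B) * exp (L + 1)"
    proof (rule gronwall_norm_within)
      fix s :: real assume s: "s \<in> {0..1}"
      show "(?u has_vector_derivative ?u' s) (at s within {0..1})"
        by (intro has_vector_derivative_diff tangent s)
      have "norm (space_deriv V (s, \<phi> s x') (tangent s x v) - space_deriv V (s, \<phi> s x) (tangent s x v)) \<le> \<eta> * norm (tangent s x v)"
        using \<delta>'(3)[OF s small[OF s]] by simp
      also have "\<dots> \<le> \<eta> * B" using \<eta> B(2)[OF s] by simp
      finally have "norm (space_deriv V (s, \<phi> s x') (tangent s x v) - space_deriv V (s, \<phi> s x) (tangent s x v)) \<le> \<eta> * B" .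
      moreover have "norm (space_deriv V (s, \<phi> s x') (?u s)) \<le> L * norm (?u s)"
        using L(2)[OF s, of "\<phi> s x' - \<phi> s x" "?u s"] small[OF s] \<delta>'(2) by simp
      moreover have "?u' s = (space_deriv V (s, \<phi> s x') (tangent s x v) - space_deriv V (s, \<phi> s x) (tangent s x v))
          + space_deriv V (s, \<phi> s x') (?u s)"
        by (simp add: linear_diff[OF linear_space_deriv[OF s]])
      ultimately show "norm (?u' s) \<le> \<eta> * B + L * norm (?u s)"
        by (smt (verit) norm_triangle_ineq)
    qed (use L B \<eta> t in auto)
    also have "\<dots> = \<eta> * B * exp (L + 1)" by (simp add: tangent(1))
    also have "\<dots> \<le> \<eta> * (B + 1) * exp (L + 1)" using \<eta> by (intro mult_right_mono) auto
    also have "\<dots> = e / 2"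
    proof -
      have "exp (L + 1) \<noteq> 0" "B + 1 \<noteq> 0" using B by auto
      then show ?thesis unfolding \<eta>_def by (simp add: divide_simps distrib_left)
    qed
    also have "\<dots> < e" using e by simp
    finally show ?thesis by (simp add: dist_norm)
  qed
  with d show "\<exists>d>0. \<forall>x'\<in>UNIV. dist x' x < d \<longrightarrow> dist (tangent t x' v) (tangent t x v) < e" by blast
qed

lemma Ck_on_flow: "t \<in> {0..1} \<Longrightarrow> Ck_on 1 (\<phi> t) UNIV"
  using Ck_on_SucI[OF open_UNIV has_derivative_flow, of t 0] continuous_on_tangent by auto

end

text \<open>The pair of flow and tangent solution is itself a family of solutions, of the
  \<open>C\<^sup>1\<close> field \<open>W\<close> on the product space. Applying the locale to it
  makes the derivative of the flow \<open>C\<^sup>1\<close>.\<close>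

lemma (in C1_flow) Ck_on_2_flow:
  assumes V2: "Ck_on 2 V (T \<times> UNIV)" and t: "t \<in> {0..1}"
  shows "Ck_on 2 (\<phi> t) UNIV"
proof -
  have op: "open (T \<times> (UNIV :: ('a \<times> 'a) set))" using T by (intro open_Times) auto
  define W where "W z = (V (fst z, fst (snd z)), space_deriv V (fst z, fst (snd z)) (snd (snd z)))"
    for z :: "real \<times> ('a \<times> 'a)"
  have lin: "linear (space_deriv V (t, x))" if "t \<in> T" for t x
    using has_derivative_linear[OF has_derivative_space_deriv[OF Ck_on_1_has_derivative[OF V]]] that by simp
  have V2': "Ck_on (Suc 1) V (T \<times> UNIV)" using V2 by (simp add: numeral_2_eq_2)
  have pr: "Ck_on 1 (\<lambda>z :: real \<times> 'a \<times> 'a. (fst z, fst (snd z))) (T \<times> UNIV)"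
    "Ck_on 1 (\<lambda>z :: real \<times> 'a \<times> 'a. snd (snd z)) (T \<times> UNIV)"
    by (intro Ck_on_linear[OF op] bounded_linear_Pair bounded_linear_fst bounded_linear_fst_comp bounded_linear_snd_comp bounded_linear_snd)+
  have "Ck_on 1 W (T \<times> UNIV)"
  proof (rule Ck_on_cong[OF op])
    show "Ck_on 1 (\<lambda>z. (V (fst z, fst (snd z)),
        \<Sum>b\<in>Basis. (snd (snd z) \<bullet> b) *\<^sub>R space_deriv V (fst z, fst (snd z)) b)) (T \<times> UNIV)"
      by (intro Ck_on_Pair Ck_on_sum Ck_on_scaleR Ck_on_inner Ck_on_const pr op
          Ck_on_compose[OF op openT V pr(1)] Ck_on_compose[OF op openT Ck_on_frechet[OF openT V2'] pr(1)]) auto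
    show "(V (fst z, fst (snd z)), \<Sum>b\<in>Basis. (snd (snd z) \<bullet> b) *\<^sub>R space_deriv V (fst z, fst (snd z)) b) = W z"
      if "z \<in> T \<times> UNIV" for z
      using that linear_basis_sum[OF lin, of "fst z" "fst (snd z)" "snd (snd z)"] by (auto simp: W_def)
  qed
  moreover have "is_solution W (\<lambda>t. (\<phi> t (fst z), tangent t (fst z) (snd z)))" for z
    using sol[of "fst z"] tangent(2)[of _ "fst z" "snd z"]
    unfolding is_solution_def by (auto simp: W_def intro!: has_vector_derivative_Pair)
  ultimately interpret W: C1_flow W T "\<lambda>t z. (\<phi> t (fst z), tangent t (fst z) (snd z))"
    by unfold_locales (use T in \<open>auto simp: \<phi>0 tangent(1)\<close>)
  have "Ck_on 1 (\<lambda>x. snd (\<phi> t (fst (x, v)), tangent t (fst (x, v)) (snd (x, v)))) UNIV" for v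
    by (intro Ck_on_linear_image[OF open_UNIV bounded_linear_snd]
        Ck_on_compose[OF open_UNIV open_UNIV W.Ck_on_flow[OF t]] Ck_on_Pair Ck_on_ident Ck_on_const) auto
  then have "Ck_on (Suc 1) (\<phi> t) UNIV"
    by (intro Ck_on_SucI[OF open_UNIV has_derivative_flow[OF t]]) simp
  then show ?thesis by (simp add: numeral_2_eq_2)
qed

section \<open>Uniqueness, time reversal and the inverse of the time-one map\<close>

lemma solution_unique:
  fixes V :: "real \<times> 'a::euclidean_space \<Rightarrow> 'a"
  assumes lip: "\<And>t x y. t \<in> {0..1} \<Longrightarrow> norm (V (t, x) - V (t, y)) \<le> L * norm (x - y)" "L \<ge> 0"
    and "is_solution V y" "is_solution V z" "y 0 = z 0" "t \<in> {0..1}"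
  shows "y t = z t"
proof -
  have "norm (y t - z t) \<le> (norm (y 0 - z 0) + 0) * exp (L + 1)"
    by (rule gronwall_norm_within[where u'="\<lambda>t. V (t, y t) - V (t, z t)"])
       (use assms in \<open>auto simp: is_solution_def intro!: has_vector_derivative_diff\<close>)
  then show ?thesis using assms by simp
qed

lemma solution_reverse:
  assumes "is_solution V y"
  shows "is_solution (\<lambda>z. - V (1 - fst z, snd z)) (\<lambda>t. y (1 - t))"
  unfolding is_solution_def
proof
  fix t :: real assume t: "t \<in> {0..1}"
  have im: "(\<lambda>t. 1 - t) ` {0..1::real} = {0..1}"
    by (auto simp: image_iff intro: bexI[of _ "1 - _"])
  have "(y has_vector_derivative V (1 - t, y (1 - t))) (at (1 - t) within (\<lambda>t. 1 - t) ` {0..1})"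
    using assms t unfolding im by (auto simp: is_solution_def)
  moreover have "((\<lambda>t. 1 - t) has_vector_derivative - 1) (at t within {0..1::real})"
    by (auto intro!: derivative_eq_intros)
  ultimately have "(y \<circ> (\<lambda>t. 1 - t) has_vector_derivative (- 1) *\<^sub>R V (1 - t, y (1 - t))) (at t within {0..1})"
    by (intro vector_diff_chain_within)
  then show "((\<lambda>t. y (1 - t)) has_vector_derivative - V (1 - fst (t, y (1 - t)), snd (t, y (1 - t)))) (at t within {0..1})"
    by (simp add: o_def)
qed

text \<open>The inverse of the time-one map is the time-one map of the reversed field, so it is
  \<open>C\<^sup>2\<close> for the same reason and no inverse function theorem enters. The two maps
  are inverse to each other by uniqueness of solutions.\<close>

theorem C2_flow_exists:
  fixes V :: "real \<times> 'a::euclidean_space \<Rightarrow> 'a"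
  assumes T: "open T" "{0..1} \<subseteq> T" and V: "Ck_on 2 V (T \<times> UNIV)"
    and lip: "\<And>t x y. t \<in> {0..1} \<Longrightarrow> norm (V (t, x) - V (t, y)) \<le> L * norm (x - y)" and L: "L \<ge> 0"
  shows "\<exists>\<phi> \<psi>. C1_flow V T \<phi> \<and> Ck_on 2 (\<phi> 1) UNIV \<and> Ck_on 2 \<psi> UNIV \<and>
    (\<forall>x. \<psi> (\<phi> 1 x) = x) \<and> (\<forall>x. \<phi> 1 (\<psi> x) = x)"
proof -
  have ex: "\<exists>\<phi>. C1_flow V T \<phi> \<and> Ck_on 2 (\<phi> 1) UNIV"
    if T: "open T" "{0..1} \<subseteq> T" and V: "Ck_on 2 V (T \<times> UNIV)"
      and lip: "\<And>t x y. t \<in> {0..1} \<Longrightarrow> norm (V (t, x) - V (t, y)) \<le> L * norm (x - y)"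
    for V :: "real \<times> 'a \<Rightarrow> 'a" and T
  proof -
    have "continuous_on ({0..1} \<times> UNIV) V"
      by (rule continuous_on_subset[OF Ck_on_imp_continuous_on[OF V]]) (use T in auto)
    from picard_lindelof[OF this lip L]
    have "\<forall>x. \<exists>y. y 0 = x \<and> is_solution V y" by blast
    then obtain Y where Y: "\<And>x. Y x 0 = x" "\<And>x. is_solution V (Y x)" by metis
    have "C1_flow V T (\<lambda>t x. Y x t)"
      by unfold_locales (use T Y Ck_on_mono[OF V, of 1] in auto)
    with C1_flow.Ck_on_2_flow[OF this V, of 1] show ?thesis by auto
  qed
  obtain \<phi> where \<phi>: "C1_flow V T \<phi>" "Ck_on 2 (\<phi> 1) UNIV" using ex[OF T V lip] by blast
  let ?V = "\<lambda>z. - V (1 - fst z, snd z)"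
  let ?T = "(\<lambda>t. 1 - t) -` T"
  have T': "open ?T" "{0..1} \<subseteq> ?T"
    using T(1) by (auto intro!: open_vimage continuous_intros subsetD[OF T(2)])
  then have op: "open (?T \<times> (UNIV::'a set))" "open (T \<times> (UNIV::'a set))" using T by (auto intro: open_Times)
  have "Ck_on 2 ?V (?T \<times> UNIV)"
    by (intro Ck_on_linear_image[OF op(1) bounded_linear_minus[OF bounded_linear_ident]]
        Ck_on_compose[OF op V] Ck_on_Pair Ck_on_minus Ck_on_const op(1) Ck_on_linear
        bounded_linear_fst bounded_linear_snd) auto
  moreover have lip': "norm (?V (t, x) - ?V (t, y)) \<le> L * norm (x - y)" if "t \<in> {0..1}" for t x y
    using lip[of "1 - t" x y] that by (simp add: norm_minus_commute)
  ultimately obtain \<psi> where \<psi>: "C1_flow ?V ?T \<psi>" "Ck_on 2 (\<psi> 1) UNIV" using ex[OF T'] by blast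
  show ?thesis
  proof (intro exI[of _ \<phi>] exI[of _ "\<psi> 1"] conjI allI)
    interpret \<phi>: C1_flow V T \<phi> by (rule \<phi>)
    interpret \<psi>: C1_flow ?V ?T \<psi> by (rule \<psi>)
    fix x
    have "\<psi> 1 (\<phi> 1 x) = \<phi> (1 - 1) x"
      by (rule solution_unique[OF lip' L \<psi>.sol solution_reverse[OF \<phi>.sol]]) (auto simp: \<psi>.\<phi>0)
    then show "\<psi> 1 (\<phi> 1 x) = x" by (simp add: \<phi>.\<phi>0)
    have "is_solution V (\<lambda>t. \<psi> (1 - t) x)" using solution_reverse[OF \<psi>.sol[of x]] by simp
    from solution_unique[OF lip L \<phi>.sol this, of "\<psi> 1 x" 1]
    show "\<phi> 1 (\<psi> 1 x) = x" by (simp add: \<phi>.\<phi>0 \<psi>.\<phi>0)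
  qed (rule \<phi> \<psi>)+
qed

section \<open>Skew matrices and 2-forms\<close>

definition skew :: "real^4^4 \<Rightarrow> bool" where
  "skew M \<longleftrightarrow> (\<forall>a b. a \<bullet> (M *v b) = - (b \<bullet> (M *v a)))"

lemma norm_matrix_vector_mult_le:
  fixes A :: "real^'n^'m"
  shows "norm (A *v x) \<le> norm A * norm x"
proof (rule power2_le_imp_le)
  have "(norm (A *v x))\<^sup>2 = (\<Sum>i\<in>UNIV. (A $ i \<bullet> x)\<^sup>2)"
    by (simp add: norm_vec_def L2_set_def sum_nonneg matrix_vector_mul_component)
  also have "\<dots> \<le> (\<Sum>i\<in>UNIV. (norm (A $ i))\<^sup>2 * (norm x)\<^sup>2)"
    by (intro sum_mono) (metis Cauchy_Schwarz_ineq power2_norm_eq_inner)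
  also have "\<dots> = (norm A * norm x)\<^sup>2"
    by (simp add: norm_vec_def[of A] L2_set_def sum_nonneg power_mult_distrib sum_distrib_right)
  finally show "(norm (A *v x))\<^sup>2 \<le> (norm A * norm x)\<^sup>2" .
qed simp

lemma bounded_bilinear_matrix_vector:
  "bounded_bilinear ((*v) :: real^'n^'m \<Rightarrow> real^'n \<Rightarrow> real^'m)"
  by (rule bounded_bilinear.intro)
     (auto simp: matrix_vector_mult_add_rdistrib matrix_vector_right_distrib scaleR_matrix_vector_assoc
       matrix_vector_mult_scaleR intro!: exI[of _ 1] norm_matrix_vector_mult_le)

lemma skew_iff_transpose: "skew M \<longleftrightarrow> transpose M = - M"
proof
  assume M: "skew M"
  have e: "axis i 1 \<bullet> (M *v axis j 1) = M $ i $ j" for i j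
    by (simp add: inner_axis' matrix_vector_mul_component inner_axis)
  have "transpose M $ i $ j = (- M) $ i $ j" for i j
    using M[unfolded skew_def, rule_format, of "axis j 1" "axis i 1"]
    unfolding e by (simp add: transpose_def)
  then show "transpose M = - M" unfolding vec_eq_iff by blast
next
  assume M: "transpose M = - M"
  show "skew M" unfolding skew_def
  proof (intro allI)
    fix a b
    have "a \<bullet> (M *v b) = (transpose M *v a) \<bullet> b" by (simp add: dot_lmul_matrix)
    also have "\<dots> = - ((M *v a) \<bullet> b)"
      unfolding M bounded_bilinear.minus_left[OF bounded_bilinear_matrix_vector] by simp
    finally show "a \<bullet> (M *v b) = - (b \<bullet> (M *v a))" by (simp only: inner_commute)
  qed
qed

lemma skew_entry:
  assumes "skew M"
  shows "M $ i $ j = - M $ j $ i"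
proof -
  have "transpose M $ j $ i = (- M) $ j $ i" using assms by (simp add: skew_iff_transpose)
  then show ?thesis by (simp add: transpose_def)
qed

lemmas Ck_on_matrix_vector = Ck_on_bilinear[OF _ bounded_bilinear_matrix_vector]

definition pfaffian :: "real^4^4 \<Rightarrow> real" where
  "pfaffian A = A $ 1 $ 2 * A $ 3 $ 4 - A $ 1 $ 3 * A $ 2 $ 4 + A $ 1 $ 4 * A $ 2 $ 3"

text \<open>The Hodge dual of a skew matrix: up to sign it is the Pfaffian times the inverse.\<close>

definition hodge_dual :: "real^4^4 \<Rightarrow> real^4^4" where
  "hodge_dual A = vector [
     vector [0, A $ 3 $ 4, - A $ 2 $ 4, A $ 2 $ 3],
     vector [- A $ 3 $ 4, 0, A $ 1 $ 4, - A $ 1 $ 3],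
     vector [A $ 2 $ 4, - A $ 1 $ 4, 0, A $ 1 $ 2],
     vector [- A $ 2 $ 3, A $ 1 $ 3, - A $ 1 $ 2, 0]]"

lemma vector_4_nth [simp]:
  "(vector [a, b, c, d] :: 'a::zero^4) $ 1 = a" "(vector [a, b, c, d] :: 'a^4) $ 2 = b"
  "(vector [a, b, c, d] :: 'a^4) $ 3 = c" "(vector [a, b, c, d] :: 'a^4) $ 4 = d"
  by (simp_all add: vector_def)

text \<open>An explicit inverse that is rational in the entries: it makes the solution of a skew
  linear system as smooth as its data, whenever the Pfaffian does not vanish.\<close>

lemma skew_hodge_dual:
  assumes "skew A"
  shows "A *v (hodge_dual A *v x) = - pfaffian A *\<^sub>R x"
proof -
  have d: "A $ 1 $ 1 = 0" "A $ 2 $ 2 = 0" "A $ 3 $ 3 = 0" "A $ 4 $ 4 = 0"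
    using skew_entry[OF assms, of 1 1] skew_entry[OF assms, of 2 2] skew_entry[OF assms, of 3 3]
      skew_entry[OF assms, of 4 4] by linarith+
  have s: "A $ 2 $ 1 = - A $ 1 $ 2" "A $ 3 $ 1 = - A $ 1 $ 3" "A $ 4 $ 1 = - A $ 1 $ 4"
    "A $ 3 $ 2 = - A $ 2 $ 3" "A $ 4 $ 2 = - A $ 2 $ 4" "A $ 4 $ 3 = - A $ 3 $ 4"
    using skew_entry[OF assms] by blast+
  show ?thesis
    unfolding vec_eq_iff forall_4 matrix_vector_mul_component inner_vec_def sum_4
    by (simp add: hodge_dual_def pfaffian_def d s algebra_simps)
qed

lemma Ck_on_hodge_dual:
  assumes "open S" "Ck_on k A S"
  shows "Ck_on k (\<lambda>x. hodge_dual (A x)) S"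
proof -
  have e: "Ck_on k (\<lambda>x. A x $ i $ j) S" for i j by (rule Ck_on_matrix_entry[OF assms])
  then have "Ck_on k (\<lambda>x. - (A x $ i $ j)) S" for i j
    by (intro Ck_on_linear_image[OF assms(1) bounded_linear_minus[OF bounded_linear_ident]])
  with e have "\<forall>i j. Ck_on k (\<lambda>x. hodge_dual (A x) $ i $ j) S"
    unfolding forall_4 by (simp add: hodge_dual_def Ck_on_const)
  then show ?thesis by (intro Ck_on_matrix[OF assms(1)]) blast
qed

lemma Ck_on_pfaffian:
  assumes "open S" "Ck_on k A S"
  shows "Ck_on k (\<lambda>x. pfaffian (A x)) S"
  unfolding pfaffian_def
  by (intro Ck_on_add Ck_on_minus Ck_on_mult Ck_on_matrix_entry assms)

lemma omega0_mult_vec: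
  "omega0 *v x = vector [x $ 2, - x $ 1, x $ 4, - x $ 3]"
  unfolding vec_eq_iff forall_4 matrix_vector_mul_component inner_vec_def sum_4
  by (simp add: omega0_def dx_wedge_def mat_unit_def)

lemma norm_omega0: "norm (omega0 *v x) = norm x"
  unfolding norm_vec_def L2_set_def sum_4 omega0_mult_vec by (simp add: add_ac)

lemma skew_omega0: "skew omega0"
  unfolding skew_def omega0_mult_vec inner_vec_def sum_4 by simp

lemma skewD: "skew M \<Longrightarrow> a \<bullet> (M *v b) = - (b \<bullet> (M *v a))"
  unfolding skew_def by blast

lemma skew_add:
  assumes "skew A" "skew B" shows "skew (A + B)"
  unfolding skew_def
proof (intro allI)
  show "a \<bullet> ((A + B) *v b) = - (b \<bullet> ((A + B) *v a))" for a b
    using skewD[OF assms(1), of a b] skewD[OF assms(2), of a b]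
    by (simp add: matrix_vector_mult_add_rdistrib inner_add_right)
qed

lemma skew_scaleR:
  assumes "skew A" shows "skew (c *\<^sub>R A)"
  unfolding skew_def
proof (intro allI)
  show "a \<bullet> ((c *\<^sub>R A) *v b) = - (b \<bullet> ((c *\<^sub>R A) *v a))" for a b
    using skewD[OF assms, of a b] by (simp add: scaleR_matrix_vector_assoc[symmetric])
qed

lemma skew_diff: "skew A \<Longrightarrow> skew B \<Longrightarrow> skew (A - B)"
  using skew_add[OF _ skew_scaleR, of A B "- 1"] by simp

text \<open>\<open>omega0\<close> is an isometry, and a perturbation of norm at most 1/2 takes away
  at most half of the length.\<close>

lemma perturbed_omega0_bound:
  assumes "\<bar>t\<bar> * norm A \<le> 1 / 2"
  shows "norm x \<le> 2 * norm ((omega0 + t *\<^sub>R A) *v x)"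
proof -
  have "norm ((t *\<^sub>R A) *v x) \<le> norm (t *\<^sub>R A) * norm x" by (rule norm_matrix_vector_mult_le)
  also have "\<dots> \<le> 1 / 2 * norm x" using assms by (intro mult_right_mono) auto
  finally have "norm ((t *\<^sub>R A) *v x) \<le> norm x / 2" by simp
  moreover have "norm (omega0 *v x) \<le> norm ((omega0 + t *\<^sub>R A) *v x) + norm ((t *\<^sub>R A) *v x)"
    by (metis add_diff_cancel_right' matrix_vector_mult_add_rdistrib norm_triangle_ineq4)
  ultimately show ?thesis by (simp add: norm_omega0)
qed

text \<open>If the Pfaffian vanished, \<open>A\<close> would annihilate the image of its Hodge dual.
  Injectivity would make the dual zero; the dual contains the entries of the first row of
  \<open>A\<close> up to sign, so by skewness the first column of \<open>A\<close> would vanish,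
  contradicting injectivity.\<close>

lemma pfaffian_nonzero:
  assumes "skew A" and inj: "\<And>x. norm x \<le> c * norm (A *v x)"
  shows "pfaffian A \<noteq> 0"
proof
  assume "pfaffian A = 0"
  then have "A *v (hodge_dual A *v x) = 0" for x using skew_hodge_dual[OF assms(1)] by simp
  then have h: "hodge_dual A *v x = 0" for x using inj[of "hodge_dual A *v x"] by simp
  have e: "hodge_dual A $ i $ j = 0" for i j
  proof -
    have "(hodge_dual A *v axis j 1) $ i = hodge_dual A $ i $ j"
      by (simp add: matrix_vector_mul_component inner_axis)
    then show ?thesis using h by simp
  qed
  have "A $ 1 $ 2 = 0" "A $ 1 $ 3 = 0" "A $ 1 $ 4 = 0"
    using e[of 3 4] e[of 2 4] e[of 2 3] by (auto simp: hodge_dual_def)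
  moreover have "A $ 1 $ 1 = 0" using skew_entry[OF assms(1), of 1 1] by simp
  ultimately have "A *v axis 1 1 = 0"
    using skew_entry[OF assms(1), of 2 1] skew_entry[OF assms(1), of 3 1] skew_entry[OF assms(1), of 4 1]
    by (simp add: vec_eq_iff forall_4 matrix_vector_mul_component inner_axis)
  with inj[of "axis 1 1"] show False by (simp add: axis_eq_0_iff)
qed

section \<open>Closed 2-forms and their primitives\<close>

definition closed_form :: "(real^4 \<Rightarrow> real^4^4) \<Rightarrow> (real^4) set \<Rightarrow> bool" where
  "closed_form F S \<longleftrightarrow> (\<forall>x\<in>S. \<forall>a b c. b \<bullet> (frechet_derivative F (at x) a *v c) +
     c \<bullet> (frechet_derivative F (at x) b *v a) + a \<bullet> (frechet_derivative F (at x) c *v b) = 0)"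

text \<open>The equation d\<theta> = F, where the 1-form \<theta> is stored as a vector field
  through the Euclidean inner product and \<open>F\<close> is evaluated as
  \<open>a \<bullet> (F x *v b)\<close>.\<close>

definition primitive_of :: "(real^4 \<Rightarrow> real^4^4) \<Rightarrow> (real^4 \<Rightarrow> real^4) \<Rightarrow> (real^4) set \<Rightarrow> bool" where
  "primitive_of F \<theta> S \<longleftrightarrow> (\<forall>x\<in>S. \<forall>a b. frechet_derivative \<theta> (at x) a \<bullet> b -
     frechet_derivative \<theta> (at x) b \<bullet> a = a \<bullet> (F x *v b))"

lemma skew_frechet_derivative:
  assumes "open S" "x \<in> S" "F differentiable (at x)" "\<And>y. y \<in> S \<Longrightarrow> skew (F y)"
  shows "skew (frechet_derivative F (at x) v)"
  unfolding skew_def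
proof (intro allI)
  fix a b
  have D: "(F has_derivative frechet_derivative F (at x)) (at x)" by (rule has_frechet_derivative[OF assms(3)])
  have bl: "bounded_linear (\<lambda>M. c \<bullet> (M *v d))" for c d :: "real^4"
    by (rule bounded_linear_compose[OF bounded_linear_inner_right
          bounded_bilinear.bounded_linear_left[OF bounded_bilinear_matrix_vector]])
  have "((\<lambda>y. a \<bullet> (F y *v b)) has_derivative (\<lambda>v. a \<bullet> (frechet_derivative F (at x) v *v b))) (at x)"
    by (rule bounded_linear.has_derivative[OF bl D])
  moreover have "((\<lambda>y. a \<bullet> (F y *v b)) has_derivative (\<lambda>v. - (b \<bullet> (frechet_derivative F (at x) v *v a)))) (at x)"
    by (rule has_derivative_transform_within_open[OF has_derivative_minus[OF bounded_linear.has_derivative[OF bl D]] assms(1,2)])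
       (simp add: skewD[OF assms(4), of _ a b])
  ultimately have "(\<lambda>v. a \<bullet> (frechet_derivative F (at x) v *v b)) = (\<lambda>v. - (b \<bullet> (frechet_derivative F (at x) v *v a)))"
    by (rule has_derivative_unique)
  then show "a \<bullet> (frechet_derivative F (at x) v *v b) = - (b \<bullet> (frechet_derivative F (at x) v *v a))"
    by meson
qed

text \<open>The infinitesimal Moser identity: the Lie derivative of \<open>\<omega>\<^sub>t\<close> along \<open>V\<close> cancels
  \<open>\<partial>\<^sub>t \<omega>\<^sub>t = F\<close> when \<open>\<omega>\<^sub>t V = \<theta>\<close> and \<open>d\<theta> = F\<close>. Here \<open>W\<close> stands for \<open>\<omega>\<^sub>t\<close>, and \<open>Va\<close>, \<open>Fa\<close>, \<open>\<theta>a\<close>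
  for derivatives in direction \<open>a\<close>.\<close>

lemma moser_cancellation:
  fixes W F Fa Fb Fv :: "real^4^4" and a b v Va Vb \<theta>a \<theta>b :: "real^4"
  assumes W: "skew W" and "skew Fb"
    and closed: "b \<bullet> (Fa *v v) + v \<bullet> (Fb *v a) + a \<bullet> (Fv *v b) = 0"
    and d\<theta>: "\<theta>a \<bullet> b - \<theta>b \<bullet> a = a \<bullet> (F *v b)"
    and Da: "t *\<^sub>R (Fa *v v) + W *v Va = \<theta>a" and Db: "t *\<^sub>R (Fb *v v) + W *v Vb = \<theta>b"
  shows "Va \<bullet> (W *v b) + a \<bullet> (F *v b) + t * (a \<bullet> (Fv *v b)) + a \<bullet> (W *v Vb) = 0"
proof -
  have 1: "Va \<bullet> (W *v b) = - (b \<bullet> (W *v Va))" by (rule skewD[OF W])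
  have 2: "\<theta>a \<bullet> b = t * (b \<bullet> (Fa *v v)) + b \<bullet> (W *v Va)"
    unfolding Da[symmetric] by (simp add: inner_add_left inner_add_right inner_commute)
  have 3: "\<theta>b \<bullet> a = t * (a \<bullet> (Fb *v v)) + a \<bullet> (W *v Vb)"
    unfolding Db[symmetric] by (simp add: inner_add_left inner_add_right inner_commute)
  have 4: "v \<bullet> (Fb *v a) = - (a \<bullet> (Fb *v v))" by (rule skewD[OF assms(2)])
  have "t * (b \<bullet> (Fa *v v)) + t * (v \<bullet> (Fb *v a)) + t * (a \<bullet> (Fv *v b)) = 0"
    using closed by (simp flip: distrib_left)
  then show ?thesis using 1 2 3 4 d\<theta> by simp
qed

section \<open>Moser's argument near infinity\<close>

lemma powr_small:
  assumes "p > 0" "\<delta> > 0"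
  shows "\<exists>\<rho>. \<forall>x\<ge>\<rho>. c * x powr (- p) \<le> (\<delta>::real)"
proof -
  have "((\<lambda>x::real. c * x powr (- p)) \<longlongrightarrow> c * 0) at_top"
    by (intro tendsto_intros tendsto_neg_powr filterlim_ident) (use assms in auto)
  then have "\<forall>\<^sub>F x in at_top. c * x powr (- p) < \<delta>"
    using assms by (intro order_tendstoD) auto
  then show ?thesis by (auto simp: eventually_at_top_linorder intro: less_imp_le)
qed

lemma open_compl_cball: "open (- cball (0::'a::euclidean_space) \<rho>)"
  by (simp add: open_Compl)

text \<open>The square of the norm, unlike the norm, is smooth at the origin. For
  \<open>\<rho> > 0\<close> the value 1 is reached at radius \<open>sqrt 2 * \<rho>\<close>;
  \<open>2 * \<rho>\<close> is the round bound used below.\<close>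

definition annulus_cutoff :: "real \<Rightarrow> 'a::euclidean_space \<Rightarrow> real" where
  "annulus_cutoff \<rho> x = smoothstep (inverse (\<rho>\<^sup>2) * (x \<bullet> x) - 1)"

lemma annulus_cutoff_Ck: "Ck_on 2 (annulus_cutoff \<rho>) UNIV"
  unfolding annulus_cutoff_def
  by (intro Ck_on_compose[OF _ _ Ck_on_smoothstep] Ck_on_minus Ck_on_mult Ck_on_inner Ck_on_const Ck_on_ident) auto

lemma annulus_cutoff_0: "norm x \<le> \<rho> \<Longrightarrow> annulus_cutoff \<rho> x = 0"
proof -
  assume "norm x \<le> \<rho>"
  then have "(norm x)\<^sup>2 \<le> \<rho>\<^sup>2" by (intro power_mono) auto
  then have "inverse (\<rho>\<^sup>2) * (x \<bullet> x) \<le> 1"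
    by (cases "\<rho> = 0") (auto simp: field_simps power2_norm_eq_inner)
  then show ?thesis by (auto simp: annulus_cutoff_def intro: smoothstep_0)
qed

lemma annulus_cutoff_1: "\<rho> > 0 \<Longrightarrow> norm x \<ge> 2 * \<rho> \<Longrightarrow> annulus_cutoff \<rho> x = 1"
proof -
  assume r: "\<rho> > 0" "norm x \<ge> 2 * \<rho>"
  then have "(2 * \<rho>)\<^sup>2 \<le> (norm x)\<^sup>2" by (intro power_mono) auto
  then have "4 * \<rho>\<^sup>2 \<le> x \<bullet> x" by (simp add: power2_norm_eq_inner power_mult_distrib)
  then have "2 * \<rho>\<^sup>2 \<le> x \<bullet> x" using zero_le_power2[of \<rho>] by linarith
  then have "2 \<le> inverse (\<rho>\<^sup>2) * (x \<bullet> x)"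
    using r by (simp add: field_simps)
  then show ?thesis by (auto simp: annulus_cutoff_def intro: smoothstep_1)
qed

lemma annulus_cutoff_bounds: "\<bar>annulus_cutoff \<rho> x\<bar> \<le> 1"
  using smoothstep_nonneg smoothstep_le_1 by (auto simp: annulus_cutoff_def abs_le_iff intro: order_trans[of _ 0])

lemma annulus_cutoff_derivative_bound:
  assumes "\<rho> > 0"
  obtains K where "K \<ge> 0" "\<And>x v. \<bar>frechet_derivative (annulus_cutoff \<rho>) (at (x::'a::euclidean_space)) v\<bar> \<le> K * norm v"
proof -
  let ?N = "\<lambda>x::'a. \<Sum>b\<in>Basis. norm (frechet_derivative (annulus_cutoff \<rho>) (at x) b)"
  have ck: "Ck_on 1 (annulus_cutoff \<rho> :: 'a \<Rightarrow> real) UNIV" by (rule Ck_on_mono[OF annulus_cutoff_Ck]) simp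
  have "continuous_on (cball 0 (2 * \<rho>)) ?N"
    using ck by (intro continuous_intros continuous_on_subset[OF continuous_on_frechet[OF open_UNIV, of 0]]) auto
  then obtain K where K: "K \<ge> 0" "\<And>x. x \<in> cball 0 (2 * \<rho>) \<Longrightarrow> ?N x \<le> K"
    by (rule continuous_attains_bound[OF compact_cball]) blast
  show ?thesis
  proof (rule that[OF K(1)])
    fix x v :: 'a
    show "\<bar>frechet_derivative (annulus_cutoff \<rho>) (at x) v\<bar> \<le> K * norm v"
    proof (cases "x \<in> cball 0 (2 * \<rho>)")
      case True
      have "norm (frechet_derivative (annulus_cutoff \<rho>) (at x) v) \<le> ?N x * norm v"
        by (rule linear_bound_by_basis[OF has_derivative_linear[OF Ck_on_1_has_derivative[OF ck]]]) simp
      also have "\<dots> \<le> K * norm v" by (intro mult_right_mono K(2) True) auto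
      finally show ?thesis by simp
    next
      case False
      have "frechet_derivative (annulus_cutoff \<rho>) (at x) = frechet_derivative (\<lambda>_. 1) (at x)"
        by (rule frechet_derivative_cong[OF open_compl_cball, of _ "2 * \<rho>"])
           (use False assms in \<open>auto intro!: annulus_cutoff_1\<close>)
      then show ?thesis using K by (simp add: frechet_derivative_const)
    qed
  qed
qed

text \<open>Times range over the open interval (-1, 2), so \<open>norm (F x) \<le> 1 / 4\<close>
  keeps \<open>t F\<close> within norm 1/2, where \<open>omega0 + t F\<close> is uniformly
  invertible. The bound \<open>exp (- 1)\<close> on the field cancels the factor
  \<open>exp 1\<close> of the Gronwall estimate, so that no point moves by more than 1.\<close>

locale moser =
  fixes F :: "real^4 \<Rightarrow> real^4^4" and \<theta> :: "real^4 \<Rightarrow> real^4" and \<epsilon> \<rho>1 CF C\<theta> :: real and \<Gamma> :: "(real^4^4) set"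
  assumes eps: "\<epsilon> > 0" and \<rho>1: "\<rho>1 \<ge> 1"
    and F: "Ck_on 2 F (- cball 0 \<rho>1)" and skewF: "\<And>x. x \<in> - cball 0 \<rho>1 \<Longrightarrow> skew (F x)"
    and closedF: "closed_form F (- cball 0 \<rho>1)"
    and CF: "CF \<ge> 0" "\<And>x v. norm x > \<rho>1 \<Longrightarrow> norm (frechet_derivative F (at x) v) \<le> CF * norm x powr (- 2 - \<epsilon>) * norm v"
    and F_small: "\<And>x. norm x > \<rho>1 \<Longrightarrow> norm (F x) \<le> 1 / 4"
    and \<theta>: "Ck_on 2 \<theta> (- cball 0 \<rho>1)" and prim: "primitive_of F \<theta> (- cball 0 \<rho>1)"
    and C\<theta>: "C\<theta> \<ge> 0" "\<And>x. norm x > \<rho>1 \<Longrightarrow> norm (\<theta> x) \<le> C\<theta> * norm x powr (- \<epsilon>)"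
      "\<And>x v. norm x > \<rho>1 \<Longrightarrow> norm (frechet_derivative \<theta> (at x) v) \<le> C\<theta> * norm x powr (- \<epsilon> - 1) * norm v"
    and \<theta>_small: "\<And>x. norm x > \<rho>1 \<Longrightarrow> 2 * norm (\<theta> x) \<le> exp (- 1)"
    and orth: "\<And>A. A \<in> \<Gamma> \<Longrightarrow> orthogonal_matrix A"
    and omega0_inv: "\<And>A x. A \<in> \<Gamma> \<Longrightarrow> omega0 *v (A *v x) = A *v (omega0 *v x)"
    and F_inv: "\<And>A x v. A \<in> \<Gamma> \<Longrightarrow> norm x > \<rho>1 \<Longrightarrow> F (A *v x) *v (A *v v) = A *v (F x *v v)"
    and \<theta>_inv: "\<And>A x. A \<in> \<Gamma> \<Longrightarrow> norm x > \<rho>1 \<Longrightarrow> \<theta> (A *v x) = A *v \<theta> x"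
begin

abbreviation "T \<equiv> {-1<..<2::real}"
abbreviation "S \<equiv> - cball (0::real^4) \<rho>1"
abbreviation "\<rho> \<equiv> \<rho>1 + 1"

definition W :: "real \<times> (real^4) \<Rightarrow> real^4^4" where "W z = omega0 + fst z *\<^sub>R F (snd z)"

definition V :: "real \<times> (real^4) \<Rightarrow> real^4" where
  "V z = - inverse (pfaffian (W z)) *\<^sub>R (hodge_dual (W z) *v \<theta> (snd z))"

text \<open>Cutting off \<open>V\<close> near the ball makes the field globally Lipschitz, so its flow exists up to time 1 and is
  the identity on a ball. The smallness of \<open>\<theta>\<close> confines the trajectories starting far out to the region
  where the cut-off is inactive.\<close>

definition X :: "real \<times> (real^4) \<Rightarrow> real^4" where
  "X z = (if norm (snd z) > \<rho>1 then annulus_cutoff \<rho> (snd z) *\<^sub>R V z else 0)"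

lemma opS: "open S" and opTS: "open (T \<times> S)"
  by (auto intro: open_compl_cball open_Times)

lemma W_bound: "t \<in> T \<Longrightarrow> norm x > \<rho>1 \<Longrightarrow> norm v \<le> 2 * norm (W (t, x) *v v)"
proof -
  assume "t \<in> T" "norm x > \<rho>1"
  then have "\<bar>t\<bar> * norm (F x) \<le> 2 * (1 / 4)" using F_small by (intro mult_mono) auto
  then show ?thesis unfolding W_def by (auto intro: perturbed_omega0_bound)
qed

lemma skewW: "norm x > \<rho>1 \<Longrightarrow> skew (W (t, x))"
  unfolding W_def by (auto intro!: skew_add skew_omega0 skew_scaleR skewF)

lemma pfaffian_W_nonzero: "t \<in> T \<Longrightarrow> norm x > \<rho>1 \<Longrightarrow> pfaffian (W (t, x)) \<noteq> 0"
  by (rule pfaffian_nonzero[OF skewW W_bound])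

lemma W_mult_V: "t \<in> T \<Longrightarrow> norm x > \<rho>1 \<Longrightarrow> W (t, x) *v V (t, x) = \<theta> x"
  using skew_hodge_dual[OF skewW, of x t "\<theta> x"] pfaffian_W_nonzero[of t x]
  by (simp add: V_def matrix_vector_mult_scaleR
      bounded_bilinear.minus_right[OF bounded_bilinear_matrix_vector])

lemma Ck_V: "Ck_on 2 V (T \<times> S)"
proof -
  have fs: "Ck_on 2 fst (T \<times> S)" "Ck_on 2 snd (T \<times> S)"
    by (intro Ck_on_linear opTS bounded_linear_fst bounded_linear_snd)+
  have c: "Ck_on 2 (\<lambda>z. F (snd z)) (T \<times> S)" "Ck_on 2 (\<lambda>z. \<theta> (snd z)) (T \<times> S)"
    by (intro Ck_on_compose[OF opTS opS F fs(2)] Ck_on_compose[OF opTS opS \<theta> fs(2)]; auto)+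
  have W: "Ck_on 2 W (T \<times> S)" unfolding W_def
    by (intro Ck_on_add Ck_on_const Ck_on_scaleR opTS c fs)
  show "Ck_on 2 V (T \<times> S)" unfolding V_def
    by (intro Ck_on_scaleR Ck_on_matrix_vector Ck_on_hodge_dual W c opTS
        Ck_on_linear_image[OF opTS bounded_linear_minus[OF bounded_linear_ident]] Ck_on_inverse Ck_on_pfaffian)
       (use pfaffian_W_nonzero in auto)
qed

lemma norm_V: "t \<in> T \<Longrightarrow> norm x > \<rho>1 \<Longrightarrow> norm (V (t, x)) \<le> 2 * norm (\<theta> x)"
  using W_bound[of t x "V (t, x)"] W_mult_V by simp

text \<open>Implicit differentiation of \<open>W V = \<theta>\<close>, which avoids the explicit
  formula for \<open>V\<close>. It serves twice: solved for the derivative of \<open>V\<close> it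
  yields the decay of that derivative, and it supplies the last two hypotheses of
  \<open>moser_cancellation\<close>.\<close>

lemma V_equation:
  assumes "t \<in> T" "norm x > \<rho>1"
  shows "t *\<^sub>R (frechet_derivative F (at x) a *v V (t, x)) + W (t, x) *v space_deriv V (t, x) a =
    frechet_derivative \<theta> (at x) a"
proof -
  have x: "x \<in> S" using assms by simp
  have DV: "((\<lambda>x. V (t, x)) has_derivative space_deriv V (t, x)) (at x)"
    by (rule has_derivative_space_deriv[OF Ck_on_1_has_derivative[OF Ck_on_mono[OF Ck_V]]])
       (use assms in auto)
  have DF: "(F has_derivative frechet_derivative F (at x)) (at x)"
    by (rule Ck_on_1_has_derivative[OF Ck_on_mono[OF F] x]) simp
  have D\<theta>: "(\<theta> has_derivative frechet_derivative \<theta> (at x)) (at x)"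
    by (rule Ck_on_1_has_derivative[OF Ck_on_mono[OF \<theta>] x]) simp
  have "((\<lambda>x. W (t, x)) has_derivative (\<lambda>a. t *\<^sub>R frechet_derivative F (at x) a)) (at x)"
    unfolding W_def using has_derivative_add[OF has_derivative_const has_derivative_scaleR_right[OF DF]] by simp
  from bounded_bilinear.FDERIV[OF bounded_bilinear_matrix_vector this DV]
  have "(\<theta> has_derivative (\<lambda>a. W (t, x) *v space_deriv V (t, x) a + (t *\<^sub>R frechet_derivative F (at x) a) *v V (t, x))) (at x)"
    by (rule has_derivative_transform_within_open[OF _ opS x]) (use assms W_mult_V in auto)
  from has_derivative_unique[OF this D\<theta>] show ?thesis
    by (metis (no_types, lifting) add.commute scaleR_matrix_vector_assoc)
qed

definition "C1 = 2 * (C\<theta> + 2 * CF)"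

lemma C1: "C1 \<ge> 0" using C\<theta> CF by (simp add: C1_def)

text \<open>The term with the derivative of \<open>F\<close> decays like |x|^(-2-\<epsilon>) times
  the bounded field \<open>V\<close>, so the rate is dictated by the derivative of \<theta>. In
  \<open>C1\<close> the outer 2 comes from \<open>W_bound\<close> and the inner 2 bounds the
  time.\<close>

lemma norm_DV:
  assumes "t \<in> T" "norm x > \<rho>1"
  shows "norm (space_deriv V (t, x) a) \<le> C1 * norm x powr (- 1 - \<epsilon>) * norm a"
proof -
  let ?D = "frechet_derivative \<theta> (at x) a" and ?E = "frechet_derivative F (at x) a"
  have x: "norm x > 1" using assms \<rho>1 by simp
  have "2 * norm (\<theta> x) \<le> 1" using \<theta>_small[OF assms(2)] by (smt (verit) exp_le_one_iff)
  then have V1: "norm (V (t, x)) \<le> 1" using norm_V[OF assms] by simp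
  have "norm (t *\<^sub>R (?E *v V (t, x))) \<le> 2 * (norm ?E * norm (V (t, x)))"
    using norm_matrix_vector_mult_le[of ?E "V (t, x)"] assms(1) by (auto intro!: mult_mono)
  also have "\<dots> \<le> 2 * (norm ?E * 1)" by (intro mult_left_mono V1) auto
  also have "\<dots> \<le> 2 * (CF * norm x powr (- 2 - \<epsilon>) * norm a)" using CF(2)[OF assms(2)] by simp
  also have "\<dots> \<le> 2 * (CF * norm x powr (- 1 - \<epsilon>) * norm a)"
    using x CF(1) by (intro mult_left_mono mult_right_mono powr_mono) auto
  finally have 1: "norm (t *\<^sub>R (?E *v V (t, x))) \<le> 2 * CF * norm x powr (- 1 - \<epsilon>) * norm a" by simp
  have 2: "norm ?D \<le> C\<theta> * norm x powr (- 1 - \<epsilon>) * norm a"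
    using C\<theta>(3)[OF assms(2), of a] by (simp add: minus_diff_commute)
  have "norm (W (t, x) *v space_deriv V (t, x) a) = norm (?D - t *\<^sub>R (?E *v V (t, x)))"
    by (simp flip: V_equation[OF assms])
  also have "\<dots> \<le> (C\<theta> + 2 * CF) * norm x powr (- 1 - \<epsilon>) * norm a"
    using norm_triangle_ineq4[of ?D "t *\<^sub>R (?E *v V (t, x))"] 1 2 by (simp add: algebra_simps)
  finally show ?thesis using W_bound[OF assms, of "space_deriv V (t, x) a"] by (simp add: C1_def algebra_simps)
qed

text \<open>The case distinction in \<open>X\<close> is harmless because the cut-off vanishes up to
  radius \<open>\<rho>1 + 1\<close>: the open sets \<open>norm x > \<rho>1\<close> and
  \<open>norm x < \<rho>\<close> cover the space, and \<open>X\<close> is smooth on each.\<close>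

lemma Ck_X: "Ck_on 2 X (T \<times> UNIV)"
proof (rule Ck_on_local)
  fix z :: "real \<times> (real^4)" assume z: "z \<in> T \<times> UNIV"
  have c: "Ck_on 2 (\<lambda>z::real \<times> (real^4). annulus_cutoff \<rho> (snd z)) (T \<times> S)"
    by (rule Ck_on_compose[OF opTS open_UNIV annulus_cutoff_Ck]) (auto intro: Ck_on_linear opTS bounded_linear_snd)
  have 1: "Ck_on 2 X (T \<times> S)"
    by (rule Ck_on_cong[OF opTS _ Ck_on_scaleR[OF opTS c Ck_V]]) (auto simp: X_def)
  have op: "open (T \<times> ball (0::real^4) \<rho>)" by (intro open_Times) auto
  have 2: "Ck_on 2 X (T \<times> ball 0 \<rho>)"
    by (rule Ck_on_cong[OF op _ Ck_on_const[of _ 0]]) (auto simp: X_def annulus_cutoff_0)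
  show "\<exists>U. open U \<and> z \<in> U \<and> Ck_on 2 X U"
  proof (cases "norm (snd z) > \<rho>1")
    case True then show ?thesis using 1 opTS z by (intro exI[of _ "T \<times> S"]) (auto simp: mem_Times_iff)
  next
    case False then show ?thesis using 2 op z by (intro exI[of _ "T \<times> ball 0 \<rho>"]) (auto simp: mem_Times_iff)
  qed
qed

lemma norm_X: "t \<in> T \<Longrightarrow> norm (X (t, x)) \<le> exp (- 1)"
  "t \<in> T \<Longrightarrow> norm x > \<rho>1 \<Longrightarrow> norm (X (t, x)) \<le> 2 * C\<theta> * norm x powr (- \<epsilon>)"
proof -
  have le: "norm (annulus_cutoff \<rho> x *\<^sub>R V (t, x)) \<le> 2 * norm (\<theta> x)" if "t \<in> T" "norm x > \<rho>1"
    using mult_mono[OF annulus_cutoff_bounds[of \<rho> x] norm_V[OF that]] by simp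
  then show "t \<in> T \<Longrightarrow> norm (X (t, x)) \<le> exp (- 1)"
    using \<theta>_small[of x] by (fastforce simp: X_def)
  show "t \<in> T \<Longrightarrow> norm x > \<rho>1 \<Longrightarrow> norm (X (t, x)) \<le> 2 * C\<theta> * norm x powr (- \<epsilon>)"
    using le C\<theta>(2)[of x] by (fastforce simp: X_def)
qed

lemma X_eq_V: "norm x > 2 * \<rho> \<Longrightarrow> X (t, x) = V (t, x)"
  using \<rho>1 annulus_cutoff_1[of \<rho> x] by (simp add: X_def)

lemma DX_eq_DV:
  assumes "t \<in> T" "norm x > 2 * \<rho>"
  shows "frechet_derivative X (at (t, x)) = frechet_derivative V (at (t, x))"
proof (rule frechet_derivative_cong[of "T \<times> - cball 0 (2 * \<rho>)"])
  show "open (T \<times> - cball (0::real^4) (2 * \<rho>))" by (intro open_Times open_compl_cball) auto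
qed (use assms X_eq_V in auto)

text \<open>Product rule: \<open>V\<close> and its derivative are bounded beyond radius
  \<open>\<rho>1 \<ge> 1\<close>, and the derivative of the cut-off is bounded everywhere. The
  result is the global Lipschitz constant of \<open>X\<close>.\<close>

lemma DX_bound:
  obtains L where "L \<ge> 0" "\<And>t x v. t \<in> T \<Longrightarrow> norm (space_deriv X (t, x) v) \<le> L * norm v"
proof -
  obtain K where K: "K \<ge> 0" "\<And>x v. \<bar>frechet_derivative (annulus_cutoff \<rho>) (at (x::real^4)) v\<bar> \<le> K * norm v"
    using annulus_cutoff_derivative_bound[of \<rho>] \<rho>1 by auto
  show ?thesis
  proof (rule that[of "K + C1"])
    fix t x and v :: "real^4" assume t: "t \<in> T"
    have D: "((\<lambda>x. X (t, x)) has_derivative space_deriv X (t, x)) (at x)"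
      by (rule has_derivative_space_deriv[OF Ck_on_1_has_derivative[OF Ck_on_mono[OF Ck_X]]]) (use t in auto)
    show "norm (space_deriv X (t, x) v) \<le> (K + C1) * norm v"
    proof (cases "norm x > \<rho>1")
      case True
      have DV: "((\<lambda>x. V (t, x)) has_derivative space_deriv V (t, x)) (at x)"
        by (rule has_derivative_space_deriv[OF Ck_on_1_has_derivative[OF Ck_on_mono[OF Ck_V]]])
           (use t True in auto)
      have Dc: "(annulus_cutoff \<rho> has_derivative frechet_derivative (annulus_cutoff \<rho>) (at x)) (at x)"
        by (rule Ck_on_1_has_derivative[OF Ck_on_mono[OF annulus_cutoff_Ck]]) auto
      have "((\<lambda>x. X (t, x)) has_derivative (\<lambda>v. annulus_cutoff \<rho> x *\<^sub>R space_deriv V (t, x) v +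
          frechet_derivative (annulus_cutoff \<rho>) (at x) v *\<^sub>R V (t, x))) (at x)"
        by (rule has_derivative_transform_within_open[OF has_derivative_scaleR[OF Dc DV] opS])
           (use True in \<open>auto simp: X_def\<close>)
      from has_derivative_unique[OF D this]
      have e: "space_deriv X (t, x) v = annulus_cutoff \<rho> x *\<^sub>R space_deriv V (t, x) v +
          frechet_derivative (annulus_cutoff \<rho>) (at x) v *\<^sub>R V (t, x)" by meson
      have "norm (annulus_cutoff \<rho> x *\<^sub>R space_deriv V (t, x) v) \<le> 1 * norm (space_deriv V (t, x) v)"
        using mult_right_mono[OF annulus_cutoff_bounds[of \<rho> x] norm_ge_zero[of "space_deriv V (t, x) v"]] by simp
      also have "\<dots> \<le> C1 * norm x powr (- 1 - \<epsilon>) * norm v" using norm_DV[OF t True] by simp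
      also have "\<dots> \<le> C1 * 1 * norm v"
        using powr_mono[of "- 1 - \<epsilon>" 0 "norm x"] \<rho>1 True eps C1
        by (intro mult_right_mono mult_left_mono) (auto split: if_splits)
      finally have 1: "norm (annulus_cutoff \<rho> x *\<^sub>R space_deriv V (t, x) v) \<le> C1 * norm v" by simp
      have "norm (V (t, x)) \<le> 1" using norm_V[OF t True] \<theta>_small[OF True] by (smt (verit) exp_le_one_iff)
      then have "norm (frechet_derivative (annulus_cutoff \<rho>) (at x) v *\<^sub>R V (t, x)) \<le> K * norm v * 1"
        using mult_mono[OF K(2)[of x v], of "norm (V (t, x))" 1] K(1) by simp
      with 1 show ?thesis unfolding e by (intro norm_triangle_le) (simp add: algebra_simps)
    next
      case False
      have "((\<lambda>x. X (t, x)) has_derivative (\<lambda>v. 0)) (at x)"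
        by (rule has_derivative_transform_within_open[OF has_derivative_const[of 0] open_ball[of 0 \<rho>]])
           (use False in \<open>auto simp: X_def annulus_cutoff_0\<close>)
      from has_derivative_unique[OF D this] have "space_deriv X (t, x) v = 0" by meson
      then show ?thesis using K C1 by simp
    qed
  qed (use K C1 in auto)
qed

lemma norm_orth: "A \<in> \<Gamma> \<Longrightarrow> norm (A *v x) = norm x"
  using orth orthogonal_transformation_matrix[of "(*v) A"] orthogonal_transformation_norm by fastforce

text \<open>Both \<open>A *v V (t, x)\<close> and \<open>V (t, A *v x)\<close> solve the linear
  system with matrix \<open>W (t, A *v x)\<close> and right-hand side
  \<open>\<theta> (A *v x)\<close>, and the solution is unique. The cut-off is radial.\<close>

lemma X_equivariant:
  assumes A: "A \<in> \<Gamma>" and t: "t \<in> T"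
  shows "X (t, A *v x) = A *v X (t, x)"
proof (cases "norm x > \<rho>1")
  case True
  then have Ax: "norm (A *v x) > \<rho>1" by (simp add: norm_orth A)
  have "W (t, A *v x) *v (A *v V (t, x)) = A *v (W (t, x) *v V (t, x))"
    unfolding W_def using omega0_inv[OF A] F_inv[OF A True]
    by (simp add: matrix_vector_mult_add_rdistrib matrix_vector_right_distrib scaleR_matrix_vector_assoc[symmetric]
        matrix_vector_mult_scaleR)
  also have "\<dots> = W (t, A *v x) *v V (t, A *v x)" using W_mult_V[OF t True] W_mult_V[OF t Ax] \<theta>_inv[OF A True] by simp
  finally have "W (t, A *v x) *v (A *v V (t, x) - V (t, A *v x)) = 0"
    by (simp add: matrix_vector_mult_diff_distrib)
  then have "A *v V (t, x) - V (t, A *v x) = 0"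
    using W_bound[OF t Ax, of "A *v V (t, x) - V (t, A *v x)"] by simp
  moreover have "annulus_cutoff \<rho> (A *v x) = annulus_cutoff \<rho> x"
    unfolding annulus_cutoff_def by (metis norm_orth[OF A] power2_norm_eq_inner)
  ultimately show ?thesis using True Ax by (simp add: X_def matrix_vector_mult_scaleR)
qed (auto simp: X_def norm_orth A)

text \<open>On trajectories that stay where \<open>X = V\<close>, the value of \<open>W\<close> on
  two transported tangent vectors is constant in time; comparing times 0 and 1 gives the pullback
  identity. Both decay estimates integrate bounds on the field along such trajectories. Equivariance
  and the fixed ball follow from uniqueness of solutions.\<close>

theorem moser_diffeo:
  obtains \<phi> \<psi> r C where "r > \<rho>1" "Ck_on 2 \<phi> UNIV" "Ck_on 2 \<psi> UNIV" "\<And>x. \<psi> (\<phi> x) = x" "\<And>x. \<phi> (\<psi> x) = x"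
    and "\<And>x. norm x \<le> \<rho>1 \<Longrightarrow> \<phi> x = x"
    and "\<And>A x. A \<in> \<Gamma> \<Longrightarrow> \<phi> (A *v x) = A *v \<phi> x"
    and "\<And>x a b. norm x > r \<Longrightarrow> frechet_derivative \<phi> (at x) a \<bullet> ((omega0 + F (\<phi> x)) *v frechet_derivative \<phi> (at x) b) = a \<bullet> (omega0 *v b)"
    and "\<And>x. norm x > r \<Longrightarrow> norm (\<phi> x - x) \<le> C * norm x powr (- \<epsilon>)"
    and "\<And>x v. norm x > r \<Longrightarrow> norm (frechet_derivative \<phi> (at x) v - v) \<le> C * norm x powr (- 1 - \<epsilon>) * norm v"
proof -
  obtain L where L: "L \<ge> 0" "\<And>t x v. t \<in> T \<Longrightarrow> norm (space_deriv X (t, x) v) \<le> L * norm v"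
    by (rule DX_bound) blast
  have T: "open T" "{0..1} \<subseteq> T" by auto
  have lip: "norm (X (t, x) - X (t, y)) \<le> L * norm (x - y)" if "t \<in> {0..1}" for t x y
  proof (rule differentiable_bound[of UNIV])
    show "((\<lambda>x. X (t, x)) has_derivative space_deriv X (t, x)) (at x within UNIV)" for x
      using has_derivative_space_deriv[OF Ck_on_1_has_derivative[OF Ck_on_mono[OF Ck_X]], of t x] that by auto
    show "onorm (space_deriv X (t, x)) \<le> L" for x using L that by (intro onorm_bound) auto
  qed auto
  obtain \<phi> \<psi> where flow: "C1_flow X T \<phi>" and \<phi>: "Ck_on 2 (\<phi> 1) UNIV" "Ck_on 2 \<psi> UNIV"
    "\<And>x. \<psi> (\<phi> 1 x) = x" "\<And>x. \<phi> 1 (\<psi> x) = x"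
    using C2_flow_exists[OF T Ck_X lip L(1)] by blast
  interpret C1_flow X T \<phi> by (rule flow)
  \<comment> \<open>Displacements are at most 1, so trajectories starting beyond
    \<open>2 * \<rho> + 1\<close> stay beyond \<open>2 * \<rho>\<close>, where the cut-off equals
    1.\<close>
  define r where "r = 2 * \<rho> + 1"
  have T': "t \<in> T" if "t \<in> {0..1}" for t using that by auto
  \<comment> \<open>Gronwall with rate 0: the velocity bound \<open>b\<close> alone controls the
    displacement. The derivative of the flow is treated in the same way below.\<close>
  have near: "norm (\<phi> t x - x) \<le> b * exp 1"
    if "t \<in> {0..1}" "b \<ge> 0" "\<And>s. s \<in> {0..1} \<Longrightarrow> norm (X (s, \<phi> s x)) \<le> b" for t x b
  proof -
    have "norm (\<phi> t x - x) \<le> (norm (\<phi> 0 x - x) + b) * exp (0 + 1)"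
    proof (rule gronwall_norm_within[where u'="\<lambda>t. X (t, \<phi> t x) - 0"])
      show "((\<lambda>t. \<phi> t x - x) has_vector_derivative X (s, \<phi> s x) - 0) (at s within {0..1})" if "s \<in> {0..1}" for s
        using sol[of x] that unfolding is_solution_def by (intro has_vector_derivative_diff) auto
    qed (use that in auto)
    then show ?thesis by (simp add: \<phi>0)
  qed
  have disp: "norm (\<phi> t x - x) \<le> 1" if "t \<in> {0..1}" for t x
    using near[OF that, of "exp (- 1)" x] norm_X(1)[OF T'] by (simp flip: exp_add)
  have far: "norm (\<phi> t x) > 2 * \<rho>" "norm (\<phi> t x) \<ge> norm x / 2" if "norm x > r" "t \<in> {0..1}" for t x
  proof -
    have "norm x \<le> norm (\<phi> t x) + norm (\<phi> t x - x)"
      by (metis norm_minus_commute norm_triangle_sub add.commute)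
    then show "norm (\<phi> t x) > 2 * \<rho>" "norm (\<phi> t x) \<ge> norm x / 2" using disp[OF that(2), of x] that \<rho>1 by (auto simp: r_def)
  qed
  have farS: "norm (\<phi> t x) > \<rho>1" if "norm x > r" "t \<in> {0..1}" for t x
    using far(1)[OF that] \<rho>1 by simp
  \<comment> \<open>Trajectories keep at least half of their initial norm, so decay in the moving
    point becomes decay in the initial point, at the price of a power of 2.\<close>
  have pw: "norm (\<phi> t x) powr (- p) \<le> 2 powr p * norm x powr (- p)"
    if "norm x > r" "t \<in> {0..1}" "p \<ge> 0" for p t x
  proof -
    have "norm x > 0" using that \<rho>1 by (auto simp: r_def)
    then have "norm (\<phi> t x) powr (- p) \<le> (norm x / 2) powr (- p)"
      using far(2)[OF that(1,2)] that by (intro powr_mono2') auto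
    also have "\<dots> = 2 powr p * norm x powr (- p)"
      using \<open>norm x > 0\<close> by (simp add: powr_divide powr_minus field_simps)
    finally show ?thesis .
  qed
  have D: "frechet_derivative (\<phi> 1) (at x) = tangent 1 x" for x
    by (rule frechet_derivative_eqI[OF has_derivative_flow]) simp
  \<comment> \<open>A crude bound from the global constant \<open>L\<close>; it affects the constant
    \<open>Cb\<close> and not the rate.\<close>
  have tb: "norm (tangent t x v) \<le> exp (L + 1) * norm v" if "t \<in> {0..1}" for t x v
  proof -
    have "norm (tangent t x v) \<le> (norm (tangent 0 x v) + 0) * exp (L + 1)"
      by (rule gronwall_norm_within[OF tangent(2)]) (use that L T' in auto)
    then show ?thesis by (simp add: tangent(1) mult.commute)
  qed
  define Ca where "Ca = 2 * C\<theta> * 2 powr \<epsilon> * exp 1"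
  define Cb where "Cb = C1 * 2 powr (1 + \<epsilon>) * exp (L + 1) * exp 1"
  have Cab: "Ca \<ge> 0" "Cb \<ge> 0" using C\<theta> C1 by (auto simp: Ca_def Cb_def)
  show ?thesis
  proof (rule that[of r "\<phi> 1" \<psi> "max Ca Cb"])
    show "r > \<rho>1" using \<rho>1 by (simp add: r_def)
    show "\<phi> 1 x = x" if "norm x \<le> \<rho>1" for x
    proof (rule solution_unique[OF lip L(1) sol, of "\<lambda>t. x" x])
      show "is_solution X (\<lambda>t. x)" using that by (auto simp: is_solution_def X_def)
    qed (simp_all add: \<phi>0)
    show "\<phi> 1 (A *v x) = A *v \<phi> 1 x" if A: "A \<in> \<Gamma>" for A x
    proof (rule solution_unique[OF lip L(1) sol, of "\<lambda>t. A *v \<phi> t x"])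
      show "is_solution X (\<lambda>t. A *v \<phi> t x)"
        unfolding is_solution_def
      proof
        fix t :: real assume t: "t \<in> {0..1}"
        have "((\<lambda>t. A *v \<phi> t x) has_vector_derivative A *v X (t, \<phi> t x)) (at t within {0..1})"
          using sol[of x] t unfolding is_solution_def
          by (intro bounded_linear.has_vector_derivative[OF matrix_vector_mul_bounded_linear]) auto
        then show "((\<lambda>t. A *v \<phi> t x) has_vector_derivative X (t, A *v \<phi> t x)) (at t within {0..1})"
          using X_equivariant[OF A T'[OF t]] by simp
      qed
    qed (simp_all add: \<phi>0)
    show "norm (\<phi> 1 x - x) \<le> max Ca Cb * norm x powr (- \<epsilon>)" if x: "norm x > r" for x
    proof -
      have "norm (\<phi> 1 x - x) \<le> (2 * C\<theta> * (2 powr \<epsilon> * norm x powr (- \<epsilon>))) * exp 1"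
      proof (rule near)
        fix s :: real assume s: "s \<in> {0..1}"
        have "norm (X (s, \<phi> s x)) \<le> 2 * C\<theta> * norm (\<phi> s x) powr (- \<epsilon>)"
          by (rule norm_X(2)[OF T'[OF s] farS[OF x s]])
        also have "\<dots> \<le> 2 * C\<theta> * (2 powr \<epsilon> * norm x powr (- \<epsilon>))"
          using C\<theta> eps by (intro mult_left_mono pw x s) auto
        finally show "norm (X (s, \<phi> s x)) \<le> 2 * C\<theta> * (2 powr \<epsilon> * norm x powr (- \<epsilon>))" .
      qed (use C\<theta> in auto)
      also have "\<dots> = Ca * norm x powr (- \<epsilon>)" by (simp add: Ca_def)
      also have "\<dots> \<le> max Ca Cb * norm x powr (- \<epsilon>)" by (intro mult_right_mono) auto
      finally show ?thesis .
    qed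
    have DX: "space_deriv X (s, \<phi> s x) w = space_deriv V (s, \<phi> s x) w" if "norm x > r" "s \<in> {0..1}" for s x w
      using DX_eq_DV[OF T'[OF that(2)] far(1)[OF that]] by simp
    show "norm (frechet_derivative (\<phi> 1) (at x) v - v) \<le> max Ca Cb * norm x powr (- 1 - \<epsilon>) * norm v"
      if x: "norm x > r" for x v
    proof -
      let ?b = "C1 * (2 powr (1 + \<epsilon>) * norm x powr (- 1 - \<epsilon>)) * (exp (L + 1) * norm v)"
      have "norm (tangent 1 x v - v) \<le> (norm (tangent 0 x v - v) + ?b) * exp (0 + 1)"
      proof (rule gronwall_norm_within[where u'="\<lambda>t. space_deriv X (t, \<phi> t x) (tangent t x v) - 0"])
        fix s :: real assume s: "s \<in> {0..1}"
        show "((\<lambda>t. tangent t x v - v) has_vector_derivative space_deriv X (s, \<phi> s x) (tangent s x v) - 0) (at s within {0..1})"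
          by (intro has_vector_derivative_diff tangent s) auto
        have "norm (space_deriv X (s, \<phi> s x) (tangent s x v)) \<le> C1 * norm (\<phi> s x) powr (- 1 - \<epsilon>) * norm (tangent s x v)"
          unfolding DX[OF x s] by (rule norm_DV[OF T'[OF s] farS[OF x s]])
        also have "\<dots> \<le> ?b"
          using pw[OF x s, of "1 + \<epsilon>"] eps C1 tb[OF s] by (intro mult_mono mult_left_mono) auto
        finally show "norm (space_deriv X (s, \<phi> s x) (tangent s x v) - 0) \<le> ?b + 0 * norm (tangent s x v - v)" by simp
      qed (use C1 in auto)
      also have "\<dots> = Cb * norm x powr (- 1 - \<epsilon>) * norm v" by (simp add: Cb_def tangent(1))
      also have "\<dots> \<le> max Ca Cb * norm x powr (- 1 - \<epsilon>) * norm v" by (intro mult_right_mono) auto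
      finally show ?thesis unfolding D .
    qed
    fix x a b :: "real^4" assume x: "norm x > r"
    \<comment> \<open>The form at time \<open>t\<close> evaluated on the two tangent vectors carried
      along by the flow.\<close>
    define h where "h t = tangent t x a \<bullet> (W (t, \<phi> t x) *v tangent t x b)" for t
    have "(h has_vector_derivative 0) (at t within {0..1})" if t: "t \<in> {0..1}" for t
    proof -
      let ?y = "\<phi> t x" and ?a = "tangent t x a" and ?b = "tangent t x b"
      let ?v = "V (t, ?y)"
      have yS: "norm ?y > \<rho>1" by (rule farS[OF x t])
      then have y: "?y \<in> S" by simp
      have Xv: "X (t, ?y) = ?v" by (rule X_eq_V[OF far(1)[OF x t]])
      have DF: "(F has_derivative frechet_derivative F (at ?y)) (at ?y)"
        by (rule Ck_on_1_has_derivative[OF Ck_on_mono[OF F] y]) simp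
      have d\<phi>: "((\<lambda>t. \<phi> t x) has_vector_derivative ?v) (at t within {0..1})"
        using sol[of x, unfolded is_solution_def, rule_format, OF t] unfolding Xv .
      have dF: "((\<lambda>t. F (\<phi> t x)) has_vector_derivative frechet_derivative F (at ?y) ?v) (at t within {0..1})"
        using vector_derivative_diff_chain_within[OF d\<phi> has_derivative_at_withinI[OF DF]] by (simp add: o_def)
      have dW: "((\<lambda>t. W (t, \<phi> t x)) has_vector_derivative
          (F ?y + t *\<^sub>R frechet_derivative F (at ?y) ?v)) (at t within {0..1})"
        unfolding W_def using has_vector_derivative_add[OF has_vector_derivative_const
            has_vector_derivative_scaleR[OF DERIV_ident dF]] by (simp add: add.commute)
      have dt: "((\<lambda>t. tangent t x c) has_vector_derivative space_deriv V (t, ?y) (tangent t x c)) (at t within {0..1})" for c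
        using tangent(2)[OF t, of x c] unfolding DX[OF x t] .
      have "(h has_vector_derivative ?a \<bullet> (W (t, ?y) *v space_deriv V (t, ?y) ?b + (F ?y + t *\<^sub>R frechet_derivative F (at ?y) ?v) *v ?b)
          + space_deriv V (t, ?y) ?a \<bullet> (W (t, ?y) *v ?b)) (at t within {0..1})"
        unfolding h_def
        by (intro bounded_bilinear.has_vector_derivative[OF bounded_bilinear_inner]
            bounded_bilinear.has_vector_derivative[OF bounded_bilinear_matrix_vector] dt dW)
      moreover have "?a \<bullet> (W (t, ?y) *v space_deriv V (t, ?y) ?b + (F ?y + t *\<^sub>R frechet_derivative F (at ?y) ?v) *v ?b)
          + space_deriv V (t, ?y) ?a \<bullet> (W (t, ?y) *v ?b) = 0"
      proof -
        have "space_deriv V (t, ?y) ?a \<bullet> (W (t, ?y) *v ?b) + ?a \<bullet> (F ?y *v ?b) +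
            t * (?a \<bullet> (frechet_derivative F (at ?y) ?v *v ?b)) + ?a \<bullet> (W (t, ?y) *v space_deriv V (t, ?y) ?b) = 0"
        proof (rule moser_cancellation[OF skewW[OF yS]])
          show "skew (frechet_derivative F (at ?y) ?b)"
            by (rule skew_frechet_derivative[OF opS y _ skewF]) (use DF in \<open>auto simp: differentiable_def\<close>)
          show "?b \<bullet> (frechet_derivative F (at ?y) ?a *v ?v) + ?v \<bullet> (frechet_derivative F (at ?y) ?b *v ?a) +
            ?a \<bullet> (frechet_derivative F (at ?y) ?v *v ?b) = 0"
            using closedF y by (simp add: closed_form_def)
          show "frechet_derivative \<theta> (at ?y) ?a \<bullet> ?b - frechet_derivative \<theta> (at ?y) ?b \<bullet> ?a = ?a \<bullet> (F ?y *v ?b)"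
            using prim y by (simp add: primitive_of_def)
        qed (rule V_equation[OF T'[OF t] yS])+
        then show ?thesis
          by (simp add: inner_add_right matrix_vector_mult_add_rdistrib scaleR_matrix_vector_assoc[symmetric] algebra_simps)
      qed
      ultimately show ?thesis by simp
    qed
    then have "\<exists>c. \<forall>t\<in>{0..1}. h t = c"
      by (rule has_vector_derivative_zero_constant[of "{0..1}" h, rotated 1]) auto
    then have "h 1 = h 0" by force
    then show "frechet_derivative (\<phi> 1) (at x) a \<bullet> ((omega0 + F (\<phi> 1 x)) *v frechet_derivative (\<phi> 1) (at x) b) = a \<bullet> (omega0 *v b)"
      by (simp add: h_def D W_def \<phi>0 tangent(1))
  qed (rule \<phi>)+
qed

end

section \<open>Primitives by integration along rays\<close>

text \<open>Only directions close to \<open>- e\<close> are left out. The cones of \<open>e\<close>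
  and \<open>- e\<close> together cover the exterior of the ball and overlap in a wide band, while
  within one cone the ray in direction \<open>e\<close> cannot come back towards the origin.\<close>

definition ray_cone :: "'a::euclidean_space \<Rightarrow> real \<Rightarrow> 'a set" where
  "ray_cone e R = {x. norm x > R \<and> x \<bullet> e > - (4 / 5) * norm x}"

lemma open_ray_cone: "open (ray_cone e R)"
proof -
  have "ray_cone e R = {x. R < norm x} \<inter> {x. - (4 / 5) * norm x < x \<bullet> e}" by (auto simp: ray_cone_def)
  then show ?thesis by (simp add: open_Int open_Collect_less continuous_intros)
qed

text \<open>The cone condition bounds the cross term of the squared norm from below by
  \<open>- (8 / 5) * t * norm x\<close>, and the inequality between arithmetic and geometric mean
  does the rest. Any factor up to the square root of 1/10 would be possible; 1/4 is a round
  choice.\<close>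

lemma cone_ray:
  assumes "norm e = 1" "x \<in> ray_cone e R" "t \<ge> 0"
  shows "norm (x + t *\<^sub>R e) \<ge> (norm x + t) / 4"
proof (rule power2_le_imp_le)
  have "t * (- (4 / 5) * norm x) \<le> t * (x \<bullet> e)"
    using assms by (intro mult_left_mono) (auto simp: ray_cone_def)
  moreover have "(norm (x + t *\<^sub>R e))\<^sup>2 = (norm x)\<^sup>2 + 2 * (t * (x \<bullet> e)) + t\<^sup>2"
    using assms(1) by (simp add: power2_norm_eq_inner inner_add_left inner_add_right inner_commute norm_eq_1)
      (simp add: power2_eq_square norm_eq_1)
  moreover have "((norm x + t) / 4)\<^sup>2 = ((norm x)\<^sup>2 + 2 * (t * norm x) + t\<^sup>2) / 16"
    by (simp add: power_divide power2_sum)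
  moreover have "2 * (t * norm x) \<le> (norm x)\<^sup>2 + t\<^sup>2"
    using sum_squares_bound[of "norm x" t] by (simp add: mult_ac)
  moreover have "0 \<le> t * norm x" using assms by simp
  moreover have "t * (- (4 / 5) * norm x) = - (4 / 5) * (t * norm x)" by simp
  moreover have "(p + 2 * c + q) / 16 \<le> p + 2 * d + q"
    if "- (4 / 5) * c \<le> d" "2 * c \<le> p + q" "0 \<le> c" for p q c d :: real
    using that by (simp add: field_simps)
  ultimately show "((norm x + t) / 4)\<^sup>2 \<le> (norm (x + t *\<^sub>R e))\<^sup>2" by metis
qed simp

text \<open>The factor 1/4 of \<open>cone_ray\<close> is the reason why the cones start at radius
  \<open>4 * r\<close>.\<close>

lemma cone_ray_outside:
  assumes "norm e = 1" "x \<in> ray_cone e (4 * r)" "t \<ge> 0" "r \<ge> 0"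
  shows "norm (x + t *\<^sub>R e) > r"
  using cone_ray[OF assms(1-3)] assms by (auto simp: ray_cone_def)

text \<open>An improper integral, taken as a limit over integer upper bounds so that theorems on
  sequences of functions apply. It carries information only where the limit exists, see
  \<open>ray_tendsto\<close>.\<close>

definition ray_integral :: "('a::euclidean_space \<Rightarrow> 'b::euclidean_space) \<Rightarrow> 'a \<Rightarrow> 'a \<Rightarrow> 'b" where
  "ray_integral h e x = lim (\<lambda>n. integral {0..real n} (\<lambda>t. h (x + t *\<^sub>R e)))"

context
  fixes h :: "'a::euclidean_space \<Rightarrow> 'b::euclidean_space" and e :: 'a and C p r :: real
  assumes e: "norm e = 1" and r: "r \<ge> 1" and p: "p > 0" and C: "C \<ge> 0"
    and cont: "continuous_on (- cball 0 r) h"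
    and bound: "\<And>x. norm x > r \<Longrightarrow> norm (h x) \<le> C * norm x powr (- 1 - p)"
begin

private abbreviation "I n x \<equiv> integral {0..real n} (\<lambda>t. h (x + t *\<^sub>R e))"
private abbreviation "K \<equiv> C * 4 powr (1 + p) / p"

lemma ray_continuous:
  assumes "x \<in> ray_cone e (4 * r)" "a \<ge> 0"
  shows "continuous_on {a..b} (\<lambda>t. h (x + t *\<^sub>R e))"
proof (rule continuous_on_compose2[OF cont])
  show "(\<lambda>t. x + t *\<^sub>R e) ` {a..b} \<subseteq> - cball 0 r"
  proof clarify
    fix t assume "t \<in> {a..b}" "x + t *\<^sub>R e \<in> cball 0 r"
    then show False using cone_ray_outside[OF e assms(1), of t] assms(2) r by simp
  qed
qed (intro continuous_intros)

text \<open>By \<open>cone_ray\<close> the integrand is at most a constant times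
  \<open>(norm x + t) powr (- 1 - p)\<close>, which has an explicit antiderivative; this is the
  origin of \<open>K\<close>. As the bound does not depend on \<open>n\<close>, letting
  \<open>n\<close> grow gives decay of the integral for \<open>m = 0\<close> and uniform convergence
  for large \<open>m\<close>.\<close>

lemma ray_increment:
  assumes x: "x \<in> ray_cone e (4 * r)" and mn: "m \<le> n"
  shows "norm (I n x - I m x) \<le> K * (norm x + real m) powr (- p)"
proof -
  have x0: "norm x > 0" using x r by (auto simp: ray_cone_def)
  have pos: "norm x + t > 0" if "t \<in> {real m..real n}" for t
    using that x0 by (intro add_pos_nonneg) auto
  have int: "(\<lambda>t. h (x + t *\<^sub>R e)) integrable_on {a..b}" if "a \<ge> 0" for a b
    by (intro integrable_continuous_real ray_continuous x that)
  have "I m x + integral {real m..real n} (\<lambda>t. h (x + t *\<^sub>R e)) = I n x"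
    using mn by (intro Henstock_Kurzweil_Integration.integral_combine int) auto
  then have "norm (I n x - I m x) = norm (integral {real m..real n} (\<lambda>t. h (x + t *\<^sub>R e)))"
    by (metis add_diff_cancel_left')
  also have "\<dots> \<le> integral {real m..real n} (\<lambda>t. C * 4 powr (1 + p) * (norm x + t) powr (- 1 - p))"
  proof (rule integral_norm_bound_integral)
    show "(\<lambda>t. C * 4 powr (1 + p) * (norm x + t) powr (- 1 - p)) integrable_on {real m..real n}"
      using pos by (intro integrable_continuous_real continuous_intros) force
    fix t assume t: "t \<in> {real m..real n}"
    have "norm (h (x + t *\<^sub>R e)) \<le> C * norm (x + t *\<^sub>R e) powr (- 1 - p)"
      using cone_ray_outside[OF e x] t r by (intro bound) auto
    also have "\<dots> \<le> C * ((norm x + t) / 4) powr (- 1 - p)"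
      using cone_ray[OF e x, of t] t x0 p C by (intro mult_left_mono powr_mono2') (auto simp: add_pos_nonneg)
    also have "\<dots> = C * 4 powr (1 + p) * (norm x + t) powr (- 1 - p)"
      using t x0 by (simp add: powr_divide powr_minus powr_diff powr_add field_simps)
    finally show "norm (h (x + t *\<^sub>R e)) \<le> C * 4 powr (1 + p) * (norm x + t) powr (- 1 - p)" .
  qed (intro int, simp)
  also have "\<dots> = C * 4 powr (1 + p) * integral {real m..real n} (\<lambda>t. (norm x + t) powr (- 1 - p))"
    by simp
  also have "integral {real m..real n} (\<lambda>t. (norm x + t) powr (- 1 - p)) =
      - ((norm x + real n) powr (- p) / p) - (- ((norm x + real m) powr (- p) / p))"
  proof (intro integral_unique fundamental_theorem_of_calculus)
    fix t assume t: "t \<in> {real m..real n}"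
    note pos = pos[OF t]
    have "((\<lambda>t. norm x + t) has_real_derivative 1) (at t)" by (auto intro!: derivative_eq_intros)
    from DERIV_minus[OF DERIV_cdivide[OF DERIV_chain2[OF has_real_derivative_powr[OF pos] this]], of "- p" p]
    have "((\<lambda>t. - ((norm x + t) powr (- p) / p)) has_real_derivative (norm x + t) powr (- 1 - p)) (at t)"
      using p by (simp add: minus_diff_commute)
    then have "((\<lambda>t. - ((norm x + t) powr (- p) / p)) has_real_derivative (norm x + t) powr (- 1 - p)) (at t within {real m..real n})"
      by (rule has_field_derivative_at_within)
    then show "((\<lambda>t. - ((norm x + t) powr (- p) / p)) has_vector_derivative (norm x + t) powr (- 1 - p)) (at t within {real m..real n})"
      by (simp add: has_real_derivative_iff_has_vector_derivative)
  qed (use mn in auto)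
  also have "C * 4 powr (1 + p) * (- ((norm x + real n) powr (- p) / p) - (- ((norm x + real m) powr (- p) / p))) \<le>
      C * 4 powr (1 + p) * ((norm x + real m) powr (- p) / p)"
    using C p by (intro mult_left_mono) auto
  finally show ?thesis by simp
qed

lemma ray_tendsto: "x \<in> ray_cone e (4 * r) \<Longrightarrow> (\<lambda>n. I n x) \<longlonglongrightarrow> ray_integral h e x"
proof -
  assume x: "x \<in> ray_cone e (4 * r)"
  then have x0: "norm x > 0" using r by (auto simp: ray_cone_def)
  have "Cauchy (\<lambda>n. I n x)"
  proof (rule metric_CauchyI)
    fix \<eta> :: real assume \<eta>: "\<eta> > 0"
    obtain R where R: "\<And>y. y \<ge> R \<Longrightarrow> K * y powr (- p) \<le> \<eta> / 2" using powr_small[OF p, of "\<eta> / 2" K] \<eta> by auto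
    obtain N :: nat where N: "real N \<ge> R" using real_arch_simple by blast
    have *: "dist (I m x) (I n x) < \<eta>" if "m \<ge> N" "m \<le> n" for m n
    proof -
      have "norm x + real m \<ge> R" using that N norm_ge_zero[of x] by linarith
      from order_trans[OF ray_increment[OF x that(2)] R[OF this]] show ?thesis
        using \<eta> by (simp add: dist_norm norm_minus_commute)
    qed
    then have "dist (I m x) (I n x) < \<eta>" if "m \<ge> N" "n \<ge> N" for m n
      using that by (metis dist_commute nle_le)
    then show "\<exists>M. \<forall>m\<ge>M. \<forall>n\<ge>M. dist (I m x) (I n x) < \<eta>" by blast
  qed
  then show ?thesis unfolding ray_integral_def
    by (simp add: convergent_LIMSEQ_iff[symmetric] Cauchy_convergent_iff)
qed

lemma ray_error:
  assumes x: "x \<in> ray_cone e (4 * r)"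
  shows "norm (I m x - ray_integral h e x) \<le> K * (norm x + real m) powr (- p)"
proof -
  have "(\<lambda>n. norm (I n x - I m x)) \<longlonglongrightarrow> norm (ray_integral h e x - I m x)"
    by (intro tendsto_intros ray_tendsto x)
  then have "norm (ray_integral h e x - I m x) \<le> K * (norm x + real m) powr (- p)"
    by (rule LIMSEQ_le_const2) (use ray_increment[OF x] in blast)
  then show ?thesis by (simp add: norm_minus_commute)
qed

lemma ray_bound: "x \<in> ray_cone e (4 * r) \<Longrightarrow> norm (ray_integral h e x) \<le> K * norm x powr (- p)"
  using ray_error[of x 0] by simp

lemma ray_uniform:
  assumes x: "x \<in> ray_cone e (4 * r)" and "m > 0"
  shows "norm (I m x - ray_integral h e x) \<le> K * real m powr (- p)"
proof -
  have "K * (norm x + real m) powr (- p) \<le> K * real m powr (- p)"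
    using C p assms(2) by (intro mult_left_mono powr_mono2') auto
  with ray_error[OF x, of m] show ?thesis by simp
qed

lemma continuous_on_ray_integral: "continuous_on (ray_cone e (4 * r)) (ray_integral h e)"
proof (rule uniform_limit_theorem)
  have "Ck_on 0 (\<lambda>x. integral {0..real n} (\<lambda>s. 1 *\<^sub>R h (x + s *\<^sub>R e))) (ray_cone e (4 * r))" for n
    by (rule Ck_on_line_integral[OF open_ray_cone open_compl_cball[of r]])
       (use cont cone_ray_outside[OF e] r in \<open>auto simp: not_le\<close>)
  then show "\<forall>\<^sub>F n in sequentially. continuous_on (ray_cone e (4 * r)) (I n)" by simp
  show "uniform_limit (ray_cone e (4 * r)) I (ray_integral h e) sequentially"
    unfolding uniform_limit_iff
  proof (intro allI impI)
    fix \<eta> :: real assume \<eta>: "\<eta> > 0"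
    obtain R where R: "\<And>y. y \<ge> R \<Longrightarrow> K * y powr (- p) \<le> \<eta> / 2" using powr_small[OF p, of "\<eta> / 2" K] \<eta> by auto
    obtain N :: nat where N: "real N \<ge> R" using real_arch_simple by blast
    show "\<forall>\<^sub>F n in sequentially. \<forall>x\<in>ray_cone e (4 * r). dist (I n x) (ray_integral h e x) < \<eta>"
      unfolding eventually_sequentially
    proof (intro exI[of _ "max N 1"] allI impI ballI)
      fix n x assume n: "max N 1 \<le> n" and x: "x \<in> ray_cone e (4 * r)"
      show "dist (I n x) (ray_integral h e x) < \<eta>"
      proof -
        have "real n \<ge> R" "n > 0" using n N by auto
        from order_trans[OF ray_uniform[OF x this(2)] R[OF this(1)]] show ?thesis
          using \<eta> by (simp add: dist_norm)
      qed
    qed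
  qed
qed auto

end

text \<open>The derivative of \<open>g\<close> decays one order faster than \<open>g\<close>, so the
  preceding estimates apply to it with exponent \<open>1 + \<epsilon>\<close> in place of
  \<epsilon>. Its ray integrals converge uniformly, which justifies differentiation of the limit and
  makes the derivative one order smaller.\<close>

lemma
  fixes g :: "'a::euclidean_space \<Rightarrow> 'b::euclidean_space"
  assumes e: "norm e = 1" and r: "r \<ge> 1" and p: "\<epsilon> > 0" and g: "symb (1 + \<epsilon>) g (- cball 0 r)"
  shows has_derivative_ray_integral: "\<And>x. x \<in> ray_cone e (4 * r) \<Longrightarrow>
      (ray_integral g e has_derivative (\<lambda>v. ray_integral (\<lambda>y. frechet_derivative g (at y) v) e x)) (at x)"
    and symb_ray_integral: "symb \<epsilon> (ray_integral g e) (ray_cone e (4 * r))"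
    and ray_tendsto_deriv: "\<And>x v. x \<in> ray_cone e (4 * r) \<Longrightarrow>
      (\<lambda>n. integral {0..real n} (\<lambda>t. frechet_derivative g (at (x + t *\<^sub>R e)) v)) \<longlonglongrightarrow>
      ray_integral (\<lambda>y. frechet_derivative g (at y) v) e x"
    and tendsto_zero_along_ray: "\<And>x. x \<in> ray_cone e (4 * r) \<Longrightarrow> (\<lambda>n. g (x + real n *\<^sub>R e)) \<longlonglongrightarrow> 0"
proof -
  obtain C where C: "C \<ge> 0" "\<And>x. x \<in> - cball 0 r \<Longrightarrow> norm (g x) \<le> C * norm x powr (- (1 + \<epsilon>))"
    "\<And>x v. x \<in> - cball 0 r \<Longrightarrow> norm (frechet_derivative g (at x) v) \<le> C * norm x powr (- (1 + \<epsilon>) - 1) * norm v"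
    by (rule symbE[OF g]) blast
  have ck: "Ck_on 1 g (- cball 0 r)" by (rule symb_Ck[OF g])
  have gc: "continuous_on (- cball 0 r) g" by (rule Ck_on_imp_continuous_on[OF ck])
  have Dc: "continuous_on (- cball 0 r) (\<lambda>y. frechet_derivative g (at y) v)" for v
    using continuous_on_frechet[OF open_compl_cball, of 0 g] ck by simp
  have gb: "norm (g x) \<le> C * norm x powr (- 1 - \<epsilon>)" if "norm x > r" for x
    using C(2)[of x] that by simp
  have Db: "norm (frechet_derivative g (at x) v) \<le> (C * norm v) * norm x powr (- 1 - (1 + \<epsilon>))" if "norm x > r" for x v
    using C(3)[of x v] that by (simp add: mult_ac)
  have Cv: "C * norm v \<ge> 0" for v :: 'a using C by simp
  have p': "1 + \<epsilon> > 0" using p by simp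
  have lim_g: "(\<lambda>n. integral {0..real n} (\<lambda>t. g (x + t *\<^sub>R e))) \<longlonglongrightarrow> ray_integral g e x"
    if "x \<in> ray_cone e (4 * r)" for x
    by (rule ray_tendsto[OF e r p C(1) gc _ that], erule gb)
  have lim_D: "(\<lambda>n. integral {0..real n} (\<lambda>t. frechet_derivative g (at (x + t *\<^sub>R e)) v)) \<longlonglongrightarrow>
      ray_integral (\<lambda>y. frechet_derivative g (at y) v) e x" if "x \<in> ray_cone e (4 * r)" for x v
    by (rule ray_tendsto[OF e r p' Cv Dc _ that], erule Db)
  show "\<And>x v. x \<in> ray_cone e (4 * r) \<Longrightarrow>
      (\<lambda>n. integral {0..real n} (\<lambda>t. frechet_derivative g (at (x + t *\<^sub>R e)) v)) \<longlonglongrightarrow>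
      ray_integral (\<lambda>y. frechet_derivative g (at y) v) e x" by (erule lim_D)
  show der: "(ray_integral g e has_derivative (\<lambda>v. ray_integral (\<lambda>y. frechet_derivative g (at y) v) e x)) (at x)"
    if x: "x \<in> ray_cone e (4 * r)" for x
  proof -
    obtain d where d: "d > 0" "ball x d \<subseteq> ray_cone e (4 * r)" using open_ray_cone x open_contains_ball by blast
    let ?K = "C * 4 powr (1 + (1 + \<epsilon>)) / (1 + \<epsilon>)"
    have "\<exists>G. \<forall>y\<in>ball x d. (\<lambda>n. integral {0..real n} (\<lambda>t. 1 *\<^sub>R g (y + t *\<^sub>R e))) \<longlonglongrightarrow> G y \<and>
      (G has_derivative (\<lambda>v. ray_integral (\<lambda>y. frechet_derivative g (at y) v) e y)) (at y within ball x d)"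
    proof (rule has_derivative_sequence[where ?x0.0 = x])
      show "((\<lambda>x. integral {0..real n} (\<lambda>t. 1 *\<^sub>R g (x + t *\<^sub>R e))) has_derivative
        (\<lambda>v. integral {0..real n} (\<lambda>t. 1 *\<^sub>R frechet_derivative g (at (y + t *\<^sub>R e)) v))) (at y within ball x d)"
        if "y \<in> ball x d" for n y
        by (rule has_derivative_at_withinI[OF has_derivative_line_integral[OF open_ray_cone open_compl_cball[of r] ck]])
           (use that d cone_ray_outside[OF e] r in \<open>auto simp: not_le\<close>)
      show "(\<lambda>n. integral {0..real n} (\<lambda>t. 1 *\<^sub>R g (x + t *\<^sub>R e))) \<longlonglongrightarrow> ray_integral g e x"
        using lim_g[OF x] by simp
      fix \<eta> :: real assume \<eta>: "\<eta> > 0"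
      obtain R where R: "\<And>y. y \<ge> R \<Longrightarrow> ?K * y powr (- (1 + \<epsilon>)) \<le> \<eta>" using powr_small[OF p' \<eta>, of ?K] by auto
      obtain N :: nat where N: "real N \<ge> R" using real_arch_simple by blast
      show "\<forall>\<^sub>F n in sequentially. \<forall>y\<in>ball x d. \<forall>v.
        norm (integral {0..real n} (\<lambda>t. 1 *\<^sub>R frechet_derivative g (at (y + t *\<^sub>R e)) v) -
          ray_integral (\<lambda>y. frechet_derivative g (at y) v) e y) \<le> \<eta> * norm v"
        unfolding eventually_sequentially
      proof (intro exI[of _ "max N 1"] allI impI ballI)
        fix n y v assume n: "max N 1 \<le> n" and y: "y \<in> ball x d"
        have "norm (integral {0..real n} (\<lambda>t. frechet_derivative g (at (y + t *\<^sub>R e)) v) -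
          ray_integral (\<lambda>y. frechet_derivative g (at y) v) e y) \<le> (C * norm v) * 4 powr (1 + (1 + \<epsilon>)) / (1 + \<epsilon>) * real n powr (- (1 + \<epsilon>))"
          by (rule ray_uniform[OF e r p' Cv Dc], erule Db) (use y d n in auto)
        also have "\<dots> = (?K * real n powr (- (1 + \<epsilon>))) * norm v" by simp
        also have "\<dots> \<le> \<eta> * norm v" using R[of "real n"] n N by (intro mult_right_mono) auto
        finally show "norm (integral {0..real n} (\<lambda>t. 1 *\<^sub>R frechet_derivative g (at (y + t *\<^sub>R e)) v) -
          ray_integral (\<lambda>y. frechet_derivative g (at y) v) e y) \<le> \<eta> * norm v" by simp
      qed
    qed (use d in auto)
    then obtain G where G0: "\<forall>y\<in>ball x d. (\<lambda>n. integral {0..real n} (\<lambda>t. 1 *\<^sub>R g (y + t *\<^sub>R e))) \<longlonglongrightarrow> G y \<and>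
      (G has_derivative (\<lambda>v. ray_integral (\<lambda>y. frechet_derivative g (at y) v) e y)) (at y within ball x d)"
      by (elim exE)
    have G: "\<And>y. y \<in> ball x d \<Longrightarrow> (\<lambda>n. integral {0..real n} (\<lambda>t. g (y + t *\<^sub>R e))) \<longlonglongrightarrow> G y"
      "(G has_derivative (\<lambda>v. ray_integral (\<lambda>y. frechet_derivative g (at y) v) e x)) (at x within ball x d)"
      using bspec[OF G0] bspec[OF G0, of x] d by simp_all
    have xB: "x \<in> ball x d" using d by simp
    have "G y = ray_integral g e y" if "y \<in> ball x d" for y
      using LIMSEQ_unique[OF G(1)[OF that] lim_g[of y]] that d by auto
    then show ?thesis
      using G(2) has_derivative_transform_within_open[OF _ open_ball xB, of G] at_within_open[OF xB open_ball] by simp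
  qed
  show "symb \<epsilon> (ray_integral g e) (ray_cone e (4 * r))"
  proof (rule symbI[OF open_ray_cone der])
    show "continuous_on (ray_cone e (4 * r)) (\<lambda>x. ray_integral (\<lambda>y. frechet_derivative g (at y) v) e x)" for v
      by (rule continuous_on_ray_integral[OF e r p' Cv Dc], erule Db)
    show "norm (ray_integral g e x) \<le> (C * 4 powr (1 + \<epsilon>) / \<epsilon>) * norm x powr (- \<epsilon>)" if "x \<in> ray_cone e (4 * r)" for x
      by (rule ray_bound[OF e r p C(1) gc _ that], erule gb)
    show "norm (ray_integral (\<lambda>y. frechet_derivative g (at y) v) e x) \<le>
      (C * 4 powr (1 + (1 + \<epsilon>)) / (1 + \<epsilon>)) * norm x powr (- \<epsilon> - 1) * norm v" if "x \<in> ray_cone e (4 * r)" for x v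
          proof -
      have "norm (ray_integral (\<lambda>y. frechet_derivative g (at y) v) e x) \<le>
          (C * norm v) * 4 powr (1 + (1 + \<epsilon>)) / (1 + \<epsilon>) * norm x powr (- (1 + \<epsilon>))"
        by (rule ray_bound[OF e r p' Cv Dc _ that], erule Db)
      then show ?thesis by (simp add: mult_ac minus_diff_commute)
    qed
  qed
  show "(\<lambda>n. g (x + real n *\<^sub>R e)) \<longlonglongrightarrow> 0" if x: "x \<in> ray_cone e (4 * r)" for x
  proof (rule Lim_null_comparison)
    show "\<forall>\<^sub>F n in sequentially. norm (g (x + real n *\<^sub>R e)) \<le> C * (real n / 4) powr (- (1 + \<epsilon>))"
      unfolding eventually_sequentially
    proof (intro exI[of _ 1] allI impI)
      fix n :: nat assume n: "1 \<le> n"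
      have "norm (g (x + real n *\<^sub>R e)) \<le> C * norm (x + real n *\<^sub>R e) powr (- 1 - \<epsilon>)"
        by (rule gb[OF cone_ray_outside[OF e x]]) (use r in auto)
      also have "\<dots> \<le> C * (real n / 4) powr (- 1 - \<epsilon>)"
      proof -
        have "real n / 4 \<le> norm (x + real n *\<^sub>R e)"
          using cone_ray[OF e x of_nat_0_le_iff, of n] norm_ge_zero[of x] unfolding add_divide_distrib by linarith
        then show ?thesis using C p n by (intro mult_left_mono powr_mono2') auto
      qed
      finally show "norm (g (x + real n *\<^sub>R e)) \<le> C * (real n / 4) powr (- (1 + \<epsilon>))" by simp
    qed
    have "filterlim (\<lambda>n. inverse 4 * real n) at_top sequentially"
      by (rule filterlim_tendsto_pos_mult_at_top[OF tendsto_const _ filterlim_real_sequentially]) simp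
    then have "(\<lambda>n. C * (inverse 4 * real n) powr (- (1 + \<epsilon>))) \<longlonglongrightarrow> C * 0"
      using p by (intro tendsto_mult[OF tendsto_const tendsto_neg_powr]) auto
    moreover have "inverse 4 * real n = real n / 4" for n by simp
    ultimately show "(\<lambda>n. C * (real n / 4) powr (- (1 + \<epsilon>))) \<longlonglongrightarrow> 0" by (simp only: mult_zero_right)
  qed
qed

text \<open>The flow of a translation does not stretch, so this integral converges for every \<open>\<epsilon> > 0\<close>;
  the radial primitive of the usual Poincare lemma would need \<open>\<epsilon> > 1\<close>.\<close>

lemma ray_primitive:
  fixes F :: "real^4 \<Rightarrow> real^4^4"
  assumes e: "norm e = 1" and r: "r \<ge> 1" and p: "\<epsilon> > 0" and F: "symb (1 + \<epsilon>) F (- cball 0 r)"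
    and skewF: "\<And>x. x \<in> - cball 0 r \<Longrightarrow> skew (F x)" and closedF: "closed_form F (- cball 0 r)"
  defines "\<theta> \<equiv> ray_integral (\<lambda>y. F y *v e) e"
  shows "symb \<epsilon> \<theta> (ray_cone e (4 * r))" "primitive_of F \<theta> (ray_cone e (4 * r))"
    and "\<And>x. x \<in> ray_cone e (4 * r) \<Longrightarrow> \<theta> x \<bullet> e = 0"
    and "\<And>x. x \<in> ray_cone e (4 * r) \<Longrightarrow> frechet_derivative \<theta> (at x) e = - (F x *v e)"
proof -
  let ?S = "- cball (0::real^4) r"
  let ?g = "\<lambda>y. F y *v e"
  have S: "open ?S" "0 \<notin> ?S" using r by (auto intro: open_compl_cball)
  have bl: "bounded_linear (\<lambda>M::real^4^4. M *v e)"
    by (rule bounded_bilinear.bounded_linear_left[OF bounded_bilinear_matrix_vector])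
  have g: "symb (1 + \<epsilon>) ?g ?S" by (rule symb_linear_image[OF S bl F])
  have DF: "(F has_derivative frechet_derivative F (at y)) (at y)" if "y \<in> ?S" for y
    by (rule Ck_on_1_has_derivative[OF symb_Ck[OF F] that])
  have Dg: "frechet_derivative ?g (at y) v = frechet_derivative F (at y) v *v e" if "y \<in> ?S" for y v
    using frechet_derivative_eqI[OF bounded_linear.has_derivative[OF bl DF[OF that]]] by simp
  show "symb \<epsilon> \<theta> (ray_cone e (4 * r))" unfolding \<theta>_def by (rule symb_ray_integral[OF e r p g])
  have S_ray: "x + t *\<^sub>R e \<in> ?S" if "x \<in> ray_cone e (4 * r)" "t \<ge> 0" for x t
    using cone_ray_outside[OF e that] r by simp
  have D\<theta>: "frechet_derivative \<theta> (at x) v = ray_integral (\<lambda>y. frechet_derivative ?g (at y) v) e x"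
    if "x \<in> ray_cone e (4 * r)" for x v
    unfolding \<theta>_def using frechet_derivative_eqI[OF has_derivative_ray_integral[OF e r p g that]] by simp
  have lim: "(\<lambda>n. integral {0..real n} (\<lambda>t. frechet_derivative ?g (at (x + t *\<^sub>R e)) v)) \<longlonglongrightarrow> frechet_derivative \<theta> (at x) v"
    if "x \<in> ray_cone e (4 * r)" for x v
    unfolding D\<theta>[OF that] by (rule ray_tendsto_deriv[OF e r p g that])
  have ckg: "continuous_on ?S (\<lambda>y. frechet_derivative ?g (at y) v)" for v
    using continuous_on_frechet[OF S(1), of 0 ?g] symb_Ck[OF g] by simp
  have int: "(\<lambda>t. frechet_derivative ?g (at (x + t *\<^sub>R e)) v) integrable_on {0..real n}"
    if "x \<in> ray_cone e (4 * r)" for x v n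
    by (intro integrable_continuous_real continuous_on_compose2[OF ckg] continuous_intros) (use S_ray[OF that] in auto)
  show "frechet_derivative \<theta> (at x) e = - (F x *v e)" if x: "x \<in> ray_cone e (4 * r)" for x
  proof -
    have "integral {0..real n} (\<lambda>t. frechet_derivative ?g (at (x + t *\<^sub>R e)) e) = ?g (x + real n *\<^sub>R e) - ?g x" for n
      using integral_along_line[of 0 "real n" ?g "\<lambda>y. frechet_derivative ?g (at y)" x e]
        Ck_on_1_has_derivative[OF symb_Ck[OF g]] S_ray[OF x] by (simp add: integral_unique)
    with lim[OF x, of e] have a: "(\<lambda>n. ?g (x + real n *\<^sub>R e) - ?g x) \<longlonglongrightarrow> frechet_derivative \<theta> (at x) e"
      by (simp only:)
    have b: "(\<lambda>n. ?g (x + real n *\<^sub>R e) - ?g x) \<longlonglongrightarrow> 0 - ?g x"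
      by (rule tendsto_diff[OF tendsto_zero_along_ray[OF e r p g x] tendsto_const])
    from LIMSEQ_unique[OF a b] show ?thesis by simp
  qed
  show "\<theta> x \<bullet> e = 0" if x: "x \<in> ray_cone e (4 * r)" for x
  proof -
    obtain C where C: "C \<ge> 0" "\<And>x. x \<in> ?S \<Longrightarrow> norm (?g x) \<le> C * norm x powr (- (1 + \<epsilon>))"
      by (rule symbE[OF g]) blast
    have gc: "continuous_on ?S ?g" by (rule Ck_on_imp_continuous_on[OF symb_Ck[OF g]])
    have "(\<lambda>n. integral {0..real n} (\<lambda>t. ?g (x + t *\<^sub>R e))) \<longlonglongrightarrow> \<theta> x"
      unfolding \<theta>_def by (rule ray_tendsto[OF e r p C(1) gc _ x]) (use C(2) in \<open>simp add: not_le\<close>)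
    then have "(\<lambda>n. integral {0..real n} (\<lambda>t. ?g (x + t *\<^sub>R e)) \<bullet> e) \<longlonglongrightarrow> \<theta> x \<bullet> e" by (intro tendsto_intros)
    moreover have "integral {0..real n} (\<lambda>t. ?g (x + t *\<^sub>R e)) \<bullet> e = 0" for n
    proof -
      have "(\<lambda>t. ?g (x + t *\<^sub>R e)) integrable_on {0..real n}"
        by (intro integrable_continuous_real continuous_on_compose2[OF gc] continuous_intros) (use S_ray[OF x] in auto)
      then have "integral {0..real n} (\<lambda>t. ?g (x + t *\<^sub>R e) \<bullet> e) = integral {0..real n} (\<lambda>t. ?g (x + t *\<^sub>R e)) \<bullet> e"
        using integral_linear[OF _ bounded_linear_inner_left, of _ "{0..real n}" e] by (simp add: o_def)
      moreover have "?g (x + t *\<^sub>R e) \<bullet> e = 0" if "t \<in> {0..real n}" for t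
        using skewD[OF skewF[OF S_ray[OF x]], of t e e] that by (simp add: inner_commute)
      ultimately show ?thesis using integral_cong[of "{0..real n}" "\<lambda>t. ?g (x + t *\<^sub>R e) \<bullet> e" "\<lambda>t. 0"] by simp
    qed
    ultimately have "(\<lambda>n. 0) \<longlonglongrightarrow> \<theta> x \<bullet> e" by (simp only:)
    then show ?thesis by (simp add: LIMSEQ_const_iff)
  qed
  show "primitive_of F \<theta> (ray_cone e (4 * r))"
    unfolding primitive_of_def
  proof (intro ballI allI)
    fix x a b assume x: "x \<in> ray_cone e (4 * r)"
    let ?J = "\<lambda>v n. integral {0..real n} (\<lambda>t. frechet_derivative ?g (at (x + t *\<^sub>R e)) v)"
    let ?h = "\<lambda>y. a \<bullet> (F y *v b)"
    have bh: "bounded_linear (\<lambda>M::real^4^4. a \<bullet> (M *v b))"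
      by (rule bounded_linear_compose[OF bounded_linear_inner_right
            bounded_bilinear.bounded_linear_left[OF bounded_bilinear_matrix_vector]])
    \<comment> \<open>Cartan's formula for translations: closedness turns the antisymmetrized
      derivative of \<open>F y *v e\<close> into minus the derivative of
      \<open>a \<bullet> (F y *v b)\<close> along the ray, so that the integral reduces to boundary
      terms. The one at infinity tends to 0.\<close>
    have eq: "?J a n \<bullet> b - ?J b n \<bullet> a = - (?h (x + real n *\<^sub>R e) - ?h x)" for n
    proof -
      have il: "?J v n \<bullet> w = integral {0..real n} (\<lambda>t. frechet_derivative ?g (at (x + t *\<^sub>R e)) v \<bullet> w)"
        "(\<lambda>t. frechet_derivative ?g (at (x + t *\<^sub>R e)) v \<bullet> w) integrable_on {0..real n}" for v w
        using integral_linear[OF int[OF x, of v n] bounded_linear_inner_left[of w]]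
          integrable_linear[OF int[OF x, of v n] bounded_linear_inner_left[of w]] by (simp_all add: o_def)
      have "?J a n \<bullet> b - ?J b n \<bullet> a = integral {0..real n} (\<lambda>t. frechet_derivative ?g (at (x + t *\<^sub>R e)) a \<bullet> b -
          frechet_derivative ?g (at (x + t *\<^sub>R e)) b \<bullet> a)"
        unfolding il(1) by (rule integral_diff[symmetric]) (rule il(2))+
      also have "\<dots> = integral {0..real n} (\<lambda>t. - (a \<bullet> (frechet_derivative F (at (x + t *\<^sub>R e)) e *v b)))"
      proof (rule integral_cong)
        fix t assume "t \<in> {0..real n}"
        then have y: "x + t *\<^sub>R e \<in> ?S" by (intro S_ray[OF x]) simp
        let ?D = "frechet_derivative F (at (x + t *\<^sub>R e))"
        have "b \<bullet> (?D a *v e) + e \<bullet> (?D b *v a) + a \<bullet> (?D e *v b) = 0"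
          using closedF y unfolding closed_form_def by blast
        moreover have "skew (?D b)"
          by (rule skew_frechet_derivative[OF S(1) y _ skewF]) (use DF[OF y] in \<open>auto simp: differentiable_def\<close>)
        then have "e \<bullet> (?D b *v a) = - (a \<bullet> (?D b *v e))" by (rule skewD)
        ultimately show "frechet_derivative ?g (at (x + t *\<^sub>R e)) a \<bullet> b - frechet_derivative ?g (at (x + t *\<^sub>R e)) b \<bullet> a =
            - (a \<bullet> (?D e *v b))"
          unfolding Dg[OF y] by (simp add: inner_commute)
      qed
      also have "\<dots> = - (?h (x + real n *\<^sub>R e) - ?h x)"
        using integral_along_line[of 0 "real n" ?h "\<lambda>y v. a \<bullet> (frechet_derivative F (at y) v *v b)" x e]
          bounded_linear.has_derivative[OF bh DF] S_ray[OF x] by (simp add: integral_unique)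
      finally show ?thesis .
    qed
    have A: "(\<lambda>n. ?J a n \<bullet> b - ?J b n \<bullet> a) \<longlonglongrightarrow> frechet_derivative \<theta> (at x) a \<bullet> b - frechet_derivative \<theta> (at x) b \<bullet> a"
      by (intro tendsto_diff tendsto_inner tendsto_const lim x)
    have B: "(\<lambda>n. - (?h (x + real n *\<^sub>R e) - ?h x)) \<longlonglongrightarrow> - (a \<bullet> (0 *v b) - ?h x)"
      by (intro tendsto_minus tendsto_diff tendsto_const bounded_linear.tendsto[OF bh]
          tendsto_zero_along_ray[OF e r p F x])
    from LIMSEQ_unique[OF A[unfolded eq] B]
    show "frechet_derivative \<theta> (at x) a \<bullet> b - frechet_derivative \<theta> (at x) b \<bullet> a = a \<bullet> (F x *v b)"
      by simp
  qed
qed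

section \<open>Potentials of closed 1-forms\<close>

definition has_potential :: "('a::euclidean_space \<Rightarrow> 'a) \<Rightarrow> 'a set \<Rightarrow> bool" where
  "has_potential \<eta> A \<longleftrightarrow> (\<exists>f. \<forall>x\<in>A. (f has_derivative (\<lambda>v. \<eta> x \<bullet> v)) (at x))"

definition curl_free :: "('a::euclidean_space \<Rightarrow> 'a) \<Rightarrow> 'a set \<Rightarrow> bool" where
  "curl_free \<eta> A \<longleftrightarrow> (\<forall>x\<in>A. \<forall>a b. frechet_derivative \<eta> (at x) a \<bullet> b = frechet_derivative \<eta> (at x) b \<bullet> a)"

text \<open>The Poincare lemma: the potential at \<open>x\<close> is the integral of \<eta> along
  the segment from a fixed point \<open>a\<close> to \<open>x\<close>.\<close>

lemma has_potential_convex: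
  fixes \<eta> :: "'a::euclidean_space \<Rightarrow> 'a"
  assumes H: "open H" "convex H" and \<eta>: "Ck_on 1 \<eta> H" and sym: "curl_free \<eta> H"
  shows "has_potential \<eta> H"
proof (cases "H = {}")
  case False
  then obtain a where a: "a \<in> H" by blast
  have seg: "a + t *\<^sub>R (x - a) \<in> H" if "x \<in> H" "t \<in> {0..1}" for x t
  proof -
    have "(1 - t) *\<^sub>R a + t *\<^sub>R x \<in> H" using H(2) a that by (intro convexD) auto
    then show ?thesis by (simp add: algebra_simps)
  qed
  have D: "(\<eta> has_derivative frechet_derivative \<eta> (at y)) (at y)" if "y \<in> H" for y
    by (rule Ck_on_1_has_derivative[OF \<eta> that])
  have cD: "continuous_on H (\<lambda>y. frechet_derivative \<eta> (at y) v)" for v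
    using continuous_on_frechet[OF H(1), of 0 \<eta>] \<eta> by simp
  let ?f = "\<lambda>x. integral {0..1} (\<lambda>t. \<eta> (a + t *\<^sub>R (x - a)) \<bullet> (x - a))"
  let ?f' = "\<lambda>x t v. \<eta> (a + t *\<^sub>R (x - a)) \<bullet> v + frechet_derivative \<eta> (at (a + t *\<^sub>R (x - a))) (t *\<^sub>R v) \<bullet> (x - a)"
  have c\<eta>: "continuous_on H \<eta>" by (rule Ck_on_imp_continuous_on[OF \<eta>])
  have "(?f has_derivative (\<lambda>v. \<eta> x \<bullet> v)) (at x)" if x: "x \<in> H" for x
  proof -
    have "(?f has_derivative (\<lambda>v. integral {0..1} (\<lambda>t. ?f' x t v))) (at x)"
    proof (rule has_derivative_parametric_integral[OF H(1) x])
      fix x t assume xt: "x \<in> H" "t \<in> {0..1::real}"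
      have "((\<lambda>x. a + t *\<^sub>R (x - a)) has_derivative (\<lambda>v. t *\<^sub>R v)) (at x)"
        by (auto intro!: derivative_eq_intros)
      from has_derivative_compose[OF this D[OF seg[OF xt]]]
      show "((\<lambda>x. \<eta> (a + t *\<^sub>R (x - a)) \<bullet> (x - a)) has_derivative ?f' x t) (at x)"
        by (intro has_derivative_inner) (auto intro!: derivative_eq_intros)
    next
      fix x assume "x \<in> H"
      then show "continuous_on {0..1} (\<lambda>t. \<eta> (a + t *\<^sub>R (x - a)) \<bullet> (x - a))"
        by (intro continuous_intros continuous_on_compose2[OF c\<eta>]) (use seg in auto)
    next
      fix v
      have "continuous_on (H \<times> {0..1}) (\<lambda>z. \<eta> (a + snd z *\<^sub>R (fst z - a)) \<bullet> v +
          (snd z *\<^sub>R frechet_derivative \<eta> (at (a + snd z *\<^sub>R (fst z - a))) v) \<bullet> (fst z - a))"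
        by (intro continuous_on_add continuous_on_inner continuous_on_scaleR continuous_on_compose2[OF c\<eta>]
            continuous_on_compose2[OF cD] continuous_on_diff continuous_on_const continuous_on_fst
            continuous_on_snd continuous_on_id) (use seg in auto)
      then show "continuous_on (H \<times> {0..1}) (\<lambda>(x, t). ?f' x t v)"
        by (rule continuous_on_eq)
           (use seg in \<open>auto simp: linear_scale[OF has_derivative_linear[OF D]]\<close>)
    qed
    moreover have "integral {0..1} (\<lambda>t. ?f' x t v) = \<eta> x \<bullet> v" for v
    proof (rule integral_unique)
      \<comment> \<open>Because \<eta> is curl-free, \<open>?f' x t v\<close> is the
        \<open>t\<close>-derivative of
        \<open>t *\<^sub>R (\<eta> (a + t *\<^sub>R (x - a)) \<bullet> v)\<close>.\<close>
      have "((\<lambda>t. ?f' x t v) has_integral 1 *\<^sub>R (\<eta> (a + 1 *\<^sub>R (x - a)) \<bullet> v) - 0 *\<^sub>R (\<eta> (a + 0 *\<^sub>R (x - a)) \<bullet> v)) {0..1}"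
      proof (rule fundamental_theorem_of_calculus)
        fix t :: real assume t: "t \<in> {0..1}"
        let ?y = "a + t *\<^sub>R (x - a)"
        note y = seg[OF x t]
        have "((\<lambda>t. a + t *\<^sub>R (x - a)) has_derivative (\<lambda>h. h *\<^sub>R (x - a))) (at t)"
          by (auto intro!: derivative_eq_intros)
        from has_derivative_inner_left[OF has_derivative_compose[OF this D[OF y]], of v]
        have "((\<lambda>t. \<eta> (a + t *\<^sub>R (x - a)) \<bullet> v) has_derivative (\<lambda>h. h *\<^sub>R (frechet_derivative \<eta> (at ?y) (x - a) \<bullet> v))) (at t)"
          by (simp add: linear_scale[OF has_derivative_linear[OF D[OF y]]])
        then have "((\<lambda>t. \<eta> (a + t *\<^sub>R (x - a)) \<bullet> v) has_vector_derivative frechet_derivative \<eta> (at ?y) (x - a) \<bullet> v) (at t within {0..1})"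
          by (simp add: has_vector_derivative_def has_derivative_at_withinI)
        from has_vector_derivative_scaleR[OF DERIV_ident this]
        have "((\<lambda>t. t *\<^sub>R (\<eta> (a + t *\<^sub>R (x - a)) \<bullet> v)) has_vector_derivative
          t *\<^sub>R (frechet_derivative \<eta> (at ?y) (x - a) \<bullet> v) + \<eta> ?y \<bullet> v) (at t within {0..1})"
          by simp
        moreover have "frechet_derivative \<eta> (at ?y) (x - a) \<bullet> v = frechet_derivative \<eta> (at ?y) v \<bullet> (x - a)"
          using sym y unfolding curl_free_def by blast
        ultimately show "((\<lambda>t. t *\<^sub>R (\<eta> (a + t *\<^sub>R (x - a)) \<bullet> v)) has_vector_derivative ?f' x t v) (at t within {0..1})"
          by (simp add: linear_scale[OF has_derivative_linear[OF D[OF y]]] add.commute)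
      qed simp
      then show "((\<lambda>t. ?f' x t v) has_integral \<eta> x \<bullet> v) {0..1}" by simp
    qed
    ultimately show ?thesis by simp
  qed
  then show ?thesis unfolding has_potential_def by blast
qed (simp add: has_potential_def)

text \<open>Two potentials differ by a constant on the connected intersection; adding this constant
  to one of them makes them agree there. This is the only use of topology in the construction of
  potentials.\<close>

lemma has_potential_Un:
  assumes A: "open A" "open B" and conn: "connected (A \<inter> B)" and pot: "has_potential \<eta> A" "has_potential \<eta> B"
  shows "has_potential \<eta> (A \<union> B)"
proof -
  obtain f g where f: "\<And>x. x \<in> A \<Longrightarrow> (f has_derivative (\<lambda>v. \<eta> x \<bullet> v)) (at x)"
    and g: "\<And>x. x \<in> B \<Longrightarrow> (g has_derivative (\<lambda>v. \<eta> x \<bullet> v)) (at x)"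
    using pot unfolding has_potential_def by blast
  have d: "((\<lambda>x. f x - g x) has_derivative (\<lambda>v. 0)) (at x within A \<inter> B)" if "x \<in> A \<inter> B" for x
    using has_derivative_diff[OF f g, of x] that by (simp add: has_derivative_at_withinI)
  have "continuous_on (A \<inter> B) (\<lambda>x. f x - g x)"
    using d has_derivative_continuous unfolding continuous_on_eq_continuous_within by blast
  then have "(\<lambda>x. f x - g x) constant_on A \<inter> B"
    using d by (intro has_derivative_zero_connected_constant_on[OF conn open_Int[OF A] finite.emptyI]) auto
  then obtain c where c: "\<And>x. x \<in> A \<inter> B \<Longrightarrow> f x = g x + c" by (force simp: constant_on_def algebra_simps)
  define k where "k x = (if x \<in> A then f x else g x + c)" for x
  have "(k has_derivative (\<lambda>v. \<eta> x \<bullet> v)) (at x)" if "x \<in> A \<union> B" for x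
  proof (cases "x \<in> A")
    case True
    show ?thesis
      by (rule has_derivative_transform_within_open[OF f[OF True] A(1) True]) (simp add: k_def)
  next
    case False
    then have xB: "x \<in> B" using that by simp
    have "((\<lambda>x. g x + c) has_derivative (\<lambda>v. \<eta> x \<bullet> v)) (at x)"
      using has_derivative_add[OF g[OF xB] has_derivative_const[of c]] by simp
    then show ?thesis
      by (rule has_derivative_transform_within_open[OF _ A(2) xB]) (use c in \<open>auto simp: k_def\<close>)
  qed
  then show ?thesis unfolding has_potential_def by blast
qed

lemma has_potential_subset: "has_potential \<eta> A \<Longrightarrow> B \<subseteq> A \<Longrightarrow> has_potential \<eta> B"
  unfolding has_potential_def by blast

abbreviation halfspace :: "'a::euclidean_space \<Rightarrow> real \<Rightarrow> 'a set" where
  "halfspace u R \<equiv> {x. x \<bullet> u > R}"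

lemma open_halfspace: "open (halfspace u R)" and convex_halfspace: "convex (halfspace u R)"
  using open_halfspace_gt[of R u] convex_halfspace_gt[of R u] by (simp_all add: inner_commute)

text \<open>Six half-spaces are added one at a time; each meets the union of the previous ones in a
  connected set. This is \<open>H\<^sup>1 = 0\<close> for the exterior of a cube in a space of dimension three.\<close>

lemma has_potential_cube_exterior:
  fixes u v w :: "'a::euclidean_space"
  assumes on: "norm u = 1" "norm v = 1" "norm w = 1" "u \<bullet> v = 0" "u \<bullet> w = 0" "v \<bullet> w = 0" and R: "R \<ge> 0"
    and pot: "\<And>y. y \<in> {u, - u, v, - v, w, - w} \<Longrightarrow> has_potential \<eta> (halfspace y R)"
  shows "has_potential \<eta> (\<Union>y\<in>{u, - u, v, - v, w, - w}. halfspace y R)"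
proof -
  let ?H = "\<lambda>y. halfspace y R"
  have ip: "u \<bullet> u = 1" "v \<bullet> v = 1" "w \<bullet> w = 1" "v \<bullet> u = 0" "w \<bullet> u = 0" "w \<bullet> v = 0"
    using on by (simp_all add: norm_eq_1 inner_commute)
  have c2: "connected (?H y \<inter> ?H z)" for y z
    by (intro convex_connected convex_Int convex_halfspace)
  have ne: "?H y \<inter> ?H z \<inter> ?H x \<noteq> {}"
    if "x \<in> {w, - w, v, - v}" "y \<in> {u, - u}" "z \<in> {w, - w, v, - v}" "x \<bullet> z \<ge> 0" for x y z
  proof -
    \<comment> \<open>The inner products among the three vectors are nonnegative and each is a unit
      vector, so each half-space sees at least \<open>R + 1\<close>.\<close>
    have "(R + 1) *\<^sub>R (x + y + z) \<in> ?H y \<inter> ?H z \<inter> ?H x"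
      using that R on ip by (auto simp: inner_add_left algebra_simps)
    then show ?thesis by blast
  qed
  have ne': "?H y \<inter> ?H z \<inter> ?H x \<noteq> {}" if "x \<in> {w, - w}" "z \<in> {v, - v}" "y \<in> {u, - u}" for x y z
    using that R on ip by (intro ne) auto
  have disj: "?H y \<inter> ?H (- y) = {}" for y using R by auto
  have opn: "open (\<Union>y\<in>Y. ?H y)" for Y by (intro open_UN ballI open_halfspace)
  have step: "has_potential \<eta> (\<Union>y\<in>insert z Y. ?H y)"
    if "has_potential \<eta> (\<Union>y\<in>Y. ?H y)" "z \<in> {u, - u, v, - v, w, - w}" "connected ((\<Union>y\<in>Y. ?H y) \<inter> ?H z)" for z Y
    using has_potential_Un[OF opn open_halfspace that(3,1) pot[OF that(2)]] by (simp add: Un_commute)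
  have 1: "has_potential \<eta> (\<Union>y\<in>{u}. ?H y)" using pot by simp
  have 2: "has_potential \<eta> (\<Union>y\<in>{v, u}. ?H y)" by (rule step[OF 1]) (use c2 in auto)
  have 3: "has_potential \<eta> (\<Union>y\<in>{- v, v, u}. ?H y)"
  proof (rule step[OF 2])
    have "(\<Union>y\<in>{v, u}. ?H y) \<inter> ?H (- v) = ?H u \<inter> ?H (- v)" using disj[of v] by auto
    then show "connected ((\<Union>y\<in>{v, u}. ?H y) \<inter> ?H (- v))" by (simp only: c2)
  qed auto
  have star: "connected ((?H u \<inter> ?H x) \<union> (?H v \<inter> ?H x) \<union> (?H (- v) \<inter> ?H x))" if "x \<in> {w, - w}" for x
    using ne'[OF that, of v u] ne'[OF that, of "- v" u] by (intro connected_Un c2) auto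
  have 4: "has_potential \<eta> (\<Union>y\<in>{w, - v, v, u}. ?H y)"
  proof (rule step[OF 3])
    have "(\<Union>y\<in>{- v, v, u}. ?H y) \<inter> ?H w = (?H u \<inter> ?H w) \<union> (?H v \<inter> ?H w) \<union> (?H (- v) \<inter> ?H w)" by auto
    then show "connected ((\<Union>y\<in>{- v, v, u}. ?H y) \<inter> ?H w)" using star[of w] by (simp only: insert_iff simp_thms)
  qed auto
  have 5: "has_potential \<eta> (\<Union>y\<in>{- w, w, - v, v, u}. ?H y)"
  proof (rule step[OF 4])
    have "(\<Union>y\<in>{w, - v, v, u}. ?H y) \<inter> ?H (- w) = (?H u \<inter> ?H (- w)) \<union> (?H v \<inter> ?H (- w)) \<union> (?H (- v) \<inter> ?H (- w))"
      using disj[of w] by auto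
    then show "connected ((\<Union>y\<in>{w, - v, v, u}. ?H y) \<inter> ?H (- w))" using star[of "- w"] by (simp only: insert_iff simp_thms)
  qed auto
  have 6: "has_potential \<eta> (\<Union>y\<in>{- u, - w, w, - v, v, u}. ?H y)"
  proof (rule step[OF 5])
    let ?X = "\<lambda>x. ?H x \<inter> ?H (- u)"
    \<comment> \<open>Here the third direction is essential: without \<open>w\<close> and
      \<open>- w\<close> the last half-space would meet the others in two disjoint pieces. The four
      pieces are arranged in a ring around the axis of \<open>u\<close>.\<close>
    have "connected (?X w \<union> ?X v \<union> ?X (- v) \<union> ?X (- w))"
      using ne'[of w v "- u"] ne'[of w "- v" "- u"] ne'[of "- w" v "- u"] by (intro connected_Un c2) auto
    moreover have "(\<Union>y\<in>{- w, w, - v, v, u}. ?H y) \<inter> ?H (- u) = ?X w \<union> ?X v \<union> ?X (- v) \<union> ?X (- w)"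
      using disj[of u] by auto
    ultimately show "connected ((\<Union>y\<in>{- w, w, - v, v, u}. ?H y) \<inter> ?H (- u))" by (simp only:)
  qed auto
  then show ?thesis by (rule has_potential_subset) auto
qed

text \<open>A mean value estimate along a segment, so that potentials can be bounded by the length
  of a path on which the gradient is known to be small.\<close>

lemma potential_increment:
  fixes f :: "'a::euclidean_space \<Rightarrow> real"
  assumes f: "\<And>t. t \<in> {0..1} \<Longrightarrow> (f has_derivative (\<lambda>v. \<eta> (a + t *\<^sub>R (b - a)) \<bullet> v)) (at (a + t *\<^sub>R (b - a)))"
    and bd: "\<And>t. t \<in> {0..1} \<Longrightarrow> norm (\<eta> (a + t *\<^sub>R (b - a))) \<le> B"
  shows "\<bar>f b - f a\<bar> \<le> B * norm (b - a)"
proof -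
  have i: "((\<lambda>t. \<eta> (a + t *\<^sub>R (b - a)) \<bullet> (b - a)) has_integral f b - f a) {0..1}"
    using integral_along_line[of 0 1 f "\<lambda>y v. \<eta> y \<bullet> v" a "b - a"] f by simp
  have B: "B \<ge> 0" using order_trans[OF norm_ge_zero bd[of 0]] by simp
  have le: "norm (\<eta> (a + t *\<^sub>R (b - a)) \<bullet> (b - a)) \<le> B * norm (b - a)" if "t \<in> {0..1}" for t
  proof -
    have "norm (\<eta> (a + t *\<^sub>R (b - a)) \<bullet> (b - a)) \<le> norm (\<eta> (a + t *\<^sub>R (b - a))) * norm (b - a)"
      using Cauchy_Schwarz_ineq2 by simp
    also have "\<dots> \<le> B * norm (b - a)" by (intro mult_right_mono bd that) simp
    finally show ?thesis .
  qed
  have "norm (f b - f a) \<le> (B * norm (b - a)) * Henstock_Kurzweil_Integration.content (cbox 0 (1::real))"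
    by (rule has_integral_bound[of _ "\<lambda>t. \<eta> (a + t *\<^sub>R (b - a)) \<bullet> (b - a)"]) (use i le B in auto)
  then show ?thesis by simp
qed

section \<open>A primitive with sharp decay\<close>

lemma primitive_of_cong:
  assumes "open A" "\<And>x. x \<in> A \<Longrightarrow> f x = g x" "primitive_of F f A"
  shows "primitive_of F g A"
proof -
  have "frechet_derivative g (at x) = frechet_derivative f (at x)" if "x \<in> A" for x
    using frechet_derivative_cong[OF assms(1) that, of f g] assms(2) by simp
  then show ?thesis using assms(3) unfolding primitive_of_def by simp
qed

lemma primitive_of_subset: "primitive_of F f A \<Longrightarrow> B \<subseteq> A \<Longrightarrow> primitive_of F f B"
  unfolding primitive_of_def by blast

text \<open>The ray primitives in the directions \<open>e1\<close> and \<open>- e1\<close> cover the exterior of a ball. On the band where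
  both are defined they differ by a closed form \<open>\<delta>\<close> that does not depend on the first coordinate. Its
  potential may grow, or tend to a constant which spoils the decay when \<open>\<epsilon> > 1\<close>; subtracting the values of the
  potential on the ray through \<open>e2\<close>, as a radial function with gradient \<open>\<kappa>\<close>, leaves \<open>G = O(|x|\<^sup>1\<^sup>-\<^sup>\<epsilon>)\<close>
  for every \<open>\<epsilon>\<close>. The primitive \<open>\<theta>0\<close> interpolates between the two with a cut-off that is homogeneous of
  degree 0.\<close>

locale two_rays =
  fixes F :: "real^4 \<Rightarrow> real^4^4" and r \<epsilon> :: real
  assumes r: "r \<ge> 1" and eps: "\<epsilon> > 0" and F: "symb (1 + \<epsilon>) F (- cball 0 r)"
    and skewF: "\<And>x. x \<in> - cball 0 r \<Longrightarrow> skew (F x)" and closedF: "closed_form F (- cball 0 r)"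
begin

abbreviation e1 :: "real^4" where "e1 \<equiv> axis 1 1"
abbreviation e2 :: "real^4" where "e2 \<equiv> axis 2 1"
abbreviation e3 :: "real^4" where "e3 \<equiv> axis 3 1"
abbreviation e4 :: "real^4" where "e4 \<equiv> axis 4 1"

definition "\<theta>p = ray_integral (\<lambda>y. F y *v e1) e1"
definition "\<theta>m = ray_integral (\<lambda>y. F y *v (- e1)) (- e1)"
definition "\<delta> y = \<theta>p y - \<theta>m y"
definition "P x = x - (x \<bullet> e1) *\<^sub>R e1"
definition "D0 = ray_cone e1 (4 * r) \<inter> ray_cone (- e1) (4 * r)"

lemma D0_iff: "x \<in> D0 \<longleftrightarrow> norm x > 4 * r \<and> \<bar>x \<bullet> e1\<bar> < 4 / 5 * norm x"
  by (auto simp: D0_def ray_cone_def)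

lemma open_D0: "open D0" unfolding D0_def by (intro open_Int open_ray_cone)

lemma D0_nz: "0 \<notin> D0"
  using r by (auto simp: D0_iff ray_cone_def)

lemma norm_e: "norm e1 = 1" "norm (- e1) = 1" by simp_all

lemmas ray_primitive_plus = ray_primitive[OF norm_e(1) r eps F skewF closedF, folded \<theta>p_def]
lemmas ray_primitive_minus = ray_primitive[OF norm_e(2) r eps F skewF closedF, folded \<theta>m_def]

lemma D_theta_plus: "x \<in> ray_cone e1 (4 * r) \<Longrightarrow> (\<theta>p has_derivative frechet_derivative \<theta>p (at x)) (at x)"
  by (rule Ck_on_1_has_derivative[OF symb_Ck[OF ray_primitive_plus(1)]])

lemma D_theta_minus: "x \<in> ray_cone (- e1) (4 * r) \<Longrightarrow> (\<theta>m has_derivative frechet_derivative \<theta>m (at x)) (at x)"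
  by (rule Ck_on_1_has_derivative[OF symb_Ck[OF ray_primitive_minus(1)]])

lemma symb_delta: "symb \<epsilon> \<delta> D0"
  unfolding \<delta>_def
  by (rule symb_minus[OF open_D0 D0_nz symb_subset[OF ray_primitive_plus(1)] symb_subset[OF ray_primitive_minus(1)]]) (auto simp: D0_def)

lemma D_delta: "x \<in> D0 \<Longrightarrow> (\<delta> has_derivative frechet_derivative \<delta> (at x)) (at x)"
  by (rule Ck_on_1_has_derivative[OF symb_Ck[OF symb_delta]])

lemma frechet_delta: "x \<in> D0 \<Longrightarrow> frechet_derivative \<delta> (at x) v = frechet_derivative \<theta>p (at x) v - frechet_derivative \<theta>m (at x) v"
proof -
  assume "x \<in> D0"
  then have "(\<delta> has_derivative (\<lambda>v. frechet_derivative \<theta>p (at x) v - frechet_derivative \<theta>m (at x) v)) (at x)"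
    unfolding \<delta>_def by (intro has_derivative_diff D_theta_plus D_theta_minus) (auto simp: D0_def)
  from frechet_derivative_eqI[OF this] show ?thesis by simp
qed

lemma delta_e1: "x \<in> D0 \<Longrightarrow> \<delta> x \<bullet> e1 = 0"
  using ray_primitive_plus(3)[of x] ray_primitive_minus(3)[of x] by (auto simp: D0_def \<delta>_def inner_diff_left)

text \<open>Reversing the ray changes the sign both of the contracted vector and of the direction of
  differentiation, so the two primitives have the same derivative along \<open>e1\<close>.\<close>

lemma frechet_delta_e1: "x \<in> D0 \<Longrightarrow> frechet_derivative \<delta> (at x) e1 = 0"
proof -
  assume x: "x \<in> D0"
  then have "frechet_derivative \<theta>m (at x) (- e1) = F x *v e1"
    using ray_primitive_minus(4)[of x] by (simp add: D0_def bounded_bilinear.minus_right[OF bounded_bilinear_matrix_vector])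
  moreover have "frechet_derivative \<theta>m (at x) (- e1) = - frechet_derivative \<theta>m (at x) e1"
    using linear_neg[OF has_derivative_linear[OF D_theta_minus]] x by (simp add: D0_def)
  moreover have "frechet_derivative \<theta>p (at x) e1 = - (F x *v e1)" using ray_primitive_plus(4)[of x] x by (simp add: D0_def)
  ultimately show ?thesis unfolding frechet_delta[OF x] by (metis add.inverse_inverse diff_self)
qed

lemma frechet_delta_inner_e1:
  assumes x: "x \<in> D0" shows "frechet_derivative \<delta> (at x) v \<bullet> e1 = 0"
proof -
  have "((\<lambda>y. \<delta> y \<bullet> e1) has_derivative (\<lambda>v. frechet_derivative \<delta> (at x) v \<bullet> e1)) (at x)"
    by (rule has_derivative_inner_left[OF D_delta[OF x]])
  moreover have "((\<lambda>y. \<delta> y \<bullet> e1) has_derivative (\<lambda>v. 0)) (at x)"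
    by (rule has_derivative_transform_within_open[OF has_derivative_const[of 0] open_D0 x]) (simp add: delta_e1)
  ultimately have "(\<lambda>v. frechet_derivative \<delta> (at x) v \<bullet> e1) = (\<lambda>v. 0)" by (rule has_derivative_unique)
  from fun_cong[OF this, of v] show ?thesis .
qed

lemma curl_free_delta: "curl_free \<delta> D0"
  unfolding curl_free_def
proof (intro ballI allI)
  fix x a b assume x: "x \<in> D0"
  have "frechet_derivative \<theta>p (at x) a \<bullet> b - frechet_derivative \<theta>p (at x) b \<bullet> a =
    frechet_derivative \<theta>m (at x) a \<bullet> b - frechet_derivative \<theta>m (at x) b \<bullet> a"
    using ray_primitive_plus(2) ray_primitive_minus(2) x unfolding primitive_of_def D0_def by simp
  then show "frechet_derivative \<delta> (at x) a \<bullet> b = frechet_derivative \<delta> (at x) b \<bullet> a"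
    by (simp add: frechet_delta[OF x] inner_diff_left)
qed

lemma P_e1: "P x \<bullet> e1 = 0" by (simp add: P_def inner_diff_left inner_axis_axis)

lemma bounded_linear_P: "bounded_linear P"
  unfolding P_def by (intro bounded_linear_intros)

lemma norm_P: "(norm x)\<^sup>2 = (norm (P x))\<^sup>2 + (x \<bullet> e1)\<^sup>2"
proof -
  have "x = P x + (x \<bullet> e1) *\<^sub>R e1" by (simp add: P_def)
  then have "(norm x)\<^sup>2 = (norm (P x + (x \<bullet> e1) *\<^sub>R e1))\<^sup>2" by metis
  also have "\<dots> = (norm (P x))\<^sup>2 + (x \<bullet> e1)\<^sup>2"
    by (subst norm_add_Pythagorean) (simp_all add: orthogonal_def P_e1 power_mult_distrib)
  finally show ?thesis .
qed

lemma norm_P_le: "norm (P x) \<le> norm x"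
  by (rule power2_le_imp_le) (simp_all add: norm_P[of x])

section \<open>A potential for the difference of the two ray primitives\<close>

definition "H = {x. norm (P x) > 4 * r}"

lemma P_D0: "x \<in> H \<Longrightarrow> P x \<in> D0" using r by (auto simp: D0_iff P_e1 H_def)

lemma open_H: "open H" unfolding H_def
  by (intro open_Collect_less continuous_on_const continuous_on_norm linear_continuous_on bounded_linear_P)

text \<open>The extension of \<delta> from the band to the exterior of a solid cylinder around the
  \<open>e1\<close>-axis, constant in direction \<open>e1\<close>. There the half-spaces in the
  directions orthogonal to \<open>e1\<close> are available, and the problem becomes one of the three
  remaining dimensions.\<close>

definition "\<eta> x = \<delta> (P x)"

lemma D_eta: "x \<in> H \<Longrightarrow> (\<eta> has_derivative (\<lambda>v. frechet_derivative \<delta> (at (P x)) (P v))) (at x)"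
  unfolding \<eta>_def by (rule has_derivative_linear_arg[OF bounded_linear_P D_delta[OF P_D0]])

lemma Ck_eta: "Ck_on 1 \<eta> H"
  unfolding \<eta>_def
  by (rule Ck_on_compose[OF open_H open_D0 symb_Ck[OF symb_delta] Ck_on_linear[OF open_H bounded_linear_P]])
     (use P_D0 in auto)

lemma curl_free_eta: "curl_free \<eta> H"
  unfolding curl_free_def
proof (intro ballI allI)
  fix x a b assume x: "x \<in> H"
  let ?D = "frechet_derivative \<delta> (at (P x))"
  have "?D (P a) \<bullet> b = ?D (P a) \<bullet> P b" for a b
    using frechet_delta_inner_e1[OF P_D0[OF x], of "P a"] by (simp add: P_def[of b] inner_diff_right)
  then show "frechet_derivative \<eta> (at x) a \<bullet> b = frechet_derivative \<eta> (at x) b \<bullet> a"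
    using curl_free_delta P_D0[OF x] unfolding curl_free_def frechet_derivative_eqI[OF D_eta[OF x]] by metis
qed

lemma halfspace_subset_H: "y \<in> {e2, - e2, e3, - e3, e4, - e4} \<Longrightarrow> halfspace y (4 * r) \<subseteq> H"
proof
  fix x assume y: "y \<in> {e2, - e2, e3, - e3, e4, - e4}" and x: "x \<in> halfspace y (4 * r)"
  have "x \<bullet> y = P x \<bullet> y" using y by (auto simp: P_def inner_diff_left inner_axis_axis)
  also have "\<dots> \<le> norm (P x) * norm y" by (rule norm_cauchy_schwarz)
  also have "norm y = 1" using y by auto
  finally show "x \<in> H" using x by (simp add: H_def)
qed

text \<open>A point of the cube with half-side \<open>4 * r\<close> has squared norm at most
  \<open>48 * r\<^sup>2\<close>, which is less than \<open>(8 * r)\<^sup>2\<close>.\<close>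

lemma P_large_in_halfspaces:
  assumes "norm (P x) > 8 * r"
  shows "x \<in> (\<Union>y\<in>{e2, - e2, e3, - e3, e4, - e4}. halfspace y (4 * r))"
proof (rule ccontr)
  assume "\<not> ?thesis"
  then have "\<bar>x $ 2\<bar> \<le> 4 * r" "\<bar>x $ 3\<bar> \<le> 4 * r" "\<bar>x $ 4\<bar> \<le> 4 * r"
    by (auto simp: inner_axis not_less)
  then have "\<bar>x $ 2\<bar>\<^sup>2 \<le> (4 * r)\<^sup>2" "\<bar>x $ 3\<bar>\<^sup>2 \<le> (4 * r)\<^sup>2" "\<bar>x $ 4\<bar>\<^sup>2 \<le> (4 * r)\<^sup>2"
    by (intro power_mono; simp)+
  moreover have "(norm (P x))\<^sup>2 = (x $ 2)\<^sup>2 + (x $ 3)\<^sup>2 + (x $ 4)\<^sup>2"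
  proof -
    have "(norm x)\<^sup>2 = (x $ 1)\<^sup>2 + (x $ 2)\<^sup>2 + (x $ 3)\<^sup>2 + (x $ 4)\<^sup>2"
      by (simp add: norm_vec_def L2_set_def sum_4)
    moreover have "x \<bullet> e1 = x $ 1" by (simp add: inner_axis)
    ultimately show ?thesis using norm_P[of x] by simp
  qed
  moreover have "(8 * r)\<^sup>2 < (norm (P x))\<^sup>2" using assms r by (intro power_strict_mono) auto
  moreover have "(4 * r)\<^sup>2 = 16 * r\<^sup>2" "(8 * r)\<^sup>2 = 64 * r\<^sup>2" "0 \<le> r\<^sup>2" by (simp_all add: power_mult_distrib)
  ultimately show False unfolding power2_abs by linarith
qed

lemma potential_eta:
  obtains f where "\<And>x. norm (P x) > 8 * r \<Longrightarrow> (f has_derivative (\<lambda>v. \<eta> x \<bullet> v)) (at x)"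
proof -
  have "has_potential \<eta> (\<Union>y\<in>{e2, - e2, e3, - e3, e4, - e4}. halfspace y (4 * r))"
  proof (rule has_potential_cube_exterior)
    fix y assume y: "y \<in> {e2, - e2, e3, - e3, e4, - e4}"
    show "has_potential \<eta> (halfspace y (4 * r))"
      using has_potential_convex[OF open_halfspace convex_halfspace Ck_on_subset[OF Ck_eta halfspace_subset_H[OF y]]]
        curl_free_eta halfspace_subset_H[OF y] unfolding curl_free_def by blast
  qed (use r in \<open>auto simp: inner_axis_axis\<close>)
  then show ?thesis using that P_large_in_halfspaces unfolding has_potential_def by blast
qed

text \<open>Three nested bands, measured by the ratio of \<open>\<bar>x \<bullet> e1\<bar>\<close>
  to \<open>norm x\<close>: the cut-off varies below 1/2, \<open>O0\<close> ends at 3/4 and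
  \<open>D0\<close> at 4/5. On \<open>O0\<close> at least a quarter of the norm is orthogonal to
  \<open>e1\<close>, so the factor 40 gives \<open>norm (P x) > 10 * r\<close>, inside the domain of
  the potential.\<close>

definition "R = 40 * r"
definition "O0 = {x. norm x > R \<and> \<bar>x \<bullet> e1\<bar> < 3 / 4 * norm x}"

lemma R: "R \<ge> 40" using r by (simp add: R_def)

lemma open_O0: "open O0"
proof -
  have "O0 = {x. R < norm x} \<inter> {x. \<bar>x \<bullet> e1\<bar> < 3 / 4 * norm x}" by (auto simp: O0_def)
  then show ?thesis by (simp add: open_Int open_Collect_less continuous_intros)
qed

lemma O0_nz: "0 \<notin> O0" using R by (auto simp: O0_def)

lemma O0_P:
  assumes x: "x \<in> O0"
  shows "16 * (norm (P x))\<^sup>2 \<ge> 7 * (norm x)\<^sup>2"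
proof -
  have "\<bar>x \<bullet> e1\<bar>\<^sup>2 \<le> (3 / 4 * norm x)\<^sup>2" using x by (intro power_mono) (auto simp: O0_def)
  then show ?thesis using norm_P[of x] by (simp add: power_mult_distrib power_divide)
qed

lemma O0_P_lower: "x \<in> O0 \<Longrightarrow> norm (P x) \<ge> norm x / 4"
proof (rule power2_le_imp_le)
  assume "x \<in> O0"
  note O0_P[OF this]
  moreover have "(norm x / 4)\<^sup>2 = (norm x)\<^sup>2 / 16" by (simp add: power_divide)
  moreover have "0 \<le> (norm x)\<^sup>2" by simp
  ultimately show "(norm x / 4)\<^sup>2 \<le> (norm (P x))\<^sup>2" by linarith
qed simp

lemma O0_subset_D0: "O0 \<subseteq> D0" using r by (auto simp: O0_def D0_iff R_def)

lemma O0_large: "x \<in> O0 \<Longrightarrow> norm (P x) > 8 * r"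
  using O0_P_lower[of x] r by (auto simp: O0_def R_def)

text \<open>The segment from \<open>P x\<close> to \<open>x\<close> is parallel to
  \<open>e1\<close>, along which \<delta> is constant. The gap between 3/4 and 4/5 leaves room for
  the whole segment to lie in \<open>D0\<close>.\<close>

lemma delta_eq_eta:
  assumes x: "x \<in> O0" shows "\<delta> x = \<eta> x"
proof -
  have in_D0: "P x + s *\<^sub>R ((x \<bullet> e1) *\<^sub>R e1) \<in> D0" if s: "s \<in> {0..1}" for s
  proof -
    let ?y = "P x + s *\<^sub>R ((x \<bullet> e1) *\<^sub>R e1)"
    have Py: "P ?y = P x" and ye: "?y \<bullet> e1 = s * (x \<bullet> e1)"
      by (simp_all add: P_def inner_add_left inner_diff_left inner_axis_axis)
    have big: "norm ?y > 4 * r" using norm_P_le[of ?y] O0_large[OF x] r unfolding Py by simp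
    have "(s * (x \<bullet> e1))\<^sup>2 \<le> (x \<bullet> e1)\<^sup>2"
      using s by (simp add: power_mult_distrib mult_left_le_one_le power_le_one)
    moreover have "7 * (x \<bullet> e1)\<^sup>2 \<le> 9 * (norm (P x))\<^sup>2" using O0_P[OF x] norm_P[of x] by simp
    moreover have "norm (P x) > 0" using O0_large[OF x] r by linarith
    then have "(norm (P x))\<^sup>2 > 0" by (rule zero_less_power)
    ultimately have "9 * (s * (x \<bullet> e1))\<^sup>2 < 16 * (norm (P x))\<^sup>2" by linarith
    then have "(s * (x \<bullet> e1))\<^sup>2 < (4 / 5 * norm ?y)\<^sup>2"
      using norm_P[of ?y] unfolding Py ye by (simp add: power_mult_distrib power_divide)
    then have "\<bar>s * (x \<bullet> e1)\<bar> < 4 / 5 * norm ?y"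
      by (metis abs_of_nonneg abs_square_less_1 mult_nonneg_nonneg norm_ge_zero power2_abs power2_less_imp_less zero_le_divide_iff zero_le_numeral)
    with big show ?thesis unfolding D0_iff ye by blast
  qed
  have "((\<lambda>s. frechet_derivative \<delta> (at (P x + s *\<^sub>R ((x \<bullet> e1) *\<^sub>R e1))) ((x \<bullet> e1) *\<^sub>R e1)) has_integral
     \<delta> (P x + 1 *\<^sub>R ((x \<bullet> e1) *\<^sub>R e1)) - \<delta> (P x + 0 *\<^sub>R ((x \<bullet> e1) *\<^sub>R e1))) {0..1}"
    by (rule integral_along_line) (use D_delta[OF in_D0] in auto)
  moreover have "frechet_derivative \<delta> (at (P x + s *\<^sub>R ((x \<bullet> e1) *\<^sub>R e1))) ((x \<bullet> e1) *\<^sub>R e1) = 0" if "s \<in> {0..1}" for s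
    using linear_scale[OF has_derivative_linear[OF D_delta[OF in_D0[OF that]]]] frechet_delta_e1[OF in_D0[OF that]] by simp
  ultimately have "((\<lambda>s. 0) has_integral \<delta> x - \<delta> (P x)) {0..1::real}"
    by (subst (asm) has_integral_cong[of _ _ "\<lambda>s. 0"]) (auto simp: P_def)
  then have "\<delta> x - \<delta> (P x) = 0" using has_integral_unique[OF _ has_integral_0] by blast
  then show ?thesis by (simp add: \<eta>_def)
qed

section \<open>Radial normalization of the potential\<close>

definition N :: "real^4 \<Rightarrow> real^4" where "N x = norm x *\<^sub>R e2"

lemma norm_N: "norm (N x) = norm x" by (simp add: N_def)

lemma P_N: "P (N x) = N x" by (simp add: P_def N_def inner_axis_axis)

lemma open_nz: "open (- {0::real^4})" by (simp add: open_Compl)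

lemma symb_N: "symb (- 1) N (- {0})"
proof (rule symb_homogeneous(1))
  show "Ck_on 1 N (- {0})" unfolding N_def
    by (intro Ck_on_scaleR Ck_on_norm Ck_on_const open_nz) auto
qed (simp add: N_def)

lemma D_N: "x \<noteq> 0 \<Longrightarrow> (N has_derivative (\<lambda>v. ((x \<bullet> v) / norm x) *\<^sub>R e2)) (at x)"
  unfolding N_def
  using has_derivative_scaleR_left[OF has_derivative_norm[of x], of e2]
  by (simp add: sgn_div_norm inner_commute divide_inverse mult.commute)

text \<open>The gradient of \<open>potential (N x)\<close> by the chain rule. The formula mentions
  \<delta> only and not the potential, so \<kappa> inherits the decay of \<delta>.\<close>

definition \<kappa> :: "real^4 \<Rightarrow> real^4" where
  "\<kappa> x = (\<delta> (N x) \<bullet> e2) *\<^sub>R (inverse (norm x) *\<^sub>R x)"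

lemma N_D0: "norm x > 4 * r \<Longrightarrow> N x \<in> D0"
proof -
  assume x: "norm x > 4 * r"
  moreover have "N x \<bullet> e1 = 0" by (simp add: N_def inner_axis_axis)
  moreover have "norm x > 0" using x r by linarith
  ultimately show ?thesis unfolding D0_iff norm_N by simp
qed

lemma symb_kappa: "symb \<epsilon> \<kappa> (- cball 0 (4 * r))"
proof -
  let ?U = "- cball (0::real^4) (4 * r)"
  have U: "open ?U" "0 \<notin> ?U" using r by (auto intro: open_compl_cball)
  have sub: "?U \<subseteq> - {0}" using U by auto
  have 1: "symb \<epsilon> (\<lambda>x. \<delta> (N x)) ?U"
    by (rule symb_compose_norm_preserving[OF U(1) open_D0 U(2) symb_subset[OF symb_N sub] _ _ symb_delta])
       (auto simp: norm_N intro: N_D0)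
  have 2: "symb \<epsilon> (\<lambda>x. \<delta> (N x) \<bullet> e2) ?U" by (rule symb_linear_image[OF U bounded_linear_inner_left 1])
  have "symb 0 (\<lambda>x::real^4. inverse (norm x) *\<^sub>R x) (- {0})"
  proof (rule symb_homogeneous(1))
    show "Ck_on 1 (\<lambda>x::real^4. inverse (norm x) *\<^sub>R x) (- {0})"
      by (intro Ck_on_scaleR Ck_on_inverse Ck_on_norm Ck_on_ident open_nz) auto
  qed simp
  from symb_bilinear[OF U bounded_bilinear_scaleR 2 symb_subset[OF this sub]]
  show ?thesis unfolding \<kappa>_def by simp
qed

definition potential :: "real^4 \<Rightarrow> real" where
  "potential = (SOME f. \<forall>x. norm (P x) > 8 * r \<longrightarrow> (f has_derivative (\<lambda>v. \<eta> x \<bullet> v)) (at x))"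

lemma D_potential: "norm (P x) > 8 * r \<Longrightarrow> (potential has_derivative (\<lambda>v. \<eta> x \<bullet> v)) (at x)"
proof -
  have "\<exists>f. \<forall>x. norm (P x) > 8 * r \<longrightarrow> (f has_derivative (\<lambda>v. \<eta> x \<bullet> v)) (at x)"
    using potential_eta by metis
  then have "\<forall>x. norm (P x) > 8 * r \<longrightarrow> (potential has_derivative (\<lambda>v. \<eta> x \<bullet> v)) (at x)"
    unfolding potential_def by (rule someI_ex)
  then show "norm (P x) > 8 * r \<Longrightarrow> (potential has_derivative (\<lambda>v. \<eta> x \<bullet> v)) (at x)" by blast
qed

lemma D_potential_N:
  assumes "norm x > 8 * r"
  shows "((\<lambda>x. potential (N x)) has_derivative (\<lambda>v. \<kappa> x \<bullet> v)) (at x)"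
proof -
  have "x \<noteq> 0" using assms r by auto
  from has_derivative_compose[OF D_N[OF this] D_potential] assms
  have "((\<lambda>x. potential (N x)) has_derivative (\<lambda>v. \<eta> (N x) \<bullet> (((x \<bullet> v) / norm x) *\<^sub>R e2))) (at x)"
    by (simp add: P_N norm_N)
  moreover have "\<eta> (N x) \<bullet> (((x \<bullet> v) / norm x) *\<^sub>R e2) = \<kappa> x \<bullet> v" for v
    by (simp add: \<eta>_def P_N \<kappa>_def divide_inverse mult_ac)
  ultimately show ?thesis by simp
qed

text \<open>\<kappa> is a gradient and is \<open>C\<^sup>1\<close>, so the function
  \<open>potential (N x)\<close> is \<open>C\<^sup>2\<close> there and its second derivatives
  commute.\<close>

lemma curl_free_kappa: "curl_free \<kappa> (- cball 0 (8 * r))"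
  unfolding curl_free_def
proof (intro ballI allI)
  let ?U = "- cball (0::real^4) (8 * r)"
  let ?f = "\<lambda>x. potential (N x)"
  fix x a b assume x: "x \<in> ?U"
  have U: "open ?U" by (rule open_compl_cball)
  have sub: "?U \<subseteq> - cball 0 (4 * r)" using r by auto
  have ck: "Ck_on 1 \<kappa> ?U" by (rule Ck_on_subset[OF symb_Ck[OF symb_kappa] sub])
  have D: "(?f has_derivative (\<lambda>v. \<kappa> y \<bullet> v)) (at y)" if "y \<in> ?U" for y
    by (rule D_potential_N) (use that in auto)
  have "Ck_on (Suc 1) ?f ?U"
    using Ck_on_SucI[OF U D] Ck_on_inner[OF U ck Ck_on_const] by blast
  then have c2: "Ck_on 2 ?f ?U" by (simp add: numeral_2_eq_2)
  have k: "frechet_derivative (\<lambda>y. frechet_derivative ?f (at y) a) (at x) b = frechet_derivative \<kappa> (at x) b \<bullet> a" for a b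
  proof -
    have "frechet_derivative (\<lambda>y. frechet_derivative ?f (at y) a) (at x) = frechet_derivative (\<lambda>y. \<kappa> y \<bullet> a) (at x)"
      by (rule frechet_derivative_cong[OF U x]) (simp add: frechet_derivative_eqI[OF D])
    also have "\<dots> = (\<lambda>v. frechet_derivative \<kappa> (at x) v \<bullet> a)"
      by (rule frechet_derivative_eqI[OF has_derivative_inner_left[OF Ck_on_1_has_derivative[OF ck x]]])
    finally show ?thesis by simp
  qed
  from second_frechet_derivative_commute[OF U x c2, of a b]
  show "frechet_derivative \<kappa> (at x) a \<bullet> b = frechet_derivative \<kappa> (at x) b \<bullet> a"
    unfolding k by simp
qed

definition "G x = potential x - potential (N x)"

lemma D_G:
  assumes x: "x \<in> O0"
  shows "(G has_derivative (\<lambda>v. (\<delta> x - \<kappa> x) \<bullet> v)) (at x)"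
proof -
  have "norm x > 8 * r" using x r by (auto simp: O0_def R_def)
  from has_derivative_diff[OF D_potential[OF O0_large[OF x]] D_potential_N[OF this]]
  show ?thesis unfolding G_def delta_eq_eta[OF x] by (simp add: inner_diff_left)
qed

text \<open>The gradient \<eta> is integrated along a path from \<open>N x\<close> over
  \<open>m\<close> to \<open>x\<close> of length at most \<open>4 * norm x\<close>, on which
  \<open>norm (P y) \<ge> norm x / 4\<close> and hence \<eta> is O(|x|^(-\<epsilon>)). No integral
  reaches infinity, which is why all values of \<epsilon> are treated alike.\<close>

lemma G_bound:
  obtains C where "\<And>x. x \<in> O0 \<Longrightarrow> norm (G x) \<le> C * norm x powr (1 - \<epsilon>)"
proof -
  obtain C where C: "C \<ge> 0" "\<And>x. x \<in> D0 \<Longrightarrow> norm (\<delta> x) \<le> C * norm x powr (- \<epsilon>)"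
    by (rule symbE[OF symb_delta]) blast
  show ?thesis
  proof (rule that[of "4 * C * 4 powr \<epsilon>"])
    fix x assume x: "x \<in> O0"
    then have nx: "norm x > 40 * r" by (simp add: O0_def R_def)
    then have x0: "norm x > 0" using r by linarith
    define B where "B = C * (norm x / 4) powr (- \<epsilon>)"
    have inc: "\<bar>potential b - potential a\<bar> \<le> B * norm (b - a)"
      if far: "\<And>t. t \<in> {0..1} \<Longrightarrow> norm (P (a + t *\<^sub>R (b - a))) \<ge> norm x / 4" for a b
    proof (rule potential_increment[where \<eta>=\<eta>])
      fix t :: real assume t: "t \<in> {0..1}"
      have big: "norm (P (a + t *\<^sub>R (b - a))) > 8 * r" using far[OF t] nx r by linarith
      show "(potential has_derivative (\<lambda>v. \<eta> (a + t *\<^sub>R (b - a)) \<bullet> v)) (at (a + t *\<^sub>R (b - a)))"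
        by (rule D_potential[OF big])
      have "a + t *\<^sub>R (b - a) \<in> H" using big r by (simp add: H_def)
      then have "norm (\<eta> (a + t *\<^sub>R (b - a))) \<le> C * norm (P (a + t *\<^sub>R (b - a))) powr (- \<epsilon>)"
        unfolding \<eta>_def by (intro C(2) P_D0)
      also have "\<dots> \<le> B" unfolding B_def
        using far[OF t] x0 eps C(1) by (intro mult_left_mono powr_mono2') auto
      finally show "norm (\<eta> (a + t *\<^sub>R (b - a))) \<le> B" .
    qed
    \<comment> \<open>The direct segment from \<open>N x\<close> to \<open>x\<close> might cross the
      \<open>e1\<close>-axis. The detour through \<open>m\<close>, on the \<open>e3\<close>-axis on
      the same side as \<open>x\<close>, avoids this: both of its segments join points whose
      projections have a nonnegative inner product.\<close>
    define \<sigma> :: real where "\<sigma> = (if x \<bullet> e3 \<ge> 0 then 1 else - 1)"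
    have \<sigma>: "\<sigma>\<^sup>2 = 1" "\<sigma> * (x \<bullet> e3) \<ge> 0" by (auto simp: \<sigma>_def)
    define m where "m = (\<sigma> * norm x) *\<^sub>R e3"
    have nm: "norm m = norm x" by (auto simp: m_def \<sigma>_def)
    have half: "1 / 2 \<le> (1 - t)\<^sup>2 + t\<^sup>2" for t :: real
      using zero_le_power2[of "1 - 2 * t"] by (simp add: power2_eq_square algebra_simps)
    \<comment> \<open>7/32 is the product of 7/16, the share of the squared norm orthogonal to
      \<open>e1\<close> on \<open>O0\<close>, and 1/2 from \<open>half\<close>; it exceeds the
      required 1/16.\<close>
    have lower: "norm x / 4 \<le> norm y" if "7 / 32 * (norm x)\<^sup>2 \<le> (norm y)\<^sup>2" for y :: "real^4"
    proof (rule power2_le_imp_le)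
      have "0 \<le> (norm x)\<^sup>2" by simp
      moreover have "(norm x / 4)\<^sup>2 = (norm x)\<^sup>2 / 16" by (simp add: power_divide)
      ultimately show "(norm x / 4)\<^sup>2 \<le> (norm y)\<^sup>2" using that by linarith
    qed simp
    have 1: "\<bar>potential m - potential (N x)\<bar> \<le> B * norm (m - N x)"
    proof (rule inc, rule lower)
      fix t :: real
      let ?y = "N x + t *\<^sub>R (m - N x)"
      have "?y = ((1 - t) * norm x) *\<^sub>R e2 + (t * \<sigma> * norm x) *\<^sub>R e3"
        by (simp add: N_def m_def algebra_simps)
      then have y: "P ?y = ((1 - t) * norm x) *\<^sub>R e2 + (t * \<sigma> * norm x) *\<^sub>R e3"
        by (simp add: P_def inner_add_left inner_axis_axis)
      have "(norm (P ?y))\<^sup>2 = ((1 - t)\<^sup>2 + t\<^sup>2) * (norm x)\<^sup>2"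
        unfolding y by (subst norm_add_Pythagorean)
          (simp_all add: orthogonal_def inner_axis_axis power_mult_distrib \<sigma> distrib_right)
      moreover have "1 / 2 * (norm x)\<^sup>2 \<le> ((1 - t)\<^sup>2 + t\<^sup>2) * (norm x)\<^sup>2"
        by (intro mult_right_mono half) simp
      moreover have "0 \<le> (norm x)\<^sup>2" by simp
      ultimately show "7 / 32 * (norm x)\<^sup>2 \<le> (norm (P ?y))\<^sup>2" by linarith
    qed
    have 2: "\<bar>potential x - potential m\<bar> \<le> B * norm (x - m)"
    proof (rule inc, rule lower)
      fix t :: real assume t: "t \<in> {0..1}"
      let ?y = "m + t *\<^sub>R (x - m)"
      have Pe: "P e3 = e3" by (simp add: P_def inner_axis_axis)
      interpret P: linear P by (rule bounded_linear.linear[OF bounded_linear_P])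
      have y: "P ?y = ((1 - t) * \<sigma> * norm x) *\<^sub>R e3 + t *\<^sub>R P x"
        by (simp add: P.add P.diff P.scale m_def Pe algebra_simps)
      have gen: "(norm (c *\<^sub>R e3 + t *\<^sub>R w))\<^sup>2 = c\<^sup>2 + (t * norm w)\<^sup>2 + 2 * (c * t) * (w \<bullet> e3)" for c w
        by (simp add: power2_norm_eq_inner power_mult_distrib inner_add_left inner_add_right inner_axis_axis
            inner_commute[of e3] power2_eq_square[of t] power2_eq_square[of c]) (simp add: algebra_simps)
      have "P x \<bullet> e3 = x \<bullet> e3" by (simp add: P_def inner_diff_left inner_axis_axis)
      then have "(norm (P ?y))\<^sup>2 = ((1 - t) * \<sigma> * norm x)\<^sup>2 + (t * norm (P x))\<^sup>2 + 2 * ((1 - t) * t * norm x) * (\<sigma> * (x \<bullet> e3))"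
        unfolding y gen by (simp add: mult_ac)
      moreover have "0 \<le> 2 * ((1 - t) * t * norm x) * (\<sigma> * (x \<bullet> e3))"
        using mult_nonneg_nonneg[OF _ \<sigma>(2), of "2 * ((1 - t) * t * norm x)"] t by simp
      moreover have "((1 - t) * \<sigma> * norm x)\<^sup>2 = (1 - t)\<^sup>2 * (norm x)\<^sup>2" by (simp add: power_mult_distrib \<sigma>)
      moreover have "(1 - t)\<^sup>2 * (norm x)\<^sup>2 \<ge> 7 / 16 * ((1 - t)\<^sup>2 * (norm x)\<^sup>2)" by simp
      moreover have "(t * norm (P x))\<^sup>2 \<ge> 7 / 16 * (t\<^sup>2 * (norm x)\<^sup>2)"
        using mult_left_mono[OF O0_P[OF x], of "t\<^sup>2"] by (simp add: power_mult_distrib)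
      moreover have "1 / 2 * (norm x)\<^sup>2 \<le> ((1 - t)\<^sup>2 + t\<^sup>2) * (norm x)\<^sup>2"
        by (intro mult_right_mono half) simp
      moreover have "((1 - t)\<^sup>2 + t\<^sup>2) * (norm x)\<^sup>2 = (1 - t)\<^sup>2 * (norm x)\<^sup>2 + t\<^sup>2 * (norm x)\<^sup>2"
        by (rule distrib_right)
      ultimately show "7 / 32 * (norm x)\<^sup>2 \<le> (norm (P ?y))\<^sup>2" by linarith
    qed
    have B0: "B \<ge> 0" using C(1) by (simp add: B_def)
    have "norm (m - N x) \<le> 2 * norm x" "norm (x - m) \<le> 2 * norm x"
      using norm_triangle_ineq4[of m "N x"] norm_triangle_ineq4[of x m] by (simp_all add: nm norm_N)
    then have "B * norm (m - N x) \<le> B * (2 * norm x)" "B * norm (x - m) \<le> B * (2 * norm x)"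
      using B0 by (auto intro: mult_left_mono)
    moreover have "norm (G x) \<le> \<bar>potential x - potential m\<bar> + \<bar>potential m - potential (N x)\<bar>"
      by (simp add: G_def)
    ultimately have "norm (G x) \<le> B * (4 * norm x)" using 1 2 by linarith
    also have "B = C * 4 powr \<epsilon> * norm x powr (- \<epsilon>)"
      using x0 by (simp add: B_def powr_divide powr_minus field_simps)
    also have "C * 4 powr \<epsilon> * norm x powr (- \<epsilon>) * (4 * norm x) = (4 * C * 4 powr \<epsilon>) * norm x powr (1 - \<epsilon>)"
      using x0 by (simp add: powr_diff powr_minus field_simps)
    finally show "norm (G x) \<le> (4 * C * 4 powr \<epsilon>) * norm x powr (1 - \<epsilon>)" .
  qed
qed

lemma O0_subset_kappa: "O0 \<subseteq> - cball 0 (8 * r)" "O0 \<subseteq> - cball 0 (4 * r)"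
  using r by (auto simp: O0_def R_def)

lemma symb_G: "symb (\<epsilon> - 1) G O0"
proof -
  obtain C where C: "\<And>x. x \<in> O0 \<Longrightarrow> norm (G x) \<le> C * norm x powr (1 - \<epsilon>)" by (rule G_bound) blast
  have s: "symb \<epsilon> (\<lambda>x. \<delta> x - \<kappa> x) O0"
    by (rule symb_minus[OF open_O0 O0_nz symb_subset[OF symb_delta O0_subset_D0] symb_subset[OF symb_kappa O0_subset_kappa(2)]])
  obtain C' where C': "C' \<ge> 0" "\<And>x. x \<in> O0 \<Longrightarrow> norm (\<delta> x - \<kappa> x) \<le> C' * norm x powr (- \<epsilon>)"
    by (rule symbE[OF s]) blast
  show ?thesis
  proof (rule symbI[OF open_O0 D_G])
    show "continuous_on O0 (\<lambda>x. (\<delta> x - \<kappa> x) \<bullet> v)" for v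
      by (intro continuous_on_inner continuous_on_const Ck_on_imp_continuous_on[OF symb_Ck[OF s]])
    show "norm (G x) \<le> C * norm x powr (- (\<epsilon> - 1))" if "x \<in> O0" for x using C[OF that] by simp
    show "norm ((\<delta> x - \<kappa> x) \<bullet> v) \<le> C' * norm x powr (- (\<epsilon> - 1) - 1) * norm v" if "x \<in> O0" for x v
    proof -
      have "norm ((\<delta> x - \<kappa> x) \<bullet> v) \<le> norm (\<delta> x - \<kappa> x) * norm v" using Cauchy_Schwarz_ineq2 by simp
      also have "\<dots> \<le> C' * norm x powr (- \<epsilon>) * norm v" by (intro mult_right_mono C'(2) that) simp
      finally show ?thesis by simp
    qed
  qed
qed

section \<open>Gluing the two ray primitives\<close>

definition cut :: "real^4 \<Rightarrow> real" where "cut x = smoothstep (1 / 2 - (x \<bullet> e1) * inverse (norm x))"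

definition grad_cut :: "real^4 \<Rightarrow> real^4" where "grad_cut x = (\<Sum>b\<in>Basis. frechet_derivative cut (at x) b *\<^sub>R b)"

lemma Ck_cut: "Ck_on 2 cut (- {0})"
  unfolding cut_def
  by (rule Ck_on_compose[OF open_nz open_UNIV Ck_on_smoothstep])
     (auto intro!: Ck_on_minus Ck_on_mult Ck_on_inner Ck_on_inverse Ck_on_norm Ck_on_const Ck_on_ident open_nz)

lemma Ck_1_cut: "Ck_on (Suc 1) cut (- {0})" "Ck_on 1 cut (- {0})"
  using Ck_cut Ck_on_mono[OF Ck_cut, of 1] by (simp_all add: numeral_2_eq_2)

lemma cut_homogeneous: "x \<noteq> 0 \<Longrightarrow> c > 0 \<Longrightarrow> cut (c *\<^sub>R x) = c powr (- 0) *\<^sub>R cut x"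
proof -
  assume "x \<noteq> 0" "c > 0"
  moreover from this have "((c *\<^sub>R x) \<bullet> e1) * inverse (norm (c *\<^sub>R x)) = (x \<bullet> e1) * inverse (norm x)"
    by (simp add: field_simps)
  ultimately show ?thesis unfolding cut_def by (simp only: minus_zero powr_zero_eq_one scaleR_one scaleR_eq_0_iff) simp
qed

lemma symb_cut: "symb 0 cut (- {0})"
  by (rule symb_homogeneous(1)[OF Ck_1_cut(2) cut_homogeneous])

lemma D_cut: "x \<noteq> 0 \<Longrightarrow> (cut has_derivative frechet_derivative cut (at x)) (at x)"
  by (rule Ck_on_1_has_derivative[OF Ck_1_cut(2)]) simp

lemma Ck_grad_cut: "Ck_on 1 grad_cut (- {0})"
  unfolding grad_cut_def
  by (intro Ck_on_sum Ck_on_scaleR Ck_on_const Ck_on_frechet[OF open_nz Ck_1_cut(1)] open_nz)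

lemma symb_grad_cut: "symb 1 grad_cut (- {0})"
proof (rule symb_homogeneous(1)[OF Ck_grad_cut])
  fix x :: "real^4" and c :: real assume "x \<noteq> 0" "c > 0"
  from symb_homogeneous(2)[OF Ck_1_cut(2) cut_homogeneous this]
  show "grad_cut (c *\<^sub>R x) = c powr (- 1) *\<^sub>R grad_cut x"
    by (simp add: grad_cut_def scaleR_sum_right)
qed

lemma grad_cut_inner: "x \<noteq> 0 \<Longrightarrow> grad_cut x \<bullet> v = frechet_derivative cut (at x) v"
proof -
  assume x: "x \<noteq> 0"
  have "grad_cut x \<bullet> v = (\<Sum>b\<in>Basis. (v \<bullet> b) *\<^sub>R frechet_derivative cut (at x) b)"
    by (simp add: grad_cut_def inner_sum_left inner_commute[of v] mult.commute)
  also have "\<dots> = frechet_derivative cut (at x) v"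
    by (rule linear_basis_sum[OF has_derivative_linear[OF D_cut[OF x]], symmetric])
  finally show ?thesis .
qed

lemma curl_free_grad_cut: "curl_free grad_cut (- {0})"
  unfolding curl_free_def
proof (intro ballI allI)
  fix x a b assume x: "x \<in> - {0::real^4}"
  have k: "frechet_derivative (\<lambda>y. frechet_derivative cut (at y) a) (at x) b = frechet_derivative grad_cut (at x) b \<bullet> a" for a b
  proof -
    have "frechet_derivative (\<lambda>y. frechet_derivative cut (at y) a) (at x) = frechet_derivative (\<lambda>y. grad_cut y \<bullet> a) (at x)"
      by (rule frechet_derivative_cong[OF open_nz x]) (simp add: grad_cut_inner)
    also have "\<dots> = (\<lambda>v. frechet_derivative grad_cut (at x) v \<bullet> a)"
      by (rule frechet_derivative_eqI[OF has_derivative_inner_left[OF Ck_on_1_has_derivative[OF Ck_grad_cut x]]])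
    finally show ?thesis by simp
  qed
  from second_frechet_derivative_commute[OF open_nz x Ck_cut, of a b]
  show "frechet_derivative grad_cut (at x) a \<bullet> b = frechet_derivative grad_cut (at x) b \<bullet> a"
    unfolding k by simp
qed

text \<open>On the band the gradient of \<open>G\<close> is
  \<open>\<theta>p - \<theta>m - \<kappa>\<close>, so the right-hand side is \<theta>p minus the
  gradient of \<open>cut x * G x\<close>: the interpolation changes \<theta>p by an exact form only.
  The last term has order \<open>(\<epsilon> - 1) + 1 = \<epsilon>\<close> like the others.\<close>

definition "\<theta>0 x = (1 - cut x) *\<^sub>R \<theta>p x + cut x *\<^sub>R (\<theta>m x + \<kappa> x) - G x *\<^sub>R grad_cut x"

definition "Ap = {x. norm x > R \<and> x \<bullet> e1 > 1 / 2 * norm x}"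
definition "Am = {x. norm x > R \<and> - (x \<bullet> e1) > 1 / 2 * norm x}"

lemma regions: "open Ap" "open Am" "- cball 0 R = Ap \<union> Am \<union> O0"
  "Ap \<subseteq> ray_cone e1 (4 * r)" "Am \<subseteq> ray_cone (- e1) (4 * r)" "Am \<subseteq> - cball 0 (8 * r)"
proof -
  have "Ap = {x. R < norm x} \<inter> {x. 1 / 2 * norm x < x \<bullet> e1}" "Am = {x. R < norm x} \<inter> {x. 1 / 2 * norm x < - (x \<bullet> e1)}"
    by (auto simp: Ap_def Am_def)
  then show "open Ap" "open Am" by (simp_all add: open_Int open_Collect_less continuous_intros)
  show "- cball 0 R = Ap \<union> Am \<union> O0" using R by (auto simp: Ap_def Am_def O0_def abs_less_iff)
  show "Ap \<subseteq> ray_cone e1 (4 * r)" "Am \<subseteq> ray_cone (- e1) (4 * r)" "Am \<subseteq> - cball 0 (8 * r)"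
    using r by (auto simp: Ap_def Am_def ray_cone_def R_def)
qed

lemma cut_locally_constant:
  assumes "open A" "x \<in> A" "0 \<notin> A" "\<And>y. y \<in> A \<Longrightarrow> cut y = c"
  shows "grad_cut x = 0"
  using frechet_derivative_cong[OF assms(1,2), of cut "\<lambda>_. c"] assms(4)
  by (simp add: grad_cut_def frechet_derivative_const)

text \<open>Beyond \<open>O0\<close> nothing is known about \<open>G\<close>; it drops out because
  the cut-off is locally constant and its gradient vanishes.\<close>

lemma theta0_Ap: "x \<in> Ap \<Longrightarrow> \<theta>p x = \<theta>0 x"
proof -
  have c: "cut y = 0" if "y \<in> Ap" for y
  proof -
    have "norm y > 0" using that R by (auto simp: Ap_def)
    then have "1 / 2 \<le> (y \<bullet> e1) * inverse (norm y)" using that by (simp add: Ap_def field_simps)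
    then show ?thesis unfolding cut_def by (intro smoothstep_0) simp
  qed
  moreover have "0 \<notin> Ap" using R by (auto simp: Ap_def)
  moreover assume x: "x \<in> Ap"
  ultimately have "grad_cut x = 0" using cut_locally_constant[OF regions(1), of x 0] by blast
  then show ?thesis by (simp add: \<theta>0_def c x)
qed

lemma theta0_Am: "x \<in> Am \<Longrightarrow> \<theta>m x + \<kappa> x = \<theta>0 x"
proof -
  have c: "cut y = 1" if "y \<in> Am" for y
  proof -
    have "norm y > 0" using that R by (auto simp: Am_def)
    then have "(y \<bullet> e1) * inverse (norm y) \<le> - (1 / 2)" using that by (simp add: Am_def field_simps)
    then show ?thesis unfolding cut_def by (intro smoothstep_1) simp
  qed
  moreover have "0 \<notin> Am" using R by (auto simp: Am_def)
  moreover assume x: "x \<in> Am"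
  ultimately have "grad_cut x = 0" using cut_locally_constant[OF regions(2), of x 1] by blast
  then show ?thesis by (simp add: \<theta>0_def c x)
qed

lemma O0_cones: "O0 \<subseteq> ray_cone e1 (4 * r)" "O0 \<subseteq> ray_cone (- e1) (4 * r)"
  using O0_subset_D0 by (auto simp: D0_def)

lemma symb_theta0: "symb \<epsilon> \<theta>0 (- cball 0 R)"
proof -
  have Am0: "0 \<notin> Am" using R by (auto simp: Am_def)
  have O0s: "O0 \<subseteq> - {0}" using O0_nz by auto
  have 1: "symb \<epsilon> \<theta>0 Ap"
    by (rule symb_cong[OF regions(1) theta0_Ap symb_subset[OF ray_primitive_plus(1) regions(4)]])
  have "Am \<subseteq> - cball 0 (4 * r)" using regions(6) r by auto
  then have 2: "symb \<epsilon> \<theta>0 Am"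
    by (intro symb_cong[OF regions(2) theta0_Am] symb_add[OF regions(2)] symb_subset[OF ray_primitive_minus(1) regions(5)]
        symb_subset[OF symb_kappa])
  have c: "symb 0 cut O0" "symb 0 (\<lambda>x. 1 - cut x) O0"
    using symb_subset[OF symb_cut O0s] symb_minus[OF open_O0 O0_nz symb_const[OF O0_nz] symb_subset[OF symb_cut O0s]] by blast+
  note bil = symb_bilinear[OF open_O0 O0_nz bounded_bilinear_scaleR]
  have "symb \<epsilon> (\<lambda>x. (1 - cut x) *\<^sub>R \<theta>p x) O0"
    using bil[OF c(2) symb_subset[OF ray_primitive_plus(1) O0_cones(1)]] by simp
  moreover have "symb \<epsilon> (\<lambda>x. cut x *\<^sub>R (\<theta>m x + \<kappa> x)) O0"
    using bil[OF c(1) symb_add[OF open_O0 symb_subset[OF ray_primitive_minus(1) O0_cones(2)] symb_subset[OF symb_kappa O0_subset_kappa(2)]]]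
    by simp
  moreover have "symb \<epsilon> (\<lambda>x. G x *\<^sub>R grad_cut x) O0"
    using bil[OF symb_G symb_subset[OF symb_grad_cut O0s]] by simp
  ultimately have 3: "symb \<epsilon> \<theta>0 O0"
    unfolding \<theta>0_def by (intro symb_minus symb_add open_O0 O0_nz) simp_all
  show ?thesis unfolding regions(3)
    by (intro symb_Un open_Un regions(1,2) open_O0 1 2 3)
qed

lemma prim_theta0: "primitive_of F \<theta>0 (- cball 0 R)"
proof -
  have 1: "primitive_of F \<theta>0 Ap"
    by (rule primitive_of_cong[OF regions(1) theta0_Ap primitive_of_subset[OF ray_primitive_plus(2) regions(4)]])
  have D\<kappa>: "(\<kappa> has_derivative frechet_derivative \<kappa> (at x)) (at x)" if "x \<in> - cball 0 (8 * r)" for x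
    by (rule Ck_on_1_has_derivative[OF symb_Ck[OF symb_kappa]]) (use that r in auto)
  have 2: "primitive_of F \<theta>0 Am"
  proof (rule primitive_of_cong[OF regions(2) theta0_Am])
    show "primitive_of F (\<lambda>x. \<theta>m x + \<kappa> x) Am"
      unfolding primitive_of_def
    proof (intro ballI allI)
      fix x a b assume x: "x \<in> Am"
      have k: "x \<in> - cball 0 (8 * r)" and m: "x \<in> ray_cone (- e1) (4 * r)" using regions(5,6) x by blast+
      have "frechet_derivative (\<lambda>x. \<theta>m x + \<kappa> x) (at x) = (\<lambda>v. frechet_derivative \<theta>m (at x) v + frechet_derivative \<kappa> (at x) v)"
        by (rule frechet_derivative_eqI[OF has_derivative_add[OF D_theta_minus[OF m] D\<kappa>[OF k]]])
      moreover have "frechet_derivative \<kappa> (at x) a \<bullet> b = frechet_derivative \<kappa> (at x) b \<bullet> a"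
        using curl_free_kappa k unfolding curl_free_def by blast
      moreover have "frechet_derivative \<theta>m (at x) a \<bullet> b - frechet_derivative \<theta>m (at x) b \<bullet> a = a \<bullet> (F x *v b)"
        using ray_primitive_minus(2) m unfolding primitive_of_def by blast
      ultimately show "frechet_derivative (\<lambda>x. \<theta>m x + \<kappa> x) (at x) a \<bullet> b -
        frechet_derivative (\<lambda>x. \<theta>m x + \<kappa> x) (at x) b \<bullet> a = a \<bullet> (F x *v b)"
        by (simp add: inner_add_left)
    qed
  qed
  have 3: "primitive_of F \<theta>0 O0"
    unfolding primitive_of_def
  proof (intro ballI allI)
    fix x a b assume x: "x \<in> O0"
    have k: "x \<in> - cball 0 (8 * r)" and m: "x \<in> ray_cone (- e1) (4 * r)" and p: "x \<in> ray_cone e1 (4 * r)"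
      using O0_cones O0_subset_kappa x by blast+
    have x0: "x \<noteq> 0" using x O0_nz by auto
    have Dg: "(grad_cut has_derivative frechet_derivative grad_cut (at x)) (at x)"
      by (rule Ck_on_1_has_derivative[OF Ck_grad_cut]) (simp add: x0)
    let ?c = "frechet_derivative cut (at x)" and ?p = "frechet_derivative \<theta>p (at x)" and ?m = "frechet_derivative \<theta>m (at x)"
      and ?k = "frechet_derivative \<kappa> (at x)" and ?g = "frechet_derivative grad_cut (at x)"
    let ?D = "\<lambda>v. ((1 - cut x) *\<^sub>R ?p v + (0 - ?c v) *\<^sub>R \<theta>p x) + (cut x *\<^sub>R (?m v + ?k v) + ?c v *\<^sub>R (\<theta>m x + \<kappa> x)) -
        (G x *\<^sub>R ?g v + ((\<delta> x - \<kappa> x) \<bullet> v) *\<^sub>R grad_cut x)"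
    have "(\<theta>0 has_derivative ?D) (at x)" unfolding \<theta>0_def
      by (intro has_derivative_diff has_derivative_add has_derivative_scaleR has_derivative_const D_cut[OF x0]
          D_theta_plus[OF p] D_theta_minus[OF m] D\<kappa>[OF k] D_G[OF x] Dg)
    then have D: "frechet_derivative \<theta>0 (at x) = ?D" by (rule frechet_derivative_eqI)
    have "?p a \<bullet> b - ?p b \<bullet> a = a \<bullet> (F x *v b)" "?m a \<bullet> b - ?m b \<bullet> a = a \<bullet> (F x *v b)"
      using ray_primitive_plus(2) ray_primitive_minus(2) p m unfolding primitive_of_def by blast+
    moreover have "?k a \<bullet> b = ?k b \<bullet> a" "?g a \<bullet> b = ?g b \<bullet> a"
      using curl_free_kappa curl_free_grad_cut k x0 unfolding curl_free_def by auto
    ultimately have e: "?p a \<bullet> b = ?p b \<bullet> a + a \<bullet> (F x *v b)" "?m a \<bullet> b = ?m b \<bullet> a + a \<bullet> (F x *v b)"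
      "?k a \<bullet> b = ?k b \<bullet> a" "?g a \<bullet> b = ?g b \<bullet> a" by simp_all
    show "frechet_derivative \<theta>0 (at x) a \<bullet> b - frechet_derivative \<theta>0 (at x) b \<bullet> a = a \<bullet> (F x *v b)"
      unfolding D by (simp add: inner_add_left inner_diff_left e grad_cut_inner[OF x0] \<delta>_def algebra_simps)
  qed
  show ?thesis using 1 2 3 unfolding regions(3) primitive_of_def by blast
qed

end

lemma symb_weaken:
  assumes f: "symb (q + 1) f U" and U: "\<And>x. x \<in> U \<Longrightarrow> norm x \<ge> 1"
  shows "symb q f U"
proof -
  obtain C where C: "C \<ge> 0" "\<And>x. x \<in> U \<Longrightarrow> norm (f x) \<le> C * norm x powr (- (q + 1))"
    "\<And>x v. x \<in> U \<Longrightarrow> norm (frechet_derivative f (at x) v) \<le> C * norm x powr (- (q + 1) - 1) * norm v"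
    by (rule symbE[OF f]) blast
  have "norm (f x) \<le> C * norm x powr (- q)" if "x \<in> U" for x
    using C(2)[OF that] mult_left_mono[OF powr_mono[OF _ U[OF that], of "- (q + 1)" "- q"] C(1)] by simp
  moreover have "norm (frechet_derivative f (at x) v) \<le> C * norm x powr (- q - 1) * norm v" if "x \<in> U" for x v
  proof -
    have "C * norm x powr (- (q + 1) - 1) * norm v \<le> C * norm x powr (- q - 1) * norm v"
      by (intro mult_right_mono mult_left_mono powr_mono U[OF that] C(1)) auto
    with C(3)[OF that, of v] show ?thesis by linarith
  qed
  ultimately show ?thesis using symb_Ck[OF f] unfolding symb_def by blast
qed

text \<open>Nothing is known about the decay of the second derivatives of \<open>F\<close>, so a primitive built from
  improper integrals is only \<open>C\<^sup>1\<close>. Averaging it over unit segments in direction \<open>e\<close> gains one derivative in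
  that direction, and the chain homotopy between the identity and a translation gives the correction
  needed to stay a primitive of \<open>F\<close>.\<close>

lemma primitive_smoothing:
  fixes F :: "real^4 \<Rightarrow> real^4^4" and \<theta> :: "real^4 \<Rightarrow> real^4"
  assumes r: "r \<ge> 1" and eps: "\<epsilon> > 0" and e: "norm e = 1"
    and F2: "Ck_on 2 F (- cball 0 r)" and F: "symb (1 + \<epsilon>) F (- cball 0 r)"
    and skewF: "\<And>x. x \<in> - cball 0 r \<Longrightarrow> skew (F x)" and closedF: "closed_form F (- cball 0 r)"
    and \<theta>: "symb \<epsilon> \<theta> (- cball 0 r)" and prim: "primitive_of F \<theta> (- cball 0 r)"
  shows "\<exists>\<theta>'. symb \<epsilon> \<theta>' (- cball 0 (r + 1)) \<and> primitive_of F \<theta>' (- cball 0 (r + 1)) \<and>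
    Ck_on 1 (\<lambda>x. frechet_derivative \<theta>' (at x) e) (- cball 0 (r + 1)) \<and>
    (\<forall>b. Ck_on 1 (\<lambda>x. frechet_derivative \<theta> (at x) b) (- cball 0 r) \<longrightarrow>
      Ck_on 1 (\<lambda>x. frechet_derivative \<theta>' (at x) b) (- cball 0 (r + 1)))"
proof -
  let ?S = "- cball (0::real^4) r" and ?S' = "- cball (0::real^4) (r + 1)"
  have S: "open ?S" "open ?S'" "0 \<notin> ?S" "0 \<notin> ?S'" using r by (auto intro: open_compl_cball)
  have sh: "x + s *\<^sub>R e \<in> ?S" if "x \<in> ?S'" "s \<in> {0..1}" for x s
  proof -
    have "norm (s *\<^sub>R e) \<le> 1" using that e by simp
    moreover have "norm x \<le> norm (x + s *\<^sub>R e) + norm (s *\<^sub>R e)"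
      by (metis add_diff_cancel_right' norm_triangle_ineq4)
    ultimately show ?thesis using that by simp
  qed
  let ?g = "\<lambda>y. F y *v e"
  have bl: "bounded_linear (\<lambda>M::real^4^4. M *v e)"
    by (rule bounded_bilinear.bounded_linear_left[OF bounded_bilinear_matrix_vector])
  have g: "symb (1 + \<epsilon>) ?g ?S" by (rule symb_linear_image[OF S(1,3) bl F])
  have g\<epsilon>: "symb \<epsilon> ?g ?S" by (rule symb_weaken) (use g r in \<open>auto simp: add.commute\<close>)
  have g2: "Ck_on (Suc 1) ?g ?S" using Ck_on_linear_image[OF S(1) bl F2] by (simp add: numeral_2_eq_2)
  \<comment> \<open>The translate of \<theta> by \<open>s *\<^sub>R e\<close> becomes a primitive of
    \<open>F\<close> after adding the integral of \<open>?g\<close> over the segment from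
    \<open>x\<close> to \<open>x + s *\<^sub>R e\<close>. Averaging over \<open>s\<close> and
    exchanging the two integrals produces the weight \<open>1 - s\<close>.\<close>
  define w1 w2 :: "real \<Rightarrow> real" where "w1 s = 1" and "w2 s = 1 - s" for s
  have w: "continuous_on {0..1} w1" "continuous_on {0..1} w2" "\<And>s. s \<in> {0..1} \<Longrightarrow> \<bar>w1 s\<bar> \<le> 1" "\<And>s. s \<in> {0..1} \<Longrightarrow> \<bar>w2 s\<bar> \<le> 1"
    unfolding w1_def w2_def by (auto intro!: continuous_intros)
  define M :: "(real \<Rightarrow> real) \<Rightarrow> (real^4 \<Rightarrow> real^4) \<Rightarrow> real^4 \<Rightarrow> real^4"
    where "M w g x = integral {0..1} (\<lambda>s. w s *\<^sub>R g (x + s *\<^sub>R e))" for w g x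
  define \<theta>' where "\<theta>' x = M w1 \<theta> x + M w2 ?g x" for x
  have DM: "(M w h has_derivative (\<lambda>v. M w (\<lambda>y. frechet_derivative h (at y) v) x)) (at x)"
    if "Ck_on 1 h ?S" "continuous_on {0..1} w" "x \<in> ?S'" for w h x
    unfolding M_def by (rule has_derivative_line_integral[OF S(2,1) that(1,3,2) sh])
  have CkM: "Ck_on k (M w h) ?S'" if "Ck_on k h ?S" "continuous_on {0..1} w" for k w h
    unfolding M_def by (rule Ck_on_line_integral[OF S(2,1) that sh])
  have \<theta>1: "Ck_on 1 \<theta> ?S" and g1: "Ck_on 1 ?g ?S" using symb_Ck[OF \<theta>] symb_Ck[OF g] .
  have D\<theta>': "frechet_derivative \<theta>' (at x) v = M w1 (\<lambda>y. frechet_derivative \<theta> (at y) v) x + M w2 (\<lambda>y. frechet_derivative ?g (at y) v) x"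
    if "x \<in> ?S'" for x v
  proof -
    have "(\<theta>' has_derivative (\<lambda>v. M w1 (\<lambda>y. frechet_derivative \<theta> (at y) v) x + M w2 (\<lambda>y. frechet_derivative ?g (at y) v) x)) (at x)"
      unfolding \<theta>'_def by (intro has_derivative_add DM \<theta>1 g1 w that)
    from frechet_derivative_eqI[OF this] show ?thesis by simp
  qed
  have A: "symb \<epsilon> \<theta>' ?S'"
    unfolding \<theta>'_def M_def
    by (intro symb_add[OF S(2)] symb_line_integral \<theta> g\<epsilon> w r) (use eps e in auto)
  have c2: "Ck_on 1 (M w2 (\<lambda>y. frechet_derivative ?g (at y) v)) ?S'" for v
    by (rule CkM[OF Ck_on_frechet[OF S(1) g2] w(2)])
  have D\<theta>: "(\<theta> has_derivative frechet_derivative \<theta> (at y)) (at y)" if "y \<in> ?S" for y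
    by (rule Ck_on_1_has_derivative[OF \<theta>1 that])
  \<comment> \<open>Here the derivative is gained: in direction \<open>e\<close> the derivative of
    the average is the difference of the end values of \<theta>, which is
    \<open>C\<^sup>1\<close>.\<close>
  have C: "Ck_on 1 (\<lambda>x. frechet_derivative \<theta>' (at x) e) ?S'"
  proof (rule Ck_on_cong[OF S(2)])
    show "(\<theta> (x + e) - \<theta> x) + M w2 (\<lambda>y. frechet_derivative ?g (at y) e) x = frechet_derivative \<theta>' (at x) e" if x: "x \<in> ?S'" for x
    proof -
      have "((\<lambda>s. frechet_derivative \<theta> (at (x + s *\<^sub>R e)) e) has_integral \<theta> (x + 1 *\<^sub>R e) - \<theta> (x + 0 *\<^sub>R e)) {0..1}"
        by (rule integral_along_line) (use D\<theta> sh[OF x] in auto)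
      then have "M w1 (\<lambda>y. frechet_derivative \<theta> (at y) e) x = \<theta> (x + e) - \<theta> x"
        unfolding M_def w1_def by (simp add: integral_unique)
      then show ?thesis by (simp add: D\<theta>'[OF x])
    qed
    have "Ck_on 1 (\<lambda>x. \<theta> (x + e)) ?S'"
      by (rule Ck_on_compose[OF S(2,1) \<theta>1]) (use sh[of _ 1] in \<open>auto intro!: Ck_on_add Ck_on_ident Ck_on_const S(2) simp del: Ck_on.simps One_nat_def\<close>)
    moreover have "Ck_on 1 \<theta> ?S'" by (rule Ck_on_subset[OF \<theta>1]) auto
    ultimately show "Ck_on 1 (\<lambda>x. (\<theta> (x + e) - \<theta> x) + M w2 (\<lambda>y. frechet_derivative ?g (at y) e) x) ?S'"
      by (intro Ck_on_add[OF S(2)] Ck_on_minus[OF S(2)] c2)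
  qed
  have D: "Ck_on 1 (\<lambda>x. frechet_derivative \<theta>' (at x) b) ?S'" if "Ck_on 1 (\<lambda>x. frechet_derivative \<theta> (at x) b) ?S" for b
    by (rule Ck_on_cong[OF S(2) _ Ck_on_add[OF S(2) CkM[OF that w(1)] c2[of b]]]) (simp add: D\<theta>')
  have B: "primitive_of F \<theta>' ?S'"
    unfolding primitive_of_def
  proof (intro ballI allI)
    fix x a b assume x: "x \<in> ?S'"
    have DF: "(F has_derivative frechet_derivative F (at y)) (at y)" if "y \<in> ?S" for y
      by (rule Ck_on_1_has_derivative[OF symb_Ck[OF F] that])
    have Dg: "frechet_derivative ?g (at y) v = frechet_derivative F (at y) v *v e" if "y \<in> ?S" for y v
      using frechet_derivative_eqI[OF bounded_linear.has_derivative[OF bl DF[OF that]]] by simp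
    have MI: "M w h x \<bullet> c = integral {0..1} (\<lambda>s. w s * (h (x + s *\<^sub>R e) \<bullet> c))"
      "(\<lambda>s. w s * (h (x + s *\<^sub>R e) \<bullet> c)) integrable_on {0..1}"
      if "continuous_on ?S h" "continuous_on {0..1} w" for w h c
    proof -
      have "continuous_on {0..1} (\<lambda>s. h (x + s *\<^sub>R e))"
        by (rule continuous_on_compose2[OF that(1)]) (use sh[OF x] in \<open>auto intro!: continuous_intros\<close>)
      then have "continuous_on {0..1} (\<lambda>s. w s *\<^sub>R h (x + s *\<^sub>R e))"
        by (intro continuous_on_scaleR that)
      then have i: "(\<lambda>s. w s *\<^sub>R h (x + s *\<^sub>R e)) integrable_on {0..1}" by (rule integrable_continuous_real)
      show "M w h x \<bullet> c = integral {0..1} (\<lambda>s. w s * (h (x + s *\<^sub>R e) \<bullet> c))"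
        using integral_linear[OF i bounded_linear_inner_left[of c]] by (simp add: M_def o_def)
      show "(\<lambda>s. w s * (h (x + s *\<^sub>R e) \<bullet> c)) integrable_on {0..1}"
        using integrable_linear[OF i bounded_linear_inner_left[of c]] by (simp add: o_def)
    qed
    have cD: "continuous_on ?S (\<lambda>y. frechet_derivative \<theta> (at y) v)" "continuous_on ?S (\<lambda>y. frechet_derivative ?g (at y) v)" for v
      using continuous_on_frechet[OF S(1), of 0] \<theta>1 g1 by auto
    let ?h = "\<lambda>y. a \<bullet> (F y *v b)"
    have bh: "bounded_linear (\<lambda>M::real^4^4. a \<bullet> (M *v b))"
      by (rule bounded_linear_compose[OF bounded_linear_inner_right
            bounded_bilinear.bounded_linear_left[OF bounded_bilinear_matrix_vector]])
    have "frechet_derivative \<theta>' (at x) a \<bullet> b - frechet_derivative \<theta>' (at x) b \<bullet> a =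
      integral {0..1} (\<lambda>s. w1 s * (frechet_derivative \<theta> (at (x + s *\<^sub>R e)) a \<bullet> b) - w1 s * (frechet_derivative \<theta> (at (x + s *\<^sub>R e)) b \<bullet> a)) +
      integral {0..1} (\<lambda>s. w2 s * (frechet_derivative ?g (at (x + s *\<^sub>R e)) a \<bullet> b) - w2 s * (frechet_derivative ?g (at (x + s *\<^sub>R e)) b \<bullet> a))"
      unfolding D\<theta>'[OF x] inner_add_left MI(1)[OF cD(1) w(1)] MI(1)[OF cD(2) w(2)]
      by (subst (1 2) integral_diff) (auto intro!: MI(2) cD w)
    also have "\<dots> = integral {0..1} (\<lambda>s. (w1 s * (frechet_derivative \<theta> (at (x + s *\<^sub>R e)) a \<bullet> b) - w1 s * (frechet_derivative \<theta> (at (x + s *\<^sub>R e)) b \<bullet> a)) +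
      (w2 s * (frechet_derivative ?g (at (x + s *\<^sub>R e)) a \<bullet> b) - w2 s * (frechet_derivative ?g (at (x + s *\<^sub>R e)) b \<bullet> a)))"
      by (rule integral_add[symmetric]) (intro integrable_diff MI(2) cD w)+
    also have "\<dots> = ?h x"
    proof (rule integral_unique)
      \<comment> \<open>Product rule for \<open>- (1 - s) *\<^sub>R ?h (x + s *\<^sub>R e)\<close>:
        the average of \<theta> contributes \<open>?h\<close>, the correction contributes the
        derivative of \<open>?h\<close> along \<open>e\<close>, and only the end point
        \<open>s = 0\<close> survives.\<close>
      have "((\<lambda>s. (w1 s * (frechet_derivative \<theta> (at (x + s *\<^sub>R e)) a \<bullet> b) - w1 s * (frechet_derivative \<theta> (at (x + s *\<^sub>R e)) b \<bullet> a)) +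
      (w2 s * (frechet_derivative ?g (at (x + s *\<^sub>R e)) a \<bullet> b) - w2 s * (frechet_derivative ?g (at (x + s *\<^sub>R e)) b \<bullet> a)))
        has_integral (- (1 - 1) *\<^sub>R ?h (x + 1 *\<^sub>R e)) - (- (1 - 0) *\<^sub>R ?h (x + 0 *\<^sub>R e))) {0..1}"
      proof (rule fundamental_theorem_of_calculus)
        fix s :: real assume s: "s \<in> {0..1}"
        let ?y = "x + s *\<^sub>R e"
        have y: "?y \<in> ?S" by (rule sh[OF x s])
        let ?D = "frechet_derivative F (at ?y)"
        have "b \<bullet> (?D a *v e) + e \<bullet> (?D b *v a) + a \<bullet> (?D e *v b) = 0"
          using closedF y unfolding closed_form_def by blast
        moreover have "skew (?D b)"
          by (rule skew_frechet_derivative[OF S(1) y _ skewF]) (use DF[OF y] in \<open>auto simp: differentiable_def\<close>)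
        then have "e \<bullet> (?D b *v a) = - (a \<bullet> (?D b *v e))" by (rule skewD)
        ultimately have 1: "frechet_derivative ?g (at ?y) a \<bullet> b - frechet_derivative ?g (at ?y) b \<bullet> a = - (a \<bullet> (?D e *v b))"
          unfolding Dg[OF y] by (simp add: inner_commute)
        have 2: "frechet_derivative \<theta> (at ?y) a \<bullet> b - frechet_derivative \<theta> (at ?y) b \<bullet> a = ?h ?y"
          using prim y unfolding primitive_of_def by blast
        have "((\<lambda>s. x + s *\<^sub>R e) has_derivative (\<lambda>h. h *\<^sub>R e)) (at s)" by (auto intro!: derivative_eq_intros)
        from has_derivative_compose[OF this bounded_linear.has_derivative[OF bh DF[OF y]]]
        have "((\<lambda>s. ?h (x + s *\<^sub>R e)) has_vector_derivative a \<bullet> (?D e *v b)) (at s within {0..1})"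
          using has_derivative_at_withinI
          by (fastforce simp: has_vector_derivative_def linear_scale[OF has_derivative_linear[OF DF[OF y]]] scaleR_matrix_vector_assoc[symmetric])
        moreover have "((\<lambda>s. - (1 - s)) has_field_derivative 1) (at s within {0..1})" by (auto intro!: derivative_eq_intros)
        ultimately have "((\<lambda>s. - (1 - s) *\<^sub>R ?h (x + s *\<^sub>R e)) has_vector_derivative - (1 - s) *\<^sub>R (a \<bullet> (?D e *v b)) + 1 *\<^sub>R ?h ?y) (at s within {0..1})"
          by (intro has_vector_derivative_scaleR)
        moreover have "(w1 s * (frechet_derivative \<theta> (at ?y) a \<bullet> b) - w1 s * (frechet_derivative \<theta> (at ?y) b \<bullet> a)) +
            (w2 s * (frechet_derivative ?g (at ?y) a \<bullet> b) - w2 s * (frechet_derivative ?g (at ?y) b \<bullet> a)) =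
            - (1 - s) *\<^sub>R (a \<bullet> (?D e *v b)) + 1 *\<^sub>R ?h ?y"
          unfolding right_diff_distrib[symmetric] 1 2 by (simp add: w1_def w2_def algebra_simps)
        ultimately show "((\<lambda>s. - (1 - s) *\<^sub>R ?h (x + s *\<^sub>R e)) has_vector_derivative
          (w1 s * (frechet_derivative \<theta> (at ?y) a \<bullet> b) - w1 s * (frechet_derivative \<theta> (at ?y) b \<bullet> a)) +
            (w2 s * (frechet_derivative ?g (at ?y) a \<bullet> b) - w2 s * (frechet_derivative ?g (at ?y) b \<bullet> a))) (at s within {0..1})"
          by (simp only:)
      qed simp
      then show "((\<lambda>s. (w1 s * (frechet_derivative \<theta> (at (x + s *\<^sub>R e)) a \<bullet> b) - w1 s * (frechet_derivative \<theta> (at (x + s *\<^sub>R e)) b \<bullet> a)) +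
      (w2 s * (frechet_derivative ?g (at (x + s *\<^sub>R e)) a \<bullet> b) - w2 s * (frechet_derivative ?g (at (x + s *\<^sub>R e)) b \<bullet> a)))
        has_integral ?h x) {0..1}" by simp
    qed
    finally show "frechet_derivative \<theta>' (at x) a \<bullet> b - frechet_derivative \<theta>' (at x) b \<bullet> a = a \<bullet> (F x *v b)" .
  qed
  from A B C D show ?thesis by blast
qed

text \<open>Smoothing along the four coordinate axes in turn: each step keeps the regularity gained
  before and enlarges the radius by 1. Once all four partial derivatives are
  \<open>C\<^sup>1\<close>, the primitive is \<open>C\<^sup>2\<close>.\<close>

lemma C2_primitive_exists:
  fixes F :: "real^4 \<Rightarrow> real^4^4"
  assumes r: "r \<ge> 1" and eps: "\<epsilon> > 0" and F2: "Ck_on 2 F (- cball 0 r)" and F: "symb (1 + \<epsilon>) F (- cball 0 r)"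
    and skewF: "\<And>x. x \<in> - cball 0 r \<Longrightarrow> skew (F x)" and closedF: "closed_form F (- cball 0 r)"
  shows "\<exists>R\<ge>r. \<exists>\<theta>. Ck_on 2 \<theta> (- cball 0 R) \<and> symb \<epsilon> \<theta> (- cball 0 R) \<and> primitive_of F \<theta> (- cball 0 R)"
proof -
  interpret two_rays F r \<epsilon> by unfold_locales (rule r eps F skewF closedF; assumption?)+
  let ?S = "\<lambda>R. - cball (0::real^4) R"
  let ?ok = "\<lambda>R \<theta> B. symb \<epsilon> \<theta> (?S R) \<and> primitive_of F \<theta> (?S R) \<and> (\<forall>i\<in>B. Ck_on 1 (\<lambda>x. frechet_derivative \<theta> (at x) (axis i 1)) (?S R))"
  have step: "\<exists>\<theta>'. ?ok (R + 1) \<theta>' (insert i B)" if "?ok R \<theta> B" "R \<ge> r" for R \<theta> i and B :: "4 set"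
  proof -
    have sub: "?S R \<subseteq> ?S r" using that(2) by auto
    have "closed_form F (?S R)" using closedF sub unfolding closed_form_def by blast
    from primitive_smoothing[OF _ eps _ Ck_on_subset[OF F2 sub] symb_subset[OF F sub] _ this, of "axis i 1" \<theta>] that r sub skewF
    obtain \<theta>' where "symb \<epsilon> \<theta>' (?S (R + 1))" "primitive_of F \<theta>' (?S (R + 1))"
      "Ck_on 1 (\<lambda>x. frechet_derivative \<theta>' (at x) (axis i 1)) (?S (R + 1))"
      "\<forall>b. Ck_on 1 (\<lambda>x. frechet_derivative \<theta> (at x) b) (?S R) \<longrightarrow> Ck_on 1 (\<lambda>x. frechet_derivative \<theta>' (at x) b) (?S (R + 1))"
      by (auto simp del: Ck_on.simps)
    with that(1) show ?thesis by (intro exI[of _ \<theta>']) (auto simp del: Ck_on.simps)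
  qed
  have Rr: "R \<ge> r" using r by (simp add: R_def)
  have 0: "?ok R \<theta>0 {}" using symb_theta0 prim_theta0 by simp
  from step[OF 0 Rr, of 1] obtain \<theta>1 where 1: "?ok (R + 1) \<theta>1 {1}" by (elim exE)
  have "R + 1 \<ge> r" "R + 1 + 1 \<ge> r" "R + 1 + 1 + 1 \<ge> r" using Rr by auto
  note ge = this
  from step[OF 1 ge(1), of 2] obtain \<theta>2 where 2: "?ok (R + 1 + 1) \<theta>2 {2, 1}" by (elim exE)
  from step[OF 2 ge(2), of 3] obtain \<theta>3 where 3: "?ok (R + 1 + 1 + 1) \<theta>3 {3, 2, 1}" by (elim exE)
  from step[OF 3 ge(3), of 4] obtain \<theta>4 where 4: "?ok (R + 1 + 1 + 1 + 1) \<theta>4 {4, 3, 2, 1}" by (elim exE)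
  let ?R = "R + 1 + 1 + 1 + 1"
  have "Ck_on (Suc 1) \<theta>4 (?S ?R)"
  proof (rule Ck_on_SucI[OF open_compl_cball])
    show "(\<theta>4 has_derivative frechet_derivative \<theta>4 (at x)) (at x)" if "x \<in> ?S ?R" for x
      using 4 symb_Ck Ck_on_1_has_derivative[OF _ that] by blast
    show "Ck_on 1 (\<lambda>x. frechet_derivative \<theta>4 (at x) v) (?S ?R)" if v: "v \<in> Basis" for v
    proof -
      obtain i :: 4 where i: "v = axis i 1" using v by (auto simp: Basis_vec_def)
      have "i \<in> {4, 3, 2, 1}" using exhaust_4[of i] by blast
      with 4 i show ?thesis by blast
    qed
  qed
  then have "Ck_on 2 \<theta>4 (?S ?R)" by (simp add: numeral_2_eq_2)
  with 4 Rr show ?thesis by (intro exI[of _ ?R] conjI exI[of _ \<theta>4]) auto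
qed

text \<open>\<open>t A\<close> is the pullback of the 1-form \<theta> by \<open>A\<close>. As
  \<open>F\<close> is invariant, each pullback is again a primitive of \<open>F\<close>, and so is
  their average. Invariance of a 1-form under an orthogonal map is equivariance of the corresponding
  vector field.\<close>

lemma equivariant_primitive_exists:
  fixes F :: "real^4 \<Rightarrow> real^4^4"
  assumes r: "r \<ge> 1" and eps: "\<epsilon> > 0" and F2: "Ck_on 2 F (- cball 0 r)" and F: "symb (1 + \<epsilon>) F (- cball 0 r)"
    and skewF: "\<And>x. x \<in> - cball 0 r \<Longrightarrow> skew (F x)" and closedF: "closed_form F (- cball 0 r)"
    and fin: "finite \<Gamma>" and ne: "\<Gamma> \<noteq> {}" and orth: "\<And>A. A \<in> \<Gamma> \<Longrightarrow> orthogonal_matrix A"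
    and grp: "\<And>A B. A \<in> \<Gamma> \<Longrightarrow> B \<in> \<Gamma> \<Longrightarrow> A ** B \<in> \<Gamma>"
    and inv: "\<And>A x v. A \<in> \<Gamma> \<Longrightarrow> norm x > r \<Longrightarrow> F (A *v x) *v (A *v v) = A *v (F x *v v)"
  shows "\<exists>R\<ge>r. \<exists>\<theta>. Ck_on 2 \<theta> (- cball 0 R) \<and> symb \<epsilon> \<theta> (- cball 0 R) \<and> primitive_of F \<theta> (- cball 0 R) \<and>
    (\<forall>A\<in>\<Gamma>. \<forall>x. \<theta> (A *v x) = A *v \<theta> x)"
proof -
  obtain R \<theta> where R: "R \<ge> r" and \<theta>2: "Ck_on 2 \<theta> (- cball 0 R)" and \<theta>: "symb \<epsilon> \<theta> (- cball 0 R)"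
    and prim: "primitive_of F \<theta> (- cball 0 R)"
    using C2_primitive_exists[OF r eps F2 F skewF closedF] by blast
  let ?S = "- cball (0::real^4) R"
  have S: "open ?S" "0 \<notin> ?S" using r R by (auto intro: open_compl_cball)
  define k where "k = inverse (real (card \<Gamma>))"
  have card: "card \<Gamma> > 0" using fin ne by (simp add: card_gt_0_iff)
  define t where "t A x = transpose A *v \<theta> (A *v x)" for A :: "real^4^4" and x
  define av where "av x = k *\<^sub>R (\<Sum>A\<in>\<Gamma>. t A x)" for x
  have nA: "norm (A *v x) = norm x" if "A \<in> \<Gamma>" for A x
    using orth[OF that] orthogonal_transformation_matrix[of "(*v) A"] orthogonal_transformation_norm by fastforce
  have AS: "A *v x \<in> ?S" if "A \<in> \<Gamma>" "x \<in> ?S" for A x using that by (simp add: nA)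
  have bl: "bounded_linear ((*v) M)" for M :: "real^4^4" by (rule matrix_vector_mul_bounded_linear)
  have At: "A ** transpose A = mat 1" "transpose A ** A = mat 1" if "A \<in> \<Gamma>" for A
    using orth[OF that] by (simp_all add: orthogonal_matrix_def)
  have "Ck_on 2 (t A) ?S" if "A \<in> \<Gamma>" for A
    unfolding t_def
    by (intro Ck_on_linear_image[OF S(1) bl] Ck_on_compose[OF S(1,1) \<theta>2] Ck_on_linear[OF S(1) bl]) (use AS that in auto)
  then have "Ck_on 2 (\<lambda>x. \<Sum>A\<in>\<Gamma>. t A x) ?S" by (rule Ck_on_sum[OF S(1)])
  then have 1: "Ck_on 2 av ?S"
    unfolding av_def by (rule Ck_on_linear_image[OF S(1) bounded_linear_scaleR_right])
  have "symb \<epsilon> (t A) ?S" if "A \<in> \<Gamma>" for A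
    unfolding t_def
  proof (rule symb_linear_image[OF S bl symb_compose_norm_preserving[OF S(1,1) S(2) _ _ _ \<theta>]])
    have "symb (- 1) ((*v) A) (- {0})"
      by (rule symb_homogeneous(1)[OF Ck_on_linear[OF _ bl]]) (simp_all add: matrix_vector_mult_scaleR open_Compl)
    then show "symb (- 1) ((*v) A) ?S" by (rule symb_subset) (use S in auto)
  qed (use nA AS that in auto)
  then have "symb \<epsilon> (\<lambda>x. \<Sum>A\<in>\<Gamma>. t A x) ?S" by (rule symb_sum[OF S])
  then have 2: "symb \<epsilon> av ?S"
    unfolding av_def by (rule symb_linear_image[OF S bounded_linear_scaleR_right])
  have 3: "primitive_of F av ?S"
    unfolding primitive_of_def
  proof (intro ballI allI)
    fix x a b assume x: "x \<in> ?S"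
    let ?D = "\<lambda>A v. transpose A *v frechet_derivative \<theta> (at (A *v x)) (A *v v)"
    have D\<theta>: "(\<theta> has_derivative frechet_derivative \<theta> (at y)) (at y)" if "y \<in> ?S" for y
      by (rule Ck_on_1_has_derivative[OF symb_Ck[OF \<theta>] that])
    have "(t A has_derivative ?D A) (at x)" if "A \<in> \<Gamma>" for A
      unfolding t_def by (rule bounded_linear.has_derivative[OF bl has_derivative_linear_arg[OF bl D\<theta>[OF AS[OF that x]]]])
    then have "(av has_derivative (\<lambda>v. k *\<^sub>R (\<Sum>A\<in>\<Gamma>. ?D A v))) (at x)"
      unfolding av_def by (intro has_derivative_scaleR_right has_derivative_sum)
    then have D: "frechet_derivative av (at x) = (\<lambda>v. k *\<^sub>R (\<Sum>A\<in>\<Gamma>. ?D A v))" by (rule frechet_derivative_eqI)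
    have "?D A a \<bullet> b - ?D A b \<bullet> a = a \<bullet> (F x *v b)" if A: "A \<in> \<Gamma>" for A
    proof -
      have tr: "(transpose A *v u) \<bullet> v = u \<bullet> (A *v v)" for u v
        by (simp add: dot_lmul_matrix)
      have "?D A a \<bullet> b - ?D A b \<bullet> a = (A *v a) \<bullet> (F (A *v x) *v (A *v b))"
        unfolding tr using prim AS[OF A x] unfolding primitive_of_def by blast
      also have "\<dots> = (A *v a) \<bullet> (A *v (F x *v b))" using inv[OF A, of x b] x R by simp
      also have "\<dots> = (transpose A *v (A *v a)) \<bullet> (F x *v b)" by (rule tr[symmetric])
      also have "\<dots> = a \<bullet> (F x *v b)" by (simp add: matrix_vector_mul_assoc At[OF A])
      finally show ?thesis .
    qed
    then have "(\<Sum>A\<in>\<Gamma>. ?D A a \<bullet> b - ?D A b \<bullet> a) = real (card \<Gamma>) * (a \<bullet> (F x *v b))" by simp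
    then show "frechet_derivative av (at x) a \<bullet> b - frechet_derivative av (at x) b \<bullet> a = a \<bullet> (F x *v b)"
      using card by (simp add: D k_def inner_sum_left sum_subtractf field_simps)
  qed
  have 4: "av (B *v x) = B *v av x" if B: "B \<in> \<Gamma>" for B x
  proof -
    have inj: "inj_on (\<lambda>A. A ** B) \<Gamma>"
      by (rule inj_on_inverseI[where g="\<lambda>A. A ** transpose B"]) (simp add: At[OF B] flip: matrix_mul_assoc)
    \<comment> \<open>Right multiplication by \<open>B\<close> maps the finite set \<Gamma>
      injectively into itself, hence permutes it.\<close>
    have bij: "bij_betw (\<lambda>A. A ** B) \<Gamma> \<Gamma>"
      unfolding bij_betw_def using inj endo_inj_surj[OF fin _ inj] grp[OF _ B] by blast
    have "t A (B *v x) = B *v t (A ** B) x" for A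
      unfolding t_def by (simp add: matrix_vector_mul_assoc matrix_transpose_mul matrix_mul_assoc At[OF B])
    then have "(\<Sum>A\<in>\<Gamma>. t A (B *v x)) = (\<Sum>A\<in>\<Gamma>. B *v t (A ** B) x)" by simp
    also have "\<dots> = (\<Sum>A\<in>\<Gamma>. B *v t A x)" by (rule sum.reindex_bij_betw[OF bij])
    also have "\<dots> = B *v (\<Sum>A\<in>\<Gamma>. t A x)"
      by (rule linear_sum[OF bounded_linear.linear[OF bl], symmetric])
    finally show ?thesis by (simp add: av_def matrix_vector_mult_scaleR)
  qed
  from R 1 2 3 4 show ?thesis by blast
qed

section \<open>The Kaehler form on the end\<close>

lemma jacobian_apply:
  fixes f :: "real^'n \<Rightarrow> real^'m"
  assumes "(f has_derivative D) (at x)"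
  shows "jacobian f (at x) *v v = D v"
proof -
  have "(f has_derivative (*v) (jacobian f (at x))) (at x)"
    using assms jacobian_works[of f "at x"] unfolding differentiable_def by blast
  from has_derivative_unique[OF this assms] show ?thesis by simp
qed

lemma pullback_form_inner:
  assumes "(f has_derivative D) (at x)"
  shows "a \<bullet> (pullback_form f T x *v b) = D a \<bullet> (T (f x) *v D b)"
proof -
  have tr: "u \<bullet> (transpose M *v v) = (M *v u) \<bullet> v" for u v :: "real^4" and M :: "real^4^4"
    by (metis dot_lmul_matrix inner_commute transpose_matrix_vector transpose_transpose)
  show ?thesis
    unfolding pullback_form_def matrix_vector_mul_assoc[symmetric] tr jacobian_apply[OF assms] ..
qed

lemma matrix_eq_inner:
  assumes "\<And>a b. a \<bullet> (A *v b) = a \<bullet> (B *v b)"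
  shows "A = (B :: real^4^4)"
proof -
  have "A *v b = B *v b" for b using vector_eq_rdot[of "A *v b" "B *v b"] assms by (metis inner_commute)
  then show ?thesis by (simp add: matrix_eq)
qed

lemma linear_vanishing:
  fixes h :: "'a::euclidean_space \<Rightarrow> 'b::real_normed_vector"
  assumes "linear h" "\<And>b. b \<in> Basis \<Longrightarrow> h b = 0"
  shows "h v = 0"
  unfolding linear_basis_sum[OF assms(1), of v] using assms(2) by simp

lemma axis_inner_matrix: "axis i 1 \<bullet> (M *v axis j 1) = (M :: real^4^4) $ i $ j"
  by (simp add: inner_axis' matrix_vector_mul_component inner_axis)

text \<open>The cyclic sum is linear in each of the three vectors, so its vanishing on coordinate
  vectors extends to all vectors.\<close>

lemma closed_form_of_partials:
  assumes F: "\<And>x. x \<in> S \<Longrightarrow> F differentiable (at x)" and closed: "closed_2form_on F S"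
  shows "closed_form F S"
  unfolding closed_form_def
proof (intro ballI allI)
  fix x a b c assume x: "x \<in> S"
  let ?D = "frechet_derivative F (at x)"
  interpret D: linear ?D
    using has_derivative_linear[OF has_frechet_derivative[OF F[OF x]]] .
  let ?T = "\<lambda>a b c. b \<bullet> (?D a *v c) + c \<bullet> (?D b *v a) + a \<bullet> (?D c *v b)"
  note simps = inner_add_left inner_add_right matrix_vector_mult_add_rdistrib matrix_vector_right_distrib D.add D.scale
    matrix_vector_mult_scaleR scaleR_matrix_vector_assoc[symmetric]
  have lin: "linear (\<lambda>a. ?T a b c)" "linear (\<lambda>b. ?T a b c)" "linear (\<lambda>c. ?T a b c)" for a b c
    by (rule linearI; simp add: simps algebra_simps)+
  have "?T (axis i 1) (axis j 1) (axis k 1) = 0" for i j k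
    using closed x unfolding closed_2form_on_def axis_inner_matrix by blast
  then have 1: "?T a b c = 0" if "a \<in> Basis" "b \<in> Basis" "c \<in> Basis" for a b c
    using that by (auto simp: Basis_vec_def)
  have 2: "?T a b c = 0" if "a \<in> Basis" "b \<in> Basis" for a b c
    by (rule linear_vanishing[OF lin(3)]) (rule 1[OF that])
  have 3: "?T a b c = 0" if "a \<in> Basis" for a b c
    by (rule linear_vanishing[OF lin(2)]) (rule 2[OF that])
  show "?T a b c = 0"
    by (rule linear_vanishing[OF lin(1)]) (rule 3)
qed

lemma bilinear_form_derivative:
  fixes F :: "real^4 \<Rightarrow> real^4^4"
  assumes "(F has_derivative D) (at x)"
  shows "((\<lambda>y. a \<bullet> (F y *v b)) has_derivative (\<lambda>v. a \<bullet> (D v *v b))) (at x)"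
proof -
  have "bounded_linear (\<lambda>M::real^4^4. a \<bullet> (M *v b))"
    by (rule bounded_linear_compose[OF bounded_linear_inner_right
        bounded_bilinear.bounded_linear_left[OF bounded_bilinear_matrix_vector]])
  from bounded_linear.has_derivative[OF this assms] show ?thesis .
qed

text \<open>The second derivatives \<open>B\<close> of \<open>q\<close> contribute six terms to the
  cyclic sum. They cancel in pairs, since \<open>B\<close> is symmetric and \<open>w\<close> is
  skew; what remains is closedness of \<open>w\<close> at \<open>q x\<close>.\<close>

lemma closed_form_pullback:
  assumes S: "open S" and q: "Ck_on 2 q S" "q ` S \<subseteq> U"
    and w: "\<And>y. y \<in> U \<Longrightarrow> w differentiable (at y)" "\<And>y. y \<in> U \<Longrightarrow> skew (w y)" "closed_form w U"
    and \<Omega>: "\<And>x. x \<in> S \<Longrightarrow> \<Omega> x = pullback_form q w x" "\<And>x. x \<in> S \<Longrightarrow> \<Omega> differentiable (at x)"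
  shows "closed_form \<Omega> S"
  unfolding closed_form_def
proof (intro ballI allI)
  fix x a b c assume x: "x \<in> S"
  have q2: "Ck_on (Suc 1) q S" using q(1) by (simp add: numeral_2_eq_2)
  have Dq: "(q has_derivative frechet_derivative q (at y)) (at y)" if "y \<in> S" for y
    by (rule Ck_on_Suc_has_derivative[OF q2 that])
  let ?Q = "frechet_derivative q (at x)"
  define B where "B v u = frechet_derivative (\<lambda>y. frechet_derivative q (at y) u) (at x) v" for v u
  have DB: "((\<lambda>y. frechet_derivative q (at y) u) has_derivative (\<lambda>v. B v u)) (at x)" for u
    unfolding B_def by (rule Ck_on_1_has_derivative[OF Ck_on_frechet[OF S q2] x])
  have B_sym: "B v u = B u v" for u v
    unfolding B_def by (rule second_frechet_derivative_commute[OF S x q(1)])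
  let ?w' = "frechet_derivative w (at (q x))"
  have qx: "q x \<in> U" using q(2) x by blast
  have Dw: "((\<lambda>y. w (q y)) has_derivative (\<lambda>v. ?w' (?Q v))) (at x)"
    by (rule has_derivative_compose[OF Dq[OF x] has_frechet_derivative[OF w(1)[OF qx]]])
  have \<Omega>': "u \<bullet> (frechet_derivative \<Omega> (at x) v *v z) =
      ?Q u \<bullet> (w (q x) *v B v z + ?w' (?Q v) *v ?Q z) + B v u \<bullet> (w (q x) *v ?Q z)" for u v z
  proof -
    have "((\<lambda>y. frechet_derivative q (at y) u \<bullet> (w (q y) *v frechet_derivative q (at y) z)) has_derivative
      (\<lambda>v. ?Q u \<bullet> (w (q x) *v B v z + ?w' (?Q v) *v ?Q z) + B v u \<bullet> (w (q x) *v ?Q z))) (at x)"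
      by (intro has_derivative_inner bounded_bilinear.FDERIV[OF bounded_bilinear_matrix_vector] DB Dw)
    then have "((\<lambda>y. u \<bullet> (\<Omega> y *v z)) has_derivative
      (\<lambda>v. ?Q u \<bullet> (w (q x) *v B v z + ?w' (?Q v) *v ?Q z) + B v u \<bullet> (w (q x) *v ?Q z))) (at x)"
      by (rule has_derivative_transform_within_open[OF _ S x]) (simp add: \<Omega>(1) pullback_form_inner[OF Dq])
    from has_derivative_unique[OF bilinear_form_derivative[OF has_frechet_derivative[OF \<Omega>(2)[OF x]]] this]
    show ?thesis by meson
  qed
  have sk: "u \<bullet> (w (q x) *v z) = - (z \<bullet> (w (q x) *v u))" for u z by (rule skewD[OF w(2)[OF qx]])
  have "?Q b \<bullet> (?w' (?Q a) *v ?Q c) + ?Q c \<bullet> (?w' (?Q b) *v ?Q a) + ?Q a \<bullet> (?w' (?Q c) *v ?Q b) = 0"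
    using w(3) qx unfolding closed_form_def by blast
  then show "b \<bullet> (frechet_derivative \<Omega> (at x) a *v c) + c \<bullet> (frechet_derivative \<Omega> (at x) b *v a) +
     a \<bullet> (frechet_derivative \<Omega> (at x) c *v b) = 0"
    unfolding \<Omega>' using sk[of "B a b" "?Q c"] sk[of "B b c" "?Q a"] sk[of "B c a" "?Q b"]
    by (simp add: inner_add_right B_sym[of b a] B_sym[of c b] B_sym[of a c])
qed

lemma Ck_on_matrix_mult:
  fixes A B :: "real^4 \<Rightarrow> real^4^4"
  assumes "open S" "Ck_on k A S" "Ck_on k B S"
  shows "Ck_on k (\<lambda>x. A x ** B x) S"
  by (rule Ck_on_matrix[OF assms(1)])
     (simp add: matrix_matrix_mult_def Ck_on_sum[OF assms(1)] Ck_on_mult[OF assms(1)] Ck_on_matrix_entry[OF assms(1)] assms)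

section \<open>The Kaehler form in charts and on the cover of the end\<close>

lemma chart_at:
  assumes "smooth_atlas \<A>"
  shows "chart_at \<A> m \<in> \<A>" "m \<in> fst (chart_at \<A> m)"
proof -
  have "m \<in> (\<Union>c\<in>\<A>. fst c)" using assms by (auto simp: smooth_atlas_def)
  then have "\<exists>c. c \<in> \<A> \<and> m \<in> fst c" by blast
  from someI_ex[OF this] show "chart_at \<A> m \<in> \<A>" "m \<in> fst (chart_at \<A> m)"
    by (auto simp: chart_at_def)
qed

locale kahler_end =
  fixes \<A> :: "'m::{t2_space, second_countable_topology} chart set" and g J :: "'m tensor"
    and p :: "real^4 \<Rightarrow> 'm" and S :: "(real^4) set" and \<Omega> :: "real^4 \<Rightarrow> real^4^4"
  assumes K: "kahler_surface \<A> g J" and opS: "open S" and p: "local_diffeo \<A> p S"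
    and \<Omega>_def: "\<Omega> = pullback_bilinear \<A> p (kahler_form g J)"
begin

abbreviation "w \<equiv> kahler_form g J"
abbreviation "cdom c \<equiv> {x \<in> S. p x \<in> fst c}"
abbreviation "cim c \<equiv> snd c ` fst c"

lemma atlas: "smooth_atlas \<A>" using K by (simp add: kahler_surface_def)

lemma chart:
  assumes "c \<in> \<A>"
  shows "open (fst c)" "open (cim c)" "inj_on (snd c) (fst c)"
    "open (cdom c)" "smooth_on (snd c \<circ> p) (cdom c)"
proof -
  have h: "open (fst c)" "open (cim c)" "homeomorphism (fst c) (cim c) (snd c) (inv_into (fst c) (snd c))"
    using atlas assms by (auto simp: smooth_atlas_def case_prod_beta')
  show "open (fst c)" "open (cim c)" by fact+
  show "inj_on (snd c) (fst c)"
    using h(3) unfolding homeomorphism_def by (metis inj_on_inverseI)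
  have "open (S \<inter> p -` fst c)"
    using p h(1) opS by (intro continuous_open_preimage) (auto simp: local_diffeo_def)
  then show "open (cdom c)" by (simp add: Int_def vimage_def)
  show "smooth_on (snd c \<circ> p) (cdom c)" using p assms by (auto simp: local_diffeo_def case_prod_beta')
qed

lemma kahler_form_in_chart:
  assumes c: "c \<in> \<A>"
  shows "\<And>y. y \<in> cim c \<Longrightarrow> skew (w c y)" "\<And>y. y \<in> cim c \<Longrightarrow> w c differentiable (at y)" "closed_form (w c) (cim c)"
proof -
  show "skew (w c y)" if y: "y \<in> cim c" for y
  proof -
    have J: "J c y ** J c y = - mat 1" "transpose (J c y) ** g c y ** J c y = g c y" "transpose (g c y) = g c y"
      using K c y by (auto simp: kahler_surface_def complex_structure_def riemannian_metric_def)
    have m: "A ** (- mat 1) = - A" for A :: "real^4^4"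
      unfolding matrix_eq matrix_vector_mul_assoc[symmetric] bounded_bilinear.minus_left[OF bounded_bilinear_matrix_vector]
        matrix_vector_mul_lid bounded_bilinear.minus_right[OF bounded_bilinear_matrix_vector] by simp
    \<comment> \<open>Compatibility of \<open>g\<close> with \<open>J\<close>, multiplied by
      \<open>J\<close> on the right, together with \<open>J\<^sup>2 = - 1\<close>.\<close>
    have "g c y ** J c y = (transpose (J c y) ** g c y ** J c y) ** J c y" using J(2) by simp
    also have "\<dots> = (transpose (J c y) ** g c y) ** (J c y ** J c y)" by (simp add: matrix_mul_assoc)
    also have "\<dots> = - (transpose (J c y) ** g c y)" unfolding J(1) m ..
    finally show ?thesis
      unfolding skew_iff_transpose kahler_form_def matrix_transpose_mul transpose_transpose J(3) .
  qed
  have o: "open (cim c)" by (rule chart(2)[OF c])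
  have "Ck_on 2 (J c) (cim c)" "Ck_on 2 (g c) (cim c)"
    using K c by (auto simp: kahler_surface_def complex_structure_def riemannian_metric_def smooth_on_def)
  then have "Ck_on 2 (\<lambda>y. transpose (J c y) ** g c y) (cim c)"
    by (intro Ck_on_matrix_mult[OF o] Ck_on_matrix[OF o]) (auto simp: transpose_def intro: Ck_on_matrix_entry[OF o])
  then have "Ck_on 2 (w c) (cim c)" by (rule Ck_on_cong[OF o, rotated]) (simp add: kahler_form_def)
  then have w1: "Ck_on 1 (w c) (cim c)" by (rule Ck_on_mono) simp
  show d: "w c differentiable (at y)" if "y \<in> cim c" for y
    using Ck_on_1_has_derivative[OF w1 that] unfolding differentiable_def by blast
  show "closed_form (w c) (cim c)"
    by (rule closed_form_of_partials[OF d]) (use K c in \<open>auto simp: kahler_surface_def\<close>)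
qed

lemma D_chart:
  assumes "c \<in> \<A>" "x \<in> cdom c"
  shows "(snd c \<circ> p has_derivative frechet_derivative (snd c \<circ> p) (at x)) (at x)"
  by (rule Ck_on_1_has_derivative[of _ "cdom c"]) (use chart(5)[OF assms(1)] assms(2) in \<open>auto simp: smooth_on_def simp del: Ck_on.simps One_nat_def\<close>)

lemma kahler_form_transition:
  assumes c: "c \<in> \<A>" and d: "d \<in> \<A>" and y: "y \<in> snd c ` (fst c \<inter> fst d)"
    and D: "(transition c d has_derivative D) (at y)"
  shows "a \<bullet> (w c y *v b) = D a \<bullet> (w d (transition c d y) *v D b)"
proof -
  let ?P = "jacobian (transition c d) (at y)" and ?z = "transition c d y"
  have gP: "g c y = pullback_form (transition c d) (g d) y"
    using K c d y unfolding kahler_surface_def riemannian_metric_def by blast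
  have PJ: "?P ** J c y = J d ?z ** ?P"
    using K c d y unfolding kahler_surface_def complex_structure_def by blast
  have "w c y = transpose (?P ** J c y) ** g d ?z ** ?P"
    unfolding kahler_form_def gP unfolding pullback_form_def by (simp add: matrix_transpose_mul matrix_mul_assoc)
  also have "\<dots> = transpose ?P ** w d ?z ** ?P"
    unfolding PJ kahler_form_def by (simp add: matrix_transpose_mul matrix_mul_assoc)
  finally have "w c y = pullback_form (transition c d) (w d) y" by (simp add: pullback_form_def)
  then show ?thesis using pullback_form_inner[OF D] by simp
qed

text \<open>\<Omega> is defined point by point through \<open>chart_at\<close>, which may jump
  between neighbouring points. The transformation laws express it in one fixed chart on the open set
  \<open>cdom c\<close>, where it can be differentiated as a pullback.\<close>

lemma Omega_chart:
  assumes c: "c \<in> \<A>" and x: "x \<in> cdom c"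
  shows "\<Omega> x = pullback_form (snd c \<circ> p) (w c) x"
proof (rule matrix_eq_inner)
  fix a b :: "real^4"
  define d where "d = chart_at \<A> (p x)"
  have d: "d \<in> \<A>" "p x \<in> fst d" unfolding d_def by (rule chart_at[OF atlas])+
  have xd: "x \<in> cdom d" using x d by simp
  let ?q = "snd c \<circ> p" and ?\<tau> = "transition c d"
  have tr: "?\<tau> (?q y) = (snd d \<circ> p) y" if "y \<in> cdom c" for y
    using that chart(3)[OF c] by (simp add: transition_def)
  have y: "?q x \<in> snd c ` (fst c \<inter> fst d)" using x d by auto
  have "Ck_on 1 ?\<tau> (snd c ` (fst c \<inter> fst d))"
    using atlas c d(1) unfolding smooth_atlas_def smooth_on_def by blast
  from Ck_on_1_has_derivative[OF this y]
  have D\<tau>: "(?\<tau> has_derivative frechet_derivative ?\<tau> (at (?q x))) (at (?q x))" .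
  let ?Dt = "frechet_derivative ?\<tau> (at (?q x))" and ?D_chart = "frechet_derivative ?q (at x)"
  have "((\<lambda>y. ?\<tau> (?q y)) has_derivative (\<lambda>v. ?Dt (?D_chart v))) (at x)"
    by (rule has_derivative_compose[OF D_chart[OF c x] D\<tau>])
  then have Dd: "(snd d \<circ> p has_derivative (\<lambda>v. ?Dt (?D_chart v))) (at x)"
    by (rule has_derivative_transform_within_open[OF _ chart(4)[OF c] x]) (rule tr)
  have "a \<bullet> (\<Omega> x *v b) = a \<bullet> (pullback_form (snd d \<circ> p) (w d) x *v b)"
    by (simp add: \<Omega>_def pullback_bilinear_def Let_def d_def)
  also have "\<dots> = ?Dt (?D_chart a) \<bullet> (w d (?\<tau> (?q x)) *v ?Dt (?D_chart b))"
    unfolding pullback_form_inner[OF Dd] tr[OF x] ..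
  also have "\<dots> = ?D_chart a \<bullet> (w c (?q x) *v ?D_chart b)"
    by (rule kahler_form_transition[OF c d(1) y D\<tau>, symmetric])
  also have "\<dots> = a \<bullet> (pullback_form ?q (w c) x *v b)"
    by (rule pullback_form_inner[OF D_chart[OF c x], symmetric])
  finally show "a \<bullet> (\<Omega> x *v b) = a \<bullet> (pullback_form ?q (w c) x *v b)" .
qed

lemma point_in_chart: "x \<in> S \<Longrightarrow> \<exists>c\<in>\<A>. x \<in> cdom c"
  using chart_at[OF atlas, of "p x"] by auto

lemma skew_Omega: "x \<in> S \<Longrightarrow> skew (\<Omega> x)"
proof -
  assume "x \<in> S"
  then obtain c where c: "c \<in> \<A>" "x \<in> cdom c" using point_in_chart by blast
  have "skew (w c ((snd c \<circ> p) x))" using c by (intro kahler_form_in_chart(1)) auto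
  then show ?thesis
    unfolding skew_def Omega_chart[OF c] pullback_form_inner[OF D_chart[OF c]] by blast
qed

lemma closed_Omega:
  assumes "\<And>x. x \<in> S \<Longrightarrow> \<Omega> differentiable (at x)"
  shows "closed_form \<Omega> S"
proof -
  have "closed_form \<Omega> (cdom c)" if c: "c \<in> \<A>" for c
  proof (rule closed_form_pullback[OF chart(4)[OF c] _ _ kahler_form_in_chart(2,1,3)[OF c] Omega_chart[OF c]])
    show "Ck_on 2 (snd c \<circ> p) (cdom c)" using chart(5)[OF c] by (simp add: smooth_on_def)
  qed (use assms in auto)
  then show ?thesis unfolding closed_form_def using point_in_chart by blast
qed

text \<open>Since \<open>p (A *v x) = p x\<close>, the chart expression of \<open>p\<close> is
  unchanged by \<open>A\<close>, so \<open>A\<close> pulls \<Omega> back to itself. Orthogonality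
  turns this invariance of the form into equivariance of its matrix.\<close>

lemma Omega_invariant:
  assumes A: "orthogonal_matrix A" and inv: "\<And>x. x \<in> S \<Longrightarrow> A *v x \<in> S \<and> p (A *v x) = p x" and x: "x \<in> S"
  shows "\<Omega> (A *v x) *v (A *v v) = A *v (\<Omega> x *v v)"
proof -
  obtain c where c: "c \<in> \<A>" "x \<in> cdom c" using point_in_chart x by blast
  have Ax: "A *v x \<in> cdom c" using inv[OF x] c by simp
  let ?q = "snd c \<circ> p"
  have "((\<lambda>y. ?q (A *v y)) has_derivative (\<lambda>v. frechet_derivative ?q (at (A *v x)) (A *v v))) (at x)"
    by (rule has_derivative_linear_arg[OF matrix_vector_mul_bounded_linear D_chart[OF c(1) Ax]])
  then have D: "(?q has_derivative (\<lambda>v. frechet_derivative ?q (at (A *v x)) (A *v v))) (at x)"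
    by (rule has_derivative_transform_within_open[OF _ opS x]) (use inv in auto)
  have tr: "u \<bullet> (A *v z) = (transpose A *v u) \<bullet> z" for u z
    by (simp add: dot_lmul_matrix)
  have AA: "A *v (transpose A *v u) = u" for u
    unfolding matrix_vector_mul_assoc using A by (simp add: orthogonal_matrix_def)
  have qq: "?q (A *v x) = ?q x" using inv[OF x] by simp
  have "u \<bullet> (\<Omega> (A *v x) *v (A *v v)) = u \<bullet> (A *v (\<Omega> x *v v))" for u
  proof -
    have "u \<bullet> (A *v (\<Omega> x *v v)) = (transpose A *v u) \<bullet> (\<Omega> x *v v)" by (rule tr)
    also have "\<dots> = frechet_derivative ?q (at (A *v x)) u \<bullet> (w c (?q x) *v frechet_derivative ?q (at (A *v x)) (A *v v))"
      unfolding Omega_chart[OF c] pullback_form_inner[OF D] AA ..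
    also have "\<dots> = u \<bullet> (\<Omega> (A *v x) *v (A *v v))"
      unfolding Omega_chart[OF c(1) Ax] pullback_form_inner[OF D_chart[OF c(1) Ax]] qq ..
    finally show ?thesis ..
  qed
  then show ?thesis by (metis vector_eq_rdot inner_commute)
qed

end

text \<open>In complex coordinates \<open>omega0\<close> is multiplication by the scalar
  \<open>- \<i>\<close>, which commutes with every complex linear map.\<close>

lemma omega0_commutes_U2:
  assumes "A \<in> U2"
  shows "omega0 *v (A *v x) = A *v (omega0 *v x)"
proof -
  obtain U where U: "\<And>x. complex_coords (A *v x) = U *v complex_coords x" using assms by (auto simp: U2_def)
  have i: "complex_coords (omega0 *v v) = (\<chi> i. - \<i> * complex_coords v $ i)" for v
    by (simp add: vec_eq_iff complex_coords_def omega0_mult_vec complex_eq_iff)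
  have "complex_coords (A *v (omega0 *v x)) = (\<chi> i. - \<i> * (U *v complex_coords x) $ i)"
    unfolding U i by (simp add: vec_eq_iff matrix_vector_mult_def sum_negf sum_distrib_left mult_ac)
  also have "\<dots> = complex_coords (omega0 *v (A *v x))" unfolding i U ..
  finally have eq: "complex_coords (A *v (omega0 *v x)) = complex_coords (omega0 *v (A *v x))" .
  have "u = v" if "complex_coords u = complex_coords v" for u v
  proof -
    have "complex_coords u $ 1 = complex_coords v $ 1" "complex_coords u $ 2 = complex_coords v $ 2" using that by simp_all
    then show ?thesis by (simp add: complex_coords_def vec_eq_iff forall_4)
  qed
  from this[OF eq] show ?thesis by simp
qed

lemma bigo_at_infinity_bound:
  fixes f :: "real^4 \<Rightarrow> real"
  assumes "f \<in> O[at_infinity](\<lambda>x. norm x powr q)"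
  obtains C b where "C \<ge> 0" "\<And>x. norm x \<ge> b \<Longrightarrow> \<bar>f x\<bar> \<le> C * norm x powr q"
proof -
  obtain C where C: "C > 0" "\<forall>\<^sub>F x in at_infinity. norm (f x) \<le> C * norm (norm x powr q)"
    using landau_o.bigE[OF assms] by blast
  then obtain b where "\<And>x. norm x \<ge> b \<Longrightarrow> norm (f x) \<le> C * norm (norm x powr q)"
    by (auto simp: eventually_at_infinity)
  then show ?thesis using C(1) by (intro that[of C b]) auto
qed

text \<open>The norm of a matrix is the Euclidean norm of its 16 entries, each of which is bounded
  by the operator bound \<open>B\<close>.\<close>

lemma norm_matrix_le_columns:
  fixes M :: "real^4^4"
  assumes "\<And>v. norm (M *v v) \<le> B * norm v"
  shows "norm M \<le> 16 * B"
proof -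
  have e: "\<bar>M $ i $ j\<bar> \<le> B" for i j
  proof -
    have "\<bar>M $ i $ j\<bar> = \<bar>(M *v axis j 1) $ i\<bar>" by (simp add: matrix_vector_mul_component inner_axis)
    also have "\<dots> \<le> norm (M *v axis j 1)" by (rule component_le_norm_cart)
    also have "\<dots> \<le> B" using assms[of "axis j 1"] by simp
    finally show ?thesis .
  qed
  have "norm M \<le> (\<Sum>i\<in>UNIV. norm (M $ i))" unfolding norm_vec_def[of M] by (rule L2_set_le_sum) simp
  also have "\<dots> \<le> (\<Sum>i\<in>(UNIV::4 set). \<Sum>j\<in>(UNIV::4 set). \<bar>M $ i $ j\<bar>)" by (intro sum_mono norm_le_l1_cart)
  also have "\<dots> \<le> (\<Sum>i\<in>(UNIV::4 set). \<Sum>j\<in>(UNIV::4 set). B)" by (intro sum_mono e)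
  also have "\<dots> = 16 * B" by simp
  finally show ?thesis .
qed

text \<open>With a global inverse \<psi> at hand, images under \<phi> are preimages under \<psi>, so
  \<phi> carries interiors and frontiers to interiors and frontiers. Composing with the scaling by
  \<open>r\<close> parametrizes the image of the ball by the unit ball.\<close>

lemma Ck_ball_diffeo_image:
  fixes \<phi> \<psi> :: "real^4 \<Rightarrow> real^4"
  assumes "r > 0" "Ck_on k \<phi> UNIV" "Ck_on k \<psi> UNIV" "\<And>x. \<psi> (\<phi> x) = x" "\<And>x. \<phi> (\<psi> x) = x"
  shows "frontier (\<phi> ` cball 0 r) = \<phi> ` sphere 0 r" "Ck_ball k (\<phi> ` cball 0 r)"
    "Ck_diffeo k \<phi> (- cball 0 r) (- \<phi> ` cball 0 r)"
proof -
  have inj: "inj \<phi>" by (metis assms(4) injI)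
  have c: "continuous_on UNIV \<phi>" "continuous_on UNIV \<psi>" using assms Ck_on_imp_continuous_on by blast+
  have im: "\<phi> ` X = \<psi> -` X" "\<psi> ` X = \<phi> -` X" for X
    using assms(4,5) by (auto simp: image_iff) (metis assms(4,5))+
  have opn: "open (\<phi> ` X)" "open (\<psi> ` X)" if "open X" for X
    unfolding im using that c by (auto intro: open_vimage)
  let ?D = "\<phi> ` cball 0 r"
  have comp: "compact ?D" by (intro compact_continuous_image continuous_on_subset[OF c(1)]) auto
  have "interior ?D = \<phi> ` ball 0 r"
  proof
    have "\<psi> ` interior ?D \<subseteq> cball 0 r" using interior_subset[of ?D] assms(4) by force
    then have "\<psi> ` interior ?D \<subseteq> ball 0 r" using opn(2)[OF open_interior, of ?D] by (metis interior_cball interior_maximal)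
    then show "interior ?D \<subseteq> \<phi> ` ball 0 r" using assms(5) by (metis image_eqI image_subset_iff subsetI)
    show "\<phi> ` ball 0 r \<subseteq> interior ?D" by (intro interior_maximal image_mono opn open_ball ball_subset_cball)
  qed
  then have "frontier ?D = ?D - \<phi> ` ball 0 r"
    using compact_imp_closed[OF comp] by (simp add: frontier_def)
  also have "\<dots> = \<phi> ` (cball 0 r - ball 0 r)" using inj by (simp add: image_set_diff)
  finally show fr: "frontier ?D = \<phi> ` sphere 0 r" by (simp add: cball_diff_eq_sphere)
  let ?f = "\<lambda>x. \<phi> (r *\<^sub>R x)"
  have injf: "inj ?f"
    by (rule injI) (metis assms(1,4) less_irrefl scaleR_cancel_left)
  have fi: "inv_into UNIV ?f = (\<lambda>y. inverse r *\<^sub>R \<psi> y)"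
  proof
    fix y show "inv_into UNIV ?f y = inverse r *\<^sub>R \<psi> y"
      by (rule inv_into_f_eq[OF injf]) (use assms in auto)
  qed
  have scale: "(\<lambda>x. r *\<^sub>R x) ` cball 0 1 = cball (0::real^4) r" "(\<lambda>x. r *\<^sub>R x) ` sphere 0 1 = sphere (0::real^4) r"
    using assms(1) by (simp_all add: cball_scale sphere_scale)
  have "Ck_diffeo k ?f UNIV UNIV"
    unfolding Ck_diffeo_def fi
  proof (intro conjI open_UNIV)
    show "bij_betw ?f UNIV UNIV"
      by (rule bij_betwI[where g="\<lambda>y. inverse r *\<^sub>R \<psi> y"]) (use assms in auto)
    show "Ck_on k ?f UNIV"
      by (intro Ck_on_compose[OF _ _ assms(2)] Ck_on_linear bounded_linear_scaleR_right) auto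
    show "Ck_on k (\<lambda>y. inverse r *\<^sub>R \<psi> y) UNIV"
      by (intro Ck_on_scaleR Ck_on_const assms open_UNIV)
  qed
  moreover have "?D = ?f ` cball 0 1" unfolding scale(1)[symmetric] image_image ..
  moreover have "frontier ?D = ?f ` sphere 0 1" unfolding fr scale(2)[symmetric] image_image ..
  ultimately show "Ck_ball k ?D" unfolding Ck_ball_def by blast
  have oD: "open (- ?D)" "open (- cball (0::real^4) r)"
    using compact_imp_closed[OF comp] by (auto simp: open_Compl)
  have im': "\<phi> ` (- cball 0 r) = - ?D" unfolding im by auto
  have "inv_into (- cball 0 r) \<phi> y = \<psi> y" if "y \<in> - ?D" for y
    by (rule inv_into_f_eq) (use that inj im' assms in \<open>auto simp: inj_on_def im\<close>)
  then show "Ck_diffeo k \<phi> (- cball 0 r) (- ?D)"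
    unfolding Ck_diffeo_def
    using oD im' inj Ck_on_subset[OF assms(2)] Ck_on_cong[OF oD(1) _ Ck_on_subset[OF assms(3)]]
    by (auto simp: bij_betw_def inj_on_def)
qed

section \<open>The diffeomorphism on a given end\<close>

theorem proposition1p1:
  fixes \<A> :: "'m::{t2_space, second_countable_topology} chart set"
    and g J :: "'m tensor" and K E :: "'m set" and \<epsilon> R :: real
    and Mt :: "'u::topological_space set" and \<pi> :: "'u \<Rightarrow> 'm" and X :: "'u \<Rightarrow> real^4"
    and \<Gamma> :: "(real^4^4) set"
    and p :: "real^4 \<Rightarrow> 'm" and \<Omega> :: "real^4 \<Rightarrow> real^4^4"
  assumes "ALE_kahler_surface \<A> g J K \<epsilon>"
    and "E \<in> components (- K)"
    and "asymptotic_coords \<A> g \<epsilon> E Mt \<pi> X R \<Gamma>"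
    and "p = \<pi> \<circ> inv_into Mt X"
    and "\<Omega> = pullback_bilinear \<A> p (kahler_form g J)"
    and "fall_off \<epsilon> (pullback_endo \<A> p J) J0"
    and "Ck_on 2 \<Omega> (- cball 0 R)"
    and "fall_off \<epsilon> \<Omega> omega0"
    and "\<Gamma> \<subseteq> U2"
  shows "\<exists>\<Phi> :: real^4 \<Rightarrow> real^4. \<exists>r D.
           cball 0 R \<subseteq> cball 0 r \<inter> D \<and>
           Ck_ball 2 D \<and>
           (\<forall>A\<in>\<Gamma>. (*v) A ` frontier D = frontier D) \<and>
           Ck_diffeo 2 \<Phi> (- cball 0 r) (- D) \<and>
           (\<forall>A\<in>\<Gamma>. \<forall>x\<in>- cball 0 r. \<Phi> (A *v x) = A *v \<Phi> x) \<and>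
           (\<forall>x\<in>- cball 0 r. pullback_form \<Phi> \<Omega> x = omega0) \<and>
           (\<lambda>x. norm (\<Phi> x - x)) \<in> O[at_infinity](\<lambda>x. norm x powr (- \<epsilon>)) \<and>
           (\<lambda>x. norm (jacobian \<Phi> (at x) - mat 1)) \<in> O[at_infinity](\<lambda>x. norm x powr (- 1 - \<epsilon>))"
proof -
  let ?S = "\<lambda>R. - cball (0::real^4) R"
  note op = open_compl_cball
  have K: "kahler_surface \<A> g J" and eps: "\<epsilon> > 0" using assms(1) by (auto simp: ALE_kahler_surface_def)
  have R0: "0 < R" and hom: "homeomorphism Mt (?S R) X (inv_into Mt X)"
    and ld: "local_diffeo \<A> p (?S R)" and \<Gamma>: "finite_free_subgroup_O4 \<Gamma>"
    and deck: "\<And>A. A \<in> \<Gamma> \<Longrightarrow> \<exists>h. deck_transformation Mt \<pi> h \<and> (\<forall>u\<in>Mt. X (h u) = A *v X u)"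
    using assms(3) unfolding asymptotic_coords_def assms(4) by auto
  have fin: "finite \<Gamma>" and ne: "\<Gamma> \<noteq> {}" and orth: "\<And>A. A \<in> \<Gamma> \<Longrightarrow> orthogonal_matrix A"
    and grp: "\<And>A B. A \<in> \<Gamma> \<Longrightarrow> B \<in> \<Gamma> \<Longrightarrow> A ** B \<in> \<Gamma>"
    using \<Gamma> unfolding finite_free_subgroup_O4_def by auto
  have nA: "norm (A *v x) = norm x" if "A \<in> \<Gamma>" for A x
    using orth[OF that] orthogonal_transformation_matrix[of "(*v) A"] orthogonal_transformation_norm by fastforce
  interpret kahler_end \<A> g J p "?S R" \<Omega> by unfold_locales (rule K op ld assms(5))+
  \<comment> \<open>The elements of \<Gamma> represent deck transformations, so they do not change
    the image under the covering map.\<close>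
  have pA: "A *v x \<in> ?S R \<and> p (A *v x) = p x" if A: "A \<in> \<Gamma>" and x: "x \<in> ?S R" for A x
  proof -
    obtain h where h: "deck_transformation Mt \<pi> h" "\<forall>u\<in>Mt. X (h u) = A *v X u" using deck[OF A] by blast
    define u where "u = inv_into Mt X x"
    have u: "u \<in> Mt" "X u = x" using hom x by (auto simp: homeomorphism_def u_def)
    have hu: "h u \<in> Mt" "\<pi> (h u) = \<pi> u" using h(1) u(1) by (auto simp: deck_transformation_def homeomorphism_def)
    have "inv_into Mt X (A *v x) = inv_into Mt X (X (h u))" using h(2) u by simp
    also have "\<dots> = h u" using hom hu(1) by (auto simp: homeomorphism_def)
    finally have "p (A *v x) = p x" using hu(2) by (simp add: assms(4) u_def)
    then show ?thesis using x by (simp add: nA[OF A])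
  qed
  define F where "F x = \<Omega> x - omega0" for x
  have F2: "Ck_on 2 F (?S R)" unfolding F_def by (rule Ck_on_minus[OF op assms(7) Ck_on_const])
  have \<Omega>1: "\<Omega> differentiable (at x)" if "x \<in> ?S R" for x
    using Ck_on_1_has_derivative[OF Ck_on_mono[OF assms(7)] that] unfolding differentiable_def by auto
  have DF: "frechet_derivative F (at x) = frechet_derivative \<Omega> (at x)" if "x \<in> ?S R" for x
    unfolding F_def
    using frechet_derivative_eqI[OF has_derivative_diff[OF has_frechet_derivative[OF \<Omega>1[OF that]] has_derivative_const]] by simp
  have closedF: "closed_form F (?S R)" using closed_Omega[OF \<Omega>1] unfolding closed_form_def by (simp add: DF)
  have skewF: "skew (F x)" if "x \<in> ?S R" for x
    unfolding F_def by (rule skew_diff[OF skew_Omega[OF that] skew_omega0])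
  have om_inv: "omega0 *v (A *v x) = A *v (omega0 *v x)" if "A \<in> \<Gamma>" for A x
    using omega0_commutes_U2 that assms(9) by blast
  have F_inv: "F (A *v x) *v (A *v v) = A *v (F x *v v)" if A: "A \<in> \<Gamma>" and x: "norm x > R" for A x v
    using Omega_invariant[OF orth[OF A] pA[OF A], of x v] x om_inv[OF A]
    by (simp add: F_def matrix_vector_mult_diff_rdistrib matrix_vector_mult_diff_distrib)
  obtain Ca ba where Ca: "Ca \<ge> 0" "\<And>x. norm x \<ge> ba \<Longrightarrow> \<bar>norm (F x)\<bar> \<le> Ca * norm x powr (- 1 - \<epsilon>)"
    by (rule bigo_at_infinity_bound[OF assms(8)[unfolded fall_off_def, THEN conjunct1, folded F_def]]) blast
  have "\<forall>l. \<exists>C b. C \<ge> 0 \<and> (\<forall>x. norm x \<ge> b \<longrightarrow> \<bar>norm (partial l \<Omega> x)\<bar> \<le> C * norm x powr (- 2 - \<epsilon>))"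
  proof
    fix l
    obtain C b where "C \<ge> 0" "\<And>x. norm x \<ge> b \<Longrightarrow> \<bar>norm (partial l \<Omega> x)\<bar> \<le> C * norm x powr (- 2 - \<epsilon>)"
      by (rule bigo_at_infinity_bound[OF assms(8)[unfolded fall_off_def, THEN conjunct2, rule_format, of l]]) blast
    then show "\<exists>C b. C \<ge> 0 \<and> (\<forall>x. norm x \<ge> b \<longrightarrow> \<bar>norm (partial l \<Omega> x)\<bar> \<le> C * norm x powr (- 2 - \<epsilon>))"
      by blast
  qed
  then obtain Cl bl where Cl: "\<And>l. Cl l \<ge> 0" "\<And>l x. norm x \<ge> bl l \<Longrightarrow> \<bar>norm (partial l \<Omega> x)\<bar> \<le> Cl l * norm x powr (- 2 - \<epsilon>)"
    by metis
  \<comment> \<open>Beyond this radius all order bounds on \<open>F\<close> and on its four partial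
    derivatives hold with explicit constants, \<open>F\<close> is of class \<open>C\<^sup>2\<close>,
    and norms exceed 1.\<close>
  define r0 where "r0 = Max ({1, R, ba} \<union> range bl)"
  have r0: "r0 \<ge> 1" "r0 \<ge> R" "r0 \<ge> ba" "\<And>l. r0 \<ge> bl l" unfolding r0_def by (rule Max_ge; simp)+
  have sub: "?S r0 \<subseteq> ?S R" using r0 by auto
  define CD where "CD = (\<Sum>l\<in>UNIV. Cl l)"
  have symbF: "symb (1 + \<epsilon>) F (?S r0)"
  proof (rule symbI[OF op])
    show D: "(F has_derivative frechet_derivative F (at x)) (at x)" if "x \<in> ?S r0" for x
    proof -
      have "x \<in> ?S R" using that sub by blast
      from Ck_on_1_has_derivative[OF Ck_on_mono[OF F2] this] show ?thesis by simp
    qed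
    show "continuous_on (?S r0) (\<lambda>x. frechet_derivative F (at x) v)" for v
      using continuous_on_subset[OF continuous_on_frechet[OF op, of 0 F R v] sub] Ck_on_mono[OF F2, of 1] by simp
    show "norm (F x) \<le> Ca * norm x powr (- (1 + \<epsilon>))" if "x \<in> ?S r0" for x
      using Ca(2)[of x] that r0 by simp
    show "norm (frechet_derivative F (at x) v) \<le> CD * norm x powr (- (1 + \<epsilon>) - 1) * norm v" if x: "x \<in> ?S r0" for x v
    proof -
      have xR: "x \<in> ?S R" using x sub by blast
      have "norm (frechet_derivative F (at x) v) \<le> (\<Sum>b\<in>Basis. norm (frechet_derivative F (at x) b)) * norm v"
        by (rule linear_bound_by_basis[OF has_derivative_linear[OF D[OF x]]])
      also have "(\<Sum>b\<in>Basis. norm (frechet_derivative F (at x) b)) = (\<Sum>l\<in>UNIV. norm (partial l \<Omega> x))"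
      proof -
        have B: "(Basis :: (real^4) set) = range (\<lambda>l. axis l 1)" by (auto simp: Basis_vec_def)
        have "inj (\<lambda>l::4. axis l (1::real))" by (auto simp: inj_def axis_eq_axis)
        then show ?thesis unfolding B DF[OF xR] by (simp add: sum.reindex)
      qed
      also have "\<dots> \<le> (\<Sum>l\<in>UNIV. Cl l * norm x powr (- 2 - \<epsilon>))"
      proof (rule sum_mono)
        show "norm (partial l \<Omega> x) \<le> Cl l * norm x powr (- 2 - \<epsilon>)" for l
          using Cl(2)[of l x] r0(4)[of l] x by simp
      qed
      also have "\<dots> = CD * norm x powr (- (1 + \<epsilon>) - 1)" by (simp add: CD_def sum_distrib_right)
      finally show ?thesis by (simp add: mult_right_mono)
    qed
  qed
  have closedF0: "closed_form F (?S r0)" using closedF sub unfolding closed_form_def by blast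
  have skewF0: "skew (F x)" if "x \<in> ?S r0" for x using skewF sub that by blast
  have F_inv0: "F (A *v x) *v (A *v v) = A *v (F x *v v)" if "A \<in> \<Gamma>" "norm x > r0" for A x v
    using F_inv[OF that(1)] that(2) r0(2) by simp
  obtain R1 \<theta> where R1: "R1 \<ge> r0" and \<theta>2: "Ck_on 2 \<theta> (?S R1)" and symb\<theta>: "symb \<epsilon> \<theta> (?S R1)"
    and prim: "primitive_of F \<theta> (?S R1)" and \<theta>_inv: "\<And>A x. A \<in> \<Gamma> \<Longrightarrow> \<theta> (A *v x) = A *v \<theta> x"
    using equivariant_primitive_exists[OF r0(1) eps Ck_on_subset[OF F2 sub] symbF skewF0 closedF0 fin ne orth grp F_inv0]
    by metis
  obtain CF where CF: "CF \<ge> 0" "\<And>x. x \<in> ?S r0 \<Longrightarrow> norm (F x) \<le> CF * norm x powr (- (1 + \<epsilon>))"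
    "\<And>x v. x \<in> ?S r0 \<Longrightarrow> norm (frechet_derivative F (at x) v) \<le> CF * norm x powr (- (1 + \<epsilon>) - 1) * norm v"
    by (rule symbE[OF symbF]) blast
  obtain C\<theta> where C\<theta>: "C\<theta> \<ge> 0" "\<And>x. x \<in> ?S R1 \<Longrightarrow> norm (\<theta> x) \<le> C\<theta> * norm x powr (- \<epsilon>)"
    "\<And>x v. x \<in> ?S R1 \<Longrightarrow> norm (frechet_derivative \<theta> (at x) v) \<le> C\<theta> * norm x powr (- \<epsilon> - 1) * norm v"
    by (rule symbE[OF symb\<theta>]) blast
  obtain b1 where b1: "\<And>x. x \<ge> b1 \<Longrightarrow> CF * x powr (- (1 + \<epsilon>)) \<le> 1 / 4"
    using powr_small[of "1 + \<epsilon>" "1 / 4" CF] eps by auto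
  obtain b2 where b2: "\<And>x. x \<ge> b2 \<Longrightarrow> (2 * C\<theta>) * x powr (- \<epsilon>) \<le> exp (- 1)"
    using powr_small[OF eps, of "exp (- 1)" "2 * C\<theta>"] by auto
  \<comment> \<open>Beyond \<open>R1\<close> the primitive is available, beyond \<open>b1\<close>
    the form \<open>F\<close> is at most 1/4, and beyond \<open>b2\<close> the field is small enough
    to move points by at most 1.\<close>
  define \<rho>1 where "\<rho>1 = Max {R1, b1, b2}"
  have \<rho>1: "\<rho>1 \<ge> R1" "\<rho>1 \<ge> b1" "\<rho>1 \<ge> b2" "\<rho>1 \<ge> r0" "\<rho>1 \<ge> 1" "\<rho>1 \<ge> R"
    using R1 r0 unfolding \<rho>1_def by auto
  have sub1: "?S \<rho>1 \<subseteq> ?S R1" "?S \<rho>1 \<subseteq> ?S R" "?S \<rho>1 \<subseteq> ?S r0" using \<rho>1 by auto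
  have far: "x \<in> ?S R1" "x \<in> ?S r0" if "norm x > \<rho>1" for x using that \<rho>1 by auto
  interpret M: moser F \<theta> \<epsilon> \<rho>1 CF C\<theta> \<Gamma>
  proof
    show "closed_form F (?S \<rho>1)" using closedF sub1(2) unfolding closed_form_def by blast
    show "primitive_of F \<theta> (?S \<rho>1)" by (rule primitive_of_subset[OF prim sub1(1)])
    show "norm (frechet_derivative F (at x) v) \<le> CF * norm x powr (- 2 - \<epsilon>) * norm v" if "\<rho>1 < norm x" for x v
      using CF(3)[OF far(2)[OF that], of v] by simp
    show "norm (F x) \<le> 1 / 4" if "\<rho>1 < norm x" for x
      by (rule order_trans[OF CF(2)[OF far(2)[OF that]] b1]) (use that \<rho>1 in simp)
    show "2 * norm (\<theta> x) \<le> exp (- 1)" if "\<rho>1 < norm x" for x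
      using C\<theta>(2)[OF far(1)[OF that]] b2[of "norm x"] that \<rho>1 by simp
    show "F (A *v x) *v (A *v v) = A *v (F x *v v)" if "A \<in> \<Gamma>" "\<rho>1 < norm x" for A x v
      by (rule F_inv0) (use that \<rho>1 in auto)
  qed (use eps \<rho>1 Ck_on_subset[OF F2 sub1(2)] Ck_on_subset[OF \<theta>2 sub1(1)] skewF sub1 CF(1) C\<theta> far orth om_inv \<theta>_inv in \<open>auto simp del: Ck_on.simps\<close>)
  obtain \<phi> \<psi> r C where r: "r > \<rho>1" and \<phi>: "Ck_on 2 \<phi> UNIV" "Ck_on 2 \<psi> UNIV" "\<And>x. \<psi> (\<phi> x) = x" "\<And>x. \<phi> (\<psi> x) = x"
    and fix_\<phi>: "\<And>x. norm x \<le> \<rho>1 \<Longrightarrow> \<phi> x = x"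
    and eq: "\<And>A x. A \<in> \<Gamma> \<Longrightarrow> \<phi> (A *v x) = A *v \<phi> x"
    and pull: "\<And>x a b. norm x > r \<Longrightarrow> frechet_derivative \<phi> (at x) a \<bullet> ((omega0 + F (\<phi> x)) *v frechet_derivative \<phi> (at x) b) = a \<bullet> (omega0 *v b)"
    and d0: "\<And>x. norm x > r \<Longrightarrow> norm (\<phi> x - x) \<le> C * norm x powr (- \<epsilon>)"
    and d1: "\<And>x v. norm x > r \<Longrightarrow> norm (frechet_derivative \<phi> (at x) v - v) \<le> C * norm x powr (- 1 - \<epsilon>) * norm v"
    by (rule M.moser_diffeo) blast
  have r_pos: "r > 0" using r \<rho>1 by simp
  let ?D = "\<phi> ` cball 0 r"
  note ball = Ck_ball_diffeo_image[OF r_pos \<phi>]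
  have D\<phi>: "(\<phi> has_derivative frechet_derivative \<phi> (at x)) (at x)" for x
    by (rule Ck_on_1_has_derivative[OF Ck_on_mono[OF \<phi>(1)]]) auto
  have At: "A *v (transpose A *v x) = x" "norm (transpose A *v x) = norm x" if "A \<in> \<Gamma>" for A x
  proof -
    show 1: "A *v (transpose A *v x) = x"
      unfolding matrix_vector_mul_assoc using orth[OF that] by (simp add: orthogonal_matrix_def)
    show "norm (transpose A *v x) = norm x" using nA[OF that, of "transpose A *v x"] unfolding 1 by simp
  qed
  show ?thesis
  proof (intro exI[of _ \<phi>] exI[of _ r] exI[of _ ?D] conjI ballI)
    \<comment> \<open>\<phi> fixes the ball of radius \<rho>1 pointwise and
      \<open>R \<le> \<rho>1 < r\<close>, so the ball of radius \<open>R\<close> is its own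
      image.\<close>
    show "cball 0 R \<subseteq> cball 0 r \<inter> ?D"
    proof
      fix x :: "real^4" assume "x \<in> cball 0 R"
      then have "norm x \<le> \<rho>1" using \<rho>1 by simp
      then have "x = \<phi> x" "x \<in> cball 0 r" using fix_\<phi>[of x] r by auto
      then show "x \<in> cball 0 r \<inter> ?D" by blast
    qed
    show "Ck_ball 2 ?D" by (rule ball(2))
    show "Ck_diffeo 2 \<phi> (- cball 0 r) (- ?D)" by (rule ball(3))
    \<comment> \<open>The frontier is the image of a round sphere, which orthogonal maps preserve;
      equivariance of \<phi> transports this.\<close>
    show "(*v) A ` frontier ?D = frontier ?D" if A: "A \<in> \<Gamma>" for A
    proof -
      have "(*v) A ` sphere 0 r = sphere (0::real^4) r"
      proof
        show "(*v) A ` sphere 0 r \<subseteq> sphere (0::real^4) r" using nA[OF A] by auto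
        show "sphere (0::real^4) r \<subseteq> (*v) A ` sphere 0 r"
        proof
          fix x :: "real^4" assume "x \<in> sphere 0 r"
          then have "transpose A *v x \<in> sphere 0 r" using At(2)[OF A, of x] by simp
          then show "x \<in> (*v) A ` sphere 0 r" using At(1)[OF A, of x] by (metis imageI)
        qed
      qed
      then have "(*v) A ` \<phi> ` sphere 0 r = \<phi> ` sphere 0 r"
        unfolding image_image eq[OF A, symmetric] by (metis image_image)
      then show ?thesis unfolding ball(1) .
    qed
    show "\<phi> (A *v x) = A *v \<phi> x" if "A \<in> \<Gamma>" for A x by (rule eq[OF that])
    show "pullback_form \<phi> \<Omega> x = omega0" if "x \<in> - cball 0 r" for x
    proof (rule matrix_eq_inner)
      show "a \<bullet> (pullback_form \<phi> \<Omega> x *v b) = a \<bullet> (omega0 *v b)" for a b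
        using pull[of x a b] that unfolding pullback_form_inner[OF D\<phi>] by (simp add: F_def)
    qed
    show "(\<lambda>x. norm (\<phi> x - x)) \<in> O[at_infinity](\<lambda>x. norm x powr (- \<epsilon>))"
    proof (rule bigoI)
      show "\<forall>\<^sub>F x in at_infinity. norm (norm (\<phi> x - x)) \<le> C * norm (norm x powr - \<epsilon>)"
        unfolding eventually_at_infinity using d0 by (intro exI[of _ "r + 1"]) auto
    qed
    show "(\<lambda>x. norm (jacobian \<phi> (at x) - mat 1)) \<in> O[at_infinity](\<lambda>x. norm x powr (- 1 - \<epsilon>))"
    proof (rule bigoI)
      have "norm (jacobian \<phi> (at x) - mat 1) \<le> 16 * (C * norm x powr (- 1 - \<epsilon>))" if "norm x > r" for x
      proof (rule norm_matrix_le_columns)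
        show "norm ((jacobian \<phi> (at x) - mat 1) *v v) \<le> C * norm x powr (- 1 - \<epsilon>) * norm v" for v
          using d1[OF that, of v] by (simp add: matrix_vector_mult_diff_rdistrib jacobian_apply[OF D\<phi>])
      qed
      then show "\<forall>\<^sub>F x in at_infinity. norm (norm (jacobian \<phi> (at x) - mat 1)) \<le> (16 * C) * norm (norm x powr (- 1 - \<epsilon>))"
        unfolding eventually_at_infinity by (intro exI[of _ "r + 1"]) (auto simp: mult.assoc)
    qed
  qed
qed

end
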